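(* Let $\mathbb I$ be an idealistic filtration over $R$, and assume that $R$ has a regular system of parameters $(x_1,\dots,x_d)$. Then $\mathfrak B(\mathbb I)=\mathfrak R\mathfrak D(\mathbb I)$. If $E$ is a simple normal crossing divisor defined by $\{x_1\cdots x_m=0\}$ for some $1\le m\le d$, then $\mathfrak B_E(\mathbb I)=\mathfrak R\mathfrak D_E(\mathbb I)$.
   Context: $k$ is an algebraically closed field of arbitrary characteristic. $R$ is the coordinate ring of an affine open subset of a nonsingular variety $W$ over $k$, or a localization of it, or its completion with respect to a maximal ideal. With $d=\dim W$, $(x_1,\dots,x_d)$ is a regular system of parameters for $R$ if $dx_1,\dots,dx_d$ form a basis of $\Omega^1_{R/k}$ over $R$ (when $R$ is a completion: if for suitable $\alpha_i\in k$ the elements $x_i-\alpha_i$ generate the maximal ideal of $R$). Idealistic filtration: for $T\subset R\times\mathbb R$ and $a\in\mathbb R$ write $T_a=\{f\in R:(f,a)\in T\}$. A subset $\mathbb I\subset R\times\mathbb R$ is an idealistic filtration if $\mathbb I_0=R$; each $\mathbb I_a$ is an ideal of $R$; $\mathbb I_a\mathbb I_b\subset\mathbb I_{a+b}$ for all $a,b$; and $\mathbb I_b\supset\mathbb I_a$ whenever $b\le a$. $\operatorname{Diff}^t_R$ denotes the $R$-module of $k$-linear differential operators $R\to R$ of degree $\le t$ in the sense of Grothendieck, i.e. the maps of the form $r\mapsto u\bigl((1\otimes r)\bmod\Delta_R^{t+1}\bigr)$ with $u\in\operatorname{Hom}_R\bigl((R\otimes_kR)/\Delta_R^{t+1},R\bigr)$,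 where $\Delta_R$ is the kernel of the multiplication map $R\otimes_kR\to R$ and $R$ acts on $R\otimes_kR$ through the first factor. With $I_E\subset R$ the ideal of $E$, $\operatorname{Diff}^t_{R,E}=\{d\in\operatorname{Diff}^t_R: d(I_E^s)\subset I_E^s\ \forall s\in\mathbb Z_{\ge0}\}$. $\mathbb I$ is $\mathfrak D$-saturated (resp. $\mathfrak D_E$-saturated) if $(f,a)\in\mathbb I$ and $d\in\operatorname{Diff}^t_R$ (resp. $\operatorname{Diff}^t_{R,E}$), $t\in\mathbb Z_{\ge0}$, imply $(d(f),a-t)\in\mathbb I$. $\mathbb I$ is $\mathfrak R$-saturated if (radical) $(f^n,na)\in\mathbb I$, $f\in R$, $n\in\mathbb Z_{>0}$ imply $(f,a)\in\mathbb I$, and (continuity) $(f,a_l)\in\mathbb I$ for a sequence $a_l\to a$ implies $(f,a)\in\mathbb I$. $\mathbb I$ is $\mathfrak B$-saturated (resp. $\mathfrak B_E$-saturated) if it is both $\mathfrak D$-saturated (resp. $\mathfrak D_E$-saturated) and $\mathfrak R$-saturated. For $\mathfrak X\in\{\mathfrak D,\mathfrak D_E,\mathfrak R,\mathfrak B,\mathfrak B_E\}$, $\mathfrak X(\mathbb I)$ denotes the smallest $\mathfrak X$-saturated idealistic filtration containing $\mathbb I$; $\mathfrak R\mathfrak D(\mathbb I)$ means $\mathfrak R(\mathfrak D(\mathbb I))$, etc. *)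

theory Defs
  imports
    Complex_Main
    "HOL-Library.FuncSet"
    "HOL-Library.Set_Algebras"
    "HOL-Library.Extended_Nat"
    "HOL-Library.Poly_Mapping"
    "HOL-Computational_Algebra.Polynomial"
    "HOL-Computational_Algebra.Fraction_Field"
begin

section \<open>Ideals, Krull dimension, regular local rings\<close>

text \<open>
  The notions are relative to a subring \<open>S\<close> of the ambient type, so that they apply both to
  a whole type (\<open>S = UNIV\<close>) and to a local ring \<open>A\<^sub>m\<close> inside the field of fractions of \<open>A\<close>.
\<close>

definition ideal_in :: "'a::comm_ring_1 set \<Rightarrow> 'a set \<Rightarrow> bool" where
  "ideal_in S J \<longleftrightarrow> J \<subseteq> S \<and> 0 \<in> J \<and> (\<forall>x\<in>J. \<forall>y\<in>J. x + y \<in> J) \<and> (\<forall>s\<in>S. \<forall>x\<in>J. s * x \<in> J)"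

abbreviation is_ideal :: "'a::comm_ring_1 set \<Rightarrow> bool" where
  "is_ideal \<equiv> ideal_in UNIV"

definition prime_in :: "'a::comm_ring_1 set \<Rightarrow> 'a set \<Rightarrow> bool" where
  "prime_in S P \<longleftrightarrow> ideal_in S P \<and> P \<noteq> S \<and> (\<forall>x\<in>S. \<forall>y\<in>S. x * y \<in> P \<longrightarrow> x \<in> P \<or> y \<in> P)"

definition maximal_in :: "'a::comm_ring_1 set \<Rightarrow> 'a set \<Rightarrow> bool" where
  "maximal_in S M \<longleftrightarrow> ideal_in S M \<and> M \<noteq> S \<and> (\<forall>J. ideal_in S J \<and> M \<subseteq> J \<longrightarrow> J = M \<or> J = S)"

text \<open>\<open>J ^ n\<close> is the set of \<open>n\<close>-fold products of elements of \<open>J\<close>; it equals \<open>{1}\<close> for \<open>n = 0\<close>.\<close>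

definition ideal_power :: "'a::comm_ring_1 set \<Rightarrow> nat \<Rightarrow> 'a set" where
  "ideal_power J n = is_ideal hull (J ^ n)"

definition krull_dim :: "'a::comm_ring_1 set \<Rightarrow> enat" where
  "krull_dim S =
     Sup {enat n |n. \<exists>P. (\<forall>i\<le>n. prime_in S (P i)) \<and> (\<forall>i<n. P i \<subset> P (Suc i))}"

text \<open>
  Noetherianity is not demanded: it is automatic for the localizations of finitely generated
  algebras to which the definition is applied.
\<close>

definition regular_local_ring :: "'a::comm_ring_1 set \<Rightarrow> bool" where
  "regular_local_ring S \<longleftrightarrow>
     (\<exists>M n f. {N. maximal_in S N} = {M} \<and> krull_dim S = enat n \<and>
              M = ideal_in S hull (f ` {..<n::nat}))"

definition localization_set :: "'a::idom set \<Rightarrow> 'a fract set" where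
  "localization_set S = {Fract a s |a s. s \<in> S}"


section \<open>Algebras over a field and the admissible rings\<close>

definition algebra_over :: "('k::field \<Rightarrow> 'r::comm_ring_1 \<Rightarrow> 'r) \<Rightarrow> bool" where
  "algebra_over sc \<longleftrightarrow> vector_space sc \<and> (\<forall>c x y. sc c x * y = sc c (x * y))"

definition is_subalgebra :: "('k::field \<Rightarrow> 'r::comm_ring_1 \<Rightarrow> 'r) \<Rightarrow> 'r set \<Rightarrow> bool" where
  "is_subalgebra sc B \<longleftrightarrow>
     1 \<in> B \<and> (\<forall>x\<in>B. \<forall>y\<in>B. x + y \<in> B \<and> x * y \<in> B) \<and> (\<forall>c. \<forall>x\<in>B. sc c x \<in> B)"

text \<open>
  The coordinate rings of the affine open subsets of the nonsingular (irreducible) varieties of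
  dimension \<open>d\<close> over an algebraically closed field are the finitely generated domains of Krull
  dimension \<open>d\<close> all of whose local rings at closed points are regular.
\<close>

definition nonsingular_coordinate_ring ::
    "('k::alg_closed_field \<Rightarrow> 'a::idom \<Rightarrow> 'a) \<Rightarrow> nat \<Rightarrow> bool" where
  "nonsingular_coordinate_ring sc d \<longleftrightarrow>
     algebra_over sc \<and>
     (\<exists>G. finite G \<and> is_subalgebra sc hull G = UNIV) \<and>
     krull_dim (UNIV :: 'a set) = enat d \<and>
     (\<forall>m. maximal_in (UNIV :: 'a set) m \<longrightarrow> regular_local_ring (localization_set (- m)))"

text \<open>
  \<open>R\<close> is isomorphic, as a \<open>k\<close>-algebra, to the localization of the domain \<open>A\<close> at some
  multiplicative set \<open>S\<close>. The choice \<open>S = {1}\<close> gives \<open>A\<close> itself.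
\<close>

definition is_localization_of ::
    "('k::field \<Rightarrow> 'a::idom \<Rightarrow> 'a) \<Rightarrow> ('k \<Rightarrow> 'r::comm_ring_1 \<Rightarrow> 'r) \<Rightarrow> bool" where
  "is_localization_of scA scR \<longleftrightarrow>
     (\<exists>S \<phi>. 1 \<in> S \<and> 0 \<notin> S \<and> (\<forall>s\<in>S. \<forall>t\<in>S. s * t \<in> S) \<and>
        bij_betw \<phi> UNIV (localization_set S) \<and>
        \<phi> 1 = 1 \<and> (\<forall>x y. \<phi> (x + y) = \<phi> x + \<phi> y \<and> \<phi> (x * y) = \<phi> x * \<phi> y) \<and>
        (\<forall>c x. \<phi> (scR c x) = Fract (scA c 1) 1 * \<phi> x))"

text \<open>The inverse limit of the \<open>A/m\<^sup>n\<close>: compatible sequences of residue classes.\<close>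

definition adic_limit :: "'a::comm_ring_1 set \<Rightarrow> (nat \<Rightarrow> 'a set) set" where
  "adic_limit m = {s. (\<forall>n. \<exists>a. s n = a +o ideal_power m n) \<and> (\<forall>n. s (Suc n) \<subseteq> s n)}"

text \<open>
  \<open>R\<close> is isomorphic, as a \<open>k\<close>-algebra, to the \<open>m\<close>-adic completion of \<open>A\<close>. The operations on
  residue classes are expressed by means of representatives.
\<close>

definition is_completion_of ::
    "('k::field \<Rightarrow> 'a::comm_ring_1 \<Rightarrow> 'a) \<Rightarrow> 'a set \<Rightarrow> ('k \<Rightarrow> 'r::comm_ring_1 \<Rightarrow> 'r) \<Rightarrow> bool" where
  "is_completion_of scA m scR \<longleftrightarrow>
     (\<exists>\<theta>. bij_betw \<theta> UNIV (adic_limit m) \<and>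
        (\<forall>n. 1 \<in> \<theta> 1 n) \<and>
        (\<forall>x y n. \<forall>a\<in>\<theta> x n. \<forall>b\<in>\<theta> y n. a + b \<in> \<theta> (x + y) n \<and> a * b \<in> \<theta> (x * y) n) \<and>
        (\<forall>c x n. \<forall>a\<in>\<theta> x n. scA c a \<in> \<theta> (scR c x) n))"


section \<open>The tensor product \<open>R \<otimes>\<^sub>k R\<close>, differentials and differential operators\<close>

text \<open>
  \<open>Tens a b\<close> is a formal symbol for \<open>a \<otimes> b\<close>. The index monoid of a monoid algebra
  \<open>_ \<Rightarrow>\<^sub>0 int\<close> has to be written additively, so the componentwise product of symbols is
  installed as addition. Then \<open>'r tens \<Rightarrow>\<^sub>0 int\<close> is the free abelian group on the symbols with
  the product \<open>(a \<otimes> b) * (a' \<otimes> b') = aa' \<otimes> bb'\<close>.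
\<close>

datatype 'r tens = Tens (left_factor: 'r) (right_factor: 'r)

instantiation tens :: (comm_monoid_mult) comm_monoid_add
begin

definition zero_tens :: "'a tens" where
  "zero_tens = Tens 1 1"

definition plus_tens :: "'a tens \<Rightarrow> 'a tens \<Rightarrow> 'a tens" where
  "plus_tens p q =
     Tens (left_factor p * left_factor q) (right_factor p * right_factor q)"

instance
  by standard (auto simp: zero_tens_def plus_tens_def mult_ac)

end

type_synonym 'r pretensor = "'r tens \<Rightarrow>\<^sub>0 int"

definition pt :: "'r \<Rightarrow> 'r \<Rightarrow> 'r pretensor" where
  "pt a b = frag_of (Tens a b)"

lemma pt_mult: "pt a b * pt c d = pt (a * c) (b * d)" for a b c d :: "'r::comm_ring_1"
  by (simp add: pt_def mult_single plus_tens_def)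

text \<open>
  \<open>R \<otimes>\<^sub>k R\<close> is the quotient of \<open>'r pretensor\<close> by the subgroup generated by the bilinearity
  relations below. That subgroup is stable under multiplication by symbols, hence it is the
  ideal generated by the relations.
\<close>

definition tensor_relations :: "('k \<Rightarrow> 'r::comm_ring_1 \<Rightarrow> 'r) \<Rightarrow> 'r pretensor set" where
  "tensor_relations sc =
     {pt (a + a') b - pt a b - pt a' b |a a' b. True} \<union>
     {pt a (b + b') - pt a b - pt a b' |a b b'. True} \<union>
     {pt (sc c a) b - pt a (sc c b) |c a b. True}"

definition mult_map :: "'r::comm_ring_1 pretensor \<Rightarrow> 'r" where
  "mult_map f = (\<Sum>p\<in>Poly_Mapping.keys f.
     of_int (Poly_Mapping.lookup f p) * (left_factor p * right_factor p))"

text \<open>The preimage in \<open>'r pretensor\<close> of the diagonal ideal \<open>\<Delta>\<^sub>R\<close>.\<close>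

definition diagonal :: "'r::comm_ring_1 pretensor set" where
  "diagonal = {f. mult_map f = 0}"

text \<open>
  The preimage in \<open>'r pretensor\<close> of \<open>\<Delta>\<^sub>R\<^sup>n\<close>. Accordingly \<open>f +o diagonal_power sc n\<close> is the
  class of \<open>f\<close> in \<open>(R \<otimes>\<^sub>k R)/\<Delta>\<^sub>R\<^sup>n\<close>.
\<close>

definition diagonal_power ::
    "('k \<Rightarrow> 'r::comm_ring_1 \<Rightarrow> 'r) \<Rightarrow> nat \<Rightarrow> 'r pretensor set" where
  "diagonal_power sc n = is_ideal hull (tensor_relations sc \<union> diagonal ^ n)"

text \<open>
  \<open>\<Omega>\<^sup>1\<^sub>R\<^sub>/\<^sub>k = \<Delta>\<^sub>R/\<Delta>\<^sub>R\<^sup>2\<close> with \<open>dx = 1 \<otimes> x - x \<otimes> 1\<close>, and \<open>R\<close> acting through the first factor.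
\<close>

definition Omega :: "('k \<Rightarrow> 'r::comm_ring_1 \<Rightarrow> 'r) \<Rightarrow> 'r pretensor set set" where
  "Omega sc = {f +o diagonal_power sc 2 |f. f \<in> diagonal}"

definition differentials_form_basis ::
    "('k \<Rightarrow> 'r::comm_ring_1 \<Rightarrow> 'r) \<Rightarrow> nat \<Rightarrow> (nat \<Rightarrow> 'r) \<Rightarrow> bool" where
  "differentials_form_basis sc d x \<longleftrightarrow>
     (\<forall>\<omega>\<in>Omega sc. \<exists>!c. c \<in> extensional {1..d} \<and>
        \<omega> = (\<Sum>i=1..d. pt (c i) 1 * (pt 1 (x i) - pt (x i) 1)) +o diagonal_power sc 2)"

text \<open>
  \<open>u\<close> below is an \<open>R\<close>-linear map \<open>(R \<otimes>\<^sub>k R)/\<Delta>\<^sub>R\<^sup>n \<rightarrow> R\<close>.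
\<close>

definition principal_parts_functional ::
    "('k \<Rightarrow> 'r::comm_ring_1 \<Rightarrow> 'r) \<Rightarrow> nat \<Rightarrow> ('r pretensor set \<Rightarrow> 'r) \<Rightarrow> bool" where
  "principal_parts_functional sc n u \<longleftrightarrow>
     (\<forall>f g. u ((f + g) +o diagonal_power sc n) =
              u (f +o diagonal_power sc n) + u (g +o diagonal_power sc n)) \<and>
     (\<forall>a f. u ((pt a 1 * f) +o diagonal_power sc n) = a * u (f +o diagonal_power sc n))"

definition Diff :: "('k \<Rightarrow> 'r::comm_ring_1 \<Rightarrow> 'r) \<Rightarrow> nat \<Rightarrow> ('r \<Rightarrow> 'r) set" where
  "Diff sc t = {(\<lambda>r. u (pt 1 r +o diagonal_power sc (t + 1))) |u.
                  principal_parts_functional sc (t + 1) u}"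

definition Diff_log ::
    "('k \<Rightarrow> 'r::comm_ring_1 \<Rightarrow> 'r) \<Rightarrow> 'r set \<Rightarrow> nat \<Rightarrow> ('r \<Rightarrow> 'r) set" where
  "Diff_log sc IE t = {\<delta> \<in> Diff sc t. \<forall>s. \<delta> ` ideal_power IE s \<subseteq> ideal_power IE s}"


section \<open>Regular systems of parameters\<close>

text \<open>
  \<open>R\<close> is obtained from the \<open>d\<close>-dimensional coordinate ring \<open>A\<close>, and \<open>x 1, \<dots>, x d\<close> is a regular
  system of parameters for \<open>R\<close>. The first alternative covers \<open>A\<close> itself and its localizations,
  the second one its completions.
\<close>

definition regular_system_of_parameters ::
    "('k::field \<Rightarrow> 'a::idom \<Rightarrow> 'a) \<Rightarrow> ('k \<Rightarrow> 'r::comm_ring_1 \<Rightarrow> 'r) \<Rightarrow> nat \<Rightarrow> (nat \<Rightarrow> 'r) \<Rightarrow> bool"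
  where
  "regular_system_of_parameters scA scR d x \<longleftrightarrow>
     is_localization_of scA scR \<and> differentials_form_basis scR d x \<or>
     (\<exists>m. maximal_in UNIV m \<and> is_completion_of scA m scR) \<and>
       (\<exists>\<alpha>. {M. maximal_in (UNIV :: 'r set) M} =
             {is_ideal hull {x i - scR (\<alpha> i) 1 |i. i \<in> {1..d}}})"


section \<open>Idealistic filtrations and their saturations\<close>

definition level :: "('r \<times> real) set \<Rightarrow> real \<Rightarrow> 'r set" where
  "level T a = {f. (f, a) \<in> T}"

definition idealistic_filtration :: "('r::comm_ring_1 \<times> real) set \<Rightarrow> bool" where
  "idealistic_filtration I \<longleftrightarrow>
     level I 0 = UNIV \<and>
     (\<forall>a. is_ideal (level I a)) \<and>
     (\<forall>a b. level I a * level I b \<subseteq> level I (a + b)) \<and>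
     (\<forall>a b. b \<le> a \<longrightarrow> level I a \<subseteq> level I b)"

text \<open>\<open>\<DD>\<close> is the family of the sets of admitted operators of degree at most \<open>t\<close>.\<close>

definition D_saturated :: "(nat \<Rightarrow> ('r \<Rightarrow> 'r) set) \<Rightarrow> ('r \<times> real) set \<Rightarrow> bool" where
  "D_saturated \<DD> I \<longleftrightarrow> (\<forall>f a t. \<forall>\<delta>\<in>\<DD> t. (f, a) \<in> I \<longrightarrow> (\<delta> f, a - real t) \<in> I)"

definition R_saturated :: "('r::comm_ring_1 \<times> real) set \<Rightarrow> bool" where
  "R_saturated I \<longleftrightarrow>
     (\<forall>f a n. n > 0 \<longrightarrow> (f ^ n, real n * a) \<in> I \<longrightarrow> (f, a) \<in> I) \<and>
     (\<forall>f a s. (\<forall>l. (f, s l) \<in> I) \<longrightarrow> s \<longlonglongrightarrow> a \<longrightarrow> (f, a) \<in> I)"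

definition D_saturation ::
    "(nat \<Rightarrow> ('r::comm_ring_1 \<Rightarrow> 'r) set) \<Rightarrow> ('r \<times> real) set \<Rightarrow> ('r \<times> real) set" where
  "D_saturation \<DD> I = (\<lambda>J. idealistic_filtration J \<and> D_saturated \<DD> J) hull I"

definition R_saturation :: "('r::comm_ring_1 \<times> real) set \<Rightarrow> ('r \<times> real) set" where
  "R_saturation I = (\<lambda>J. idealistic_filtration J \<and> R_saturated J) hull I"

definition B_saturation ::
    "(nat \<Rightarrow> ('r::comm_ring_1 \<Rightarrow> 'r) set) \<Rightarrow> ('r \<times> real) set \<Rightarrow> ('r \<times> real) set" where
  "B_saturation \<DD> I =
     (\<lambda>J. idealistic_filtration J \<and> D_saturated \<DD> J \<and> R_saturated J) hull I"

text \<open>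
  The three classes of filtrations are closed under arbitrary intersections, so each of the hulls
  above belongs to its class and is the smallest member containing \<open>I\<close>.
\<close>

lemma idealistic_filtration_Inter:
  assumes "\<forall>J\<in>\<J>. idealistic_filtration J"
  shows "idealistic_filtration (\<Inter>\<J>)"
proof -
  have lev: "level (\<Inter>\<J>) a = (\<Inter>J\<in>\<J>. level J a)" for a
    by (auto simp: level_def)
  have ideals: "is_ideal (level (\<Inter>\<J>) a)" for a
    using assms unfolding lev idealistic_filtration_def ideal_in_def by simp
  have "level (\<Inter>\<J>) a * level (\<Inter>\<J>) b \<subseteq> level (\<Inter>\<J>) (a + b)" for a b
  proof -
    have "level J a * level J b \<subseteq> level J (a + b)" if "J \<in> \<J>" for J
      using assms that by (simp add: idealistic_filtration_def)
    then show ?thesis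
      unfolding lev set_times_def by fast
  qed
  moreover have "level (\<Inter>\<J>) a \<subseteq> level (\<Inter>\<J>) b" if "b \<le> a" for a b
  proof -
    have "level J a \<subseteq> level J b" if "J \<in> \<J>" for J
      using assms that \<open>b \<le> a\<close> by (simp add: idealistic_filtration_def)
    then show ?thesis
      unfolding lev by fast
  qed
  moreover have "level (\<Inter>\<J>) 0 = UNIV"
    using assms unfolding lev idealistic_filtration_def by simp
  ultimately show ?thesis
    using ideals by (simp add: idealistic_filtration_def)
qed

lemma D_saturated_Inter:
  assumes "\<forall>J\<in>\<J>. D_saturated \<DD> J"
  shows "D_saturated \<DD> (\<Inter>\<J>)"
  unfolding D_saturated_def
proof (intro allI ballI impI InterI)
  fix f a t \<delta> J
  assume "\<delta> \<in> \<DD> t" "(f, a) \<in> \<Inter>\<J>" "J \<in> \<J>"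
  moreover from this have "(f, a) \<in> J" by simp
  ultimately show "(\<delta> f, a - real t) \<in> J"
    using assms by (simp add: D_saturated_def)
qed

lemma R_saturated_Inter:
  assumes "\<forall>J\<in>\<J>. R_saturated J"
  shows "R_saturated (\<Inter>\<J>)"
  unfolding R_saturated_def
proof (intro conjI allI impI InterI)
  fix f a J and n :: nat
  assume "n > 0" "(f ^ n, real n * a) \<in> \<Inter>\<J>" "J \<in> \<J>"
  then have "R_saturated J" "n > 0" "(f ^ n, real n * a) \<in> J"
    using assms by simp_all
  then show "(f, a) \<in> J"
    unfolding R_saturated_def by metis
next
  fix f a s J
  assume "\<forall>l. (f, s l) \<in> \<Inter>\<J>" "s \<longlonglongrightarrow> a" "J \<in> \<J>"
  then have "R_saturated J" "\<forall>l. (f, s l) \<in> J" "s \<longlonglongrightarrow> a"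
    using assms by simp_all
  then show "(f, a) \<in> J"
    unfolding R_saturated_def by metis
qed

lemma D_saturation_saturated:
  "idealistic_filtration (D_saturation \<DD> I) \<and> D_saturated \<DD> (D_saturation \<DD> I)"
  unfolding D_saturation_def
  by (rule hull_in, intro conjI idealistic_filtration_Inter D_saturated_Inter) simp_all

lemma R_saturation_saturated:
  "idealistic_filtration (R_saturation I) \<and> R_saturated (R_saturation I)"
  unfolding R_saturation_def
  by (rule hull_in, intro conjI idealistic_filtration_Inter R_saturated_Inter) simp_all

lemma B_saturation_saturated:
  "idealistic_filtration (B_saturation \<DD> I) \<and> D_saturated \<DD> (B_saturation \<DD> I) \<and>
   R_saturated (B_saturation \<DD> I)"
  unfolding B_saturation_def
  by (rule hull_in, intro conjI idealistic_filtration_Inter D_saturated_Inter R_saturated_Inter)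
    simp_all

end

theory Submission
  imports Defs "HOL-Computational_Algebra.Formal_Power_Series"
begin

text \<open>
  The radical and continuous closure of a filtration \<open>I\<close> consists of the \<open>(f, a)\<close> such that for every
  \<open>\<epsilon> > 0\<close> some \<open>(f\<^sup>n, n (a - \<epsilon>))\<close> with \<open>n > 0\<close> lies in \<open>I\<close>. Suppose that \<open>R\<close> has Hasse derivatives
  \<open>H i n\<close> dual to the parameters \<open>x\<^sub>i\<close>. Since \<open>f \<mapsto> \<Sum>\<^sub>n H i n f X\<^sup>n\<close> is a ring homomorphism, their
  action on a stable \<open>I\<close> passes to its closure. Every (logarithmic) operator is built by composition
  from the (logarithmic) Hasse derivatives and operators of lower order, so the closure of a
  \<open>\<DD>\<close>-saturated filtration stays \<open>\<DD>\<close>-saturated.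

  For localizations, \<open>H i n r\<close> is the coefficient of \<open>(dx\<^sub>i)\<^sup>n\<close> in the expansion of \<open>1 \<otimes> r\<close> modulo
  the other \<open>dx\<^sub>j\<close>; the coefficients are unique by iterated derivations in characteristic \<open>0\<close> and by
  functionals linear over \<open>p\<^sup>q\<close>-th powers in characteristic \<open>p\<close>. For completions, lift the parameters
  to the point of the coordinate ring \<open>A\<close>. Their differentials generate \<open>\<Omega>\<close> near the point and, because
  \<open>dim A = d\<close>, are independent; the uniqueness of the coefficients then makes the monomials in the
  parameters independent, so \<open>R\<close> is a power series ring and has the usual Hasse derivatives.
\<close>

section \<open>Ideals\<close>

text \<open>Membership in the closure is a statement about powers \<open>f ^ n\<close>, and an
  operator applied to \<open>f ^ n\<close> says little about powers of its value at
  \<open>f\<close>; hence the detour through operators that come from ring homomorphisms. Both cases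
  of the theorem meet in the locale \<open>coordinate_derivations\<close>. Beyond the derivations it
  asks that an operator commuting with all parameters and killing 1 vanish, and that a parameter can
  be cancelled modulo any constant of its own derivation; the latter allows division by the powers
  of parameters occurring in logarithmic operators. Expansions are made in one differential at a
  time, modulo the others, so that no multi-indices are needed. Iterated derivations only see
  \<open>s!\<close> times the coefficient of order \<open>s\<close>, which is worthless for
  \<open>s\<close> at least p; this forces the second argument in characteristic p. In the completed
  case the independence of the differentials is a matter of growth: a chain of d + 1 primes yields
  \<open>(M + 1) ^ d\<close> independent monomials, whereas generation by b differentials makes the
  fraction field finite over that of b elements, which leaves room for order \<open>M ^ b\<close>
  only.\<close>

lemma is_idealD:
  assumes "is_ideal J"
  shows ideal_zero: "0 \<in> J"
    and ideal_add: "x \<in> J \<Longrightarrow> y \<in> J \<Longrightarrow> x + y \<in> J"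
    and ideal_mult_left: "x \<in> J \<Longrightarrow> s * x \<in> J"
    and ideal_mult_right: "x \<in> J \<Longrightarrow> x * s \<in> J"
  using assms by (auto simp: ideal_in_def mult.commute)

lemma is_idealI:
  assumes "0 \<in> J" "\<And>x y. x \<in> J \<Longrightarrow> y \<in> J \<Longrightarrow> x + y \<in> J" "\<And>s x. x \<in> J \<Longrightarrow> s * x \<in> J"
  shows "is_ideal J"
  using assms by (auto simp: ideal_in_def)

lemma ideal_uminus: "is_ideal J \<Longrightarrow> x \<in> J \<Longrightarrow> - x \<in> J"
  using ideal_mult_left[of J x "- 1"] by simp

lemma ideal_diff: "is_ideal J \<Longrightarrow> x \<in> J \<Longrightarrow> y \<in> J \<Longrightarrow> x - y \<in> J"
  using ideal_add[of J x "- y"] ideal_uminus[of J y] by simp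

lemma ideal_sum:
  assumes "is_ideal J" "\<And>i. i \<in> A \<Longrightarrow> f i \<in> J"
  shows "sum f A \<in> J"
  using assms(2) by (induction A rule: infinite_finite_induct)
    (auto intro: ideal_zero[OF assms(1)] ideal_add[OF assms(1)])

lemma ideal_add_cancel: "is_ideal J \<Longrightarrow> x \<in> J \<Longrightarrow> x + y \<in> J \<longleftrightarrow> y \<in> J"
  using ideal_diff[of J "x + y" x] ideal_add[of J x y] by auto

lemma is_ideal_hull: "is_ideal (is_ideal hull X)"
proof (rule hull_in)
  fix T :: "'a::comm_ring_1 set set"
  assume "Ball T is_ideal"
  then show "is_ideal (\<Inter>T)"
    by (auto simp: ideal_in_def)
qed

lemma is_ideal_vimage_mult: "is_ideal J \<Longrightarrow> is_ideal {t. a * t \<in> J}"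
  by (rule is_idealI) (auto simp: distrib_left mult.left_commute[of a] intro: ideal_zero ideal_add ideal_mult_left)

lemma is_ideal_hull_least: "is_ideal J \<Longrightarrow> X \<subseteq> J \<Longrightarrow> is_ideal hull X \<subseteq> J"
  by (rule hull_minimal)

lemma is_ideal_hull_insert:
  "is_ideal hull (insert a X) = {r * a + y | r y. y \<in> is_ideal hull X}" (is "_ = ?S")
proof (rule hull_unique)
  have I: "is_ideal (is_ideal hull X)" by (rule is_ideal_hull)
  have "r * a + y \<in> ?S" if "y \<in> is_ideal hull X" for r y
    using that by blast
  from this[of 0 1] this[of _ 0] show "insert a X \<subseteq> ?S"
    using ideal_zero[OF I] hull_inc[of _ X is_ideal] by fastforce
  show "is_ideal ?S"
  proof (rule is_idealI)
    show "0 \<in> ?S" using ideal_zero[OF I] by (auto intro!: exI[of _ 0])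
  next
    fix x y assume "x \<in> ?S" "y \<in> ?S"
    then obtain r u s v where "x = r * a + u" "y = s * a + v" "u \<in> is_ideal hull X" "v \<in> is_ideal hull X"
      by blast
    then have "x + y = (r + s) * a + (u + v)" "u + v \<in> is_ideal hull X"
      using ideal_add[OF I] by (auto simp: algebra_simps)
    then show "x + y \<in> ?S" by blast
  next
    fix s x assume "x \<in> ?S"
    then obtain r u where "x = r * a + u" "u \<in> is_ideal hull X" by blast
    then have "s * x = (s * r) * a + s * u" "s * u \<in> is_ideal hull X"
      using ideal_mult_left[OF I, of u s] by (simp_all add: algebra_simps)
    then show "s * x \<in> ?S" by blast
  qed
next
  fix t assume t: "insert a X \<subseteq> t" "is_ideal t"
  have "is_ideal hull X \<subseteq> t" using t by (intro hull_minimal) auto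
  then show "?S \<subseteq> t"
    using t by (auto intro!: ideal_add ideal_mult_left)
qed

lemma is_ideal_hull_empty: "is_ideal hull {} = {0}"
  by (rule hull_unique) (auto simp: ideal_in_def)

lemma is_ideal_hull_singleton: "is_ideal hull {a} = {r * a | r. True}"
  by (simp add: is_ideal_hull_insert is_ideal_hull_empty)

lemma is_ideal_hull_finite:
  assumes "finite A"
  shows "is_ideal hull (f ` A) = {\<Sum>i\<in>A. r i * f i | r. True}"
  using assms
proof (induction A rule: finite_induct)
  case empty
  then show ?case by (simp add: is_ideal_hull_empty)
next
  case (insert a A)
  have eq: "\<exists>r'. r * f a + (\<Sum>i\<in>A. s i * f i) = (\<Sum>i\<in>insert a A. r' i * f i)" for r s
  proof
    have "(\<Sum>i\<in>A. (s(a := r)) i * f i) = (\<Sum>i\<in>A. s i * f i)"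
      by (rule sum.cong) (use insert in auto)
    then show "r * f a + (\<Sum>i\<in>A. s i * f i) = (\<Sum>i\<in>insert a A. (s(a := r)) i * f i)"
      using insert by simp
  qed
  have "is_ideal hull (f ` insert a A) = {r * f a + y | r y. y \<in> {\<Sum>i\<in>A. r i * f i | r. True}}"
    using insert.IH by (simp add: is_ideal_hull_insert)
  also have "\<dots> = {\<Sum>i\<in>insert a A. r i * f i | r. True}"
    using eq insert.hyps by fastforce
  finally show ?case .
qed


section \<open>The radical and continuous closure\<close>

context
  fixes J :: "('r::comm_ring_1 \<times> real) set"
  assumes J: "idealistic_filtration J"
begin

lemma filtration_level_ideal: "is_ideal {f. (f, a) \<in> J}"
  using J by (auto simp: idealistic_filtration_def level_def)

lemma filtration_zero: "(0, a) \<in> J"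
  using ideal_zero[OF filtration_level_ideal] by simp

lemma filtration_add: "(f, a) \<in> J \<Longrightarrow> (g, a) \<in> J \<Longrightarrow> (f + g, a) \<in> J"
  using ideal_add[OF filtration_level_ideal] by simp

lemma filtration_scale: "(f, a) \<in> J \<Longrightarrow> (r * f, a) \<in> J"
  using ideal_mult_left[OF filtration_level_ideal] by simp

lemma filtration_sum: "(\<And>i. i \<in> A \<Longrightarrow> (f i, a) \<in> J) \<Longrightarrow> (sum f A, a) \<in> J"
  using ideal_sum[OF filtration_level_ideal, of A f] by simp

lemma filtration_mult: "(f, a) \<in> J \<Longrightarrow> (g, b) \<in> J \<Longrightarrow> (f * g, a + b) \<in> J"
  using J unfolding idealistic_filtration_def level_def set_times_def by blast

lemma filtration_mono: "(f, a) \<in> J \<Longrightarrow> b \<le> a \<Longrightarrow> (f, b) \<in> J"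
  using J unfolding idealistic_filtration_def level_def by blast

lemma filtration_nonpos: "a \<le> 0 \<Longrightarrow> (f, a) \<in> J"
  using J filtration_mono[of f 0 a] unfolding idealistic_filtration_def level_def by blast

lemma filtration_power: "(f, a) \<in> J \<Longrightarrow> (f ^ n, real n * a) \<in> J"
proof (induction n)
  case (Suc n)
  then show ?case using filtration_mult[of f a "f ^ n" "real n * a"] by (simp add: algebra_simps)
qed (simp add: filtration_nonpos)

end

definition asymp_closure :: "('r::comm_ring_1 \<times> real) set \<Rightarrow> ('r \<times> real) set" where
  "asymp_closure J =
     {(f, a). \<forall>\<epsilon>>0. \<exists>n>0. (f ^ n, real n * (a - \<epsilon>)) \<in> J}"

lemma asymp_closure_iff:
  "(f, a) \<in> asymp_closure J \<longleftrightarrow> (\<forall>\<epsilon>>0. \<exists>n>0. (f ^ n, real n * (a - \<epsilon>)) \<in> J)"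
  by (simp add: asymp_closure_def)

context
  fixes J :: "('r::comm_ring_1 \<times> real) set"
  assumes J: "idealistic_filtration J"
begin

lemma asymp_closure_common_exponent:
  assumes "(f, a) \<in> asymp_closure J" "(g, b) \<in> asymp_closure J" "\<epsilon> > 0"
  obtains n where "n > 0" "(f ^ n, real n * (a - \<epsilon>)) \<in> J" "(g ^ n, real n * (b - \<epsilon>)) \<in> J"
proof -
  obtain n m where nm: "n > 0" "(f ^ n, real n * (a - \<epsilon>)) \<in> J"
      "m > 0" "(g ^ m, real m * (b - \<epsilon>)) \<in> J"
    using assms unfolding asymp_closure_iff by blast
  show thesis
  proof (rule that[of "n * m"])
    show "n * m > 0" using nm by simp
    show "(f ^ (n * m), real (n * m) * (a - \<epsilon>)) \<in> J"
      using filtration_power[OF J nm(2), of m] by (simp add: power_mult[symmetric] mult_ac)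
    show "(g ^ (n * m), real (n * m) * (b - \<epsilon>)) \<in> J"
      using filtration_power[OF J nm(4), of n] by (simp add: power_mult[symmetric] mult_ac)
  qed
qed

text \<open>Expand \<open>(f + g) ^ N\<close> binomially. Only powers of \<open>f ^ n\<close> and
  \<open>g ^ n\<close> are controlled, so each factor of a term loses at most \<open>n * b\<close>
  when its exponent is rounded down to a multiple of \<open>n\<close>; this bounded loss is absorbed
  once \<open>N\<close> is large.\<close>

lemma asymp_closure_add:
  assumes f: "(f, a) \<in> asymp_closure J" and g: "(g, a) \<in> asymp_closure J"
  shows "(f + g, a) \<in> asymp_closure J"
  unfolding asymp_closure_iff
proof (intro allI impI)
  fix \<epsilon> :: real assume \<epsilon>: "\<epsilon> > 0"
  define b where "b = a - \<epsilon> / 2"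
  show "\<exists>n>0. ((f + g) ^ n, real n * (a - \<epsilon>)) \<in> J"
  proof (cases "b \<le> 0")
    \<comment> \<open>Levels at most 0 contain everything; the estimates of the other case need
      \<open>b > 0\<close>.\<close>
    case True
    then have "a - \<epsilon> \<le> 0" using \<epsilon> by (simp add: b_def)
    then show ?thesis using filtration_nonpos[OF J, of "1 * (a - \<epsilon>)"] by (intro exI[of _ 1]) auto
  next
    case False
    obtain n where n: "n > 0" "(f ^ n, real n * b) \<in> J" "(g ^ n, real n * b) \<in> J"
      using asymp_closure_common_exponent[OF f g, of "\<epsilon> / 2"] \<epsilon> unfolding b_def by auto
    have pow: "(h ^ i, (real i - real n) * b) \<in> J" if "(h ^ n, real n * b) \<in> J" for h i
    proof -
      have 1: "((h ^ n) ^ (i div n), real (i div n) * (real n * b)) \<in> J"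
        using filtration_power[OF J that] .
      have "h ^ i = h ^ (i mod n) * (h ^ n) ^ (i div n)"
        by (simp flip: power_mult power_add)
      then have 2: "(h ^ i, real (i div n) * (real n * b)) \<in> J"
        using filtration_scale[OF J 1] by simp
      have "i div n * n + i mod n = i" by simp
      then have "real (i div n) * real n + real (i mod n) = real i"
        by (metis of_nat_add of_nat_mult)
      moreover have "real (i mod n) \<le> real n" using n by (simp add: less_imp_le)
      ultimately have "real i - real n \<le> real (i div n) * real n" by linarith
      then have "(real i - real n) * b \<le> real (i div n) * (real n * b)"
        using False by (metis mult.assoc mult_right_mono linear)
      then show ?thesis using filtration_mono[OF J 2] by blast
    qed
    \<comment> \<open>The two roundings cost \<open>2 * n * b\<close> together; the bound makes this
      at most \<open>N * \<epsilon> / 2\<close>, the other half of \<open>\<epsilon>\<close> being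
      already spent in \<open>b\<close>.\<close>
    obtain N :: nat where N: "real N > 4 * real n * b / \<epsilon>" "N > 0"
    proof -
      obtain M :: nat where "real M > 4 * real n * b / \<epsilon>" using reals_Archimedean2 by blast
      then show thesis using that[of "Suc M"] by simp
    qed
    have "((f + g) ^ N, real N * (a - \<epsilon>)) \<in> J"
      unfolding binomial_ring
    proof (rule filtration_sum[OF J])
      fix i assume i: "i \<in> {..N}"
      have "(f ^ i * g ^ (N - i), (real i - real n) * b + (real (N - i) - real n) * b) \<in> J"
        by (rule filtration_mult[OF J pow pow]) (use n in auto)
      moreover have "(real i - real n) * b + (real (N - i) - real n) * b = (real N - 2 * real n) * b"
        using i by (simp add: of_nat_diff algebra_simps)
      ultimately have 1: "(f ^ i * g ^ (N - i), (real N - 2 * real n) * b) \<in> J" by simp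
      have "2 * real n * b \<le> real N * (\<epsilon> / 2)" using N \<epsilon> by (simp add: field_simps)
      then have "real N * (a - \<epsilon>) \<le> (real N - 2 * real n) * b"
        unfolding b_def by (simp add: algebra_simps)
      then have "(f ^ i * g ^ (N - i), real N * (a - \<epsilon>)) \<in> J"
        by (rule filtration_mono[OF J 1])
      then show "(of_nat (N choose i) * f ^ i * g ^ (N - i), real N * (a - \<epsilon>)) \<in> J"
        using filtration_scale[OF J] by (simp add: mult.assoc)
    qed
    then show ?thesis using N by blast
  qed
qed

lemma asymp_closure_superset: "J \<subseteq> asymp_closure J"
proof
  fix z assume z: "z \<in> J"
  obtain f a where fa: "z = (f, a)" by (cases z)
  have "(f ^ 1, real 1 * (a - \<epsilon>)) \<in> J" if "\<epsilon> > 0" for \<epsilon>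
    using filtration_mono[OF J, of f a "a - \<epsilon>"] z fa that by simp
  then show "z \<in> asymp_closure J"
    unfolding fa asymp_closure_iff by (meson zero_less_one)
qed

lemma asymp_closure_mult:
  assumes f: "(f, a) \<in> asymp_closure J" and g: "(g, b) \<in> asymp_closure J"
  shows "(f * g, a + b) \<in> asymp_closure J"
  unfolding asymp_closure_iff
proof (intro allI impI)
  fix \<epsilon> :: real assume \<epsilon>: "\<epsilon> > 0"
  obtain n where n: "n > 0" "(f ^ n, real n * (a - \<epsilon> / 2)) \<in> J" "(g ^ n, real n * (b - \<epsilon> / 2)) \<in> J"
    using asymp_closure_common_exponent[OF f g, of "\<epsilon> / 2"] \<epsilon> by auto
  have "(f ^ n * g ^ n, real n * (a - \<epsilon> / 2) + real n * (b - \<epsilon> / 2)) \<in> J"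
    using filtration_mult[OF J n(2,3)] .
  also have "real n * (a - \<epsilon> / 2) + real n * (b - \<epsilon> / 2) = real n * (a + b - \<epsilon>)"
    by (simp add: algebra_simps)
  finally show "\<exists>n>0. ((f * g) ^ n, real n * (a + b - \<epsilon>)) \<in> J"
    using n by (auto simp: power_mult_distrib)
qed

lemma asymp_closure_mono:
  assumes "(f, a) \<in> asymp_closure J" "b \<le> a"
  shows "(f, b) \<in> asymp_closure J"
  unfolding asymp_closure_iff
proof (intro allI impI)
  fix \<epsilon> :: real assume \<epsilon>: "\<epsilon> > 0"
  then obtain n where n: "n > 0" "(f ^ n, real n * (a - \<epsilon>)) \<in> J"
    using assms(1) unfolding asymp_closure_iff by blast
  have "real n * (b - \<epsilon>) \<le> real n * (a - \<epsilon>)"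
    using assms(2) by (intro mult_left_mono) auto
  then show "\<exists>n>0. (f ^ n, real n * (b - \<epsilon>)) \<in> J"
    using n filtration_mono[OF J n(2)] by blast
qed

lemma asymp_closure_scale:
  assumes "(f, a) \<in> asymp_closure J"
  shows "(r * f, a) \<in> asymp_closure J"
proof -
  have "(r, 0) \<in> asymp_closure J"
    using asymp_closure_superset filtration_nonpos[OF J, of 0 r] by auto
  from asymp_closure_mult[OF this assms] show ?thesis by simp
qed

lemma idealistic_filtration_asymp_closure: "idealistic_filtration (asymp_closure J)"
  unfolding idealistic_filtration_def level_def
proof (intro conjI allI impI)
  show "{f. (f, 0) \<in> asymp_closure J} = UNIV"
    using asymp_closure_superset filtration_nonpos[OF J, of 0] by auto
  show "is_ideal {f. (f, a) \<in> asymp_closure J}" for a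
    using asymp_closure_superset filtration_zero[OF J, of a]
    by (intro is_idealI) (auto intro: asymp_closure_add asymp_closure_scale)
  show "{f. (f, a) \<in> asymp_closure J} * {f. (f, b) \<in> asymp_closure J}
        \<subseteq> {f. (f, a + b) \<in> asymp_closure J}" for a b
    by (auto simp: set_times_def intro: asymp_closure_mult)
  show "{f. (f, a) \<in> asymp_closure J} \<subseteq> {f. (f, b) \<in> asymp_closure J}" if "b \<le> a" for a b
    using that by (auto intro: asymp_closure_mono)
qed

lemma asymp_closure_radical:
  assumes "(f ^ n, real n * a) \<in> asymp_closure J" "n > 0"
  shows "(f, a) \<in> asymp_closure J"
  unfolding asymp_closure_iff
proof (intro allI impI)
  fix \<epsilon> :: real assume \<epsilon>: "\<epsilon> > 0"
  then have "real n * \<epsilon> > 0" using assms by simp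
  then obtain l where l: "l > 0" "((f ^ n) ^ l, real l * (real n * a - real n * \<epsilon>)) \<in> J"
    using assms(1) unfolding asymp_closure_iff by blast
  moreover have "real l * (real n * a - real n * \<epsilon>) = real (n * l) * (a - \<epsilon>)"
    by (simp add: algebra_simps)
  ultimately have "(f ^ (n * l), real (n * l) * (a - \<epsilon>)) \<in> J"
    by (simp only: power_mult)
  then show "\<exists>n>0. (f ^ n, real n * (a - \<epsilon>)) \<in> J"
    using l assms(2) by (intro exI[of _ "n * l"]) auto
qed

lemma asymp_closure_below:
  assumes "\<And>\<epsilon>. \<epsilon> > 0 \<Longrightarrow> (f, a - \<epsilon>) \<in> asymp_closure J"
  shows "(f, a) \<in> asymp_closure J"
  unfolding asymp_closure_iff
proof (intro allI impI)
  fix \<epsilon> :: real assume "\<epsilon> > 0"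
  then have "\<exists>n>0. (f ^ n, real n * (a - \<epsilon> / 2 - \<epsilon> / 2)) \<in> J"
    using assms[of "\<epsilon> / 2"] unfolding asymp_closure_iff by (meson half_gt_zero)
  then show "\<exists>n>0. (f ^ n, real n * (a - \<epsilon>)) \<in> J" by simp
qed

lemma R_saturated_asymp_closure: "R_saturated (asymp_closure J)"
  unfolding R_saturated_def
proof (intro conjI allI impI)
  fix f a s assume s: "\<forall>l. (f, s l) \<in> asymp_closure J" "s \<longlonglongrightarrow> a"
  show "(f, a) \<in> asymp_closure J"
  proof (rule asymp_closure_below)
    fix \<epsilon> :: real assume "\<epsilon> > 0"
    then have "eventually (\<lambda>l. s l > a - \<epsilon>) sequentially"
      using s(2) by (auto simp: order_tendsto_iff)
    then obtain l where "s l > a - \<epsilon>" by (auto simp: eventually_sequentially)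
    then show "(f, a - \<epsilon>) \<in> asymp_closure J"
      using asymp_closure_mono[of f "s l" "a - \<epsilon>"] s(1) by simp
  qed
qed (rule asymp_closure_radical)

text \<open>The radical condition reaches every level \<open>a - 1 / (l + 1)\<close>, and the
  continuity condition then reaches \<open>a\<close>. Conversely the closure is itself
  saturated.\<close>

lemma R_saturation_eq_asymp_closure: "R_saturation J = asymp_closure J"
proof
  show "R_saturation J \<subseteq> asymp_closure J"
    unfolding R_saturation_def
    using asymp_closure_superset idealistic_filtration_asymp_closure
      R_saturated_asymp_closure by (intro hull_minimal) auto
  have sub: "J \<subseteq> R_saturation J" unfolding R_saturation_def by (rule hull_subset)
  have sat: "R_saturated (R_saturation J)" using R_saturation_saturated by blast
  show "asymp_closure J \<subseteq> R_saturation J"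
  proof
    fix z assume z: "z \<in> asymp_closure J"
    obtain f a where fa: "z = (f, a)" by (cases z)
    have "(f, a - inverse (real (Suc l))) \<in> R_saturation J" for l
    proof -
      have "inverse (real (Suc l)) > 0" by simp
      then obtain n where n: "n > 0" "(f ^ n, real n * (a - inverse (real (Suc l)))) \<in> J"
        using z unfolding fa asymp_closure_iff by blast
      then have "(f ^ n, real n * (a - inverse (real (Suc l)))) \<in> R_saturation J" using sub by blast
      then show ?thesis
        using sat[unfolded R_saturated_def, THEN conjunct1, rule_format, OF n(1)] by simp
    qed
    moreover have "(\<lambda>l. a - inverse (real (Suc l))) \<longlonglongrightarrow> a"
      by (rule LIMSEQ_inverse_real_of_nat_add_minus[of a, simplified add_uminus_conv_diff])
    ultimately show "z \<in> R_saturation J"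
      unfolding fa
      using sat[unfolded R_saturated_def, THEN conjunct2, rule_format, of f "\<lambda>l. a - inverse (real (Suc l))" a]
      by simp
  qed
qed

end


section \<open>Higher derivations\<close>

text \<open>A Hasse-Schmidt derivation of infinite order. Linearity over the scalars is required
  separately where operators are concerned.\<close>

definition higher_derivation :: "(nat \<Rightarrow> 'r \<Rightarrow> 'r::comm_ring_1) \<Rightarrow> bool" where
  "higher_derivation h \<longleftrightarrow> h 0 = id \<and> (\<forall>n f g. h n (f + g) = h n f + h n g) \<and>
     (\<forall>n f g. h n (f * g) = (\<Sum>i\<le>n. h i f * h (n - i) g))"

lemma higher_derivationD:
  assumes "higher_derivation h"
  shows "h 0 f = f" "h n (f + g) = h n f + h n g" "h n (f * g) = (\<Sum>i\<le>n. h i f * h (n - i) g)"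
    "h n 0 = 0" "h n (f - g) = h n f - h n g"
proof -
  show 1: "h 0 f = f" "h n (f + g) = h n f + h n g" "h n (f * g) = (\<Sum>i\<le>n. h i f * h (n - i) g)" for f g
    using assms by (auto simp: higher_derivation_def)
  show "h n 0 = 0" using 1(2)[of 0 0] by simp
  show "h n (f - g) = h n f - h n g" using 1(2)[of "f - g" g] by (simp add: algebra_simps)
qed

section \<open>Taylor series and the induced filtration of power series\<close>

unbundle fps_syntax

definition taylor :: "(nat \<Rightarrow> 'r \<Rightarrow> 'r) \<Rightarrow> 'r \<Rightarrow> 'r::comm_ring_1 fps" where
  "taylor h f = Abs_fps (\<lambda>n. h n f)"

lemma taylor_nth [simp]: "taylor h f $ n = h n f"
  by (simp add: taylor_def)

lemma taylor_mult: "higher_derivation h \<Longrightarrow> taylor h (f * g) = taylor h f * taylor h g"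
  by (rule fps_ext) (simp add: higher_derivationD fps_mult_nth atLeast0AtMost)

text \<open>That \<open>h n 1 = 0\<close> for \<open>n > 0\<close> comes for free:
  \<open>taylor h 1\<close> is idempotent with constant term 1.\<close>

lemma taylor_one:
  assumes "higher_derivation h"
  shows "taylor h 1 = 1"
proof -
  define e where "e = taylor h 1 - 1"
  have "taylor h 1 * taylor h 1 = taylor h 1" using taylor_mult[OF assms, of 1 1] by simp
  \<comment> \<open>Idempotency of \<open>1 + e\<close>. As \<open>e $ 0 = 0\<close>, the
    coefficient of order \<open>n\<close> on the right only involves lower ones.\<close>
  then have e: "e = - (e * e)" by (simp add: e_def algebra_simps)
  have "e $ n = 0" for n
  proof (induction n rule: less_induct)
    case (less n)
    have e0: "e $ 0 = 0" using higher_derivationD(1)[OF assms] by (simp add: e_def)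
    have "(e * e) $ n = (\<Sum>i=0..n. e $ i * e $ (n - i))" by (rule fps_mult_nth)
    also have "\<dots> = 0"
    proof (rule sum.neutral, rule ballI)
      fix i assume "i \<in> {0..n}"
      then consider "i < n" | "n - i = 0" by fastforce
      then show "e $ i * e $ (n - i) = 0"
        by cases (use less e0 in auto)
    qed
    finally show ?case using arg_cong[OF e, of "\<lambda>F. F $ n"] by simp
  qed
  then show ?thesis by (simp add: e_def fps_eq_iff)
qed

lemma taylor_power: "higher_derivation h \<Longrightarrow> taylor h (f ^ n) = taylor h f ^ n"
  by (induction n) (simp_all add: taylor_one taylor_mult)

text \<open>The extension of \<open>J\<close> to power series in which \<open>X\<close> has level
  1.\<close>

definition fps_filtration :: "('r::comm_ring_1 \<times> real) set \<Rightarrow> ('r fps \<times> real) set" where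
  "fps_filtration J = {(F, c). \<forall>n. (F $ n, c - real n) \<in> J}"

lemma fps_filtration_iff: "(F, c) \<in> fps_filtration J \<longleftrightarrow> (\<forall>n. (F $ n, c - real n) \<in> J)"
  by (simp add: fps_filtration_def)

context
  fixes J :: "('r::comm_ring_1 \<times> real) set"
  assumes J: "idealistic_filtration J"
begin

lemma fps_filtration_mult:
  assumes "(F, a) \<in> fps_filtration J" "(G, b) \<in> fps_filtration J"
  shows "(F * G, a + b) \<in> fps_filtration J"
  unfolding fps_filtration_iff fps_mult_nth
proof (intro allI filtration_sum[OF J])
  fix n i :: nat assume i: "i \<in> {0..n}"
  have "(F $ i * G $ (n - i), (a - real i) + (b - real (n - i))) \<in> J"
    using assms by (intro filtration_mult[OF J]) (auto simp: fps_filtration_iff)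
  then show "(F $ i * G $ (n - i), a + b - real n) \<in> J"
    using i by (simp add: of_nat_diff algebra_simps)
qed

lemma idealistic_filtration_fps_filtration: "idealistic_filtration (fps_filtration J)"
  unfolding idealistic_filtration_def level_def
proof (intro conjI allI impI)
  show 0: "{f. (f, 0) \<in> fps_filtration J} = UNIV"
    by (auto simp: fps_filtration_iff intro: filtration_nonpos[OF J])
  show "is_ideal {f. (f, a) \<in> fps_filtration J}" for a
  proof (rule is_idealI)
    fix s F :: "'r fps" assume "F \<in> {f. (f, a) \<in> fps_filtration J}"
    then show "s * F \<in> {f. (f, a) \<in> fps_filtration J}"
      using fps_filtration_mult[of s 0 F a] 0 by auto
  qed (auto simp: fps_filtration_iff intro: filtration_add[OF J] filtration_zero[OF J])
  show "{f. (f, a) \<in> fps_filtration J} * {f. (f, b) \<in> fps_filtration J}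
        \<subseteq> {f. (f, a + b) \<in> fps_filtration J}" for a b
    by (auto simp: set_times_def intro: fps_filtration_mult)
  show "{f. (f, a) \<in> fps_filtration J} \<subseteq> {f. (f, b) \<in> fps_filtration J}" if "b \<le> a" for a b
    using that by (auto simp: fps_filtration_iff intro: filtration_mono[OF J])
qed

lemma asymp_closure_fps_nth_0:
  assumes "(F, a) \<in> asymp_closure (fps_filtration J)"
  shows "(F $ 0, a) \<in> asymp_closure J"
  unfolding asymp_closure_iff
proof (intro allI impI)
  fix \<epsilon> :: real assume "\<epsilon> > 0"
  then obtain n where n: "n > 0" "(F ^ n, real n * (a - \<epsilon>)) \<in> fps_filtration J"
    using assms unfolding asymp_closure_iff by blast
  have "((F ^ n) $ 0, real n * (a - \<epsilon>) - real 0) \<in> J"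
    using n(2) unfolding fps_filtration_iff by (rule spec)
  then have "((F $ 0) ^ n, real n * (a - \<epsilon>)) \<in> J"
    by (simp add: fps_power_zeroth)
  then show "\<exists>n>0. ((F $ 0) ^ n, real n * (a - \<epsilon>)) \<in> J"
    using n(1) by blast
qed

lemma asymp_closure_fps_const:
  assumes "(f, a) \<in> asymp_closure J"
  shows "(fps_const f, a) \<in> asymp_closure (fps_filtration J)"
  unfolding asymp_closure_iff
proof (intro allI impI)
  fix \<epsilon> :: real assume "\<epsilon> > 0"
  then obtain n where n: "n > 0" "(f ^ n, real n * (a - \<epsilon>)) \<in> J"
    using assms unfolding asymp_closure_iff by blast
  have "(fps_const (f ^ n) $ i, real n * (a - \<epsilon>) - real i) \<in> J" for i
    using n(2) filtration_zero[OF J] by (cases "i = 0") (simp_all add: fps_nth_fps_const)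
  then have "(fps_const f ^ n, real n * (a - \<epsilon>)) \<in> fps_filtration J"
    unfolding fps_filtration_iff fps_const_power by blast
  then show "\<exists>n>0. (fps_const f ^ n, real n * (a - \<epsilon>)) \<in> fps_filtration J"
    using n(1) by blast
qed

text \<open>
  The constant term of \<open>F ^ N\<close> is the \<open>N\<close>-th power of the constant term of \<open>F\<close>; subtracting it
  and dividing by \<open>X\<close> lowers the level by one, so all coefficients are reached successively.
\<close>

lemma asymp_closure_fps_nth:
  "(F, a) \<in> asymp_closure (fps_filtration J) \<Longrightarrow> (F $ n, a - real n) \<in> asymp_closure J"
proof (induction n arbitrary: F a)
  case 0
  then show ?case using asymp_closure_fps_nth_0 by simp
next
  case (Suc n)
  note W = idealistic_filtration_fps_filtration
  have "((- 1) * fps_const (F $ 0), a) \<in> asymp_closure (fps_filtration J)"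
    by (intro asymp_closure_scale[OF W] asymp_closure_fps_const
        asymp_closure_fps_nth_0 Suc.prems)
  then have "(F + (- 1) * fps_const (F $ 0), a) \<in> asymp_closure (fps_filtration J)"
    by (rule asymp_closure_add[OF W Suc.prems])
  also have "F + (- 1) * fps_const (F $ 0) = fps_X * fps_shift 1 F"
    by (rule fps_ext) (simp add: fps_nth_fps_const)
  finally have XF: "(fps_X * fps_shift 1 F, a) \<in> asymp_closure (fps_filtration J)" .
  have "(fps_shift 1 F, a - 1) \<in> asymp_closure (fps_filtration J)"
    unfolding asymp_closure_iff
  proof (intro allI impI)
    fix \<epsilon> :: real assume "\<epsilon> > 0"
    then obtain N where N: "N > 0"
        "((fps_X * fps_shift 1 F) ^ N, real N * (a - \<epsilon>)) \<in> fps_filtration J"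
      using XF unfolding asymp_closure_iff by blast
    have "((fps_shift 1 F ^ N) $ n, real N * (a - 1 - \<epsilon>) - real n) \<in> J" for n
    proof -
      have "(((fps_X * fps_shift 1 F) ^ N) $ (n + N), real N * (a - \<epsilon>) - real (n + N)) \<in> J"
        using N(2) unfolding fps_filtration_iff by (rule spec)
      moreover have "((fps_X * fps_shift 1 F) ^ N) $ (n + N) = (fps_shift 1 F ^ N) $ n"
        unfolding power_mult_distrib by (simp only: fps_X_power_mult_nth) simp
      moreover have "real N * (a - \<epsilon>) - real (n + N) = real N * (a - 1 - \<epsilon>) - real n"
        by (simp add: algebra_simps)
      ultimately show ?thesis by (simp only:)
    qed
    then show "\<exists>n>0. (fps_shift 1 F ^ n, real n * (a - 1 - \<epsilon>)) \<in> fps_filtration J"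
      using N(1) unfolding fps_filtration_iff by blast
  qed
  from Suc.IH[OF this] show ?case by (simp add: algebra_simps)
qed

text \<open>Stability of \<open>J\<close> puts \<open>taylor h (f ^ N)\<close> into the power series
  filtration at the level of \<open>f ^ N\<close>. As it equals \<open>taylor h f ^ N\<close>, the
  series \<open>taylor h f\<close> lies in the closure there, and membership in that closure passes
  to coefficients.\<close>

lemma asymp_closure_higher_derivation:
  assumes h: "higher_derivation h"
    and stable: "\<And>f a n. (f, a) \<in> J \<Longrightarrow> (h n f, a - real n) \<in> J"
    and f: "(f, a) \<in> asymp_closure J"
  shows "(h n f, a - real n) \<in> asymp_closure J"
proof -
  have "(taylor h f, a) \<in> asymp_closure (fps_filtration J)"
    unfolding asymp_closure_iff
  proof (intro allI impI)
    fix \<epsilon> :: real assume "\<epsilon> > 0"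
    then obtain N where N: "N > 0" "(f ^ N, real N * (a - \<epsilon>)) \<in> J"
      using f unfolding asymp_closure_iff by blast
    have "(taylor h (f ^ N), real N * (a - \<epsilon>)) \<in> fps_filtration J"
      unfolding fps_filtration_iff using stable[OF N(2)] by simp
    then show "\<exists>n>0. (taylor h f ^ n, real n * (a - \<epsilon>)) \<in> fps_filtration J"
      using N(1) by (auto simp: taylor_power[OF h])
  qed
  from asymp_closure_fps_nth[OF this, of n] show ?thesis by simp
qed

end


section \<open>Functionals on the ring of pretensors\<close>

definition is_ring_hom :: "('a::comm_ring_1 \<Rightarrow> 'b::comm_ring_1) \<Rightarrow> bool" where
  "is_ring_hom \<phi> \<longleftrightarrow> \<phi> 1 = 1 \<and> (\<forall>x y. \<phi> (x + y) = \<phi> x + \<phi> y) \<and> (\<forall>x y. \<phi> (x * y) = \<phi> x * \<phi> y)"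

lemma is_ring_homD:
  assumes "is_ring_hom \<phi>"
  shows "\<phi> 1 = 1" "\<phi> (x + y) = \<phi> x + \<phi> y" "\<phi> (x * y) = \<phi> x * \<phi> y" "\<phi> 0 = 0"
    "\<phi> (- x) = - \<phi> x" "\<phi> (x - y) = \<phi> x - \<phi> y" "\<phi> (x ^ n) = \<phi> x ^ n"
    "\<phi> (sum f A) = (\<Sum>i\<in>A. \<phi> (f i))" "\<phi> (prod f A) = (\<Prod>i\<in>A. \<phi> (f i))" "\<phi> (of_nat n) = of_nat n"
proof -
  show 1: "\<phi> 1 = 1" "\<phi> (x + y) = \<phi> x + \<phi> y" "\<phi> (x * y) = \<phi> x * \<phi> y" for x y
    using assms by (auto simp: is_ring_hom_def)
  show 0: "\<phi> 0 = 0" using 1(2)[of 0 0] by simp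
  show m: "\<phi> (- x) = - \<phi> x" for x using 1(2)[of x "- x"] 0 by (simp add: eq_neg_iff_add_eq_0 add.commute)
  show "\<phi> (x - y) = \<phi> x - \<phi> y" using 1(2)[of x "- y"] m by simp
  show "\<phi> (x ^ n) = \<phi> x ^ n" by (induction n) (simp_all add: 1)
  show "\<phi> (sum f A) = (\<Sum>i\<in>A. \<phi> (f i))" by (induction A rule: infinite_finite_induct) (simp_all add: 0 1)
  show "\<phi> (prod f A) = (\<Prod>i\<in>A. \<phi> (f i))" by (induction A rule: infinite_finite_induct) (simp_all add: 1)
  show "\<phi> (of_nat n) = of_nat n" by (induction n) (simp_all add: 0 1)
qed

lemma is_ring_hom_id: "is_ring_hom (\<lambda>x. x)"
  by (simp add: is_ring_hom_def)

text \<open>The functional \<open>a \<otimes> b \<mapsto> \<phi> a * \<mu> b\<close>, linear on the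
  left through \<open>\<phi>\<close>. It lives on formal sums, so \<open>\<mu>\<close> may be
  arbitrary; the bilinearity relations are checked afterwards.\<close>

definition tensor_map :: "('r \<Rightarrow> 'b::comm_ring_1) \<Rightarrow> ('r \<Rightarrow> 'b) \<Rightarrow> 'r pretensor \<Rightarrow> 'b" where
  "tensor_map \<phi> \<mu> f =
     (\<Sum>p\<in>Poly_Mapping.keys f. of_int (Poly_Mapping.lookup f p) * (\<phi> (left_factor p) * \<mu> (right_factor p)))"

lemma tensor_map_superset:
  assumes "finite S" "Poly_Mapping.keys f \<subseteq> S"
  shows "tensor_map \<phi> \<mu> f =
    (\<Sum>p\<in>S. of_int (Poly_Mapping.lookup f p) * (\<phi> (left_factor p) * \<mu> (right_factor p)))"
  unfolding tensor_map_def
  by (rule sum.mono_neutral_left) (use assms in \<open>auto simp: in_keys_iff\<close>)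

lemma tensor_map_add:
  "tensor_map \<phi> \<mu> (f + g) = tensor_map \<phi> \<mu> f + tensor_map \<phi> \<mu> g"
proof -
  let ?S = "Poly_Mapping.keys f \<union> Poly_Mapping.keys g"
  have "Poly_Mapping.keys (f + g) \<subseteq> ?S" by (rule Poly_Mapping.keys_add)
  then show ?thesis
    by (simp add: tensor_map_superset[of ?S] lookup_add sum.distrib algebra_simps)
qed

lemma tensor_map_zero [simp]: "tensor_map \<phi> \<mu> 0 = 0"
  by (simp add: tensor_map_def)

lemma tensor_map_uminus: "tensor_map \<phi> \<mu> (- f) = - tensor_map \<phi> \<mu> f"
  using tensor_map_add[of \<phi> \<mu> f "- f"] by (simp add: eq_neg_iff_add_eq_0 add.commute)

lemma tensor_map_diff:
  "tensor_map \<phi> \<mu> (f - g) = tensor_map \<phi> \<mu> f - tensor_map \<phi> \<mu> g"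
  using tensor_map_add[of \<phi> \<mu> f "- g"] by (simp add: tensor_map_uminus)

lemma tensor_map_sum: "tensor_map \<phi> \<mu> (sum f A) = (\<Sum>i\<in>A. tensor_map \<phi> \<mu> (f i))"
  by (induction A rule: infinite_finite_induct) (simp_all add: tensor_map_add)

lemma tensor_map_pt [simp]: "tensor_map \<phi> \<mu> (pt a b) = \<phi> a * \<mu> b"
  by (simp add: tensor_map_def pt_def)

lemma mult_map_eq: "mult_map = tensor_map (\<lambda>r. r) (\<lambda>r. r)"
  by (simp add: fun_eq_iff mult_map_def tensor_map_def)

lemma pretensor_induct [case_names zero pt diff]:
  assumes "P 0" "\<And>a b. P (pt a b)" "\<And>f g. P f \<Longrightarrow> P g \<Longrightarrow> P (f - g)"
  shows "P (f :: 'r pretensor)"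
proof -
  have "P (frag_of p)" for p using assms(2)[of "left_factor p" "right_factor p"] by (simp add: pt_def)
  then show ?thesis
    using frag_induction[of f UNIV P] assms by auto
qed

lemma pt_one: "pt 1 1 = (1 :: 'r::comm_ring_1 pretensor)"
  by (metis pt_def zero_tens_def single_one)

lemma pt_split: "pt a b = pt a 1 * pt 1 b" for a b :: "'r::comm_ring_1"
  by (simp add: pt_mult)

definition dif :: "'r::comm_ring_1 \<Rightarrow> 'r pretensor" where
  "dif c = pt 1 c - pt c 1"

definition commutator :: "('r \<Rightarrow> 'b) \<Rightarrow> ('r \<Rightarrow> 'b) \<Rightarrow> 'r::comm_ring_1 \<Rightarrow> 'r \<Rightarrow> 'b::comm_ring_1" where
  "commutator \<phi> \<mu> c r = \<mu> (c * r) - \<phi> c * \<mu> r"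

lemma tensor_map_left:
  assumes "is_ring_hom \<phi>"
  shows "tensor_map \<phi> \<mu> (pt a 1 * f) = \<phi> a * tensor_map \<phi> \<mu> f"
  by (induction f rule: pretensor_induct)
    (simp_all add: pt_mult is_ring_homD[OF assms] right_diff_distrib tensor_map_diff)

lemma tensor_map_right:
  fixes \<mu> :: "'r::comm_ring_1 \<Rightarrow> 'b::comm_ring_1"
  shows "tensor_map \<phi> \<mu> (pt 1 c * f) = tensor_map \<phi> (\<lambda>r. \<mu> (c * r)) f"
  by (induction f rule: pretensor_induct)
    (simp_all add: pt_mult right_diff_distrib tensor_map_diff)

text \<open>The dictionary that translates powers of the diagonal ideal into orders of
  operators.\<close>

lemma tensor_map_dif:
  assumes "is_ring_hom \<phi>"
  shows "tensor_map \<phi> \<mu> (dif c * f) = tensor_map \<phi> (commutator \<phi> \<mu> c) f"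
  by (induction f rule: pretensor_induct)
    (simp_all add: dif_def commutator_def pt_mult left_diff_distrib right_diff_distrib
      tensor_map_diff is_ring_homD[OF assms])

lemma mult_map_mult: "mult_map (f * g) = mult_map f * mult_map g" for f :: "'r::comm_ring_1 pretensor"
proof (induction f rule: pretensor_induct)
  case (pt a b)
  show ?case unfolding pt_split[of a b] mult.assoc mult_map_eq
    by (induction g rule: pretensor_induct)
      (simp_all add: pt_mult right_diff_distrib tensor_map_diff)
qed (simp_all add: mult_map_eq left_diff_distrib tensor_map_diff)

lemma mult_map_pt [simp]: "mult_map (pt a b) = a * b"
  by (simp add: mult_map_eq)

lemma mult_map_dif [simp]: "mult_map (dif c) = 0"
  by (simp add: dif_def mult_map_eq tensor_map_diff)

lemma mult_map_add: "mult_map (f + g) = mult_map f + mult_map g"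
  by (simp add: mult_map_eq tensor_map_add)

lemma mult_map_diff: "mult_map (f - g) = mult_map f - mult_map g"
  by (simp add: mult_map_eq tensor_map_diff)

lemma is_ring_hom_mult_map: "is_ring_hom mult_map"
  using mult_map_pt[of 1 1] by (simp add: is_ring_hom_def mult_map_mult mult_map_add pt_one)

lemma is_ideal_kernel: "is_ring_hom \<phi> \<Longrightarrow> is_ideal {x. \<phi> x = 0}"
  by (rule is_idealI) (auto simp: is_ring_homD)

lemma is_ideal_diagonal: "is_ideal (diagonal :: 'r::comm_ring_1 pretensor set)"
  using is_ideal_kernel[OF is_ring_hom_mult_map] by (simp add: diagonal_def)

lemma dif_diagonal: "dif c \<in> diagonal"
  by (simp add: diagonal_def)

section \<open>Scalars and the powers of the diagonal ideal\<close>

lemma algebra_scale: "algebra_over sc \<Longrightarrow> sc c x = sc c 1 * x"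
  by (metis algebra_over_def mult_1)

lemma algebra_scale_hom:
  assumes "algebra_over sc"
  shows "sc 1 x = x" "sc (a + b) x = sc a x + sc b x" "sc (a * b) x = sc a (sc b x)"
    "sc a (x + y) = sc a x + sc a y" "sc 0 x = 0" "sc a 0 = 0" "sc a x * y = sc a (x * y)"
    "x * sc a y = sc a (x * y)" "sc (- a) x = - sc a x" "sc (a - b) x = sc a x - sc b x"
proof -
  interpret vector_space sc using assms by (simp add: algebra_over_def)
  show "sc 1 x = x" "sc (a + b) x = sc a x + sc b x" "sc (a * b) x = sc a (sc b x)"
    "sc a (x + y) = sc a x + sc a y" "sc 0 x = 0" "sc a 0 = 0" "sc (- a) x = - sc a x"
    "sc (a - b) x = sc a x - sc b x"
    by (simp_all add: scale_left_distrib scale_right_distrib scale_left_diff_distrib)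
  show 1: "sc a x * y = sc a (x * y)" for x y using assms by (simp add: algebra_over_def)
  show "x * sc a y = sc a (x * y)" using 1[of y x] by (simp add: mult.commute)
qed

lemma tensor_relations_cases:
  assumes "t \<in> tensor_relations sc"
  obtains a a' b where "t = pt (a + a') b - pt a b - pt a' b"
  | a b b' where "t = pt a (b + b') - pt a b - pt a b'"
  | c a b where "t = pt (sc c a) b - pt a (sc c b)"
  using assms unfolding tensor_relations_def by blast

lemma tensor_relationsI:
  "pt (a + a') b - pt a b - pt a' b \<in> tensor_relations sc"
  "pt a (b + b') - pt a b - pt a b' \<in> tensor_relations sc"
  "pt (sc c a) b - pt a (sc c b) \<in> tensor_relations sc"
  unfolding tensor_relations_def by blast+

lemma tensor_relations_diagonal:
  assumes "algebra_over sc"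
  shows "tensor_relations sc \<subseteq> diagonal"
proof
  fix t assume "t \<in> tensor_relations sc"
  then show "t \<in> diagonal"
    by (rule tensor_relations_cases)
      (simp_all add: diagonal_def mult_map_diff distrib_left distrib_right algebra_scale_hom[OF assms])
qed

lemma is_ideal_diag_power: "is_ideal (diagonal_power sc n)"
  unfolding diagonal_power_def by (rule is_ideal_hull)

lemma relations_diagonal_power: "tensor_relations sc \<subseteq> diagonal_power sc n"
  unfolding diagonal_power_def using hull_subset[of "tensor_relations sc \<union> diagonal ^ n" is_ideal] by blast

lemma diagonal_set_power_subset: "diagonal ^ n \<subseteq> diagonal_power sc n"
  unfolding diagonal_power_def using hull_subset[of "tensor_relations sc \<union> diagonal ^ n" is_ideal] by blast

lemma diagonal_power_0: "diagonal_power sc 0 = UNIV"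
proof -
  have "1 \<in> diagonal_power sc 0"
    using diagonal_set_power_subset[of 0 sc] by auto
  then have "x \<in> diagonal_power sc 0" for x
    using ideal_mult_left[OF is_ideal_diag_power, of 1 sc 0 x] by simp
  then show ?thesis by blast
qed

lemma diagonal_power_1:
  assumes "algebra_over sc"
  shows "diagonal_power sc 1 = diagonal"
  unfolding diagonal_power_def power_one_right
  using tensor_relations_diagonal[OF assms] is_ideal_diagonal
  by (simp only: Un_absorb1 hull_same[of is_ideal, OF is_ideal_diagonal])

text \<open>Fix one factor and extend over the hull of the other by a colon ideal, then exchange the
  roles.\<close>

lemma hull_mult_subset:
  fixes A B :: "'a::comm_ring_1 set"
  assumes "is_ideal C" "\<And>a b. a \<in> A \<Longrightarrow> b \<in> B \<Longrightarrow> a * b \<in> C"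
    and "x \<in> is_ideal hull A" "y \<in> is_ideal hull B"
  shows "x * y \<in> C"
proof -
  have I: "is_ideal {a. \<forall>b\<in>S. a * b \<in> C}" for S
    using assms(1) by (intro is_idealI)
      (auto simp: distrib_right mult.assoc intro: ideal_zero ideal_add ideal_mult_left)
  have "is_ideal hull A \<subseteq> {a. \<forall>b\<in>B. a * b \<in> C}"
    using assms(2) by (intro hull_minimal I) auto
  then have A: "a * b \<in> C" if "a \<in> is_ideal hull A" "b \<in> B" for a b
    using that by blast
  have "is_ideal hull B \<subseteq> {b. \<forall>a\<in>is_ideal hull A. b * a \<in> C}"
  proof (intro hull_minimal I subsetI CollectI ballI)
    fix b a assume "b \<in> B" "a \<in> is_ideal hull A"
    from A[OF this(2,1)] show "b * a \<in> C" by (simp add: mult.commute)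
  qed
  then have "y * x \<in> C" using assms(3,4) by blast
  then show ?thesis by (simp add: mult.commute)
qed

lemma diagonal_power_mult:
  assumes "f \<in> diagonal_power sc m" "g \<in> diagonal_power sc n"
  shows "f * g \<in> diagonal_power sc (m + n)"
proof -
  note I = is_ideal_diag_power[of sc "m + n"]
  show ?thesis
  proof (rule hull_mult_subset[OF I _ assms[unfolded diagonal_power_def]])
    fix a b assume a: "a \<in> tensor_relations sc \<union> diagonal ^ m" and b: "b \<in> tensor_relations sc \<union> diagonal ^ n"
    show "a * b \<in> diagonal_power sc (m + n)"
    proof (cases "a \<in> tensor_relations sc \<or> b \<in> tensor_relations sc")
      case True
      then show ?thesis
        using relations_diagonal_power[of sc "m + n"] ideal_mult_left[OF I] ideal_mult_right[OF I]
        by blast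
    next
      case False
      then have "a * b \<in> diagonal ^ (m + n)" using a b by (auto simp: power_add)
      then show ?thesis using diagonal_set_power_subset by blast
    qed
  qed
qed

lemma diagonal_power_antimono:
  assumes "m \<le> n"
  shows "diagonal_power sc n \<subseteq> diagonal_power sc m"
proof
  fix f assume "f \<in> diagonal_power sc n"
  then have f: "f \<in> is_ideal hull (tensor_relations sc \<union> diagonal ^ (n - m) * diagonal ^ m)"
    using assms by (simp add: diagonal_power_def flip: power_add)
  note I = is_ideal_diag_power[of sc m]
  have "tensor_relations sc \<union> diagonal ^ (n - m) * diagonal ^ m \<subseteq> diagonal_power sc m"
    using relations_diagonal_power[of sc m] diagonal_set_power_subset[of m sc]
    by (auto simp: set_times_def intro!: ideal_mult_left[OF I])
  then have "is_ideal hull (tensor_relations sc \<union> diagonal ^ (n - m) * diagonal ^ m) \<subseteq> diagonal_power sc m"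
    using I by (rule hull_minimal)
  then show "f \<in> diagonal_power sc m" using f by blast
qed

lemma dif_power_diagonal_power:
  assumes "algebra_over sc"
  shows "dif c ^ n \<in> diagonal_power sc n"
proof (induction n)
  case (Suc n)
  then show ?case
    using diagonal_power_mult[of "dif c" sc 1] diagonal_power_1[OF assms] dif_diagonal by auto
qed (simp add: diagonal_power_0)

lemma dif_mult: "dif (a * b) = pt a 1 * dif b + pt 1 b * dif a"
  by (simp add: dif_def right_diff_distrib pt_mult mult.commute)

section \<open>Congruences modulo an ideal containing the bilinearity relations\<close>

context
  fixes sc :: "'k::field \<Rightarrow> 'r::comm_ring_1 \<Rightarrow> 'r" and J :: "'r pretensor set"
  assumes J: "is_ideal J" and rel: "tensor_relations sc \<subseteq> J"
begin

lemma pt_add_left_cong: "pt (a + a') b - (pt a b + pt a' b) \<in> J"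
  unfolding diff_diff_eq[symmetric] using rel tensor_relationsI(1) by (rule subsetD)

lemma pt_add_right_cong: "pt a (b + b') - (pt a b + pt a b') \<in> J"
  unfolding diff_diff_eq[symmetric] using rel tensor_relationsI(2) by (rule subsetD)

lemma pt_scale_cong: "pt (sc c a) b - pt a (sc c b) \<in> J"
  using rel tensor_relationsI(3) by (rule subsetD)

lemma pt_zero_left_cong: "pt 0 b \<in> J"
  using ideal_uminus[OF J pt_add_left_cong[of 0 0 b]] by simp

lemma pt_zero_right_cong: "pt a 0 \<in> J"
  using ideal_uminus[OF J pt_add_right_cong[of a 0 0]] by simp

lemma pt_diff_left_cong: "pt (a - a') b - (pt a b - pt a' b) \<in> J"
  using ideal_uminus[OF J pt_add_left_cong[of "a - a'" a' b]] by (simp add: algebra_simps)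

lemma pt_sum_left_cong: "pt (sum f A) b - (\<Sum>i\<in>A. pt (f i) b) \<in> J"
proof (induction A rule: infinite_finite_induct)
  case (insert x F)
  have "pt (sum f (insert x F)) b - (\<Sum>i\<in>insert x F. pt (f i) b) =
      (pt (f x + sum f F) b - (pt (f x) b + pt (sum f F) b)) + (pt (sum f F) b - (\<Sum>i\<in>F. pt (f i) b))"
    using insert by simp
  then show ?case using ideal_add[OF J pt_add_left_cong[of "f x" "sum f F" b] insert.IH] by (simp only:)
qed (simp_all add: pt_zero_left_cong)

lemma dif_add_cong: "dif (a + b) - (dif a + dif b) \<in> J"
  using ideal_diff[OF J pt_add_right_cong[of 1 a b] pt_add_left_cong[of a b 1]]
  by (simp add: dif_def algebra_simps)

lemma dif_scale_one_cong: "dif (sc c 1) \<in> J"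
  using ideal_uminus[OF J pt_scale_cong[of c 1 1]] by (simp add: dif_def)

text \<open>Modulo such an ideal every tensor \<open>f\<close> agrees with
  \<open>pt (mult_map f) 1\<close>, because \<open>pt a b - pt (a * b) 1\<close> is a multiple of
  \<open>dif b\<close>; on the diagonal \<open>mult_map f\<close> is 0.\<close>

lemma diagonal_subset_if_dif:
  assumes "\<And>c. dif c \<in> J"
  shows "diagonal \<subseteq> J"
proof
  have *: "f - pt (mult_map f) 1 \<in> J" for f :: "'r pretensor"
  proof (induction f rule: pretensor_induct)
    case zero
    show ?case using ideal_uminus[OF J pt_zero_left_cong[of 1]] by (simp add: mult_map_eq)
  next
    case (pt a b)
    have "pt a b - pt (a * b) 1 = pt a 1 * dif b"
      by (simp add: dif_def right_diff_distrib pt_mult)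
    then show ?case using ideal_mult_left[OF J assms] by simp
  next
    case (diff f g)
    have "f - g - pt (mult_map (f - g)) 1 = (f - pt (mult_map f) 1) - (g - pt (mult_map g) 1)
        - (pt (mult_map f - mult_map g) 1 - (pt (mult_map f) 1 - pt (mult_map g) 1))"
      by (simp add: mult_map_diff)
    then show ?case using diff pt_diff_left_cong ideal_diff[OF J] by metis
  qed
  fix f :: "'r pretensor" assume "f \<in> diagonal"
  then have "f - pt 0 1 \<in> J" using *[of f] by (simp add: diagonal_def)
  then show "f \<in> J" using ideal_add[OF J _ pt_zero_left_cong[of 1], of "f - pt 0 1"] by simp
qed

end


section \<open>Differential operators and iterated commutators\<close>

definition scalar_linear ::
    "('k \<Rightarrow> 'r \<Rightarrow> 'r) \<Rightarrow> ('r \<Rightarrow> 'b) \<Rightarrow> ('r::comm_ring_1 \<Rightarrow> 'b::comm_ring_1) \<Rightarrow> bool" where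
  "scalar_linear sc \<phi> \<mu> \<longleftrightarrow> (\<forall>x y. \<mu> (x + y) = \<mu> x + \<mu> y) \<and> (\<forall>c x. \<mu> (sc c x) = \<phi> (sc c 1) * \<mu> x)"

text \<open>Grothendieck's recursive description with the order shifted by one: index
  \<open>n\<close> means order less than \<open>n\<close>, so the recursion can start from the zero
  map. Values lie in a ring over \<open>\<phi>\<close>, so that functionals into a field are covered
  too.\<close>

primrec diff_op ::
    "('k \<Rightarrow> 'r \<Rightarrow> 'r) \<Rightarrow> ('r \<Rightarrow> 'b) \<Rightarrow> nat \<Rightarrow> ('r::comm_ring_1 \<Rightarrow> 'b::comm_ring_1) \<Rightarrow> bool" where
  "diff_op sc \<phi> 0 \<mu> \<longleftrightarrow> \<mu> = (\<lambda>_. 0)"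
| "diff_op sc \<phi> (Suc n) \<mu> \<longleftrightarrow> scalar_linear sc \<phi> \<mu> \<and> (\<forall>c. diff_op sc \<phi> n (commutator \<phi> \<mu> c))"

context
  fixes sc :: "'k::field \<Rightarrow> 'r::comm_ring_1 \<Rightarrow> 'r" and \<phi> :: "'r \<Rightarrow> 'b::comm_ring_1"
  assumes sc: "algebra_over sc" and \<phi>: "is_ring_hom \<phi>"
begin

lemma scalar_linearD:
  assumes "scalar_linear sc \<phi> \<mu>"
  shows "\<mu> (x + y) = \<mu> x + \<mu> y" "\<mu> (sc c x) = \<phi> (sc c 1) * \<mu> x" "\<mu> 0 = 0"
    "\<mu> (x - y) = \<mu> x - \<mu> y" "\<mu> (sum f A) = (\<Sum>i\<in>A. \<mu> (f i))"
proof -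
  show 1: "\<mu> (x + y) = \<mu> x + \<mu> y" "\<mu> (sc c x) = \<phi> (sc c 1) * \<mu> x" for x y
    using assms by (auto simp: scalar_linear_def)
  show 0: "\<mu> 0 = 0" using 1(1)[of 0 0] by simp
  show "\<mu> (x - y) = \<mu> x - \<mu> y" using 1(1)[of "x - y" y] by (simp add: algebra_simps)
  show "\<mu> (sum f A) = (\<Sum>i\<in>A. \<mu> (f i))" by (induction A rule: infinite_finite_induct) (simp_all add: 0 1)
qed

lemma diff_op_scalar_linear: "diff_op sc \<phi> n \<mu> \<Longrightarrow> scalar_linear sc \<phi> \<mu>"
  by (cases n) (auto simp: scalar_linear_def)

lemma tensor_map_relations:
  assumes "scalar_linear sc \<phi> \<mu>" "t \<in> tensor_relations sc"
  shows "tensor_map \<phi> \<mu> (t * f) = 0"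
proof (induction f rule: pretensor_induct)
  case (pt a b)
  have s: "sc c x = sc c 1 * x" for c x by (rule algebra_scale[OF sc])
  show ?case
    using assms(2)
  proof (cases rule: tensor_relations_cases)
    case (3 c e g)
    have "\<phi> (sc c e) = \<phi> (sc c 1) * \<phi> e"
      by (subst s) (simp add: is_ring_homD[OF \<phi>])
    moreover have "\<mu> (sc c g * b) = \<phi> (sc c 1) * \<mu> (g * b)"
      by (simp add: algebra_scale_hom(7)[OF sc] scalar_linearD[OF assms(1)])
    moreover have "tensor_map \<phi> \<mu> (t * pt a b) = \<phi> (sc c e) * \<phi> a * \<mu> (g * b) - \<phi> e * \<phi> a * \<mu> (sc c g * b)"
      by (simp add: 3 left_diff_distrib pt_mult tensor_map_diff is_ring_homD[OF \<phi>])
    ultimately show ?thesis by simp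
  qed (simp_all add: left_diff_distrib pt_mult tensor_map_diff distrib_right
        distrib_left is_ring_homD[OF \<phi>] scalar_linearD[OF assms(1)])
qed (simp_all add: tensor_map_diff right_diff_distrib)

text \<open>Both directions go through \<open>tensor_map_dif\<close>. A factor from the diagonal
  ideal is removed by one commutator, since that ideal is generated by the \<open>dif c\<close> and
  the relations; conversely \<open>dif c\<close> raises the power of the diagonal ideal by
  one.\<close>

lemma diff_op_iff_vanishing:
  "diff_op sc \<phi> n \<mu> \<longleftrightarrow> (\<forall>f\<in>diagonal_power sc n. tensor_map \<phi> \<mu> f = 0)"
proof
  have kill: "tensor_map \<phi> \<mu> (t * f) = 0" if "diff_op sc \<phi> n \<mu>" "t \<in> diagonal ^ n" for t f n \<mu>
    using that
  proof (induction n arbitrary: t f \<mu>)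
    case 0
    then show ?case by (simp add: tensor_map_def)
  next
    case (Suc n)
    then obtain s t' where t: "t = s * t'" "s \<in> diagonal" "t' \<in> diagonal ^ n"
      by (auto simp: set_times_def)
    \<comment> \<open>The kernel of a functional is no ideal; requiring vanishing on all multiples
      makes it one.\<close>
    let ?J = "{s. \<forall>f. tensor_map \<phi> \<mu> (s * (t' * f)) = 0}"
    have J: "is_ideal ?J"
    proof (rule is_idealI)
      fix u s assume s: "s \<in> ?J"
      have "tensor_map \<phi> \<mu> (u * s * (t' * f)) = 0" for f
      proof -
        have "u * s * (t' * f) = s * (t' * (u * f))" by (simp add: mult_ac)
        then show ?thesis using s by (metis (mono_tags, lifting) mem_Collect_eq)
      qed
      then show "u * s \<in> ?J" by blast
    qed (auto simp: distrib_right tensor_map_add)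
    have "tensor_relations sc \<subseteq> ?J"
      using tensor_map_relations Suc.prems(1) by auto
    moreover have "dif c \<in> ?J" for c
      using Suc.IH[OF _ t(3)] Suc.prems(1) by (simp add: tensor_map_dif[OF \<phi>])
    ultimately have "diagonal \<subseteq> ?J" using diagonal_subset_if_dif[OF J] by blast
    then show ?case using t by (auto simp: mult.assoc)
  qed
  assume D: "diff_op sc \<phi> n \<mu>"
  let ?K = "{s. \<forall>f. tensor_map \<phi> \<mu> (s * f) = 0}"
  have K: "is_ideal ?K"
  proof (rule is_idealI)
    fix u s assume s: "s \<in> ?K"
    have "tensor_map \<phi> \<mu> (u * s * f) = 0" for f
    proof -
      have "u * s * f = s * (u * f)" by (simp add: mult_ac)
      then show ?thesis using s by (metis (mono_tags, lifting) mem_Collect_eq)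
    qed
    then show "u * s \<in> ?K" by blast
  qed (auto simp: distrib_right tensor_map_add)
  have "diagonal_power sc n \<subseteq> ?K"
    unfolding diagonal_power_def
    using kill[OF D] tensor_map_relations[OF diff_op_scalar_linear[OF D]]
    by (intro hull_minimal K) auto
  then have "\<forall>f\<in>diagonal_power sc n. tensor_map \<phi> \<mu> (f * 1) = 0" by blast
  then show "\<forall>f\<in>diagonal_power sc n. tensor_map \<phi> \<mu> f = 0" by simp
next
  show "\<forall>f\<in>diagonal_power sc n. tensor_map \<phi> \<mu> f = 0 \<Longrightarrow> diff_op sc \<phi> n \<mu>"
  proof (induction n arbitrary: \<mu>)
    case 0
    then have "tensor_map \<phi> \<mu> (pt 1 r) = 0" for r by (simp only: diagonal_power_0 UNIV_I)
    then have "\<phi> 1 * \<mu> r = 0" for r by (simp only: tensor_map_pt)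
    then show ?case by (simp add: is_ring_homD[OF \<phi>] fun_eq_iff)
  next
    case (Suc n)
    have rel: "f \<in> tensor_relations sc \<Longrightarrow> tensor_map \<phi> \<mu> f = 0" for f
      using Suc.prems relations_diagonal_power by blast
    have "scalar_linear sc \<phi> \<mu>"
      unfolding scalar_linear_def
    proof (intro conjI allI)
      fix x y
      have "pt 1 (x + y) - pt 1 x - pt 1 y \<in> tensor_relations sc" by (rule tensor_relationsI)
      from rel[OF this] show "\<mu> (x + y) = \<mu> x + \<mu> y"
        by (simp add: tensor_map_diff tensor_map_add is_ring_homD[OF \<phi>] diff_diff_eq)
    next
      fix c x
      have "pt (sc c 1) x - pt 1 (sc c x) \<in> tensor_relations sc" by (rule tensor_relationsI)
      from rel[OF this] show "\<mu> (sc c x) = \<phi> (sc c 1) * \<mu> x"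
        by (simp add: tensor_map_diff is_ring_homD[OF \<phi>])
    qed
    moreover have "diff_op sc \<phi> n (commutator \<phi> \<mu> c)" for c
    proof (rule Suc.IH, rule ballI)
      fix f assume "f \<in> diagonal_power sc n"
      then have "dif c * f \<in> diagonal_power sc (1 + n)"
        using dif_diagonal[of c] unfolding diagonal_power_1[OF sc, symmetric] by (intro diagonal_power_mult)
      then show "tensor_map \<phi> (commutator \<phi> \<mu> c) f = 0"
        using Suc.prems by (simp flip: tensor_map_dif[OF \<phi>])
    qed
    ultimately show ?case by simp
  qed
qed

end

text \<open>A left linear functional on principal parts is determined by its values
  \<open>\<delta> r\<close> at \<open>pt 1 r\<close>, hence is \<open>tensor_map\<close> of
  \<open>\<delta>\<close> on representatives; factoring through the quotient means vanishing on
  \<open>diagonal_power\<close>.\<close>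

lemma Diff_iff_diff_op:
  assumes sc: "algebra_over sc"
  shows "\<delta> \<in> Diff sc t \<longleftrightarrow> diff_op sc (\<lambda>x. x) (Suc t) \<delta>"
proof
  assume "\<delta> \<in> Diff sc t"
  then obtain u where u: "principal_parts_functional sc (t + 1) u"
      and \<delta>: "\<delta> = (\<lambda>r. u (pt 1 r +o diagonal_power sc (t + 1)))"
    unfolding Diff_def by blast
  define \<Psi> where "\<Psi> f = u (f +o diagonal_power sc (t + 1))" for f
  note I = is_ideal_diag_power[of sc "t + 1"]
  have add: "\<Psi> (f + g) = \<Psi> f + \<Psi> g" and left: "\<Psi> (pt a 1 * f) = a * \<Psi> f" for a f g
    using u unfolding principal_parts_functional_def \<Psi>_def by blast+
  have diff: "\<Psi> (f - g) = \<Psi> f - \<Psi> g" for f g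
    using add[of "f - g" g] by (simp add: algebra_simps)
  have eq: "\<Psi> f = tensor_map (\<lambda>x. x) \<delta> f" for f
  proof (induction f rule: pretensor_induct)
    case zero
    show ?case using diff[of 0 0] by simp
  next
    case (pt a b)
    show ?case using left[of a "pt 1 b"] by (simp add: \<Psi>_def \<delta> pt_mult)
  qed (simp add: diff tensor_map_diff)
  have "\<Psi> f = 0" if "f \<in> diagonal_power sc (t + 1)" for f
  proof -
    have "f +o diagonal_power sc (t + 1) = 0 +o diagonal_power sc (t + 1)"
    proof (intro set_eqI iffI)
      fix z assume "z \<in> f +o diagonal_power sc (t + 1)"
      then show "z \<in> 0 +o diagonal_power sc (t + 1)"
        using that ideal_add[OF I] by (auto simp: elt_set_plus_def)
    next
      fix z assume "z \<in> 0 +o diagonal_power sc (t + 1)"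
      then have "z - f \<in> diagonal_power sc (t + 1)"
        using that ideal_diff[OF I] by (auto simp: elt_set_plus_def)
      then show "z \<in> f +o diagonal_power sc (t + 1)"
        by (auto simp: elt_set_plus_def intro!: bexI[of _ "z - f"])
    qed
    then have "\<Psi> f = \<Psi> 0" by (simp only: \<Psi>_def)
    then show ?thesis using diff[of 0 0] by simp
  qed
  then show "diff_op sc (\<lambda>x. x) (Suc t) \<delta>"
    unfolding diff_op_iff_vanishing[OF sc is_ring_hom_id] by (simp add: eq)
next
  assume D: "diff_op sc (\<lambda>x. x) (Suc t) \<delta>"
  note I = is_ideal_diag_power[of sc "t + 1"]
  let ?\<Phi> = "tensor_map (\<lambda>x. x) \<delta>"
  have van: "?\<Phi> f = 0" if "f \<in> diagonal_power sc (t + 1)" for f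
    using D that unfolding diff_op_iff_vanishing[OF sc is_ring_hom_id] by simp
  \<comment> \<open>Cosets are plain sets, so a representative is chosen; \<open>van\<close> makes
    the choice irrelevant.\<close>
  define u where "u S = ?\<Phi> (SOME f. f \<in> S)" for S
  have u: "u (f +o diagonal_power sc (t + 1)) = ?\<Phi> f" for f
  proof -
    have "f \<in> f +o diagonal_power sc (t + 1)"
      using ideal_zero[OF I] by (auto simp: elt_set_plus_def intro!: bexI[of _ 0])
    then have "(SOME g. g \<in> f +o diagonal_power sc (t + 1)) \<in> f +o diagonal_power sc (t + 1)"
      by (rule someI)
    then obtain b where "b \<in> diagonal_power sc (t + 1)" "(SOME g. g \<in> f +o diagonal_power sc (t + 1)) = f + b"
      unfolding elt_set_plus_def by auto
    then show ?thesis unfolding u_def using van by (simp add: tensor_map_add)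
  qed
  have "principal_parts_functional sc (t + 1) u"
    unfolding principal_parts_functional_def u
    by (simp add: tensor_map_add tensor_map_left[OF is_ring_hom_id])
  moreover have "\<delta> = (\<lambda>r. u (pt 1 r +o diagonal_power sc (t + 1)))"
    unfolding u by simp
  ultimately show "\<delta> \<in> Diff sc t" unfolding Diff_def by blast
qed


context
  fixes sc :: "'k::field \<Rightarrow> 'r::comm_ring_1 \<Rightarrow> 'r" and \<phi> :: "'r \<Rightarrow> 'b::comm_ring_1"
  assumes sc: "algebra_over sc" and \<phi>: "is_ring_hom \<phi>"
begin

lemma diff_op_mono: "diff_op sc \<phi> m \<mu> \<Longrightarrow> m \<le> n \<Longrightarrow> diff_op sc \<phi> n \<mu>"
  using diagonal_power_antimono[of m n sc] by (auto simp: diff_op_iff_vanishing[OF sc \<phi>])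

lemma tensor_map_linear:
  "tensor_map \<phi> (\<lambda>r. \<mu> r + \<nu> r) f = tensor_map \<phi> \<mu> f + tensor_map \<phi> \<nu> f"
  "tensor_map \<phi> (\<lambda>r. b * \<mu> r) f = b * tensor_map \<phi> \<mu> f"
  by (simp_all add: tensor_map_def algebra_simps sum.distrib sum_distrib_left)

lemma diff_op_add:
  "diff_op sc \<phi> n \<mu> \<Longrightarrow> diff_op sc \<phi> n \<nu> \<Longrightarrow> diff_op sc \<phi> n (\<lambda>r. \<mu> r + \<nu> r)"
  by (simp add: diff_op_iff_vanishing[OF sc \<phi>] tensor_map_linear)

lemma diff_op_scale: "diff_op sc \<phi> n \<mu> \<Longrightarrow> diff_op sc \<phi> n (\<lambda>r. b * \<mu> r)"
  by (simp add: diff_op_iff_vanishing[OF sc \<phi>] tensor_map_linear)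

lemma diff_op_scale_cancel:
  assumes "diff_op sc \<phi> n (\<lambda>r. b * \<mu> r)" "\<And>z. b * z = 0 \<Longrightarrow> z = 0"
  shows "diff_op sc \<phi> n \<mu>"
  using assms by (simp add: diff_op_iff_vanishing[OF sc \<phi>] tensor_map_linear)

lemma diff_op_zero: "diff_op sc \<phi> n (\<lambda>r. 0)"
  using diff_op_mono[of 0 "\<lambda>r. 0" n] by simp

lemma diff_op_sum:
  "(\<And>i. i \<in> A \<Longrightarrow> diff_op sc \<phi> n (\<mu> i)) \<Longrightarrow> diff_op sc \<phi> n (\<lambda>r. \<Sum>i\<in>A. \<mu> i r)"
  by (induction A rule: infinite_finite_induct) (simp_all add: diff_op_zero diff_op_add)

lemma diff_op_diff:
  "diff_op sc \<phi> n \<mu> \<Longrightarrow> diff_op sc \<phi> n \<nu> \<Longrightarrow> diff_op sc \<phi> n (\<lambda>r. \<mu> r - \<nu> r)"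
  using diff_op_add[of n \<mu> "\<lambda>r. (- 1) * \<nu> r"] diff_op_scale[of n \<nu> "- 1"] by simp

end

lemma commutator_id: "commutator (\<lambda>x. x) \<delta> c r = \<delta> (c * r) - c * \<delta> r"
  by (simp add: commutator_def)

text \<open>The commutator of a composite with \<open>c\<close> is the sum of two composites, in
  each of which one factor is replaced by its own commutator; hence the induction on the total
  order.\<close>

lemma diff_op_comp:
  fixes sc :: "'k::field \<Rightarrow> 'r::comm_ring_1 \<Rightarrow> 'r"
  assumes sc: "algebra_over sc"
  shows "diff_op sc (\<lambda>x. x) (Suc a) \<delta> \<Longrightarrow> diff_op sc (\<lambda>x. x) (Suc b) \<epsilon> \<Longrightarrow>
    diff_op sc (\<lambda>x. x) (Suc (a + b)) (\<lambda>r. \<delta> (\<epsilon> r))"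
proof (induction "a + b" arbitrary: a b \<delta> \<epsilon> rule: less_induct)
  case less
  note id = is_ring_hom_id
  have lin: "scalar_linear sc (\<lambda>x. x) \<delta>" "scalar_linear sc (\<lambda>x. x) \<epsilon>"
    using less.prems by auto
  have "diff_op sc (\<lambda>x. x) (a + b) (commutator (\<lambda>x. x) (\<lambda>r. \<delta> (\<epsilon> r)) c)" for c
  proof -
    have 1: "diff_op sc (\<lambda>x. x) a (commutator (\<lambda>x. x) \<delta> c)" "diff_op sc (\<lambda>x. x) b (commutator (\<lambda>x. x) \<epsilon> c)"
      using less.prems by auto
    have "diff_op sc (\<lambda>x. x) (a + b) (\<lambda>r. commutator (\<lambda>x. x) \<delta> c (\<epsilon> r))"
    proof (cases a)
      case 0
      then show ?thesis using 1(1) diff_op_zero[OF sc id] by simp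
    next
      case (Suc a')
      then show ?thesis using less.hyps[of a' b] 1(1) less.prems(2) by simp
    qed
    moreover have "diff_op sc (\<lambda>x. x) (a + b) (\<lambda>r. \<delta> (commutator (\<lambda>x. x) \<epsilon> c r))"
    proof (cases b)
      case 0
      then show ?thesis using 1(2) diff_op_zero[OF sc id] scalar_linearD(3)[OF sc id lin(1)] by simp
    next
      case (Suc b')
      then show ?thesis using less.hyps[of a b'] 1(2) less.prems(1) by simp
    qed
    ultimately have "diff_op sc (\<lambda>x. x) (a + b)
        (\<lambda>r. commutator (\<lambda>x. x) \<delta> c (\<epsilon> r) + \<delta> (commutator (\<lambda>x. x) \<epsilon> c r))"
      by (rule diff_op_add[OF sc id])
    moreover have "commutator (\<lambda>x. x) (\<lambda>r. \<delta> (\<epsilon> r)) c =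
        (\<lambda>r. commutator (\<lambda>x. x) \<delta> c (\<epsilon> r) + \<delta> (commutator (\<lambda>x. x) \<epsilon> c r))"
      by (rule ext) (simp add: commutator_id scalar_linearD[OF sc id lin(1)])
    ultimately show ?thesis by simp
  qed
  moreover have "scalar_linear sc (\<lambda>x. x) (\<lambda>r. \<delta> (\<epsilon> r))"
  proof -
    have "\<delta> (sc c 1 * r) = sc c 1 * \<delta> r" for c r
      using scalar_linearD(2)[OF sc id lin(1)] algebra_scale[OF sc] by metis
    then show ?thesis
      using scalar_linearD(1,2)[OF sc id lin(1)] scalar_linearD(1,2)[OF sc id lin(2)]
      by (simp add: scalar_linear_def)
  qed
  ultimately show ?case by simp
qed

text \<open>The Leibniz rule without its term \<open>i = 0\<close> is the commutator with
  \<open>c\<close>, and it only involves \<open>h (n - i)\<close> with \<open>i > 0\<close>.\<close>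

lemma diff_op_higher_derivation:
  fixes sc :: "'k::field \<Rightarrow> 'r::comm_ring_1 \<Rightarrow> 'r"
  assumes sc: "algebra_over sc" and h: "higher_derivation h"
    and hs: "\<And>n c r. h n (sc c r) = sc c (h n r)"
  shows "diff_op sc (\<lambda>x. x) (Suc n) (h n)"
proof (induction n rule: less_induct)
  case (less n)
  note id = is_ring_hom_id
  have "diff_op sc (\<lambda>x. x) n (commutator (\<lambda>x. x) (h n) c)" for c
  proof -
    have "diff_op sc (\<lambda>x. x) n (\<lambda>r. \<Sum>i\<in>{1..n}. h i c * h (n - i) r)"
    proof (intro diff_op_sum[OF sc id] diff_op_scale[OF sc id])
      fix i assume i: "i \<in> {1..n}"
      then have "diff_op sc (\<lambda>x. x) (Suc (n - i)) (h (n - i))" by (intro less.IH) auto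
      then show "diff_op sc (\<lambda>x. x) n (h (n - i))"
        by (rule diff_op_mono[OF sc id]) (use i in auto)
    qed
    moreover have "commutator (\<lambda>x. x) (h n) c = (\<lambda>r. \<Sum>i\<in>{1..n}. h i c * h (n - i) r)"
    proof
      fix r
      have "{..n} = insert 0 {1..n}" by auto
      then show "commutator (\<lambda>x. x) (h n) c r = (\<Sum>i\<in>{1..n}. h i c * h (n - i) r)"
        by (simp add: commutator_id higher_derivationD[OF h])
    qed
    ultimately show ?thesis by simp
  qed
  moreover have "scalar_linear sc (\<lambda>x. x) (h n)"
    unfolding scalar_linear_def hs
    using higher_derivationD(2)[OF h] algebra_scale[OF sc, of _ "h n _"] by blast
  ultimately show ?case by simp
qed


lemma higher_derivation_mult_coordinate:
  assumes h: "higher_derivation h" and X: "\<And>n. n > 0 \<Longrightarrow> h n X = (if n = 1 then 1 else 0)"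
  shows "h n (X * z) = X * h n z + (if n = 0 then 0 else h (n - 1) z)"
proof (cases n)
  case 0
  then show ?thesis by (simp add: higher_derivationD(1)[OF h])
next
  case (Suc m)
  have "h n (X * z) = (\<Sum>l\<le>n. h l X * h (n - l) z)"
    by (rule higher_derivationD[OF h])
  also have "\<dots> = (\<Sum>l\<in>{0, 1}. h l X * h (n - l) z)"
    by (rule sum.mono_neutral_right) (use X Suc in auto)
  finally show ?thesis
    using X[of 1] Suc by (simp add: higher_derivationD(1)[OF h])
qed

text \<open>Since \<open>h n\<close> strips off \<open>X ^ n\<close> up to multiples of
  \<open>X\<close>, its value at \<open>X ^ n * b\<close> is \<open>b\<close> modulo
  \<open>X\<close>; divisibility by \<open>w\<close> survives because \<open>w\<close> is a constant
  for \<open>h\<close>. Iterated, with a chain condition or with completeness, this allows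
  \<open>X\<close> to be cancelled modulo \<open>w\<close>.\<close>

lemma higher_derivation_colon:
  assumes h: "higher_derivation h" and X: "\<And>n. n > 0 \<Longrightarrow> h n X = (if n = 1 then 1 else 0)"
    and w: "\<And>n z. h n (w * z) = w * h n z" and dvd: "w dvd X ^ n * b"
  shows "\<exists>b'. w dvd b - X * b'"
proof -
  \<comment> \<open>The vanishing modulo \<open>X\<close> for \<open>k < n\<close> is carried along
    because raising \<open>n\<close> brings in \<open>h (k - 1)\<close>.\<close>
  have expand: "(k < n \<longrightarrow> X dvd h k (X ^ n * b)) \<and> X dvd h n (X ^ n * b) - b" for k n
  proof (induction n arbitrary: k)
    case 0
    show ?case by (simp add: higher_derivationD(1)[OF h])
  next
    case (Suc n)
    have eq: "h k (X ^ Suc n * b) = X * h k (X ^ n * b) + (if k = 0 then 0 else h (k - 1) (X ^ n * b))" for k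
      using higher_derivation_mult_coordinate[OF h X, of k "X ^ n * b"] by (simp add: mult.assoc)
    have "X dvd h (Suc n) (X ^ Suc n * b) - b"
      using Suc dvd_add[of X "X * h (Suc n) (X ^ n * b)" "h n (X ^ n * b) - b"]
      unfolding eq by (simp add: add_diff_eq)
    moreover have "X dvd h k (X ^ Suc n * b)" if "k < Suc n"
      unfolding eq using Suc[of "k - 1"] that by (cases k) auto
    ultimately show ?case by blast
  qed
  then obtain b' where "h n (X ^ n * b) - b = X * b'" by blast
  moreover obtain q where "X ^ n * b = w * q" using dvd by blast
  ultimately have "b - X * (- b') = w * h n q" using w by (simp add: algebra_simps)
  then show ?thesis by (metis dvd_triv_left)
qed


section \<open>Rings with coordinate derivations\<close>

text \<open>What the two kinds of rings have in common. \<open>operator_zero\<close> stands in for a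
  basis of the operators; \<open>colon\<close> says that \<open>x i\<close> is a nonzerodivisor
  modulo every constant \<open>w\<close> of \<open>H i\<close>, such as 0 or another
  parameter.\<close>

locale coordinate_derivations =
  fixes sc :: "'k::field \<Rightarrow> 'r::comm_ring_1 \<Rightarrow> 'r" and d :: nat and x :: "nat \<Rightarrow> 'r"
    and H :: "nat \<Rightarrow> nat \<Rightarrow> 'r \<Rightarrow> 'r"
  assumes algebra: "algebra_over sc"
    and higher: "i \<in> {1..d} \<Longrightarrow> higher_derivation (H i)"
    and scalars: "i \<in> {1..d} \<Longrightarrow> H i n (sc c r) = sc c (H i n r)"
    and coordinate_same: "i \<in> {1..d} \<Longrightarrow> n > 0 \<Longrightarrow> H i n (x i) = (if n = 1 then 1 else 0)"
    and coordinate_other: "i \<in> {1..d} \<Longrightarrow> j \<in> {1..d} \<Longrightarrow> i \<noteq> j \<Longrightarrow> n > 0 \<Longrightarrow> H i n (x j) = 0"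
    and operator_zero: "diff_op sc (\<lambda>x. x) n \<delta> \<Longrightarrow> (\<And>i r. i \<in> {1..d} \<Longrightarrow> \<delta> (x i * r) = x i * \<delta> r) \<Longrightarrow>
      \<delta> 1 = 0 \<Longrightarrow> \<delta> r = 0"
    and colon: "i \<in> {1..d} \<Longrightarrow> (\<And>n z. H i n (w * z) = w * H i n z) \<Longrightarrow> w dvd x i * f \<Longrightarrow> w dvd f"
begin

section \<open>Divisibility by powers of the parameters\<close>

lemma H_mult_other:
  assumes "i \<in> {1..d}" "j \<in> {1..d}" "i \<noteq> j"
  shows "H i n (x j * z) = x j * H i n z"
proof -
  have "H i n (x j * z) = (\<Sum>l\<le>n. H i l (x j) * H i (n - l) z)"
    by (rule higher_derivationD[OF higher[OF assms(1)]])
  also have "\<dots> = (\<Sum>l\<in>{0}. H i l (x j) * H i (n - l) z)"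
    by (rule sum.mono_neutral_right) (use coordinate_other[OF assms] in auto)
  finally show ?thesis by (simp add: higher_derivationD(1)[OF higher[OF assms(1)]])
qed

lemma H_mult_same:
  assumes "i \<in> {1..d}"
  shows "H i n (x i * z) = x i * H i n z + (if n = 0 then 0 else H i (n - 1) z)"
  by (rule higher_derivation_mult_coordinate[OF higher[OF assms] coordinate_same[OF assms]])

lemma coordinate_nonzero_divisor:
  assumes "i \<in> {1..d}" "x i * f = 0"
  shows "f = 0"
  using colon[OF assms(1), of 0 f] assms(2) higher_derivationD(4)[OF higher[OF assms(1)]] by simp

lemma coordinate_power_nonzero_divisor:
  assumes "i \<in> {1..d}" "x i ^ n * f = 0"
  shows "f = 0"
  using assms(2)
proof (induction n)
  case (Suc n)
  then have "x i * (x i ^ n * f) = 0" by (simp add: mult.assoc)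
  then show ?case using Suc.IH coordinate_nonzero_divisor[OF assms(1)] by blast
qed simp

lemma coordinate_dvd_cancel:
  assumes "i \<in> {1..d}" "x i ^ n * a dvd x i ^ n * b"
  shows "a dvd b"
proof -
  obtain q where "x i ^ n * b = x i ^ n * a * q" using assms(2) by blast
  then have "x i ^ n * (b - a * q) = 0" by (simp add: algebra_simps)
  then show ?thesis using coordinate_power_nonzero_divisor[OF assms(1)] by (metis dvdI eq_iff_diff_eq_0)
qed

text \<open>\<open>colon\<close> yields one factor \<open>x j\<close>; it is cancelled as a
  nonzerodivisor, and the remaining power follows by induction.\<close>

lemma coordinate_dvd:
  assumes "i \<in> {1..d}" "j \<in> {1..d}" "i \<noteq> j" "x j ^ b dvd x i * f"
  shows "x j ^ b dvd f"
  using assms(4)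
proof (induction b arbitrary: f)
  case (Suc b)
  have "x j dvd x i * f" using Suc.prems dvd_mult_left[of "x j" "x j ^ b"] by simp
  then have "x j dvd f"
    using colon[OF assms(1), of "x j" f] H_mult_other[OF assms(1-3)] by blast
  then obtain g where g: "f = x j * g" by blast
  then have "x j ^ 1 * x j ^ b dvd x j ^ 1 * (x i * g)" using Suc.prems by (simp add: mult_ac)
  then have "x j ^ b dvd g" using Suc.IH coordinate_dvd_cancel[OF assms(2)] by blast
  then show ?case unfolding g power_Suc by (rule mult_dvd_mono[OF dvd_refl])
qed simp

lemma coordinate_prod_dvd:
  assumes "A \<subseteq> {1..d}" "j \<in> {1..d}" "j \<notin> A" "x j ^ b dvd (\<Prod>i\<in>A. x i) ^ s * f"
  shows "x j ^ b dvd f"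
proof -
  have one: "x j ^ b dvd f" if "i \<in> {1..d}" "i \<noteq> j" "x j ^ b dvd x i ^ s * f" for i s f
    using that(3)
  proof (induction s)
    case (Suc s)
    then have "x j ^ b dvd x i * (x i ^ s * f)" by (simp add: mult.assoc)
    then show ?case using Suc.IH coordinate_dvd[OF that(1) assms(2) that(2)] by blast
  qed simp
  have "finite A" using assms(1) finite_subset by blast
  then show ?thesis using assms(1,3,4)
  proof (induction A arbitrary: f rule: finite_induct)
    case (insert a A)
    have "x j ^ b dvd x a ^ s * ((\<Prod>i\<in>A. x i) ^ s * f)"
      using insert.hyps insert.prems(3) by (simp add: power_mult_distrib mult.assoc)
    moreover have "a \<in> {1..d}" "a \<noteq> j" "A \<subseteq> {1..d}" "j \<notin> A" using insert.prems by auto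
    ultimately show ?case using insert.IH one by blast
  qed simp
qed

section \<open>Logarithmic operators and logarithmic derivations\<close>

definition log_op :: "nat set \<Rightarrow> ('r \<Rightarrow> 'r) \<Rightarrow> bool" where
  "log_op M \<delta> \<longleftrightarrow> (\<forall>j\<in>M. \<forall>s r. x j ^ s dvd \<delta> (x j ^ s * r))"

text \<open>For a component of the divisor this is \<open>x i ^ n\<close> times the Hasse derivative
  of order \<open>n\<close>. With \<open>M = {}\<close> only the Hasse derivatives themselves
  remain, so both halves of the theorem share one argument.\<close>

definition log_derivation :: "nat set \<Rightarrow> nat \<Rightarrow> nat \<Rightarrow> 'r \<Rightarrow> 'r" where
  "log_derivation M i n r = (if i \<in> M then x i ^ n else 1) * H i n r"

text \<open>Multiplying the term of order \<open>n\<close> by \<open>x i ^ n\<close> substitutes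
  \<open>x i * X\<close> for \<open>X\<close> in the Taylor series, which keeps it
  multiplicative.\<close>

lemma higher_derivation_log_derivation:
  assumes "i \<in> {1..d}"
  shows "higher_derivation (log_derivation M i)"
proof (cases "i \<in> M")
  case True
  have "x i ^ n * (H i l f * H i (n - l) g) = x i ^ l * H i l f * (x i ^ (n - l) * H i (n - l) g)"
    if "l \<le> n" for l n f g
  proof -
    have "x i ^ n = x i ^ l * x i ^ (n - l)" using that by (simp flip: power_add)
    then show ?thesis by (simp add: mult_ac)
  qed
  then show ?thesis
    using True by (auto simp: higher_derivation_def log_derivation_def fun_eq_iff
        higher_derivationD[OF higher[OF assms]] distrib_left sum_distrib_left intro!: sum.cong)
next
  case False
  then have "log_derivation M i = H i" by (simp add: log_derivation_def fun_eq_iff)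
  then show ?thesis using higher[OF assms] by simp
qed

lemma diff_op_log_derivation:
  assumes "i \<in> {1..d}"
  shows "diff_op sc (\<lambda>x. x) (Suc n) (log_derivation M i n)"
  unfolding log_derivation_def
  by (intro diff_op_scale[OF algebra is_ring_hom_id] diff_op_higher_derivation[OF algebra]
      higher scalars assms)

lemma log_derivation_mult_other:
  assumes "i \<in> {1..d}" "j \<in> {1..d}" "i \<noteq> j"
  shows "log_derivation M i n (x j * z) = x j * log_derivation M i n z"
  unfolding log_derivation_def H_mult_other[OF assms] by (rule mult.left_commute)

lemma log_derivation_mult_same:
  assumes "i \<in> {1..d}" "i \<in> M"
  shows "log_derivation M i n (x i * z) =
    x i * (log_derivation M i n z + (if n = 0 then 0 else log_derivation M i (n - 1) z))"
  unfolding log_derivation_def H_mult_same[OF assms(1)]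
  using assms(2) by (cases n) (simp_all add: algebra_simps)

lemma log_op_log_derivation:
  assumes "i \<in> {1..d}" "M \<subseteq> {1..d}"
  shows "log_op M (log_derivation M i n)"
  unfolding log_op_def
proof (intro ballI allI)
  fix j s r assume j: "j \<in> M"
  show "x j ^ s dvd log_derivation M i n (x j ^ s * r)"
  proof (cases "i = j")
    case False
    have "log_derivation M i n (x j ^ s * r) = x j ^ s * log_derivation M i n r"
      by (induction s) (use j assms False in \<open>auto simp: mult.assoc log_derivation_mult_other\<close>)
    then show ?thesis by simp
  next
    case True
    show ?thesis
    proof (induction s arbitrary: n)
      case (Suc s)
      have "log_derivation M j n (x j * (x j ^ s * r)) = x j *
          (log_derivation M j n (x j ^ s * r) + (if n = 0 then 0 else log_derivation M j (n - 1) (x j ^ s * r)))"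
        using log_derivation_mult_same[of j M n] j assms True by blast
      moreover have "x j ^ s dvd log_derivation M j n (x j ^ s * r) +
          (if n = 0 then 0 else log_derivation M j (n - 1) (x j ^ s * r))"
        using Suc True by auto
      ultimately show ?case using True by (simp add: mult.assoc mult_dvd_mono)
    qed simp
  qed
qed

lemma log_derivation_prod_dvd:
  assumes i: "i \<in> {1..d}" and M: "M \<subseteq> {1..d}"
  shows "(\<Prod>j\<in>M. x j) ^ s dvd log_derivation M i n ((\<Prod>j\<in>M. x j) ^ s * r)"
proof -
  have comm: "log_derivation M i n ((\<Prod>j\<in>A. x j) * z) = (\<Prod>j\<in>A. x j) * log_derivation M i n z"
    if "A \<subseteq> {1..d}" "i \<notin> A" for A n z
  proof -
    have "finite A" using that(1) finite_subset by blast
    then show ?thesis using that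
      by (induction A) (auto simp: mult.assoc log_derivation_mult_other[OF i])
  qed
  have step: "log_derivation M i n ((\<Prod>j\<in>M. x j) * z) = (\<Prod>j\<in>M. x j) *
      (log_derivation M i n z + (if n = 0 \<or> i \<notin> M then 0 else log_derivation M i (n - 1) z))" for n z
  proof (cases "i \<in> M")
    case True
    then have "(\<Prod>j\<in>M. x j) = x i * (\<Prod>j\<in>M - {i}. x j)"
      using M finite_subset[OF M] by (simp add: prod.remove)
    moreover have "log_derivation M i l ((\<Prod>j\<in>M - {i}. x j) * z) = (\<Prod>j\<in>M - {i}. x j) * log_derivation M i l z" for l
      using M by (intro comm) auto
    ultimately show ?thesis
      using True by (simp add: mult.assoc log_derivation_mult_same[OF i True] distrib_left)
  qed (use comm[OF M] in auto)
  show ?thesis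
  proof (induction s arbitrary: n)
    case (Suc s)
    have "(\<Prod>j\<in>M. x j) ^ s dvd log_derivation M i n ((\<Prod>j\<in>M. x j) ^ s * r) +
        (if n = 0 \<or> i \<notin> M then 0 else log_derivation M i (n - 1) ((\<Prod>j\<in>M. x j) ^ s * r))"
      using Suc by auto
    then show ?case by (simp add: mult.assoc step mult_dvd_mono)
  qed simp
qed

text \<open>
  A logarithmic operator along the whole divisor is logarithmic along each component, because
  the other components are nonzerodivisors modulo \<open>x j ^ s\<close>.
\<close>

lemma log_op_if_prod_dvd:
  assumes M: "M \<subseteq> {1..d}" and \<delta>: "diff_op sc (\<lambda>x. x) n \<delta>"
    and div: "\<And>s r. (\<Prod>j\<in>M. x j) ^ s dvd \<delta> ((\<Prod>j\<in>M. x j) ^ s * r)"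
  shows "log_op M \<delta>"
  unfolding log_op_def
proof (intro ballI allI)
  fix j s r assume j: "j \<in> M"
  define v where "v = (\<Prod>i\<in>M - {j}. x i)"
  have u: "(\<Prod>i\<in>M. x i) = x j * v"
    using j finite_subset[OF M] by (simp add: v_def prod.remove)
  have "x j ^ s dvd \<delta> (x j ^ s * r)"
    if "diff_op sc (\<lambda>x. x) n \<delta>" "\<And>r. x j ^ s dvd \<delta> (v ^ s * (x j ^ s * r))" for n \<delta> r
    using that
  proof (induction n arbitrary: \<delta> r)
    case (Suc n)
    \<comment> \<open>\<open>\<delta> (v ^ s * z) = ?C z + v ^ s * \<delta> z\<close>: the
      commutator has lower order and inherits the hypothesis, so
      \<open>v ^ s * \<delta> (x j ^ s * r)\<close> is divisible, and \<open>v ^ s\<close>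
      cancels.\<close>
    let ?C = "commutator (\<lambda>x. x) \<delta> (v ^ s)"
    have "x j ^ s dvd ?C (v ^ s * (x j ^ s * r))" for r
    proof -
      have "?C (v ^ s * (x j ^ s * r)) = \<delta> (v ^ s * (x j ^ s * (v ^ s * r))) - v ^ s * \<delta> (v ^ s * (x j ^ s * r))"
        by (simp add: commutator_id mult_ac)
      then show ?thesis using Suc.prems(2) by simp
    qed
    then have "x j ^ s dvd ?C (x j ^ s * r)" using Suc.IH[of ?C r] Suc.prems(1) by simp
    then have "x j ^ s dvd \<delta> (v ^ s * (x j ^ s * r)) - ?C (x j ^ s * r)"
      using Suc.prems(2) by (intro dvd_diff)
    then have "x j ^ s dvd v ^ s * \<delta> (x j ^ s * r)" by (simp add: commutator_id)
    then show ?case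
      using coordinate_prod_dvd[of "M - {j}" j s s "\<delta> (x j ^ s * r)"] M j unfolding v_def by blast
  qed simp
  moreover have "x j ^ s dvd \<delta> (v ^ s * (x j ^ s * r))" for r
  proof -
    have "x j ^ s dvd (\<Prod>j\<in>M. x j) ^ s" by (simp add: u power_mult_distrib)
    also have "\<dots> dvd \<delta> ((\<Prod>j\<in>M. x j) ^ s * r)" by (rule div)
    finally show ?thesis by (simp add: u power_mult_distrib mult_ac)
  qed
  ultimately show "x j ^ s dvd \<delta> (x j ^ s * r)" using \<delta> by blast
qed

section \<open>Iterated commutators with a parameter\<close>

definition ad :: "nat \<Rightarrow> nat \<Rightarrow> ('r \<Rightarrow> 'r) \<Rightarrow> 'r \<Rightarrow> 'r" where
  "ad i n = ((\<lambda>\<delta>. commutator (\<lambda>x. x) \<delta> (x i)) ^^ n)"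

lemma ad_0 [simp]: "ad i 0 \<delta> = \<delta>"
  by (simp add: ad_def)

lemma ad_Suc: "ad i (Suc n) \<delta> r = ad i n \<delta> (x i * r) - x i * ad i n \<delta> r"
  by (simp add: ad_def commutator_id)

lemma diff_op_ad:
  assumes "diff_op sc (\<lambda>x. x) m \<delta>"
  shows "diff_op sc (\<lambda>x. x) (m - n) (ad i n \<delta>)"
proof (induction n)
  case (Suc n)
  show ?case
  proof (cases "m - n")
    case 0
    then have "ad i n \<delta> = (\<lambda>_. 0)" using Suc by simp
    then have "ad i (Suc n) \<delta> = (\<lambda>_. 0)" by (simp add: fun_eq_iff ad_Suc)
    then show ?thesis by (simp add: diff_op_zero[OF algebra is_ring_hom_id])
  next
    case (Suc l)
    then have "diff_op sc (\<lambda>x. x) l (commutator (\<lambda>x. x) (ad i n \<delta>) (x i))"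
      using \<open>diff_op sc (\<lambda>x. x) (m - n) (ad i n \<delta>)\<close> by simp
    moreover have "l = m - Suc n" using Suc by simp
    ultimately show ?thesis by (simp add: ad_def)
  qed
qed (use assms in simp)

lemma ad_diff:
  "ad i n (\<lambda>r. \<delta> r - \<epsilon> r) r = ad i n \<delta> r - ad i n \<epsilon> r"
proof (induction n arbitrary: r)
  case (Suc n)
  show ?case unfolding ad_Suc Suc by (simp add: right_diff_distrib)
qed simp

lemma ad_mult_other:
  assumes "\<And>r. \<delta> (x l * r) = x l * \<delta> r"
  shows "ad i n \<delta> (x l * r) = x l * ad i n \<delta> r"
proof (induction n arbitrary: r)
  case (Suc n)
  have "ad i n \<delta> (x i * (x l * r)) = x l * ad i n \<delta> (x i * r)"
    using Suc[of "x i * r"] by (simp add: mult.left_commute)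
  then show ?case unfolding ad_Suc Suc by (simp add: right_diff_distrib mult.left_commute)
qed (simp add: assms)

text \<open>Each commutator gains a factor: both of its terms, the value at
  \<open>x i * (x i ^ s * r)\<close> and \<open>x i\<close> times the value at
  \<open>x i ^ s * r\<close>, carry one power more.\<close>

lemma ad_log_dvd_same:
  assumes "\<And>s r. x i ^ s dvd \<delta> (x i ^ s * r)"
  shows "x i ^ (s + n) dvd ad i n \<delta> (x i ^ s * r)"
proof (induction n arbitrary: s r)
  case (Suc n)
  have "x i ^ (Suc s + n) dvd ad i n \<delta> (x i ^ Suc s * r)" by (rule Suc)
  moreover have "x i * x i ^ (s + n) dvd x i * ad i n \<delta> (x i ^ s * r)"
    by (rule mult_dvd_mono[OF dvd_refl Suc])
  ultimately show ?case by (simp add: ad_Suc mult.assoc dvd_diff)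
qed (simp add: assms)

lemma ad_log_dvd_other:
  assumes "\<And>s r. x l ^ s dvd \<delta> (x l ^ s * r)"
  shows "x l ^ s dvd ad i n \<delta> (x l ^ s * r)"
proof (induction n arbitrary: r)
  case (Suc n)
  show ?case
    using Suc[of "x i * r"] Suc[of r] by (simp add: ad_Suc mult_ac)
qed (simp add: assms)

text \<open>Commuting with \<open>x i\<close> lowers \<open>H i n\<close> to
  \<open>H i (n - 1)\<close> without a numerical factor, in every characteristic; this is the
  advantage of Hasse derivatives over iterated ones. After \<open>n\<close> steps only
  \<open>\<delta>\<close> and the factor \<open>e\<close> are left.\<close>

lemma ad_comp_H:
  assumes i: "i \<in> {1..d}" and \<delta>: "scalar_linear sc (\<lambda>x. x) \<delta>" "\<And>r. \<delta> (x i * r) = x i * \<delta> r" and "l \<le> n"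
  shows "ad i l (\<lambda>r. \<delta> (e * H i n r)) r = \<delta> (e * H i (n - l) r)"
  using \<open>l \<le> n\<close>
proof (induction l arbitrary: r)
  case (Suc l)
  have "ad i (Suc l) (\<lambda>r. \<delta> (e * H i n r)) r = \<delta> (e * H i (n - l) (x i * r)) - x i * \<delta> (e * H i (n - l) r)"
    using Suc by (simp add: ad_Suc)
  also have "x i * \<delta> (e * H i (n - l) r) = \<delta> (x i * (e * H i (n - l) r))" by (simp add: \<delta>(2))
  also have "\<delta> (e * H i (n - l) (x i * r)) - \<delta> (x i * (e * H i (n - l) r)) =
      \<delta> (e * H i (n - l) (x i * r) - x i * (e * H i (n - l) r))"
    by (simp add: scalar_linearD[OF algebra is_ring_hom_id \<delta>(1)])
  also have "e * H i (n - l) (x i * r) - x i * (e * H i (n - l) r) = e * H i (n - Suc l) r"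
    using Suc.prems unfolding H_mult_same[OF i] by (simp add: distrib_left mult.left_commute)
  finally show ?case .
qed simp

text \<open>
  If \<open>n\<close> is maximal with \<open>ad i n \<delta> \<noteq> 0\<close>, then \<open>ad i n \<delta>\<close> commutes with \<open>x i\<close>, and subtracting
  \<open>\<epsilon> \<circ> log_derivation M i n\<close>, where \<open>ad i n \<delta> = \<epsilon>\<close> up to the factor \<open>x i ^ n\<close>, lowers \<open>n\<close>.
\<close>

lemma log_op_preserves_filtration:
  assumes C: "idealistic_filtration C" and M: "M \<subseteq> {1..d}"
    and stable: "\<And>i f a n. i \<in> {1..d} \<Longrightarrow> (f, a) \<in> C \<Longrightarrow> (log_derivation M i n f, a - real n) \<in> C"
    and \<delta>: "diff_op sc (\<lambda>x. x) (Suc t) \<delta>" "log_op M \<delta>"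
    and f: "(f, a) \<in> C"
  shows "(\<delta> f, a - real t) \<in> C"
proof -
  note id = is_ring_hom_id
  define preserves where "preserves t \<delta> \<longleftrightarrow> (\<forall>f a. (f, a) \<in> C \<longrightarrow> (\<delta> f, a - real t) \<in> C)" for t \<delta>
  \<comment> \<open>Outer induction on the parameters: \<open>\<delta>\<close> already commutes with
    those of index above \<open>j\<close>.\<close>
  have "preserves t \<delta>"
    if "j \<le> d" "diff_op sc (\<lambda>x. x) (Suc t) \<delta>" "log_op M \<delta>"
      "\<And>i r. i \<in> {j<..d} \<Longrightarrow> \<delta> (x i * r) = x i * \<delta> r" for j t \<delta>
    using that
  proof (induction j arbitrary: t \<delta>)
    case 0
    \<comment> \<open>An operator commuting with every parameter is multiplication by its value at
      1.\<close>
    define \<delta>' where "\<delta>' r = \<delta> r - \<delta> 1 * r" for r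
    have "diff_op sc (\<lambda>x. x) (Suc 0) (\<lambda>r. r)"
    proof -
      have "sc c r = sc c 1 * r" for c r by (rule algebra_scale[OF algebra])
      then have "scalar_linear sc (\<lambda>x. x) (\<lambda>r. r)" unfolding scalar_linear_def by blast
      then show ?thesis by (simp add: commutator_id fun_eq_iff)
    qed
    then have "diff_op sc (\<lambda>x. x) (Suc t) (\<lambda>r. \<delta> 1 * r)"
      by (intro diff_op_scale[OF algebra id] diff_op_mono[OF algebra id, of "Suc 0" _ "Suc t"]) simp_all
    then have "diff_op sc (\<lambda>x. x) (Suc t) \<delta>'"
      unfolding \<delta>'_def using diff_op_diff[OF algebra id 0(2)] by simp
    moreover have "\<delta>' (x i * r) = x i * \<delta>' r" if "i \<in> {1..d}" for i r
      using 0(4)[of i r] that by (simp add: \<delta>'_def algebra_simps)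
    moreover have "\<delta>' 1 = 0" by (simp add: \<delta>'_def)
    ultimately have "\<delta>' r = 0" for r
      by (rule operator_zero)
    then have eq: "\<delta> f = \<delta> 1 * f" for f
      unfolding \<delta>'_def by (rule right_minus_eq[THEN iffD1])
    have "(\<delta> 1 * f, a - real t) \<in> C" if "(f, a) \<in> C" for f a
      by (rule filtration_mono[OF C filtration_scale[OF C that]]) simp
    then show ?case unfolding preserves_def by (subst eq) blast
  next
    case (Suc j)
    define i where "i = Suc j"
    note outer_IH = Suc.IH
    have i: "i \<in> {1..d}" using Suc.prems(1) by (simp add: i_def)
    \<comment> \<open>Inner induction on an \<open>n\<close> for which the n-fold commutator with
      \<open>x i\<close> vanishes; the order of \<open>\<delta>\<close> provides the first such
      number, \<open>t + 1\<close>.\<close>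
    have "preserves t \<delta>"
      if "\<And>r. ad i n \<delta> r = 0" "diff_op sc (\<lambda>x. x) (Suc t) \<delta>" "log_op M \<delta>"
        "\<And>i r. i \<in> {Suc j<..d} \<Longrightarrow> \<delta> (x i * r) = x i * \<delta> r" for n \<delta>
      using that
    proof (induction n arbitrary: \<delta>)
      case 0
      then show ?case by (simp add: preserves_def filtration_zero[OF C])
    next
      case (Suc n)
      note IH = Suc.IH
      define D where "D = ad i n \<delta>"
      have D_op: "diff_op sc (\<lambda>x. x) (Suc t - n) D"
        unfolding D_def by (rule diff_op_ad[OF Suc.prems(2)])
      have D_i: "D (x i * r) = x i * D r" for r
        using Suc.prems(1)[of r] by (simp add: ad_Suc D_def)
      have D_l: "D (x l * r) = x l * D r" if "l \<in> {Suc j<..d}" for l r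
        unfolding D_def by (rule ad_mult_other) (rule Suc.prems(4)[OF that])
      show ?case
      proof (cases "n \<le> t")
        case False
        \<comment> \<open>\<open>Suc t - n\<close> is 0 here, so \<open>D\<close> has order less
          than 0.\<close>
        then have "D = (\<lambda>_. 0)" using D_op by simp
        then show ?thesis using IH[of \<delta>] Suc.prems by (simp add: D_def)
      next
        case True
        \<comment> \<open>For a component of the divisor \<open>D\<close> is divisible by
          \<open>x i ^ n\<close>. Dividing this out leaves an operator that is again logarithmic,
          and the factor is restored by \<open>log_derivation\<close>.\<close>
        define e where "e = (if i \<in> M then x i ^ n else 1)"
        have e_cancel: "e * z = 0 \<Longrightarrow> z = 0" for z
          using coordinate_power_nonzero_divisor[OF i] by (auto simp: e_def split: if_splits)
        have "e dvd D r" for r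
          using ad_log_dvd_same[of i \<delta> 0 n r] Suc.prems(3) by (auto simp: e_def D_def log_op_def)
        then obtain \<epsilon> where \<epsilon>: "D r = e * \<epsilon> r" for r unfolding dvd_def by metis
        have e_eq: "y = z" if "e * y = e * z" for y z
          using e_cancel[of "y - z"] that by (simp add: algebra_simps)
        have "D = (\<lambda>r. e * \<epsilon> r)" using \<epsilon> by blast
        then have \<epsilon>_op: "diff_op sc (\<lambda>x. x) (Suc (t - n)) \<epsilon>"
        proof -
          assume D: "D = (\<lambda>r. e * \<epsilon> r)"
          have "diff_op sc (\<lambda>x. x) (Suc (t - n)) (\<lambda>r. e * \<epsilon> r)"
            using D_op unfolding D Suc_diff_le[OF True] .
          then show ?thesis using e_cancel by (rule diff_op_scale_cancel[OF algebra id])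
        qed
        have \<epsilon>_l: "\<epsilon> (x l * r) = x l * \<epsilon> r" if "l \<in> {j<..d}" for l r
        proof (rule e_eq)
          have "D (x l * r) = x l * D r"
            using D_i D_l that by (cases "l = i") (auto simp: i_def)
          then show "e * \<epsilon> (x l * r) = e * (x l * \<epsilon> r)" by (simp add: \<epsilon> mult_ac)
        qed
        have \<epsilon>_log: "log_op M \<epsilon>"
          unfolding log_op_def
        proof (intro ballI allI)
          fix l s r assume l: "l \<in> M"
          show "x l ^ s dvd \<epsilon> (x l ^ s * r)"
          proof (cases "l = i")
            case True
            then have "x i ^ (s + n) dvd D (x i ^ s * r)"
              unfolding D_def using Suc.prems(3) l by (intro ad_log_dvd_same) (auto simp: log_op_def)
            then have "x i ^ n * x i ^ s dvd x i ^ n * \<epsilon> (x i ^ s * r)"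
              using True l by (simp add: \<epsilon> e_def power_add mult.commute)
            then show ?thesis using coordinate_dvd_cancel[OF i] True by blast
          next
            case False
            have "x l ^ s dvd D (x l ^ s * r)"
              unfolding D_def using Suc.prems(3) l by (intro ad_log_dvd_other) (auto simp: log_op_def)
            then have "x l ^ s dvd (\<Prod>i\<in>{i}. x i) ^ (if i \<in> M then n else 0) * \<epsilon> (x l ^ s * r)"
              by (auto simp: \<epsilon> e_def split: if_splits)
            then show ?thesis using coordinate_prod_dvd[of "{i}" l] i l M False by blast
          qed
        qed
        have \<epsilon>_pres: "preserves (t - n) \<epsilon>"
        proof (rule outer_IH[OF _ \<epsilon>_op \<epsilon>_log \<epsilon>_l])
          show "j \<le> d" using i by (simp add: i_def)
        qed
        have \<epsilon>_lin: "scalar_linear sc (\<lambda>x. x) \<epsilon>" using \<epsilon>_op by simp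
        define \<delta>' where "\<delta>' r = \<delta> r - \<epsilon> (log_derivation M i n r)" for r
        have comp: "diff_op sc (\<lambda>x. x) (Suc t) (\<lambda>r. \<epsilon> (log_derivation M i n r))"
          using diff_op_comp[OF algebra \<epsilon>_op diff_op_log_derivation[OF i, of n M]] True by simp
        have "preserves t \<delta>'"
        proof (rule IH)
          fix r
          have "ad i n (\<lambda>r. \<epsilon> (log_derivation M i n r)) r = \<epsilon> (e * r)"
            unfolding log_derivation_def e_def[symmetric]
            using ad_comp_H[OF i \<epsilon>_lin \<epsilon>_l, of n n e r] i
            by (simp add: i_def higher_derivationD(1)[OF higher])
          also have "\<epsilon> (e * r) = e * \<epsilon> r"
          proof -
            have "\<epsilon> (x i ^ k * r) = x i ^ k * \<epsilon> r" for k
              by (induction k) (use \<epsilon>_l[of i] i in \<open>simp_all add: i_def mult.assoc\<close>)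
            then show ?thesis by (simp add: e_def)
          qed
          finally show "ad i n \<delta>' r = 0"
            unfolding \<delta>'_def ad_diff using \<epsilon>[of r] by (simp add: D_def)
        next
          show "diff_op sc (\<lambda>x. x) (Suc t) \<delta>'"
            unfolding \<delta>'_def using diff_op_diff[OF algebra id Suc.prems(2) comp] .
        next
          show "log_op M \<delta>'"
            unfolding log_op_def
          proof (intro ballI allI)
            fix l s r assume l: "l \<in> M"
            obtain q where "log_derivation M i n (x l ^ s * r) = x l ^ s * q"
              using log_op_log_derivation[OF i M, of n] l unfolding log_op_def by blast
            then have "x l ^ s dvd \<epsilon> (log_derivation M i n (x l ^ s * r))"
              using \<epsilon>_log l by (simp add: log_op_def)
            then show "x l ^ s dvd \<delta>' (x l ^ s * r)"
              using Suc.prems(3) l by (simp add: \<delta>'_def log_op_def)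
          qed
        next
          fix l r assume l: "l \<in> {Suc j<..d}"
          then have "log_derivation M i n (x l * r) = x l * log_derivation M i n r"
            using i by (intro log_derivation_mult_other) (auto simp: i_def)
          then show "\<delta>' (x l * r) = x l * \<delta>' r"
            using \<epsilon>_l[of l] Suc.prems(4)[OF l] l by (simp add: \<delta>'_def right_diff_distrib)
        qed
        show ?thesis
          unfolding preserves_def
        proof (intro allI impI)
          fix f a assume f: "(f, a) \<in> C"
          have "(\<epsilon> (log_derivation M i n f), a - real n - real (t - n)) \<in> C"
            using \<epsilon>_pres stable[OF i f, of n] unfolding preserves_def by blast
          then have "(\<epsilon> (log_derivation M i n f), a - real t) \<in> C"
            using True by (simp add: of_nat_diff)
          moreover have "(\<delta>' f, a - real t) \<in> C"
            using \<open>preserves t \<delta>'\<close> f unfolding preserves_def by blast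
          ultimately have "(\<delta>' f + \<epsilon> (log_derivation M i n f), a - real t) \<in> C"
            using filtration_add[OF C] by blast
          then show "(\<delta> f, a - real t) \<in> C" by (simp add: \<delta>'_def)
        qed
      qed
    qed
    moreover have "ad i (Suc t) \<delta> r = 0" for r
      using diff_op_ad[OF Suc.prems(2), of "Suc t" i] by simp
    ultimately show ?case using Suc.prems by blast
  qed
  then have "preserves t \<delta>" using \<delta> by (metis greaterThanAtMost_empty order_refl empty_iff)
  then show ?thesis using f unfolding preserves_def by blast
qed

end

section \<open>Reduction of the saturations to the coordinate derivations\<close>

lemma ideal_power_principal: "ideal_power (is_ideal hull {u}) s = {r * u ^ s | r. True}"
proof -
  have "ideal_power (is_ideal hull {u}) s = is_ideal hull {u ^ s}"
  proof
    have "(is_ideal hull {u}) ^ s \<subseteq> is_ideal hull {u ^ s}"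
    proof (induction s)
      case (Suc s)
      show ?case
      proof
        fix z assume "z \<in> (is_ideal hull {u}) ^ Suc s"
        then obtain a b where "z = a * b" "a \<in> is_ideal hull {u}" "b \<in> (is_ideal hull {u}) ^ s"
          by (auto simp: set_times_def)
        then obtain r q where "z = (r * u) * (q * u ^ s)"
          using Suc unfolding is_ideal_hull_singleton by blast
        then have "z = (r * q) * u ^ Suc s" by (simp add: mult_ac)
        then show "z \<in> is_ideal hull {u ^ Suc s}" unfolding is_ideal_hull_singleton by blast
      qed
    qed (auto intro: hull_inc)
    then show "ideal_power (is_ideal hull {u}) s \<subseteq> is_ideal hull {u ^ s}"
      unfolding ideal_power_def by (rule hull_minimal) (rule is_ideal_hull)
    have "u ^ s \<in> (is_ideal hull {u}) ^ s"
      by (induction s) (auto intro: set_times_intro hull_inc)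
    then show "is_ideal hull {u ^ s} \<subseteq> ideal_power (is_ideal hull {u}) s"
      unfolding ideal_power_def by (intro hull_mono) auto
  qed
  then show ?thesis by (simp add: is_ideal_hull_singleton)
qed

text \<open>The assumption makes the closure a competitor in the definition of
  \<open>B_saturation\<close>; the other inclusion is minimality, used twice.\<close>

lemma B_saturation_eq:
  assumes "D_saturated \<DD> (asymp_closure (D_saturation \<DD> I))"
  shows "B_saturation \<DD> I = R_saturation (D_saturation \<DD> I)"
proof -
  let ?J = "D_saturation \<DD> I"
  have J: "idealistic_filtration ?J" "D_saturated \<DD> ?J" using D_saturation_saturated by blast+
  have R: "R_saturation ?J = asymp_closure ?J"
    by (rule R_saturation_eq_asymp_closure[OF J(1)])
  show ?thesis
  proof
    have "I \<subseteq> ?J" unfolding D_saturation_def by (rule hull_subset)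
    then have "I \<subseteq> asymp_closure ?J" using asymp_closure_superset[OF J(1)] by blast
    then show "B_saturation \<DD> I \<subseteq> R_saturation ?J"
      unfolding B_saturation_def R
      using assms idealistic_filtration_asymp_closure[OF J(1)] R_saturated_asymp_closure[OF J(1)]
      by (intro hull_minimal) auto
    have B: "idealistic_filtration (B_saturation \<DD> I)" "D_saturated \<DD> (B_saturation \<DD> I)"
        "R_saturated (B_saturation \<DD> I)"
      using B_saturation_saturated by blast+
    have "I \<subseteq> B_saturation \<DD> I" unfolding B_saturation_def by (rule hull_subset)
    then have "?J \<subseteq> B_saturation \<DD> I"
      unfolding D_saturation_def using B by (intro hull_minimal) auto
    then show "R_saturation ?J \<subseteq> B_saturation \<DD> I"
      unfolding R_saturation_def using B by (intro hull_minimal) auto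
  qed
qed

context coordinate_derivations
begin

text \<open>For \<open>M = {}\<close> the product is 1 and the divisibility condition is void, so
  both kinds of operators are covered. The logarithmic derivations pass to the closure because they
  are higher derivations; every other operator is then reached by decomposition.\<close>

lemma D_saturated_asymp_closure:
  assumes M: "M \<subseteq> {1..d}"
    and ops: "\<And>t \<delta>. \<delta> \<in> \<DD> t \<longleftrightarrow>
      diff_op sc (\<lambda>x. x) (Suc t) \<delta> \<and> (\<forall>s r. (\<Prod>j\<in>M. x j) ^ s dvd \<delta> ((\<Prod>j\<in>M. x j) ^ s * r))"
    and J: "idealistic_filtration J" "D_saturated \<DD> J"
  shows "D_saturated \<DD> (asymp_closure J)"
  unfolding D_saturated_def
proof (intro allI ballI impI)
  fix f a t \<delta> assume \<delta>: "\<delta> \<in> \<DD> t" and f: "(f, a) \<in> asymp_closure J"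
  have "(log_derivation M i n f, a - real n) \<in> J" if "i \<in> {1..d}" "(f, a) \<in> J" for i f a n
  proof -
    have "log_derivation M i n \<in> \<DD> n"
      unfolding ops using diff_op_log_derivation[OF that(1)] log_derivation_prod_dvd[OF that(1) M] by blast
    then show ?thesis using J(2) that(2) unfolding D_saturated_def by blast
  qed
  then have "(log_derivation M i n f, a - real n) \<in> asymp_closure J"
    if "i \<in> {1..d}" "(f, a) \<in> asymp_closure J" for i f a n
    using asymp_closure_higher_derivation[OF J(1) higher_derivation_log_derivation[OF that(1)]] that by blast
  moreover have "diff_op sc (\<lambda>x. x) (Suc t) \<delta>" "log_op M \<delta>"
    using \<delta> log_op_if_prod_dvd[OF M] unfolding ops by blast+
  ultimately show "(\<delta> f, a - real t) \<in> asymp_closure J"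
    using log_op_preserves_filtration[OF idealistic_filtration_asymp_closure[OF J(1)] M] f by blast
qed

theorem B_saturation_Diff: "B_saturation (Diff sc) I = R_saturation (D_saturation (Diff sc) I)"
proof (rule B_saturation_eq, rule D_saturated_asymp_closure[of "{}"])
  show "\<delta> \<in> Diff sc t \<longleftrightarrow> diff_op sc (\<lambda>x. x) (Suc t) \<delta> \<and>
      (\<forall>s r. (\<Prod>j\<in>{}. x j) ^ s dvd \<delta> ((\<Prod>j\<in>{}. x j) ^ s * r))" for \<delta> t
    by (simp add: Diff_iff_diff_op[OF algebra])
qed (use D_saturation_saturated in blast)+

theorem B_saturation_Diff_log:
  assumes "m \<le> d"
  defines "IE \<equiv> is_ideal hull {\<Prod>i=1..m. x i}"
  shows "B_saturation (Diff_log sc IE) I = R_saturation (D_saturation (Diff_log sc IE) I)"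
proof (rule B_saturation_eq, rule D_saturated_asymp_closure[of "{1..m}"])
  show "\<delta> \<in> Diff_log sc IE t \<longleftrightarrow> diff_op sc (\<lambda>x. x) (Suc t) \<delta> \<and>
      (\<forall>s r. (\<Prod>j\<in>{1..m}. x j) ^ s dvd \<delta> ((\<Prod>j\<in>{1..m}. x j) ^ s * r))" for \<delta> t
  proof -
    have "{r * u | r. True} = {z. u dvd z}" for u :: 'r by (auto simp: dvd_def mult.commute)
    then have "(\<delta> ` {r * u | r. True} \<subseteq> {r * u | r. True}) \<longleftrightarrow> (\<forall>r. u dvd \<delta> (u * r))" for u
      by (auto simp: image_subset_iff)
    then show ?thesis
      unfolding Diff_log_def IE_def ideal_power_principal by (simp add: Diff_iff_diff_op[OF algebra])
  qed
qed (use assms(1) D_saturation_saturated in auto)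

end


section \<open>Elimination in the style of Nakayama\<close>

text \<open>A substitute for the determinant trick. The relations express \<open>e * v\<close>, with
  \<open>e\<close> congruent to a power of \<open>w\<close>, through elements of \<open>V\<close>
  with coefficients in \<open>Q\<close>; Gaussian elimination only multiplies the leading
  coefficients, which therefore stay congruent to powers of \<open>w\<close>.\<close>

lemma nakayama_elimination:
  fixes J Q V :: "'t::comm_ring_1 set"
  assumes J: "is_ideal J" and Q: "is_ideal Q" and "finite V"
    and "\<And>v. v \<in> V \<Longrightarrow> \<exists>e l q. e - w ^ l \<in> Q \<and> (\<forall>u\<in>V. q u \<in> Q) \<and> e * v - (\<Sum>u\<in>V. q u * u) \<in> J"
  shows "\<exists>E l. E - w ^ l \<in> Q \<and> (\<forall>v\<in>V. E * v \<in> J)"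
  using assms(3,4)
proof (induction V rule: finite_induct)
  case empty
  show ?case using ideal_zero[OF Q] by (intro exI[of _ 1] exI[of _ 0]) simp
next
  case (insert a V)
  have mult_Q: "e * f - w ^ (k + l) \<in> Q" if "e - w ^ k \<in> Q" "f - w ^ l \<in> Q" for e f k l
  proof -
    have "e * f - w ^ (k + l) = f * (e - w ^ k) + w ^ k * (f - w ^ l)"
      by (simp add: algebra_simps power_add)
    then show ?thesis using that ideal_add[OF Q] ideal_mult_left[OF Q] by simp
  qed
  obtain e l q where e: "e - w ^ l \<in> Q" "\<forall>u\<in>insert a V. q u \<in> Q"
      "e * a - (\<Sum>u\<in>insert a V. q u * u) \<in> J"
    using insert.prems[of a] by blast
  \<comment> \<open>Moving the term \<open>q a * a\<close> to the left keeps the class of the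
    coefficient modulo \<open>Q\<close>.\<close>
  define e0 where "e0 = e - q a"
  have e0: "e0 - w ^ l \<in> Q"
    using ideal_diff[OF Q e(1), of "q a"] e(2) by (simp add: e0_def algebra_simps)
  have e0a: "e0 * a - (\<Sum>u\<in>V. q u * u) \<in> J"
    using e(3) insert.hyps by (simp add: e0_def algebra_simps)
  have "\<exists>e l q. e - w ^ l \<in> Q \<and> (\<forall>u\<in>V. q u \<in> Q) \<and> e * v - (\<Sum>u\<in>V. q u * u) \<in> J" if v: "v \<in> V" for v
  proof -
    obtain e' l' q' where e': "e' - w ^ l' \<in> Q" "\<forall>u\<in>insert a V. q' u \<in> Q"
        "e' * v - (\<Sum>u\<in>insert a V. q' u * u) \<in> J"
      using insert.prems[of v] v by blast
    \<comment> \<open>Multiply the relation for \<open>v\<close> by \<open>e0\<close> and replace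
      \<open>e0 * a\<close> by its expression in \<open>V\<close>.\<close>
    define r where "r u = q' a * q u + e0 * q' u" for u
    have "e0 * e' * v - (\<Sum>u\<in>V. r u * u) =
        e0 * (e' * v - (\<Sum>u\<in>insert a V. q' u * u)) + q' a * (e0 * a - (\<Sum>u\<in>V. q u * u))"
      using insert.hyps by (simp add: r_def algebra_simps sum.distrib sum_distrib_left)
    then have "e0 * e' * v - (\<Sum>u\<in>V. r u * u) \<in> J"
      using e'(3) e0a ideal_add[OF J] ideal_mult_left[OF J] by simp
    moreover have "\<forall>u\<in>V. r u \<in> Q"
      using e(2) e'(2) ideal_add[OF Q] ideal_mult_left[OF Q] by (simp add: r_def)
    ultimately show ?thesis using mult_Q[OF e0 e'(1)] by blast
  qed
  then obtain E k where E: "E - w ^ k \<in> Q" "\<forall>v\<in>V. E * v \<in> J"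
    using insert.IH by blast
  have "(\<Sum>u\<in>V. q u * (E * u)) \<in> J"
    using E(2) ideal_mult_left[OF J] by (intro ideal_sum[OF J]) blast
  then have "E * (e0 * a - (\<Sum>u\<in>V. q u * u)) + (\<Sum>u\<in>V. q u * (E * u)) \<in> J"
    using e0a by (intro ideal_add[OF J] ideal_mult_left[OF J])
  moreover have "E * (e0 * a - (\<Sum>u\<in>V. q u * u)) + (\<Sum>u\<in>V. q u * (E * u)) = E * e0 * a"
    by (simp add: algebra_simps sum_distrib_left)
  ultimately have "E * e0 * a \<in> J" by simp
  moreover have "E * e0 * v \<in> J" if "v \<in> V" for v
    using ideal_mult_left[OF J, of "E * v" e0] E(2) that by (simp add: mult_ac)
  ultimately show ?case using mult_Q[OF E(1) e0] by (intro exI[of _ "E * e0"]) auto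
qed


section \<open>Linear functionals over a subfield\<close>

definition is_subfield :: "'f::field set \<Rightarrow> bool" where
  "is_subfield L \<longleftrightarrow> 1 \<in> L \<and> (\<forall>a\<in>L. \<forall>b\<in>L. a - b \<in> L \<and> a * b \<in> L) \<and> (\<forall>a\<in>L. inverse a \<in> L)"

lemma is_subfieldD:
  assumes "is_subfield L"
  shows "1 \<in> L" "0 \<in> L" "a \<in> L \<Longrightarrow> b \<in> L \<Longrightarrow> a - b \<in> L" "a \<in> L \<Longrightarrow> b \<in> L \<Longrightarrow> a * b \<in> L"
    "a \<in> L \<Longrightarrow> inverse a \<in> L" "a \<in> L \<Longrightarrow> b \<in> L \<Longrightarrow> a + b \<in> L" "a \<in> L \<Longrightarrow> - a \<in> L"
proof -
  show 1: "1 \<in> L" "a \<in> L \<Longrightarrow> b \<in> L \<Longrightarrow> a - b \<in> L" "a \<in> L \<Longrightarrow> b \<in> L \<Longrightarrow> a * b \<in> L"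
    "a \<in> L \<Longrightarrow> inverse a \<in> L" for a b
    using assms by (auto simp: is_subfield_def)
  show 0: "0 \<in> L" using 1(2)[of 1 1] 1(1) by simp
  show m: "a \<in> L \<Longrightarrow> - a \<in> L" for a using 1(2)[of 0 a] 0 by simp
  show "a \<in> L \<Longrightarrow> b \<in> L \<Longrightarrow> a + b \<in> L" using 1(2)[of a "- b"] m[of b] by simp
qed

definition is_subspace :: "'f::field set \<Rightarrow> 'f set \<Rightarrow> bool" where
  "is_subspace L W \<longleftrightarrow> 0 \<in> W \<and> (\<forall>v\<in>W. \<forall>w\<in>W. v + w \<in> W) \<and> (\<forall>l\<in>L. \<forall>w\<in>W. l * w \<in> W)"

text \<open>By Zorn there is a maximal subspace \<open>W\<close> above \<open>W0\<close> avoiding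
  \<open>a\<close>. It is a hyperplane: adjoining any further \<open>z\<close> produces
  \<open>a\<close>, so \<open>z\<close> is a multiple of \<open>a\<close> modulo \<open>W\<close>,
  and the multiplier is the functional.\<close>

lemma separating_functional:
  assumes L: "is_subfield L" and W0: "is_subspace L W0" and a: "a \<notin> W0"
  obtains \<mu> where "\<And>v w. \<mu> (v + w) = \<mu> v + \<mu> w" "\<And>l w. l \<in> L \<Longrightarrow> \<mu> (l * w) = l * \<mu> w"
    "\<And>w. \<mu> w \<in> L" "\<mu> a = 1" "\<And>w. w \<in> W0 \<Longrightarrow> \<mu> w = 0"
proof -
  note Ld = is_subfieldD[OF L]
  define \<A> where "\<A> = {W. is_subspace L W \<and> W0 \<subseteq> W \<and> a \<notin> W}"
  have "\<Union>\<C> \<in> \<A>" if "\<C> \<noteq> {}" "subset.chain \<A> \<C>" for \<C>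
  proof -
    have C: "is_subspace L W" "W0 \<subseteq> W" "a \<notin> W" if "W \<in> \<C>" for W
      using that \<open>subset.chain \<A> \<C>\<close> by (auto simp: \<A>_def subset_chain_def)
    have "v + w \<in> \<Union>\<C>" if "v \<in> V" "V \<in> \<C>" "w \<in> W" "W \<in> \<C>" for v w V W
    proof -
      have "V \<subseteq> W \<or> W \<subseteq> V" using \<open>subset.chain \<A> \<C>\<close> that by (auto simp: subset_chain_def)
      then show ?thesis using that C(1) unfolding is_subspace_def by blast
    qed
    moreover have "l * w \<in> \<Union>\<C>" if "l \<in> L" "w \<in> W" "W \<in> \<C>" for l w W
      using C(1)[OF that(3)] that unfolding is_subspace_def by blast
    moreover have "0 \<in> \<Union>\<C>" "W0 \<subseteq> \<Union>\<C>" "a \<notin> \<Union>\<C>"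
      using C \<open>\<C> \<noteq> {}\<close> unfolding is_subspace_def by blast+
    ultimately show ?thesis unfolding \<A>_def is_subspace_def by blast
  qed
  moreover have "\<A> \<noteq> {}" using W0 a by (auto simp: \<A>_def)
  ultimately obtain W where W: "W \<in> \<A>" and max: "\<And>X. X \<in> \<A> \<Longrightarrow> W \<subseteq> X \<Longrightarrow> X = W"
    using subset_Zorn_nonempty[of \<A>] by blast
  have sub: "0 \<in> W" "v \<in> W \<Longrightarrow> w \<in> W \<Longrightarrow> v + w \<in> W" "l \<in> L \<Longrightarrow> w \<in> W \<Longrightarrow> l * w \<in> W" for v w l
    using W unfolding \<A>_def is_subspace_def by blast+
  have minus: "w \<in> W \<Longrightarrow> - w \<in> W" for w
    using sub(3)[of "- 1" w] Ld(7)[OF Ld(1)] by simp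
  have diff: "v \<in> W \<Longrightarrow> w \<in> W \<Longrightarrow> v - w \<in> W" for v w
    using sub(2)[of v "- w"] minus by simp
  have aW: "a \<notin> W" "W0 \<subseteq> W" using W by (auto simp: \<A>_def)
  have ex: "\<exists>l\<in>L. z - l * a \<in> W" for z
  proof (cases "z \<in> W")
    case True
    then show ?thesis using Ld(2) by (intro bexI[of _ 0]) simp_all
  next
    case False
    define X where "X = {w + l * z | w l. w \<in> W \<and> l \<in> L}"
    have WX: "W \<subseteq> X"
    proof
      fix w assume "w \<in> W"
      then have "w + 0 * z \<in> X" unfolding X_def using Ld(2) by blast
      then show "w \<in> X" by simp
    qed
    have "z \<in> X"
    proof -
      have "0 + 1 * z \<in> X" unfolding X_def using sub(1) Ld(1) by blast
      then show ?thesis by simp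
    qed
    have "is_subspace L X"
      unfolding is_subspace_def
    proof (intro conjI ballI)
      show "0 \<in> X" using WX sub(1) by blast
    next
      fix v w assume "v \<in> X" "w \<in> X"
      then obtain v' l w' m where "v = v' + l * z" "w = w' + m * z" "v' \<in> W" "w' \<in> W" "l \<in> L" "m \<in> L"
        unfolding X_def by blast
      then have "v + w = (v' + w') + (l + m) * z" "v' + w' \<in> W" "l + m \<in> L"
        using sub(2) Ld(6) by (auto simp: algebra_simps)
      then show "v + w \<in> X" unfolding X_def by blast
    next
      fix l w assume "l \<in> L" "w \<in> X"
      then obtain w' m where "w = w' + m * z" "w' \<in> W" "m \<in> L" unfolding X_def by blast
      then have "l * w = l * w' + (l * m) * z" "l * w' \<in> W" "l * m \<in> L"
        using \<open>l \<in> L\<close> sub(3) Ld(4) by (auto simp: algebra_simps)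
      then show "l * w \<in> X" unfolding X_def by blast
    qed
    then have "a \<in> X"
      using max[of X] WX \<open>z \<in> X\<close> False aW unfolding \<A>_def by blast
    then obtain w l where wl: "a = w + l * z" "w \<in> W" "l \<in> L" unfolding X_def by blast
    then have "l \<noteq> 0" using aW by auto
    then have "z - inverse l * a = inverse l * (- w)" using wl by (simp add: field_simps)
    then show ?thesis using wl Ld(5) sub(3) minus by (intro bexI[of _ "inverse l"]) auto
  qed
  have uniq: "l = m" if "l \<in> L" "m \<in> L" "z - l * a \<in> W" "z - m * a \<in> W" for l m z
  proof (rule ccontr)
    assume "l \<noteq> m"
    have "(m - l) * a \<in> W" using diff[OF that(3,4)] by (simp add: algebra_simps)
    moreover have "inverse (m - l) \<in> L" using Ld(3,5) that(1,2) by blast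
    ultimately have "inverse (m - l) * ((m - l) * a) \<in> W" by (rule sub(3)[rotated])
    moreover have "inverse (m - l) * ((m - l) * a) = a" using \<open>l \<noteq> m\<close> by (simp flip: mult.assoc)
    ultimately show False using aW by simp
  qed
  obtain \<mu> where \<mu>: "\<mu> z \<in> L" "z - \<mu> z * a \<in> W" for z using ex by metis
  have eqI: "\<mu> z = l" if "l \<in> L" "z - l * a \<in> W" for z l using uniq \<mu> that by blast
  show thesis
  proof (rule that)
    show "\<mu> (v + w) = \<mu> v + \<mu> w" for v w
      using sub(2)[OF \<mu>(2)[of v] \<mu>(2)[of w]] Ld \<mu>(1) by (intro eqI) (auto simp: algebra_simps)
    show "\<mu> (l * w) = l * \<mu> w" if "l \<in> L" for l w
      using sub(3)[OF that \<mu>(2)[of w]] Ld(4)[OF that \<mu>(1)[of w]] by (intro eqI) (auto simp: algebra_simps)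
    show "\<mu> w \<in> L" for w by (rule \<mu>)
    show "\<mu> a = 1" using sub(1) Ld(1) by (intro eqI) auto
    show "\<mu> w = 0" if "w \<in> W0" for w using aW(2) that Ld(2) by (intro eqI) auto
  qed
qed

lemma subspace_span:
  assumes L: "is_subfield L"
  shows "is_subspace L {\<Sum>i\<in>A. l i * a i | l. \<forall>i. l i \<in> L}"
  unfolding is_subspace_def
proof (intro conjI ballI)
  note Ld = is_subfieldD[OF L]
  show "0 \<in> {\<Sum>i\<in>A. l i * a i | l. \<forall>i. l i \<in> L}"
    by (rule CollectI, rule exI[of _ "\<lambda>_. 0"]) (simp add: Ld(2))
next
  note Ld = is_subfieldD[OF L]
  fix v w assume "v \<in> {\<Sum>i\<in>A. l i * a i | l. \<forall>i. l i \<in> L}" "w \<in> {\<Sum>i\<in>A. l i * a i | l. \<forall>i. l i \<in> L}"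
  then obtain l m where "v = (\<Sum>i\<in>A. l i * a i)" "w = (\<Sum>i\<in>A. m i * a i)" "\<forall>i. l i \<in> L" "\<forall>i. m i \<in> L"
    by blast
  then show "v + w \<in> {\<Sum>i\<in>A. l i * a i | l. \<forall>i. l i \<in> L}"
    using Ld(6) by (intro CollectI exI[of _ "\<lambda>i. l i + m i"]) (simp add: sum.distrib distrib_right)
next
  note Ld = is_subfieldD[OF L]
  fix c w assume "c \<in> L" "w \<in> {\<Sum>i\<in>A. l i * a i | l. \<forall>i. l i \<in> L}"
  then obtain m where "w = (\<Sum>i\<in>A. m i * a i)" "\<forall>i. m i \<in> L" by blast
  then show "c * w \<in> {\<Sum>i\<in>A. l i * a i | l. \<forall>i. l i \<in> L}"
    using Ld(4) \<open>c \<in> L\<close> by (intro CollectI exI[of _ "\<lambda>i. c * m i"]) (simp add: sum_distrib_left mult.assoc)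
qed

lemma span_member:
  assumes "is_subfield L" "finite A" "j \<in> A"
  shows "a j \<in> {\<Sum>i\<in>A. l i * a i | l. \<forall>i. l i \<in> L}"
proof -
  have "a j = (\<Sum>i\<in>A. (if i = j then 1 else 0) * a i)"
    using assms by (simp add: if_distrib[of "\<lambda>z. z * a _"] sum.delta' cong: if_cong)
  then show ?thesis
    using is_subfieldD[OF assms(1)] by (intro CollectI exI[of _ "\<lambda>i. if i = j then 1 else 0"]) simp
qed


section \<open>Independence of monomials over the field of \<open>p ^ q\<close>-th powers\<close>

definition is_derivation :: "('f \<Rightarrow> 'f::comm_ring_1) \<Rightarrow> bool" where
  "is_derivation D \<longleftrightarrow> (\<forall>a b. D (a + b) = D a + D b) \<and> (\<forall>a b. D (a * b) = a * D b + b * D a)"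

lemma is_derivationD:
  assumes "is_derivation D"
  shows "D (a + b) = D a + D b" "D (a * b) = a * D b + b * D a" "D 0 = 0" "D 1 = 0"
    "D (a - b) = D a - D b" "D (sum f A) = (\<Sum>i\<in>A. D (f i))"
    "D (a ^ n) = of_nat n * a ^ (n - 1) * D a"
proof -
  show 1: "D (a + b) = D a + D b" "D (a * b) = a * D b + b * D a" for a b
    using assms by (auto simp: is_derivation_def)
  show 0: "D 0 = 0" using 1(1)[of 0 0] by simp
  show one: "D 1 = 0" using 1(2)[of 1 1] by simp
  show "D (a - b) = D a - D b" using 1(1)[of "a - b" b] by (simp add: algebra_simps)
  show "D (sum f A) = (\<Sum>i\<in>A. D (f i))" by (induction A rule: infinite_finite_induct) (simp_all add: 0 1)
  show "D (a ^ n) = of_nat n * a ^ (n - 1) * D a"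
  proof (induction n)
    case (Suc n)
    then show ?case by (cases n) (simp_all add: 1 algebra_simps)
  qed (simp add: one)
qed

lemma derivation_of_nat: "is_derivation D \<Longrightarrow> D (of_nat n) = 0"
  by (induction n) (simp_all add: is_derivationD)

lemma derivation_prod_eq_0:
  assumes "is_derivation D" "\<And>i. i \<in> A \<Longrightarrow> D (f i) = 0"
  shows "D (prod f A) = 0"
  using assms(2) by (induction A rule: infinite_finite_induct) (simp_all add: is_derivationD[OF assms(1)])

text \<open>\<open>D\<close> turns a relation with \<open>m + 1\<close> terms into one with
  \<open>m\<close> terms and coefficients \<open>(n + 1) * z (n + 1)\<close>; below the
  characteristic these integers are invertible.\<close>

lemma powers_independent_over_constants:
  fixes D :: "'f::field \<Rightarrow> 'f"
  assumes D: "is_derivation D" "D X = 1" and m: "m \<le> CHAR('f) "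
    and "\<And>n. n < m \<Longrightarrow> D (z n) = 0" and "(\<Sum>n<m. z n * X ^ n) = 0" and "n < m"
  shows "z n = 0"
  using m assms(4-6)
proof (induction m arbitrary: z n)
  case (Suc m)
  have "(\<Sum>n<m. (of_nat (Suc n) * z (Suc n)) * X ^ n) = (\<Sum>n<m. D (z (Suc n) * X ^ Suc n))"
    by (rule sum.cong) (auto simp: is_derivationD[OF D(1)] D(2) Suc.prems simp del: power_Suc)
  also have "\<dots> = D (\<Sum>n<m. z (Suc n) * X ^ Suc n)" by (simp add: is_derivationD[OF D(1)])
  also have "(\<Sum>n<m. z (Suc n) * X ^ Suc n) = - z 0"
    using Suc.prems(3) unfolding sum.lessThan_Suc_shift by (simp add: add_eq_0_iff)
  also have "D (- z 0) = 0"
    using Suc.prems(2)[of 0] is_derivationD(5)[OF D(1), of 0 "z 0"] is_derivationD(3)[OF D(1)] by simp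
  finally have "(\<Sum>n<m. (of_nat (Suc n) * z (Suc n)) * X ^ n) = 0" .
  moreover have "D (of_nat (Suc n) * z (Suc n)) = 0" if "n < m" for n
    using Suc.prems(2)[of "Suc n"] that
    by (simp only: is_derivationD(2)[OF D(1)] derivation_of_nat[OF D(1)]) simp
  ultimately have nz: "of_nat (Suc n) * z (Suc n) = 0" if "n < m" for n
    using Suc.IH[of "\<lambda>n. of_nat (Suc n) * z (Suc n)" n] that Suc.prems(1) by simp
  have S: "z (Suc n) = 0" if "n < m" for n
  proof -
    have "\<not> CHAR('f) dvd Suc n" using that Suc.prems(1) by (auto dest: dvd_imp_le)
    then have "of_nat (Suc n) \<noteq> (0 :: 'f)" by (simp only: of_nat_eq_0_iff_char_dvd not_False_eq_True)
    then show ?thesis using nz[OF that] by (simp only: mult_eq_0_iff) simp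
  qed
  then have "z 0 = 0"
    using Suc.prems(3) unfolding sum.lessThan_Suc_shift by simp
  then show ?case using S Suc.prems(4) by (cases n) auto
qed simp

lemma sum_PiE_insert:
  assumes "a \<notin> A"
  shows "(\<Sum>I\<in>PiE (insert a A) B. f I) = (\<Sum>n\<in>B a. \<Sum>I\<in>PiE A B. f (I(a := n)))"
proof -
  have inj: "inj_on (\<lambda>(y, g). g(a := y)) (B a \<times> PiE A B)"
    using inj_combinator[OF assms] .
  show ?thesis
    unfolding PiE_insert_eq sum.reindex[OF inj] sum.cartesian_product by (simp add: case_prod_beta)
qed

lemma monomials_independent_over_constants:
  fixes X :: "nat \<Rightarrow> 'f::field"
  assumes "finite A" and D: "\<And>i. i \<in> A \<Longrightarrow> is_derivation (D i)"
    and X: "\<And>i j. i \<in> A \<Longrightarrow> j \<in> A \<Longrightarrow> D i (X j) = (if i = j then 1 else 0)"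
    and c: "\<And>i I. i \<in> A \<Longrightarrow> D i (c I) = 0"
    and sum0: "(\<Sum>I\<in>PiE A (\<lambda>_. {..<CHAR('f)}). c I * (\<Prod>i\<in>A. X i ^ I i)) = 0"
    and I: "I \<in> PiE A (\<lambda>_. {..<CHAR('f)})"
  shows "c I = 0"
  using assms
proof (induction A arbitrary: c I rule: finite_induct)
  case (insert a A)
  let ?P = "PiE A (\<lambda>_. {..<CHAR('f)})"
  define z where "z n = (\<Sum>I\<in>?P. c (I(a := n)) * (\<Prod>i\<in>A. X i ^ I i))" for n
  have prod: "(\<Prod>i\<in>insert a A. X i ^ (I(a := n)) i) = (\<Prod>i\<in>A. X i ^ I i) * X a ^ n" for I n
  proof -
    have "(\<Prod>i\<in>A. X i ^ (I(a := n)) i) = (\<Prod>i\<in>A. X i ^ I i)"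
      by (rule prod.cong) (use insert.hyps in auto)
    then show ?thesis using insert.hyps by (simp add: mult.commute)
  qed
  have "(\<Sum>n<CHAR('f). z n * X a ^ n) =
      (\<Sum>I\<in>PiE (insert a A) (\<lambda>_. {..<CHAR('f)}). c I * (\<Prod>i\<in>insert a A. X i ^ I i))"
    unfolding sum_PiE_insert[OF insert.hyps(2)] prod z_def sum_distrib_right by (simp only: mult.assoc)
  then have z_sum: "(\<Sum>n<CHAR('f). z n * X a ^ n) = 0" using insert.prems(4) by simp
  have Da: "is_derivation (D a)" "D a (X a) = 1" using insert.prems(1,2) by auto
  have "D a (\<Prod>i\<in>A. X i ^ I i) = 0" for I
  proof (rule derivation_prod_eq_0[OF Da(1)])
    fix i assume "i \<in> A"
    then have "D a (X i) = 0" using insert.prems(2)[of a i] insert.hyps by auto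
    then show "D a (X i ^ I i) = 0" by (simp add: is_derivationD[OF Da(1)])
  qed
  then have "D a (z n) = 0" for n
    by (simp add: z_def is_derivationD[OF Da(1)] insert.prems(3))
  then have z0: "z n = 0" if "n < CHAR('f)" for n
    using powers_independent_over_constants[OF Da order_refl _ z_sum that] by blast
  have "I a < CHAR('f)" using insert.prems(5) by auto
  moreover have "I(a := undefined) \<in> ?P" using fun_upd_in_PiE[OF insert.hyps(2) insert.prems(5)] .
  ultimately have "c ((I(a := undefined))(a := I a)) = 0"
    using insert.IH[of "\<lambda>J. c (J(a := I a))" "I(a := undefined)"] insert.prems(1-3) z0[of "I a"]
    unfolding z_def by blast
  moreover have "(I(a := undefined))(a := I a) = I" by auto
  ultimately show ?case by (simp only:)
qed simp

text \<open>Write each exponent as \<open>j + p * k\<close> with \<open>j < p\<close>. The terms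
  with given digits \<open>j\<close> combine to a p-th power times a monomial; that p-th power is a
  constant of all derivations and therefore vanishes, and its p-th root is a relation of the same
  kind for a smaller \<open>q\<close>.\<close>

lemma monomials_independent_over_powers:
  fixes X :: "nat \<Rightarrow> 'f::field"
  assumes p: "prime CHAR('f)" and A: "finite A" and D: "\<And>i. i \<in> A \<Longrightarrow> is_derivation (D i)"
    and X: "\<And>i j. i \<in> A \<Longrightarrow> j \<in> A \<Longrightarrow> D i (X j) = (if i = j then 1 else 0)"
    and sum0: "(\<Sum>I\<in>PiE A (\<lambda>_. {..<CHAR('f) ^ q}). c I ^ (CHAR('f) ^ q) * (\<Prod>i\<in>A. X i ^ I i)) = 0"
    and I: "I \<in> PiE A (\<lambda>_. {..<CHAR('f) ^ q})"
  shows "c I = 0"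
  using sum0 I
proof (induction q arbitrary: c I)
  case 0
  have P: "PiE A (\<lambda>_. {..<CHAR('f) ^ 0}) = {\<lambda>i\<in>A. 0}"
  proof -
    have "{..<CHAR('f) ^ 0} = {0::nat}" by (simp add: lessThan_Suc)
    then have "PiE A (\<lambda>_. {..<CHAR('f) ^ 0}) = PiE A (\<lambda>i. {(\<lambda>i\<in>A. 0::nat) i})"
      by (simp only:) (rule PiE_cong, simp)
    also have "\<dots> = {\<lambda>i\<in>A. 0}" by (rule PiE_singleton) (rule restrict_extensional)
    finally show ?thesis .
  qed
  have "(\<Prod>i\<in>A. X i ^ (\<lambda>i\<in>A. 0) i) = (1::'f)" by (rule prod.neutral) auto
  then show ?case using 0 unfolding P by simp
next
  case (Suc q)
  let ?p = "CHAR('f)"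
  let ?P = "\<lambda>n. PiE A (\<lambda>_. {..<n::nat})"
  have p0: "?p > 0" using p prime_gt_0_nat by blast
  \<comment> \<open>Lowest base-p digit and remaining part, for all exponents at once.\<close>
  define digits where "digits = (\<lambda>(J, K). \<lambda>i\<in>A. J i + ?p * K i)"
  have digit_le: "j + ?p * k < ?p * n" if "j < ?p" "k < n" for j k n
  proof -
    have "j + ?p * k < ?p * Suc k" using that by simp
    also have "\<dots> \<le> ?p * n" using that by (intro mult_le_mono) auto
    finally show ?thesis .
  qed
  have bij: "bij_betw digits (?P ?p \<times> ?P (?p ^ q)) (?P (?p ^ Suc q))"
  proof (rule bij_betwI[where g = "\<lambda>I. (\<lambda>i\<in>A. I i mod ?p, \<lambda>i\<in>A. I i div ?p)"])
    show "digits \<in> ?P ?p \<times> ?P (?p ^ q) \<rightarrow> ?P (?p ^ Suc q)"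
      using digit_le by (auto simp: digits_def PiE_iff)
    show "(\<lambda>I. (\<lambda>i\<in>A. I i mod ?p, \<lambda>i\<in>A. I i div ?p)) \<in> ?P (?p ^ Suc q) \<rightarrow> ?P ?p \<times> ?P (?p ^ q)"
      using p0 by (auto simp: PiE_iff less_mult_imp_div_less mult.commute)
  next
    fix JK assume "JK \<in> ?P ?p \<times> ?P (?p ^ q)"
    then show "(\<lambda>i\<in>A. digits JK i mod ?p, \<lambda>i\<in>A. digits JK i div ?p) = JK"
      by (cases JK) (auto simp: digits_def PiE_iff extensional_def fun_eq_iff)
  next
    fix I assume "I \<in> ?P (?p ^ Suc q)"
    then show "digits (\<lambda>i\<in>A. I i mod ?p, \<lambda>i\<in>A. I i div ?p) = I"
      by (auto simp: digits_def PiE_iff extensional_def fun_eq_iff)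
  qed
  define z where "z J = (\<Sum>K\<in>?P (?p ^ q). c (digits (J, K)) ^ (?p ^ q) * (\<Prod>i\<in>A. X i ^ K i))" for J
  have digit: "c (digits (J, K)) ^ (?p ^ Suc q) * (\<Prod>i\<in>A. X i ^ digits (J, K) i) =
      (c (digits (J, K)) ^ (?p ^ q) * (\<Prod>i\<in>A. X i ^ K i)) ^ ?p * (\<Prod>i\<in>A. X i ^ J i)" for J K
  proof -
    have "(\<Prod>i\<in>A. X i ^ digits (J, K) i) = (\<Prod>i\<in>A. (X i ^ K i) ^ ?p * X i ^ J i)"
      by (rule prod.cong) (auto simp: digits_def power_add mult.commute simp flip: power_mult)
    moreover have "c (digits (J, K)) ^ (?p ^ Suc q) = (c (digits (J, K)) ^ (?p ^ q)) ^ ?p"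
      by (simp add: mult.commute flip: power_mult)
    ultimately show ?thesis by (simp add: power_mult_distrib prod.distrib prod_power_distrib)
  qed
  have "(\<Sum>J\<in>?P ?p. z J ^ ?p * (\<Prod>i\<in>A. X i ^ J i)) =
      (\<Sum>I\<in>?P (?p ^ Suc q). c I ^ (?p ^ Suc q) * (\<Prod>i\<in>A. X i ^ I i))"
    unfolding sum.reindex_bij_betw[OF bij, symmetric] z_def freshmans_dream_sum[OF p refl]
      sum_distrib_right sum.cartesian_product
    by (rule sum.cong[OF refl]) (clarsimp simp: digit simp del: power_Suc)
  then have "(\<Sum>J\<in>?P ?p. z J ^ ?p * (\<Prod>i\<in>A. X i ^ J i)) = 0" using Suc.prems by simp
  moreover have "D i (z J ^ ?p) = 0" if "i \<in> A" for i J
    by (simp add: is_derivationD[OF D[OF that]])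
  ultimately have "z J ^ ?p = 0" if "J \<in> ?P ?p" for J
    using monomials_independent_over_constants[OF A D X, of "\<lambda>J. z J ^ ?p" J] that by blast
  then have z0: "z J = 0" if "J \<in> ?P ?p" for J using that by simp
  obtain J K where JK: "J \<in> ?P ?p" "K \<in> ?P (?p ^ q)" "I = digits (J, K)"
    using bij Suc.prems(2) unfolding bij_betw_def by blast
  then show ?case using Suc.IH[of "\<lambda>K. c (digits (J, K))" K] z0[OF JK(1)] unfolding z_def by simp
qed


section \<open>Independence of the powers of a coordinate differential\<close>

lemma power_cong_ideal:
  assumes "is_ideal J" "u - v \<in> J"
  shows "u ^ n - v ^ n \<in> J"
proof (induction n)
  case (Suc n)
  have "u ^ Suc n - v ^ Suc n = u * (u ^ n - v ^ n) + v ^ n * (u - v)" by (simp add: algebra_simps)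
  then show ?case
    using Suc assms(2) ideal_add[OF assms(1)] ideal_mult_left[OF assms(1)] by simp
qed (simp add: ideal_zero[OF assms(1)])

text \<open>Formal tensors have integer coefficients, so p is not 0 there; it only lies in the
  ideals of interest.\<close>

lemma freshmans_dream_mod_ideal:
  fixes J :: "'t::comm_ring_1 set"
  assumes J: "is_ideal J" and p: "prime p" "of_nat p \<in> J"
  shows "(a + b) ^ (p ^ q) - (a ^ (p ^ q) + b ^ (p ^ q)) \<in> J"
proof (induction q arbitrary: a b)
  case 0
  show ?case by (simp add: ideal_zero[OF J])
next
  case (Suc q)
  have step: "(u + v) ^ p - (u ^ p + v ^ p) \<in> J" for u v
  proof -
    have p0: "p > 0" using p(1) prime_gt_0_nat by blast
    have "{..p} = insert 0 (insert p {0<..<p})" using p0 by auto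
    then have "(u + v) ^ p - (u ^ p + v ^ p) = (\<Sum>k\<in>{0<..<p}. of_nat (p choose k) * u ^ k * v ^ (p - k))"
      using p0 by (simp add: binomial_ring)
    also have "\<dots> \<in> J"
    proof (rule ideal_sum[OF J])
      fix k assume k: "k \<in> {0<..<p}"
      then have "p dvd (p choose k)" by (intro dvd_choose_prime) (use p in auto)
      then obtain m where "p choose k = p * m" by blast
      then have "of_nat (p choose k) * u ^ k * v ^ (p - k) = (of_nat m * u ^ k * v ^ (p - k)) * of_nat p"
        by (simp add: mult_ac)
      then show "of_nat (p choose k) * u ^ k * v ^ (p - k) \<in> J"
        using ideal_mult_left[OF J p(2)] by simp
    qed
    finally show ?thesis .
  qed
  have "((a + b) ^ (p ^ q)) ^ p - (a ^ (p ^ q) + b ^ (p ^ q)) ^ p \<in> J"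
    by (rule power_cong_ideal[OF J Suc])
  from ideal_add[OF J this step[of "a ^ (p ^ q)" "b ^ (p ^ q)"]]
  moreover have "u - v + (v - w) = u - w" for u v w :: 't by simp
  ultimately have "((a + b) ^ (p ^ q)) ^ p - ((a ^ (p ^ q)) ^ p + (b ^ (p ^ q)) ^ p) \<in> J"
    by (simp only:)
  then show ?case by (simp add: mult.commute flip: power_mult)
qed

lemma tensor_map_of_int:
  "tensor_map \<phi> \<mu> (of_int z * f) = of_int z * tensor_map \<phi> \<mu> f"
proof -
  have nat: "tensor_map \<phi> \<mu> (of_nat n * f) = of_nat n * tensor_map \<phi> \<mu> f" for n
    by (induction n) (simp_all add: distrib_right tensor_map_add)
  show ?thesis
    by (cases z rule: int_cases2) (simp_all add: nat tensor_map_uminus)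
qed

lemma is_ideal_functional_kernel: "is_ideal {t. \<forall>f. tensor_map \<phi> \<mu> (t * f) = 0}"
proof (rule is_idealI)
  fix u s :: "'a pretensor" assume s: "s \<in> {t. \<forall>f. tensor_map \<phi> \<mu> (t * f) = 0}"
  have "tensor_map \<phi> \<mu> (u * s * f) = 0" for f
  proof -
    have "u * s * f = s * (u * f)" by (simp add: mult_ac)
    then show ?thesis using s by (metis (mono_tags, lifting) mem_Collect_eq)
  qed
  then show "u * s \<in> {t. \<forall>f. tensor_map \<phi> \<mu> (t * f) = 0}" by blast
qed (auto simp: distrib_right tensor_map_add)

lemma pt_power: "pt a b ^ n = pt (a ^ n) (b ^ n)" for a b :: "'r::comm_ring_1"
  by (induction n) (simp_all add: pt_mult pt_one)

lemma pt_prod: "(\<Prod>i\<in>A. pt (f i) (h i)) = pt (prod f A) (prod h A)" for f h :: "'i \<Rightarrow> 'r::comm_ring_1"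
  by (induction A rule: infinite_finite_induct) (simp_all add: pt_mult pt_one)

text \<open>True on formal tensors, before any relation is imposed. It allows sums over the image of
  a set under \<open>dif\<close> to be reindexed by the set.\<close>

lemma dif_inject:
  assumes "dif a = dif b"
  shows "a = b"
proof -
  have "pt 1 a - pt a 1 = pt 1 b - pt b 1" using assms by (simp add: dif_def)
  then have "Poly_Mapping.lookup (pt 1 a - pt a 1) p = Poly_Mapping.lookup (pt 1 b - pt b 1) p" for p by simp
  from this[of "Tens 1 a"] this[of "Tens 1 b"] show ?thesis by (auto simp: pt_def lookup_minus lookup_single when_def split: if_splits)
qed

section \<open>Ideals generated by coordinate differentials\<close>

definition coord_ideal ::
    "('k \<Rightarrow> 'r::comm_ring_1 \<Rightarrow> 'r) \<Rightarrow> (nat \<Rightarrow> 'r) \<Rightarrow> nat set \<Rightarrow> nat \<Rightarrow> 'r pretensor set" where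
  "coord_ideal sc x B n = is_ideal hull (diagonal_power sc n \<union> (\<lambda>i. dif (x i)) ` B)"

text \<open>The quotient by it is the tensor product of \<open>R\<close> with itself over the
  subalgebra generated by the \<open>x i\<close>, \<open>i \<in> B\<close>.\<close>

definition differential_ideal ::
    "('k \<Rightarrow> 'r::comm_ring_1 \<Rightarrow> 'r) \<Rightarrow> (nat \<Rightarrow> 'r) \<Rightarrow> nat set \<Rightarrow> 'r pretensor set" where
  "differential_ideal sc x B = is_ideal hull (tensor_relations sc \<union> (\<lambda>i. dif (x i)) ` B)"

lemma is_ideal_coord_ideal: "is_ideal (coord_ideal sc x B n)"
  unfolding coord_ideal_def by (rule is_ideal_hull)

lemma is_ideal_differential_ideal: "is_ideal (differential_ideal sc x B)"
  unfolding differential_ideal_def by (rule is_ideal_hull)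

lemma differential_ideal_generators:
  shows "tensor_relations sc \<subseteq> differential_ideal sc x B" "i \<in> B \<Longrightarrow> dif (x i) \<in> differential_ideal sc x B"
  unfolding differential_ideal_def by (auto intro: hull_inc)

lemma coord_ideal_generators:
  shows "diagonal_power sc n \<subseteq> coord_ideal sc x B n" "i \<in> B \<Longrightarrow> dif (x i) \<in> coord_ideal sc x B n"
    "tensor_relations sc \<subseteq> coord_ideal sc x B n"
proof -
  show 1: "diagonal_power sc n \<subseteq> coord_ideal sc x B n"
    unfolding coord_ideal_def by (auto intro: hull_inc)
  show "i \<in> B \<Longrightarrow> dif (x i) \<in> coord_ideal sc x B n"
    unfolding coord_ideal_def by (auto intro: hull_inc)
  show "tensor_relations sc \<subseteq> coord_ideal sc x B n"
    using relations_diagonal_power 1 by blast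
qed

text \<open>
  If \<open>\<Omega>\<close> is generated by the \<open>dx\<^sub>i\<close> after inverting \<open>g\<close>, then \<open>R \<otimes> R\<close> modulo the \<open>dx\<^sub>i\<close> is
  generically a separability idempotent away from \<open>R\<close>.
\<close>

lemma separability_element:
  fixes sc :: "'k::field \<Rightarrow> 'r::comm_ring_1 \<Rightarrow> 'r"
  assumes sc: "algebra_over sc" and V: "finite V" "diagonal \<subseteq> is_ideal hull (tensor_relations sc \<union> dif ` V)"
    and gen: "\<And>v. v \<in> V \<Longrightarrow> pt g 1 * dif v \<in> coord_ideal sc x B 2"
  obtains E l where "mult_map E = g ^ l" "\<And>\<tau>. \<tau> \<in> diagonal \<Longrightarrow> E * \<tau> \<in> differential_ideal sc x B"
proof -
  let ?J = "differential_ideal sc x B"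
  note J = is_ideal_differential_ideal[of sc x B] and Jg = differential_ideal_generators[where sc = sc and x = x and B = B]
  have lin: "\<exists>q. \<tau> - (\<Sum>v\<in>V. q v * dif v) \<in> ?J" if "\<tau> \<in> diagonal" for \<tau>
  proof -
    have "is_ideal hull (tensor_relations sc \<union> dif ` V) \<subseteq> {\<tau>. \<exists>q. \<tau> - (\<Sum>v\<in>V. q v * dif v) \<in> ?J}"
    proof (rule hull_minimal)
      show "is_ideal {\<tau>. \<exists>q. \<tau> - (\<Sum>v\<in>V. q v * dif v) \<in> ?J}"
      proof (rule is_idealI)
        show "0 \<in> {\<tau>. \<exists>q. \<tau> - (\<Sum>v\<in>V. q v * dif v) \<in> ?J}"
          using ideal_zero[OF J] by (intro CollectI exI[of _ "\<lambda>_. 0"]) simp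
      next
        fix a b assume "a \<in> {\<tau>. \<exists>q. \<tau> - (\<Sum>v\<in>V. q v * dif v) \<in> ?J}"
          "b \<in> {\<tau>. \<exists>q. \<tau> - (\<Sum>v\<in>V. q v * dif v) \<in> ?J}"
        then obtain q r where "a - (\<Sum>v\<in>V. q v * dif v) \<in> ?J" "b - (\<Sum>v\<in>V. r v * dif v) \<in> ?J" by blast
        from ideal_add[OF J this] show "a + b \<in> {\<tau>. \<exists>q. \<tau> - (\<Sum>v\<in>V. q v * dif v) \<in> ?J}"
          by (intro CollectI exI[of _ "\<lambda>v. q v + r v"]) (simp add: algebra_simps sum.distrib)
      next
        fix s a assume "a \<in> {\<tau>. \<exists>q. \<tau> - (\<Sum>v\<in>V. q v * dif v) \<in> ?J}"
        then obtain q where "a - (\<Sum>v\<in>V. q v * dif v) \<in> ?J" by blast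
        from ideal_mult_left[OF J this, of s] show "s * a \<in> {\<tau>. \<exists>q. \<tau> - (\<Sum>v\<in>V. q v * dif v) \<in> ?J}"
          by (intro CollectI exI[of _ "\<lambda>v. s * q v"]) (simp add: right_diff_distrib sum_distrib_left mult.assoc)
      qed
      show "tensor_relations sc \<union> dif ` V \<subseteq> {\<tau>. \<exists>q. \<tau> - (\<Sum>v\<in>V. q v * dif v) \<in> ?J}"
      proof
        fix \<tau> assume "\<tau> \<in> tensor_relations sc \<union> dif ` V"
        then show "\<tau> \<in> {\<tau>. \<exists>q. \<tau> - (\<Sum>v\<in>V. q v * dif v) \<in> ?J}"
        proof
          assume "\<tau> \<in> tensor_relations sc"
          then show ?thesis using Jg by (intro CollectI exI[of _ "\<lambda>_. 0"]) auto
        next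
          assume "\<tau> \<in> dif ` V"
          then obtain u where u: "u \<in> V" "\<tau> = dif u" by blast
          have "(\<Sum>v\<in>V. (if v = u then 1 else 0) * dif v) = dif u"
            using u V(1) by (simp add: if_distrib[of "\<lambda>z. z * dif _"] sum.delta cong: if_cong)
          then show ?thesis using u ideal_zero[OF J] by (intro CollectI exI[of _ "\<lambda>v. if v = u then 1 else 0"]) simp
        qed
      qed
    qed
    then show ?thesis using that V(2) by blast
  qed
  \<comment> \<open>Combinations with coefficients in the diagonal. This ideal contains the square
    of the diagonal, so generation modulo the square becomes a linear system to which elimination
    applies.\<close>
  define S where "S = {\<tau>. \<exists>q. (\<forall>v\<in>V. q v \<in> diagonal) \<and> \<tau> - (\<Sum>v\<in>V. q v * dif v) \<in> ?J}"
  have \<Delta>: "is_ideal (diagonal :: 'r pretensor set)" by (rule is_ideal_diagonal)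
  have S: "is_ideal S"
  proof (rule is_idealI)
    show "0 \<in> S" unfolding S_def
      using ideal_zero[OF J] ideal_zero[OF \<Delta>] by (intro CollectI exI[of _ "\<lambda>_. 0"]) simp
  next
    fix a b assume "a \<in> S" "b \<in> S"
    then obtain q r where qr: "a - (\<Sum>v\<in>V. q v * dif v) \<in> ?J" "b - (\<Sum>v\<in>V. r v * dif v) \<in> ?J"
        "\<forall>v\<in>V. q v \<in> diagonal" "\<forall>v\<in>V. r v \<in> diagonal" unfolding S_def by blast
    from ideal_add[OF J qr(1,2)] qr(3,4) ideal_add[OF \<Delta>] show "a + b \<in> S"
      unfolding S_def by (intro CollectI exI[of _ "\<lambda>v. q v + r v"]) (simp add: algebra_simps sum.distrib)
  next
    fix s a assume "a \<in> S"
    then obtain q where q: "a - (\<Sum>v\<in>V. q v * dif v) \<in> ?J" "\<forall>v\<in>V. q v \<in> diagonal" unfolding S_def by blast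
    from ideal_mult_left[OF J q(1), of s] q(2) ideal_mult_left[OF \<Delta>] show "s * a \<in> S"
      unfolding S_def
      by (intro CollectI exI[of _ "\<lambda>v. s * q v"]) (simp add: right_diff_distrib sum_distrib_left mult.assoc)
  qed
  have JS: "?J \<subseteq> S"
    unfolding S_def using ideal_zero[OF \<Delta>] by (auto intro!: exI[of _ "\<lambda>_. 0"])
  have "diagonal ^ 2 \<subseteq> S"
  proof
    fix \<tau> :: "'r pretensor" assume "\<tau> \<in> diagonal ^ 2"
    then obtain a b where ab: "\<tau> = a * b" "a \<in> diagonal" "b \<in> diagonal"
      by (auto simp: power2_eq_square set_times_def)
    obtain q where "b - (\<Sum>v\<in>V. q v * dif v) \<in> ?J" using lin ab by blast
    from ideal_mult_left[OF J this, of a] show "\<tau> \<in> S"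
      unfolding S_def using ab ideal_mult_right[OF \<Delta>]
      by (intro CollectI exI[of _ "\<lambda>v. a * q v"]) (simp add: right_diff_distrib sum_distrib_left mult.assoc)
  qed
  then have "diagonal_power sc 2 \<subseteq> S"
    unfolding diagonal_power_def using JS Jg S by (intro hull_minimal) auto
  then have "coord_ideal sc x B 2 \<subseteq> S"
    unfolding coord_ideal_def using JS Jg(2) S by (intro hull_minimal) auto
  then have gen': "\<exists>q. (\<forall>v\<in>V. q v \<in> diagonal) \<and> pt g 1 * dif v - (\<Sum>v\<in>V. q v * dif v) \<in> ?J" if "v \<in> V" for v
    using gen[OF that] unfolding S_def by blast
  have dif_inj: "inj_on dif V"
    by (rule inj_onI) (rule dif_inject)
  have "\<exists>e l q. e - pt g 1 ^ l \<in> diagonal \<and> (\<forall>u\<in>dif ` V. q u \<in> diagonal) \<and>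
      e * t - (\<Sum>u\<in>dif ` V. q u * u) \<in> ?J" if t: "t \<in> dif ` V" for t
  proof -
    obtain v where v: "v \<in> V" "t = dif v" using t by blast
    obtain q where q: "\<forall>v\<in>V. q v \<in> diagonal" "pt g 1 * dif v - (\<Sum>v\<in>V. q v * dif v) \<in> ?J"
      using gen'[OF v(1)] by blast
    define r where "r u = q (the_inv_into V dif u)" for u
    have r: "r (dif v) = q v" if "v \<in> V" for v
      using the_inv_into_f_f[OF dif_inj that] by (simp add: r_def)
    have "(\<Sum>u\<in>dif ` V. r u * u) = (\<Sum>v\<in>V. q v * dif v)"
      unfolding sum.reindex[OF dif_inj] by (rule sum.cong) (simp_all add: r)
    then show ?thesis
      using q v r ideal_zero[OF \<Delta>] by (intro exI[of _ "pt g 1"] exI[of _ 1] exI[of _ r]) auto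
  qed
  \<comment> \<open>Elimination with \<open>Q = diagonal\<close> and \<open>w = pt g 1\<close>: that
    \<open>E\<close> is congruent to \<open>pt g 1 ^ l\<close> means
    \<open>mult_map E = g ^ l\<close>.\<close>
  then obtain E l where E: "E - pt g 1 ^ l \<in> diagonal" "\<forall>t\<in>dif ` V. E * t \<in> ?J"
    using nakayama_elimination[OF J \<Delta>, of "dif ` V" "pt g 1"] V(1) by blast
  have "is_ideal {t. E * t \<in> ?J}" by (rule is_ideal_vimage_mult[OF J])
  then have "is_ideal hull (tensor_relations sc \<union> dif ` V) \<subseteq> {t. E * t \<in> ?J}"
    using E(2) Jg(1) ideal_mult_left[OF J] by (intro hull_minimal) blast+
  then have "E * \<tau> \<in> ?J" if "\<tau> \<in> diagonal" for \<tau> using V(2) that by blast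
  moreover have "mult_map E = g ^ l"
    using E(1) by (simp add: diagonal_def mult_map_diff pt_power)
  ultimately show thesis using that by blast
qed

text \<open>\<open>R\<close> is embedded in a field carrying the partial derivatives;
  \<open>g\<close> is the denominator needed for the \<open>dif (x i)\<close> to generate the
  differentials, and \<open>E\<close> is the element supplied by
  \<open>separability_element\<close>.\<close>

locale generic_coordinates =
  fixes sc :: "'k::alg_closed_field \<Rightarrow> 'r::comm_ring_1 \<Rightarrow> 'r" and \<phi> :: "'r \<Rightarrow> 'f::field"
    and x :: "nat \<Rightarrow> 'r" and A :: "nat set" and D :: "nat \<Rightarrow> 'f \<Rightarrow> 'f" and g :: 'r and E :: "'r pretensor" and l :: nat
  assumes sc: "algebra_over sc" and \<phi>: "is_ring_hom \<phi>" and inj: "\<phi> r = 0 \<Longrightarrow> r = 0" and finite_A: "finite A"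
    and derivation: "i \<in> A \<Longrightarrow> is_derivation (D i)"
    and D_scalar: "i \<in> A \<Longrightarrow> D i (\<phi> (sc c 1)) = 0"
    and D_coordinate: "i \<in> A \<Longrightarrow> j \<in> A \<Longrightarrow> D i (\<phi> (x j)) = (if i = j then 1 else 0)"
    and g: "g \<noteq> 0" and E: "mult_map E = g ^ l" "\<tau> \<in> diagonal \<Longrightarrow> E * \<tau> \<in> differential_ideal sc x A"
begin

section \<open>Characteristic 0: iterated derivations\<close>

definition iterated :: "nat \<Rightarrow> nat \<Rightarrow> 'r \<Rightarrow> 'f" where
  "iterated j s r = (D j ^^ s) (\<phi> r)"

text \<open>The derivation acts on the field and need not preserve the image of \<open>R\<close>, so
  this is not a case of \<open>diff_op_comp\<close>; the argument is again the product rule for the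
  commutator.\<close>

lemma diff_op_derivation:
  assumes "j \<in> A" "diff_op sc \<phi> n \<nu>"
  shows "diff_op sc \<phi> (Suc n) (\<lambda>r. D j (\<nu> r))"
  using assms(2)
proof (induction n arbitrary: \<nu>)
  case 0
  then show ?case
    using diff_op_zero[OF sc \<phi>, of "Suc 0"] by (simp only: diff_op.simps(1) is_derivationD[OF derivation[OF assms(1)]])
next
  case (Suc n)
  note Dj = is_derivationD[OF derivation[OF assms(1)]]
  have lin: "scalar_linear sc \<phi> \<nu>" using Suc.prems by simp
  have "scalar_linear sc \<phi> (\<lambda>r. D j (\<nu> r))"
    by (simp add: scalar_linear_def scalar_linearD[OF sc \<phi> lin] Dj D_scalar[OF assms(1)])
  moreover have "diff_op sc \<phi> (Suc n) (commutator \<phi> (\<lambda>r. D j (\<nu> r)) c)" for c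
  proof -
    have "commutator \<phi> (\<lambda>r. D j (\<nu> r)) c = (\<lambda>r. D j (commutator \<phi> \<nu> c r) + D j (\<phi> c) * \<nu> r)"
      by (rule ext) (simp add: commutator_def Dj algebra_simps)
    moreover have "diff_op sc \<phi> (Suc n) (\<lambda>r. D j (commutator \<phi> \<nu> c r))"
      using Suc.prems by (intro Suc.IH) simp
    moreover have "diff_op sc \<phi> (Suc n) (\<lambda>r. D j (\<phi> c) * \<nu> r)"
      by (rule diff_op_scale[OF sc \<phi> Suc.prems])
    ultimately show ?thesis using diff_op_add[OF sc \<phi>] by (simp only:)
  qed
  ultimately show ?case by (simp only: diff_op.simps(2)) blast
qed

lemma diff_op_iterated: "j \<in> A \<Longrightarrow> diff_op sc \<phi> (Suc s) (iterated j s)"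
proof (induction s)
  case 0
  have "sc c r = sc c 1 * r" for c r by (rule algebra_scale[OF sc])
  then have "\<phi> (sc c r) = \<phi> (sc c 1) * \<phi> r" for c r by (metis is_ring_homD(3)[OF \<phi>])
  then have "scalar_linear sc \<phi> \<phi>" unfolding scalar_linear_def using is_ring_homD(2)[OF \<phi>] by blast
  then show ?case
    by (simp add: iterated_def commutator_def is_ring_homD[OF \<phi>] fun_eq_iff)
next
  case (Suc s)
  then have "diff_op sc \<phi> (Suc (Suc s)) (\<lambda>r. D j (iterated j s r))"
    by (intro diff_op_derivation) auto
  then show ?case by (simp only: iterated_def funpow.simps o_def)
qed

lemma iterated_mult_other:
  assumes "i \<in> A" "j \<in> A" "i \<noteq> j"
  shows "iterated j s (x i * r) = \<phi> (x i) * iterated j s r"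
  using assms
  by (induction s) (simp_all add: iterated_def is_ring_homD[OF \<phi>] is_derivationD[OF derivation] D_coordinate)

lemma iterated_mult_same:
  assumes "j \<in> A"
  shows "iterated j (Suc s) (x j * r) = \<phi> (x j) * iterated j (Suc s) r + of_nat (Suc s) * iterated j s r"
proof (induction s)
  case 0
  show ?case
    using assms by (simp add: iterated_def is_ring_homD[OF \<phi>] is_derivationD[OF derivation] D_coordinate)
next
  case (Suc s)
  have S: "iterated j (Suc n) r = D j (iterated j n r)" for n r by (simp add: iterated_def)
  have "iterated j (Suc (Suc s)) (x j * r) =
      D j (\<phi> (x j) * iterated j (Suc s) r + of_nat (Suc s) * iterated j s r)"
    by (simp only: S[of "Suc s"] Suc)
  also have "\<dots> = \<phi> (x j) * iterated j (Suc (Suc s)) r + of_nat (Suc (Suc s)) * iterated j (Suc s) r"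
    using assms by (simp only: S is_derivationD(1,2)[OF derivation[OF assms]]
        derivation_of_nat[OF derivation[OF assms]] D_coordinate) (simp add: algebra_simps)
  finally show ?case .
qed

text \<open>Each factor \<open>dif (x j)\<close> is a commutator with \<open>x j\<close> and
  replaces \<open>s\<close> by \<open>s - 1\<close> with a factor \<open>s\<close>. So iterated
  derivations are dual to the powers only up to factorials.\<close>

lemma iterated_dif_power:
  assumes j: "j \<in> A"
  shows "tensor_map \<phi> (iterated j s) (dif (x j) ^ m) = (if m = s then of_nat (fact s) else 0)"
proof (induction m arbitrary: s)
  case 0
  have "iterated j s 1 = (if s = 0 then 1 else 0)"
  proof (cases s)
    case (Suc n)
    have "(D j ^^ n) (D j 1) = 0"
      by (induction n) (simp_all add: is_derivationD[OF derivation[OF j]])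
    then show ?thesis by (simp add: Suc iterated_def is_ring_homD[OF \<phi>] funpow_Suc_right del: funpow.simps)
  qed (simp add: iterated_def is_ring_homD[OF \<phi>])
  then show ?case
    using tensor_map_pt[of \<phi> "iterated j s" 1 1] by (simp add: pt_one is_ring_homD[OF \<phi>])
next
  case (Suc m)
  have eq: "tensor_map \<phi> (iterated j s) (dif (x j) ^ Suc m) =
      tensor_map \<phi> (commutator \<phi> (iterated j s) (x j)) (dif (x j) ^ m)"
    by (simp add: tensor_map_dif[OF \<phi>])
  show ?case
  proof (cases s)
    case 0
    have "commutator \<phi> (iterated j 0) (x j) = (\<lambda>_. 0)"
      by (rule ext) (simp add: commutator_def iterated_def is_ring_homD[OF \<phi>])
    then show ?thesis unfolding eq unfolding 0 by (simp add: tensor_map_def del: power_Suc)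
  next
    case (Suc n)
    have "commutator \<phi> (iterated j (Suc n)) (x j) = (\<lambda>r. of_nat (Suc n) * iterated j n r)"
      by (rule ext) (simp only: commutator_def iterated_mult_same[OF j] add_diff_cancel_left')
    then show ?thesis
      unfolding eq unfolding Suc using Suc.IH[of n]
      by (simp only: tensor_map_linear(2)[OF sc \<phi>]) (simp add: distrib_right)
  qed
qed

text \<open>Being of order at most \<open>N\<close> and commuting with the other parameters,
  \<open>iterated j s\<close> annihilates the whole ideal; on the sum it extracts \<open>s!\<close>
  times the coefficient.\<close>

lemma power_coefficients_zero_char_0:
  assumes "CHAR('f) = 0" and j: "j \<in> A"
    and rel: "(\<Sum>n\<le>N. pt (c n) 1 * dif (x j) ^ n) \<in> coord_ideal sc x (A - {j}) (Suc N)"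
    and "s \<le> N"
  shows "c s = 0"
proof -
  let ?K = "{t. \<forall>f. tensor_map \<phi> (iterated j s) (t * f) = 0}"
  have "diff_op sc \<phi> (Suc N) (iterated j s)"
    using diff_op_mono[OF sc \<phi> diff_op_iterated[OF j, of s], of "Suc N"] assms(4) by simp
  then have "tensor_map \<phi> (iterated j s) f = 0" if "f \<in> diagonal_power sc (Suc N)" for f
    using that unfolding diff_op_iff_vanishing[OF sc \<phi>] by blast
  then have "diagonal_power sc (Suc N) \<subseteq> ?K"
    using ideal_mult_right[OF is_ideal_diag_power, of _ sc "Suc N"] by blast
  moreover have "dif (x i) \<in> ?K" if "i \<in> A - {j}" for i
  proof -
    have "commutator \<phi> (iterated j s) (x i) = (\<lambda>_. 0)"
      by (rule ext) (use that j in \<open>simp add: commutator_def iterated_mult_other\<close>)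
    then have "tensor_map \<phi> (iterated j s) (dif (x i) * f) = 0" for f
      by (simp only: tensor_map_dif[OF \<phi>]) (simp add: tensor_map_def)
    then show ?thesis by blast
  qed
  ultimately have "coord_ideal sc x (A - {j}) (Suc N) \<subseteq> ?K"
    unfolding coord_ideal_def by (intro hull_minimal is_ideal_functional_kernel) auto
  then have "tensor_map \<phi> (iterated j s) ((\<Sum>n\<le>N. pt (c n) 1 * dif (x j) ^ n) * 1) = 0"
    using rel by blast
  then have "(\<Sum>n\<le>N. \<phi> (c n) * (if n = s then of_nat (fact s) else 0)) = 0"
    by (simp add: tensor_map_sum tensor_map_left[OF \<phi>] iterated_dif_power[OF j])
  then have "\<phi> (c s) * of_nat (fact s) = 0"
    using assms(4) by (simp add: if_distrib[of "\<lambda>z. _ * z"] sum.delta cong: if_cong)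
  moreover have "of_nat (fact s) \<noteq> (0 :: 'f)"
    using assms(1) by (simp only: of_nat_eq_0_iff_char_dvd) simp
  ultimately show ?thesis using inj by simp
qed

section \<open>Characteristic p: functionals linear over a subfield of powers\<close>

lemma is_subfield_powers:
  assumes "prime CHAR('f)"
  shows "is_subfield (range (\<lambda>c::'f. c ^ (CHAR('f) ^ q)))"
  unfolding is_subfield_def
proof (intro conjI ballI)
  let ?n = "CHAR('f) ^ q"
  have "(1::'f) = 1 ^ ?n" by simp
  then show "1 \<in> range (\<lambda>c::'f. c ^ ?n)" by blast
  fix a b assume "a \<in> range (\<lambda>c::'f. c ^ ?n)" "b \<in> range (\<lambda>c::'f. c ^ ?n)"
  then obtain c e where ce: "a = c ^ ?n" "b = e ^ ?n" by blast
  have "(c - e) ^ ?n + e ^ ?n = c ^ ?n"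
    using freshmans_dream'[OF assms refl, of "c - e" e q] by simp
  then have "a - b = (c - e) ^ ?n" using ce by (simp add: algebra_simps)
  then show "a - b \<in> range (\<lambda>c::'f. c ^ ?n)" by blast
  show "a * b \<in> range (\<lambda>c::'f. c ^ ?n)" using ce by (simp flip: power_mult_distrib)
next
  fix a assume "a \<in> range (\<lambda>c::'f. c ^ (CHAR('f) ^ q))"
  then show "inverse a \<in> range (\<lambda>c::'f. c ^ (CHAR('f) ^ q))" by (auto simp flip: power_inverse)
qed

text \<open>
  In characteristic \<open>p\<close> the derivations are replaced by a functional linear over the field of
  \<open>n = p ^ q\<close>-th powers, dual to the monomial in which all exponents are \<open>n - 1\<close>.
\<close>

lemma dual_functional:
  assumes p: "prime CHAR('f)" and n: "n = CHAR('f) ^ q"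
  obtains \<mu> where "scalar_linear sc \<phi> \<mu>" "\<And>c. commutator \<phi> \<mu> (c ^ n) = (\<lambda>_. 0)"
    "tensor_map \<phi> \<mu> (\<Prod>i\<in>A. dif (x i) ^ (n - 1)) = 1"
proof -
  let ?L = "range (\<lambda>c::'f. c ^ n)"
  have L: "is_subfield ?L" unfolding n by (rule is_subfield_powers[OF p])
  have n0: "n > 0" using p by (simp add: n prime_gt_0_nat)
  let ?P = "PiE A (\<lambda>_. {..<n})"
  have fin: "finite ?P" by (intro finite_PiE finite_A) auto
  define mon where "mon I = (\<Prod>i\<in>A. \<phi> (x i) ^ I i)" for I :: "nat \<Rightarrow> nat"
  define M where "M = (\<lambda>i\<in>A. n - 1)"
  have M: "M \<in> ?P" using n0 by (auto simp: M_def)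
  let ?W = "{\<Sum>I\<in>?P - {M}. l I * mon I | l. \<forall>I. l I \<in> ?L}"
  have notin: "mon M \<notin> ?W"
  proof
    assume "mon M \<in> ?W"
    then obtain l where l: "mon M = (\<Sum>I\<in>?P - {M}. l I * mon I)" "\<forall>I. l I \<in> ?L" by blast
    have "\<forall>I. \<exists>c. l I = c ^ n" using l(2) by (auto simp: image_iff)
    then obtain c where c: "\<And>I. l I = c I ^ n" using choice[of "\<lambda>I c. l I = c ^ n"] by auto
    \<comment> \<open>The independence lemma expects every coefficient as an n-th power; -1 is one
      because \<open>?L\<close> is a field.\<close>
    have "- 1 \<in> ?L" using is_subfieldD(7)[OF L is_subfieldD(1)[OF L]] .
    then obtain e :: 'f where e: "- 1 = e ^ n" by (auto simp: image_iff)
    define c' where "c' = c(M := e)"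
    have "(\<Sum>I\<in>?P. c' I ^ n * mon I) = e ^ n * mon M + (\<Sum>I\<in>?P - {M}. c' I ^ n * mon I)"
      using sum.remove[OF fin M, of "\<lambda>I. c' I ^ n * mon I"] by (simp add: c'_def)
    also have "(\<Sum>I\<in>?P - {M}. c' I ^ n * mon I) = mon M"
      unfolding l(1) by (rule sum.cong) (auto simp: c'_def c)
    finally have sum0: "(\<Sum>I\<in>?P. c' I ^ n * mon I) = 0" using e[symmetric] by simp
    have "c' M = 0"
    proof (rule monomials_independent_over_powers[OF p finite_A,
          where D = D and X = "\<lambda>i. \<phi> (x i)" and q = q and c = c' and I = M])
      show "M \<in> PiE A (\<lambda>_. {..<CHAR('f) ^ q})" using M unfolding n .
      show "(\<Sum>I\<in>PiE A (\<lambda>_. {..<CHAR('f) ^ q}). c' I ^ CHAR('f) ^ q * (\<Prod>i\<in>A. \<phi> (x i) ^ I i)) = 0"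
        using sum0 unfolding n mon_def .
    qed (simp_all add: derivation D_coordinate)
    then show False using e n0 by (simp add: c'_def zero_power)
  qed
  obtain \<nu> where \<nu>: "\<And>v w. \<nu> (v + w) = \<nu> v + \<nu> w"
      "\<And>l w. l \<in> ?L \<Longrightarrow> \<nu> (l * w) = l * \<nu> w" "\<And>w. \<nu> w \<in> ?L" "\<nu> (mon M) = 1" "\<And>w. w \<in> ?W \<Longrightarrow> \<nu> w = 0"
    by (rule separating_functional[OF L subspace_span[OF L, where A = "?P - {M}" and a = mon] notin]) (rule that)
  have \<nu>_mon: "\<nu> (mon I) = (if I = M then 1 else 0)" if "I \<in> ?P" for I
  proof (cases "I = M")
    case False
    then have "mon I \<in> ?W" using span_member[OF L, of "?P - {M}" I mon] fin that by blast
    then show ?thesis using \<nu>(5) False by simp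
  qed (simp add: \<nu>(4))
  define \<mu> where "\<mu> r = \<nu> (\<phi> r)" for r
  show thesis
  proof (rule that)
    have scalar: "\<phi> (sc c 1) \<in> ?L" for c
    proof -
      \<comment> \<open>Scalars are n-th powers because their field is algebraically closed; this
        makes \<open>\<mu>\<close> linear over it.\<close>
      obtain b where b: "b ^ n = c" using nth_root_exists[OF n0] by blast
      have "sc b 1 ^ m = sc (b ^ m) 1" for m
        by (induction m) (simp_all add: algebra_scale_hom(1,3,7)[OF sc])
      then have "sc c 1 = sc b 1 ^ n" using b by simp
      then show ?thesis by (simp add: is_ring_homD[OF \<phi>])
    qed
    have "sc c r = sc c 1 * r" for c r by (rule algebra_scale[OF sc])
    then have scale: "\<phi> (sc c r) = \<phi> (sc c 1) * \<phi> r" for c r by (metis is_ring_homD(3)[OF \<phi>])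
    have "\<mu> (sc c r) = \<phi> (sc c 1) * \<mu> r" for c r
      unfolding \<mu>_def by (simp only: scale[of c r] \<nu>(2)[OF scalar])
    then show "scalar_linear sc \<phi> \<mu>"
      unfolding scalar_linear_def by (simp only: \<mu>_def is_ring_homD(2)[OF \<phi>] \<nu>(1)) simp
    show "commutator \<phi> \<mu> (c ^ n) = (\<lambda>_. 0)" for c
      by (rule ext) (simp add: commutator_def \<mu>_def is_ring_homD[OF \<phi>] \<nu>(2))
    \<comment> \<open>Signed binomial coefficients of \<open>dif (x i) ^ (n - 1)\<close>. On the
      right factors \<open>\<nu>\<close> sees only the monomial \<open>M\<close>, whose coefficient
      and left factor are 1.\<close>
    define z where "z k = of_nat ((n - 1) choose k) * (- 1 :: int) ^ (n - 1 - k)" for k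
    have "dif (x i) ^ (n - 1) = (\<Sum>k\<in>{..<n}. of_int (z k) * pt (x i ^ (n - 1 - k)) (x i ^ k))" for i
    proof -
      have "{..n - 1} = {..<n}" using n0 by auto
      then have "dif (x i) ^ (n - 1) =
          (\<Sum>k\<in>{..<n}. of_nat ((n - 1) choose k) * pt 1 (x i) ^ k * (- pt (x i) 1) ^ (n - 1 - k))"
        using binomial_ring[of "pt 1 (x i)" "- pt (x i) 1" "n - 1"] by (simp add: dif_def)
      also have "\<dots> = (\<Sum>k\<in>{..<n}. of_int (z k) * pt (x i ^ (n - 1 - k)) (x i ^ k))"
      proof (rule sum.cong[OF refl])
        fix k
        have "(- pt (x i) 1) ^ (n - 1 - k) = (- 1) ^ (n - 1 - k) * pt (x i ^ (n - 1 - k)) 1"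
          by (subst power_minus) (simp add: pt_power)
        then show "of_nat ((n - 1) choose k) * pt 1 (x i) ^ k * (- pt (x i) 1) ^ (n - 1 - k) =
            of_int (z k) * pt (x i ^ (n - 1 - k)) (x i ^ k)"
          unfolding pt_split[of "x i ^ (n - 1 - k)" "x i ^ k"] by (simp add: z_def pt_power mult_ac)
      qed
      finally show ?thesis .
    qed
    then have "(\<Prod>i\<in>A. dif (x i) ^ (n - 1)) =
        (\<Sum>I\<in>?P. \<Prod>i\<in>A. of_int (z (I i)) * pt (x i ^ (n - 1 - I i)) (x i ^ I i))"
      using prod_sum_PiE[OF finite_A, of "\<lambda>_. {..<n}"] by simp
    also have "\<dots> = (\<Sum>I\<in>?P. of_int (\<Prod>i\<in>A. z (I i)) * pt (\<Prod>i\<in>A. x i ^ (n - 1 - I i)) (\<Prod>i\<in>A. x i ^ I i))"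
      by (simp add: prod.distrib pt_prod of_int_prod)
    finally have prod: "(\<Prod>i\<in>A. dif (x i) ^ (n - 1)) = \<dots>" .
    have "tensor_map \<phi> \<mu> (\<Prod>i\<in>A. dif (x i) ^ (n - 1)) =
        (\<Sum>I\<in>?P. of_int (\<Prod>i\<in>A. z (I i)) * (\<phi> (\<Prod>i\<in>A. x i ^ (n - 1 - I i)) * \<nu> (mon I)))"
      unfolding prod tensor_map_sum tensor_map_of_int tensor_map_pt
      by (simp add: \<mu>_def mon_def is_ring_homD[OF \<phi>])
    also have "\<dots> = (\<Sum>I\<in>?P. if I = M then of_int (\<Prod>i\<in>A. z (M i)) * \<phi> (\<Prod>i\<in>A. x i ^ (n - 1 - M i)) else 0)"
      by (rule sum.cong) (auto simp: \<nu>_mon)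
    also have "\<dots> = of_int (\<Prod>i\<in>A. z (M i)) * \<phi> (\<Prod>i\<in>A. x i ^ (n - 1 - M i))"
      using fin M by simp
    also have "(\<Prod>i\<in>A. z (M i)) = 1" by (rule prod.neutral) (simp add: z_def M_def)
    also have "(\<Prod>i\<in>A. x i ^ (n - 1 - M i)) = 1" by (rule prod.neutral) (simp add: M_def)
    finally show "tensor_map \<phi> \<mu> (\<Prod>i\<in>A. dif (x i) ^ (n - 1)) = 1"
      by (simp add: is_ring_homD[OF \<phi>])
  qed
qed

text \<open>\<open>K\<close> is the largest ideal annihilated by the dual functional, and modulo
  \<open>K\<close> all n-th powers from the diagonal vanish. Hence \<open>E ^ n\<close> acts as
  \<open>pt G 1\<close>, and \<open>G\<close> moves the diagonal into the ideal of the coordinate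
  differentials. Up to powers of \<open>G\<close>, the elements of order \<open>N + 1\<close>
  therefore contribute only multiples of \<open>dif (x j) ^ (N + 1)\<close>. Multiplication by the
  complementary monomial \<open>W\<close> isolates \<open>c s\<close> in front of the top monomial,
  where the functional has value 1.\<close>

lemma power_coefficients_zero_char_p:
  assumes p: "CHAR('f) > 0" and j: "j \<in> A"
    and rel: "(\<Sum>n\<le>N. pt (c n) 1 * dif (x j) ^ n) \<in> coord_ideal sc x (A - {j}) (Suc N)"
    and "s \<le> N"
  shows "c s = 0"
proof -
  have prime: "prime CHAR('f)" using prime_CHAR_semidom[OF p] .
  \<comment> \<open>A power of p beyond \<open>N\<close>; it leaves room for the complementary
    exponents \<open>n - 1 - s\<close>.\<close>
  define n where "n = CHAR('f) ^ N"
  have n: "N < n"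
  proof -
    have "N < 2 ^ N" by (rule less_exp)
    also have "\<dots> \<le> n" unfolding n_def by (intro power_mono) (use prime prime_ge_2_nat in auto)
    finally show ?thesis .
  qed
  obtain \<mu> where \<mu>: "scalar_linear sc \<phi> \<mu>" "\<And>c. commutator \<phi> \<mu> (c ^ n) = (\<lambda>_. 0)"
      "tensor_map \<phi> \<mu> (\<Prod>i\<in>A. dif (x i) ^ (n - 1)) = 1"
    using dual_functional[OF prime n_def] by blast
  define K where "K = {t. \<forall>f. tensor_map \<phi> \<mu> (t * f) = 0}"
  have K: "is_ideal K" unfolding K_def by (rule is_ideal_functional_kernel)
  have rel_K: "tensor_relations sc \<subseteq> K"
    unfolding K_def using tensor_map_relations[OF sc \<phi> \<mu>(1)] by blast
  have p_K: "of_nat CHAR('f) \<in> K"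
    unfolding K_def using tensor_map_of_int[of \<phi> \<mu> "int CHAR('f)"] by simp
  note dream = freshmans_dream_mod_ideal[OF K prime p_K, of _ _ N, folded n_def]
  \<comment> \<open>\<open>c ^ n\<close> is a constant for \<open>\<mu>\<close>, so
    \<open>dif (c ^ n)\<close> is in \<open>K\<close>; modulo \<open>K\<close> it is the n-th power
    of \<open>dif c\<close>.\<close>
  have dif_pow: "dif c ^ n \<in> K" for c
  proof -
    have "tensor_map \<phi> \<mu> (dif (c ^ n) * f) = 0" for f
      by (simp only: tensor_map_dif[OF \<phi>] \<mu>(2)) (simp add: tensor_map_def)
    then have "dif (c ^ n) \<in> K" by (simp add: K_def)
    moreover have "dif (c ^ n) - dif c ^ n \<in> K"
      using dream[of "dif c" "pt c 1"] by (simp add: dif_def pt_power diff_diff_eq add.commute)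
    ultimately show ?thesis using ideal_diff[OF K, of "dif (c ^ n)" "dif (c ^ n) - dif c ^ n"] by simp
  qed
  have diag_pow: "\<tau> ^ n \<in> K" if "\<tau> \<in> diagonal" for \<tau>
  proof -
    have "is_ideal {\<tau>. \<tau> ^ n \<in> K}"
    proof (rule is_idealI)
      show "0 \<in> {\<tau>. \<tau> ^ n \<in> K}" using n ideal_zero[OF K] by (simp add: power_0_left)
      fix a b assume "a \<in> {\<tau>. \<tau> ^ n \<in> K}" "b \<in> {\<tau>. \<tau> ^ n \<in> K}"
      then have "(a + b) ^ n - (a ^ n + b ^ n) + (a ^ n + b ^ n) \<in> K"
        using ideal_add[OF K] dream[of a b] by blast
      then show "a + b \<in> {\<tau>. \<tau> ^ n \<in> K}" by simp
    qed (simp add: power_mult_distrib ideal_mult_left[OF K])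
    moreover have "tensor_relations sc \<subseteq> {\<tau>. \<tau> ^ n \<in> K}"
    proof
      fix t assume "t \<in> tensor_relations sc"
      then have "t * t ^ (n - 1) \<in> K" using rel_K ideal_mult_right[OF K] by blast
      then show "t \<in> {\<tau>. \<tau> ^ n \<in> K}" using n by (simp flip: power_Suc)
    qed
    moreover have "dif c \<in> {\<tau>. \<tau> ^ n \<in> K}" for c using dif_pow by simp
    ultimately have "diagonal \<subseteq> {\<tau>. \<tau> ^ n \<in> K}" by (rule diagonal_subset_if_dif)
    then show ?thesis using that by blast
  qed
  \<comment> \<open>The class of \<open>E ^ n\<close> modulo \<open>K\<close>: \<open>E\<close>
    differs from \<open>pt (g ^ l) 1\<close> by an element of the diagonal, whose n-th power
    vanishes.\<close>
  define G where "G = (g ^ l) ^ n"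
  have EG: "pt G 1 - E ^ n \<in> K"
  proof -
    have "E - pt (g ^ l) 1 \<in> diagonal" by (simp add: diagonal_def mult_map_diff E(1))
    then have "(E - pt (g ^ l) 1) ^ n \<in> K" by (rule diag_pow)
    moreover have "E ^ n - ((E - pt (g ^ l) 1) ^ n + pt G 1) \<in> K"
      using dream[of "E - pt (g ^ l) 1" "pt (g ^ l) 1"] by (simp add: pt_power G_def)
    ultimately have "E ^ n - ((E - pt (g ^ l) 1) ^ n + pt G 1) + (E - pt (g ^ l) 1) ^ n \<in> K"
      by (intro ideal_add[OF K])
    from ideal_uminus[OF K this] show ?thesis by simp
  qed
  let ?Z = "dif (x j)"
  \<comment> \<open>\<open>\<Gamma>\<close> adds the other coordinate differentials, so that modulo
    it only \<open>?Z\<close> is left to generate.\<close>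
  define \<Gamma> where "\<Gamma> = is_ideal hull (K \<union> (\<lambda>i. dif (x i)) ` (A - {j}))"
  have \<Gamma>: "is_ideal \<Gamma>" unfolding \<Gamma>_def by (rule is_ideal_hull)
  have \<Gamma>_gen: "K \<subseteq> \<Gamma>" "\<And>i. i \<in> A - {j} \<Longrightarrow> dif (x i) \<in> \<Gamma>"
    unfolding \<Gamma>_def by (auto intro: hull_inc)
  have diag1: "\<exists>r. pt G 1 * \<tau> - ?Z * r \<in> \<Gamma>" if "\<tau> \<in> diagonal" for \<tau>
  proof -
    let ?S = "{t. \<exists>r. t - ?Z * r \<in> \<Gamma>}"
    have S: "is_ideal ?S"
    proof (rule is_idealI)
      show "0 \<in> ?S" using ideal_zero[OF \<Gamma>] by (intro CollectI exI[of _ 0]) simp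
    next
      fix a b assume "a \<in> ?S" "b \<in> ?S"
      then obtain q r where "a - ?Z * q \<in> \<Gamma>" "b - ?Z * r \<in> \<Gamma>" by blast
      from ideal_add[OF \<Gamma> this] show "a + b \<in> ?S"
        by (intro CollectI exI[of _ "q + r"]) (simp add: algebra_simps)
    next
      fix s a assume "a \<in> ?S"
      then obtain q where "a - ?Z * q \<in> \<Gamma>" by blast
      from ideal_mult_left[OF \<Gamma> this, of s] show "s * a \<in> ?S"
        by (intro CollectI exI[of _ "s * q"]) (simp add: algebra_simps)
    qed
    have \<Gamma>S: "\<Gamma> \<subseteq> ?S" by (auto intro!: exI[of _ 0])
    have "differential_ideal sc x A \<subseteq> ?S"
      unfolding differential_ideal_def
    proof (rule hull_minimal[of _ ?S is_ideal, rotated, OF S])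
      have "?Z \<in> ?S" using ideal_zero[OF \<Gamma>] by (intro CollectI exI[of _ 1]) simp
      then show "tensor_relations sc \<union> (\<lambda>i. dif (x i)) ` A \<subseteq> ?S"
        using rel_K \<Gamma>_gen \<Gamma>S by blast
    qed
    then have "E * \<tau> \<in> ?S" using E(2)[OF that] by blast
    then have "E ^ (n - 1) * (E * \<tau>) \<in> ?S" by (rule ideal_mult_left[OF S])
    moreover have "E ^ (n - 1) * (E * \<tau>) = E ^ n * \<tau>"
      using n by (simp add: power_eq_if[of E n] mult_ac)
    moreover have "(pt G 1 - E ^ n) * \<tau> \<in> ?S"
      using ideal_mult_right[OF K EG] \<Gamma>_gen(1) \<Gamma>S by blast
    ultimately have "(pt G 1 - E ^ n) * \<tau> + E ^ n * \<tau> \<in> ?S" using ideal_add[OF S] by simp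
    then show ?thesis by (simp add: algebra_simps)
  qed
  have diag_m: "\<exists>r. pt (G ^ m) 1 * \<tau> - ?Z ^ m * r \<in> \<Gamma>" if "\<tau> \<in> diagonal ^ m" for m \<tau>
    using that
  proof (induction m arbitrary: \<tau>)
    case 0
    then show ?case using ideal_zero[OF \<Gamma>] by (intro exI[of _ 1]) (simp add: pt_one)
  next
    case (Suc m)
    then obtain a b where ab: "\<tau> = a * b" "a \<in> diagonal" "b \<in> diagonal ^ m" by (auto simp: set_times_def)
    obtain r q where rq: "pt G 1 * a - ?Z * r \<in> \<Gamma>" "pt (G ^ m) 1 * b - ?Z ^ m * q \<in> \<Gamma>"
      using diag1[OF ab(2)] Suc.IH[OF ab(3)] by blast
    have "pt (G ^ Suc m) 1 * \<tau> - ?Z ^ Suc m * (r * q) =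
        (pt (G ^ m) 1 * b) * (pt G 1 * a - ?Z * r) + ?Z * r * (pt (G ^ m) 1 * b - ?Z ^ m * q)"
    proof -
      have "pt (G ^ Suc m) 1 = pt G 1 * pt (G ^ m) (1::'r)" by (simp add: pt_mult)
      then show ?thesis by (simp add: ab(1) algebra_simps)
    qed
    then have "pt (G ^ Suc m) 1 * \<tau> - ?Z ^ Suc m * (r * q) \<in> \<Gamma>"
      using rq ideal_add[OF \<Gamma>] ideal_mult_left[OF \<Gamma>] by simp
    then show ?case by blast
  qed
  have "c s = 0" if "s \<le> N" for s
    using that
  proof (induction s rule: less_induct)
    case (less s)
    \<comment> \<open>\<open>W\<close> kills \<open>\<Gamma>\<close>, as each other differential
      reaches exponent \<open>n\<close>, and kills \<open>?Z ^ m\<close> for \<open>m > s\<close>;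
      the coefficients before \<open>s\<close> vanish by induction.\<close>
    define R where "R = (\<Prod>i\<in>A - {j}. dif (x i) ^ (n - 1))"
    define W where "W = ?Z ^ (n - 1 - s) * R"
    have WZ: "W * ?Z ^ m \<in> K" if "m > s" for m
    proof -
      have "n - 1 - s + m = n + (m - s - 1)" using that less.prems n by simp
      then have "?Z ^ (n - 1 - s) * ?Z ^ m = ?Z ^ n * ?Z ^ (m - s - 1)"
        by (simp only: power_add[symmetric])
      moreover have "W * ?Z ^ m = (?Z ^ (n - 1 - s) * ?Z ^ m) * R"
        unfolding W_def by (simp only: mult_ac)
      ultimately have "W * ?Z ^ m = ?Z ^ n * (?Z ^ (m - s - 1) * R)"
        by (simp only: mult.assoc)
      then show ?thesis using ideal_mult_right[OF K dif_pow] by simp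
    qed
    have W\<Gamma>: "W * t \<in> K" if "t \<in> \<Gamma>" for t
    proof -
      have "is_ideal {t. W * t \<in> K}" by (rule is_ideal_vimage_mult[OF K])
      moreover have "W * dif (x i) \<in> K" if i: "i \<in> A - {j}" for i
      proof -
        have "R = dif (x i) ^ (n - 1) * (\<Prod>k\<in>A - {j} - {i}. dif (x k) ^ (n - 1))"
          unfolding R_def using finite_A i by (intro prod.remove) auto
        then have "W * dif (x i) = dif (x i) ^ n * (?Z ^ (n - 1 - s) * (\<Prod>k\<in>A - {j} - {i}. dif (x k) ^ (n - 1)))"
          unfolding W_def using n by (simp add: power_eq_if[of _ n] mult_ac)
        then show ?thesis using ideal_mult_right[OF K dif_pow] by simp
      qed
      ultimately have "\<Gamma> \<subseteq> {t. W * t \<in> K}"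
        unfolding \<Gamma>_def using ideal_mult_left[OF K] by (intro hull_minimal) auto
      then show ?thesis using that by blast
    qed
    define U where "U = pt (G ^ Suc N) 1 * W"
    have UI: "is_ideal {t. U * t \<in> K}" by (rule is_ideal_vimage_mult[OF K])
    have KU: "K \<subseteq> {t. U * t \<in> K}" using ideal_mult_left[OF K] by blast
    have \<Gamma>U: "\<Gamma> \<subseteq> {t. U * t \<in> K}"
      using W\<Gamma> ideal_mult_left[OF K] by (auto simp: U_def mult.assoc)
    have "diagonal ^ Suc N \<subseteq> {t. U * t \<in> K}"
    proof
      fix \<tau> :: "'r pretensor" assume "\<tau> \<in> diagonal ^ Suc N"
      then obtain r where r: "pt (G ^ Suc N) 1 * \<tau> - ?Z ^ Suc N * r \<in> \<Gamma>" using diag_m by blast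
      have "W * ?Z ^ Suc N * r \<in> K"
        using less.prems by (intro ideal_mult_right[OF K] WZ) simp
      then have "W * (pt (G ^ Suc N) 1 * \<tau> - ?Z ^ Suc N * r) + W * ?Z ^ Suc N * r \<in> K"
        using W\<Gamma>[OF r] ideal_add[OF K] by blast
      moreover have "W * (pt (G ^ Suc N) 1 * \<tau> - ?Z ^ Suc N * r) + W * ?Z ^ Suc N * r = U * \<tau>"
        unfolding U_def right_diff_distrib by (simp add: mult_ac)
      ultimately show "\<tau> \<in> {t. U * t \<in> K}" by simp
    qed
    then have "diagonal_power sc (Suc N) \<subseteq> {t. U * t \<in> K}"
      unfolding diagonal_power_def using KU rel_K UI by (intro hull_minimal) auto
    then have "coord_ideal sc x (A - {j}) (Suc N) \<subseteq> {t. U * t \<in> K}"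
      unfolding coord_ideal_def using \<Gamma>U \<Gamma>_gen(2) UI by (intro hull_minimal) auto
    then have "U * (\<Sum>n\<le>N. pt (c n) 1 * ?Z ^ n) \<in> K" using rel by blast
    then have total: "(\<Sum>n\<le>N. U * (pt (c n) 1 * ?Z ^ n)) \<in> K" by (simp only: sum_distrib_left)
    have others: "U * (pt (c m) 1 * ?Z ^ m) \<in> K" if "m \<le> N" "m \<noteq> s" for m
    proof (cases "m < s")
      case True
      then have "pt (c m) 1 \<in> K" using less pt_zero_left_cong[OF K rel_K, of 1] by simp
      then show ?thesis using ideal_mult_left[OF K] ideal_mult_right[OF K] by blast
    next
      case False
      then have "pt (G ^ Suc N) 1 * pt (c m) 1 * (W * ?Z ^ m) \<in> K"
        using that by (intro ideal_mult_left[OF K] WZ) simp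
      then show ?thesis by (simp only: U_def mult_ac)
    qed
    have "(\<Sum>n\<le>N. U * (pt (c n) 1 * ?Z ^ n)) =
        U * (pt (c s) 1 * ?Z ^ s) + (\<Sum>n\<in>{..N} - {s}. U * (pt (c n) 1 * ?Z ^ n))"
      using less.prems by (intro sum.remove) auto
    moreover have "(\<Sum>n\<in>{..N} - {s}. U * (pt (c n) 1 * ?Z ^ n)) \<in> K"
      by (rule ideal_sum[OF K]) (use others in auto)
    ultimately have "U * (pt (c s) 1 * ?Z ^ s) \<in> K"
      using total ideal_add_cancel[OF K, of "\<Sum>n\<in>{..N} - {s}. U * (pt (c n) 1 * ?Z ^ n)"]
      by (simp only: add.commute)
    moreover have "U * (pt (c s) 1 * ?Z ^ s) = pt (G ^ Suc N * c s) 1 * (\<Prod>i\<in>A. dif (x i) ^ (n - 1))"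
    proof -
      have "(\<Prod>i\<in>A. dif (x i) ^ (n - 1)) = ?Z ^ (n - 1) * R"
        unfolding R_def using finite_A j by (intro prod.remove) auto
      moreover have "?Z ^ (n - 1) = ?Z ^ (n - 1 - s) * ?Z ^ s"
        using less.prems n by (simp flip: power_add)
      moreover have "pt (G ^ Suc N * c s) 1 = pt (G ^ Suc N) 1 * pt (c s) (1::'r)" by (simp add: pt_mult)
      ultimately show ?thesis unfolding U_def W_def by (simp only: mult_ac)
    qed
    ultimately have "tensor_map \<phi> \<mu> (pt (G ^ Suc N * c s) 1 * (\<Prod>i\<in>A. dif (x i) ^ (n - 1)) * 1) = 0"
      unfolding K_def by (metis (mono_tags, lifting) mem_Collect_eq)
    then have "\<phi> (G ^ Suc N * c s) = 0"
      by (simp only: mult_1_right tensor_map_left[OF \<phi>] \<mu>(3))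
    then have "\<phi> g ^ (l * n * Suc N) * \<phi> (c s) = 0"
      by (simp only: G_def is_ring_homD[OF \<phi>] power_mult)
    moreover have "\<phi> g \<noteq> 0" using inj g by blast
    ultimately show ?case using inj by simp
  qed
  then show ?thesis using assms(4) by blast
qed

theorem power_coefficients_zero:
  assumes "j \<in> A" "(\<Sum>n\<le>N. pt (c n) 1 * dif (x j) ^ n) \<in> coord_ideal sc x (A - {j}) (Suc N)" "s \<le> N"
  shows "c s = 0"
  using power_coefficients_zero_char_0[OF _ assms] power_coefficients_zero_char_p[OF _ assms] by blast

end


section \<open>Expansion in powers of a coordinate differential\<close>

lemma is_ideal_hull_Un:
  assumes "is_ideal I" "z \<in> is_ideal hull (I \<union> X)"
  obtains a b where "a \<in> I" "b \<in> is_ideal hull X" "z = a + b"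
proof -
  let ?S = "{a + b | a b. a \<in> I \<and> b \<in> is_ideal hull X}"
  note X = is_ideal_hull[of X]
  have "is_ideal ?S"
  proof (rule is_idealI)
    show "0 \<in> ?S" using ideal_zero[OF assms(1)] ideal_zero[OF X] by (auto intro!: exI[of _ 0])
  next
    fix u v assume "u \<in> ?S" "v \<in> ?S"
    then obtain a b c e where "u = a + b" "v = c + e" "a \<in> I" "c \<in> I" "b \<in> is_ideal hull X" "e \<in> is_ideal hull X"
      by blast
    then have "u + v = (a + c) + (b + e)" "a + c \<in> I" "b + e \<in> is_ideal hull X"
      using ideal_add[OF assms(1)] ideal_add[OF X] by (simp_all add: algebra_simps)
    then show "u + v \<in> ?S" by blast
  next
    fix s u assume "u \<in> ?S"
    then obtain a b where "u = a + b" "a \<in> I" "b \<in> is_ideal hull X" by blast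
    then have "s * u = s * a + s * b" "s * a \<in> I" "s * b \<in> is_ideal hull X"
      using ideal_mult_left[OF assms(1)] ideal_mult_left[OF X] by (simp_all add: algebra_simps)
    then show "s * u \<in> ?S" by blast
  qed
  moreover have "I \<union> X \<subseteq> ?S"
  proof
    fix u assume "u \<in> I \<union> X"
    then show "u \<in> ?S"
    proof
      assume "u \<in> I"
      then have "u = u + 0" "u \<in> I" "0 \<in> is_ideal hull X" using ideal_zero[OF X] by simp_all
      then show ?thesis by blast
    next
      assume "u \<in> X"
      then have "u = 0 + u" "0 \<in> I" "u \<in> is_ideal hull X" using ideal_zero[OF assms(1)] hull_inc[of u X] by simp_all
      then show ?thesis by blast
    qed
  qed
  ultimately have "is_ideal hull (I \<union> X) \<subseteq> ?S" by (intro hull_minimal)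
  then show thesis using assms(2) that by blast
qed

lemma diagonal_power_Suc_0: "algebra_over sc \<Longrightarrow> diagonal_power sc (Suc 0) = diagonal"
  using diagonal_power_1 by simp

lemma coord_ideal_antimono:
  assumes "m \<le> n"
  shows "coord_ideal sc x B n \<subseteq> coord_ideal sc x B m"
  unfolding coord_ideal_def using diagonal_power_antimono[OF assms] by (intro hull_mono) blast

lemma coord_ideal_mult:
  assumes "u \<in> diagonal_power sc m" "z \<in> coord_ideal sc x B n"
  shows "u * z \<in> coord_ideal sc x B (m + n)"
proof -
  let ?C = "coord_ideal sc x B (m + n)"
  note C = is_ideal_coord_ideal[of sc x B "m + n"] and gen = coord_ideal_generators[where sc = sc and x = x and B = B]
  have "is_ideal {z. u * z \<in> ?C}" by (rule is_ideal_vimage_mult[OF C])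
  then have "coord_ideal sc x B n \<subseteq> {z. u * z \<in> ?C}"
    unfolding coord_ideal_def[of sc x B n]
    using diagonal_power_mult[OF assms(1)] gen ideal_mult_left[OF C] by (intro hull_minimal) blast+
  then show ?thesis using assms(2) by blast
qed

lemma coord_ideal_diagonal:
  assumes "algebra_over sc" "n > 0"
  shows "coord_ideal sc x B n \<subseteq> diagonal"
proof -
  have "diagonal_power sc n \<subseteq> diagonal"
    using diagonal_power_antimono[of 1 n sc] assms diagonal_power_1[OF assms(1)] by simp
  then show ?thesis
    unfolding coord_ideal_def using dif_diagonal by (intro hull_minimal is_ideal_diagonal) auto
qed

lemma pt_mult_map_cong: "f - pt (mult_map f) 1 \<in> diagonal"
  by (simp add: diagonal_def mult_map_diff)

context
  fixes sc :: "'k::field \<Rightarrow> 'r::comm_ring_1 \<Rightarrow> 'r" and x :: "nat \<Rightarrow> 'r" and A :: "nat set" and g :: 'r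
  assumes sc: "algebra_over sc" and A: "finite A"
    and gen: "\<And>\<tau>. \<tau> \<in> diagonal \<Longrightarrow> pt g 1 * \<tau> \<in> coord_ideal sc x A 2"
begin

text \<open>A coefficient in the tensor ring may be replaced by its image under
  \<open>mult_map\<close>: the difference lies in the diagonal and is multiplied by
  \<open>dif (x j)\<close>, hence drops out modulo the square.\<close>

lemma diagonal_cong_coordinate:
  assumes "j \<in> A" "\<tau> \<in> diagonal"
  obtains a where "pt g 1 * \<tau> - pt a 1 * dif (x j) \<in> coord_ideal sc x (A - {j}) 2"
proof -
  note C = is_ideal_coord_ideal[of sc x "A - {j}" 2]
  have "(\<lambda>i. dif (x i)) ` A = insert (dif (x j)) ((\<lambda>i. dif (x i)) ` (A - {j}))" using assms by blast
  then have "coord_ideal sc x A 2 =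
      is_ideal hull (insert (dif (x j)) (diagonal_power sc 2 \<union> (\<lambda>i. dif (x i)) ` (A - {j})))"
    by (simp add: coord_ideal_def)
  then obtain r y where ry: "pt g 1 * \<tau> = r * dif (x j) + y" "y \<in> coord_ideal sc x (A - {j}) 2"
    using gen[OF assms(2)] unfolding is_ideal_hull_insert coord_ideal_def by blast
  have "(r - pt (mult_map r) 1) * dif (x j) \<in> diagonal_power sc (1 + 1)"
    using diagonal_power_1[OF sc] pt_mult_map_cong dif_diagonal by (intro diagonal_power_mult) auto
  then have "(r - pt (mult_map r) 1) * dif (x j) + y \<in> coord_ideal sc x (A - {j}) 2"
    using coord_ideal_generators(1)[of sc 2 x "A - {j}"] ry(2) ideal_add[OF C] by (auto simp: numeral_2_eq_2)
  then have "pt g 1 * \<tau> - pt (mult_map r) 1 * dif (x j) \<in> coord_ideal sc x (A - {j}) 2"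
    unfolding ry(1) by (simp add: algebra_simps)
  then show thesis by (rule that)
qed

lemma diagonal_power_cong_coordinate_power:
  assumes j: "j \<in> A" and \<xi>: "\<xi> \<in> diagonal_power sc n"
  shows "\<exists>c. pt (g ^ n) 1 * \<xi> - pt c 1 * dif (x j) ^ n \<in> coord_ideal sc x (A - {j}) (Suc n)"
proof -
  let ?C = "\<lambda>n. coord_ideal sc x (A - {j}) n"
  let ?Z = "dif (x j)"
  note C = is_ideal_coord_ideal[of sc x "A - {j}"]
  note Cgen = coord_ideal_generators[where sc = sc and x = x and B = "A - {j}"]
  note DP = is_ideal_diag_power[of sc]
  have ptm: "pt (a * b) 1 = pt a 1 * pt b (1::'r)" for a b by (simp add: pt_mult)
  define S where "S n = {\<xi> \<in> diagonal_power sc n. \<exists>c. pt (g ^ n) 1 * \<xi> - pt c 1 * ?Z ^ n \<in> ?C (Suc n)}" for n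
  have prod: "diagonal ^ n \<subseteq> S n" for n
  proof (induction n)
    case 0
    show ?case using ideal_zero[OF C] diagonal_power_0[of sc]
      by (auto simp: S_def pt_one intro!: exI[of _ 1])
  next
    case (Suc n)
    show ?case
    proof
      fix \<xi> :: "'r pretensor" assume \<xi>: "\<xi> \<in> diagonal ^ Suc n"
      then obtain a b where ab: "\<xi> = a * b" "a \<in> diagonal" "b \<in> diagonal ^ n" by (auto simp: set_times_def)
      obtain a' where a': "pt g 1 * a - pt a' 1 * ?Z \<in> ?C 2" using diagonal_cong_coordinate[OF j ab(2)] by blast
      obtain c where c: "pt (g ^ n) 1 * b - pt c 1 * ?Z ^ n \<in> ?C (Suc n)"
        using Suc ab(3) unfolding S_def by blast
      have "pt (g ^ n) 1 * b \<in> diagonal_power sc n"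
        using ideal_mult_left[OF DP] diagonal_set_power_subset ab(3) by blast
      then have 1: "(pt (g ^ n) 1 * b) * (pt g 1 * a - pt a' 1 * ?Z) \<in> ?C (n + 2)"
        by (rule coord_ideal_mult[OF _ a'])
      have "pt a' 1 * ?Z \<in> diagonal_power sc 1"
        unfolding diagonal_power_1[OF sc] by (rule ideal_mult_left[OF is_ideal_diagonal dif_diagonal])
      then have 2: "(pt a' 1 * ?Z) * (pt (g ^ n) 1 * b - pt c 1 * ?Z ^ n) \<in> ?C (1 + Suc n)"
        by (rule coord_ideal_mult[OF _ c])
      have "pt (g ^ Suc n) 1 * \<xi> - pt (a' * c) 1 * ?Z ^ Suc n =
          (pt (g ^ n) 1 * b) * (pt g 1 * a - pt a' 1 * ?Z) + (pt a' 1 * ?Z) * (pt (g ^ n) 1 * b - pt c 1 * ?Z ^ n)"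
        unfolding power_Suc[of g] ptm ab(1) by (simp add: algebra_simps)
      then have "pt (g ^ Suc n) 1 * \<xi> - pt (a' * c) 1 * ?Z ^ Suc n \<in> ?C (Suc (Suc n))"
        using 1 2 ideal_add[OF C] by simp
      moreover have "\<xi> \<in> diagonal_power sc (Suc n)" using \<xi> diagonal_set_power_subset by blast
      ultimately show "\<xi> \<in> S (Suc n)" unfolding S_def by blast
    qed
  qed
  have "is_ideal (S n)"
  proof (rule is_idealI)
    have "pt (g ^ n) 1 * 0 - pt 0 1 * ?Z ^ n \<in> ?C (Suc n)"
      using ideal_uminus[OF C ideal_mult_right[OF C pt_zero_left_cong[OF C Cgen(3)]]] by simp
    then show "0 \<in> S n" unfolding S_def using ideal_zero[OF DP] by blast
  next
    fix u v assume "u \<in> S n" "v \<in> S n"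
    then obtain c e where ce: "pt (g ^ n) 1 * u - pt c 1 * ?Z ^ n \<in> ?C (Suc n)"
        "pt (g ^ n) 1 * v - pt e 1 * ?Z ^ n \<in> ?C (Suc n)" "u \<in> diagonal_power sc n" "v \<in> diagonal_power sc n"
      unfolding S_def by blast
    have "pt (g ^ n) 1 * (u + v) - pt (c + e) 1 * ?Z ^ n =
        (pt (g ^ n) 1 * u - pt c 1 * ?Z ^ n) + (pt (g ^ n) 1 * v - pt e 1 * ?Z ^ n) -
        (pt (c + e) 1 - (pt c 1 + pt e 1)) * ?Z ^ n"
      by (simp add: algebra_simps)
    then have "pt (g ^ n) 1 * (u + v) - pt (c + e) 1 * ?Z ^ n \<in> ?C (Suc n)"
      using ideal_diff[OF C ideal_add[OF C ce(1,2)] ideal_mult_right[OF C pt_add_left_cong[OF C Cgen(3)]]]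
      by simp
    then show "u + v \<in> S n" unfolding S_def using ideal_add[OF DP ce(3,4)] by blast
  next
    fix s u :: "'r pretensor" assume "u \<in> S n"
    then obtain c where c: "pt (g ^ n) 1 * u - pt c 1 * ?Z ^ n \<in> ?C (Suc n)" "u \<in> diagonal_power sc n"
      unfolding S_def by blast
    let ?b = "mult_map s"
    have "(s - pt ?b 1) * u \<in> diagonal_power sc (1 + n)"
      using diagonal_power_1[OF sc] pt_mult_map_cong c(2) by (intro diagonal_power_mult) auto
    then have "pt (g ^ n) 1 * ((s - pt ?b 1) * u) \<in> ?C (Suc n)"
      using ideal_mult_left[OF C] Cgen(1)[of "Suc n"] by auto
    then have "pt ?b 1 * (pt (g ^ n) 1 * u - pt c 1 * ?Z ^ n) + pt (g ^ n) 1 * ((s - pt ?b 1) * u) \<in> ?C (Suc n)"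
      using c(1) ideal_add[OF C] ideal_mult_left[OF C] by blast
    moreover have "pt ?b 1 * (pt (g ^ n) 1 * u - pt c 1 * ?Z ^ n) + pt (g ^ n) 1 * ((s - pt ?b 1) * u) =
        pt (g ^ n) 1 * (s * u) - pt (?b * c) 1 * ?Z ^ n"
      unfolding ptm by (simp add: algebra_simps)
    ultimately show "s * u \<in> S n" unfolding S_def using ideal_mult_left[OF DP c(2)] by auto
  qed
  moreover have "tensor_relations sc \<subseteq> S n"
  proof
    fix t assume t: "t \<in> tensor_relations sc"
    have "pt (g ^ n) 1 * t \<in> ?C (Suc n)" "pt 0 1 * ?Z ^ n \<in> ?C (Suc n)"
      using t Cgen(3) ideal_mult_left[OF C] ideal_mult_right[OF C pt_zero_left_cong[OF C Cgen(3)]] by blast+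
    then have "pt (g ^ n) 1 * t - pt 0 1 * ?Z ^ n \<in> ?C (Suc n)" by (rule ideal_diff[OF C])
    then show "t \<in> S n" unfolding S_def using t relations_diagonal_power by blast
  qed
  ultimately have "diagonal_power sc n \<subseteq> S n"
    unfolding diagonal_power_def[of sc n] using prod by (intro hull_minimal) auto
  then show ?thesis using \<xi> unfolding S_def by blast
qed

text \<open>After multiplication by \<open>g ^ (N + 1)\<close> a remainder of order
  \<open>N + 1\<close> is a multiple of \<open>dif (x j) ^ (N + 1)\<close> up to higher order. The
  exponent \<open>e\<close> is chosen before the tensor, so that all expansions share one
  denominator.\<close>

lemma expansion_exists:
  assumes j: "j \<in> A"
  shows "\<exists>e. \<forall>\<xi>. \<exists>c. pt (g ^ e) 1 * \<xi> - (\<Sum>n\<le>N. pt (c n) 1 * dif (x j) ^ n) \<in> coord_ideal sc x (A - {j}) (Suc N)"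
proof (induction N)
  case 0
  have "\<xi> - pt (mult_map \<xi>) 1 \<in> coord_ideal sc x (A - {j}) (Suc 0)" for \<xi>
    using pt_mult_map_cong[of \<xi>] coord_ideal_generators(1)[of sc 1 x "A - {j}"]
    by (auto simp: diagonal_power_Suc_0[OF sc])
  then have "\<exists>c. pt (g ^ 0) 1 * \<xi> - (\<Sum>n\<le>0. pt (c n) 1 * dif (x j) ^ n) \<in> coord_ideal sc x (A - {j}) (Suc 0)" for \<xi>
    by (intro exI[of _ "\<lambda>_. mult_map \<xi>"]) (simp add: pt_one)
  then show ?case by blast
next
  case (Suc N)
  let ?C = "\<lambda>n. coord_ideal sc x (A - {j}) n"
  let ?Z = "dif (x j)"
  note C = is_ideal_coord_ideal[of sc x "A - {j}"]
  have ptm: "pt (a * b) 1 = pt a 1 * pt b (1::'r)" for a b by (simp add: pt_mult)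
  obtain e where e: "\<And>\<xi>. \<exists>c. pt (g ^ e) 1 * \<xi> - (\<Sum>n\<le>N. pt (c n) 1 * ?Z ^ n) \<in> ?C (Suc N)"
    using Suc by blast
  have "\<exists>c. pt (g ^ (Suc N + e)) 1 * \<xi> - (\<Sum>n\<le>Suc N. pt (c n) 1 * ?Z ^ n) \<in> ?C (Suc (Suc N))" for \<xi>
  proof -
    obtain c where "pt (g ^ e) 1 * \<xi> - (\<Sum>n\<le>N. pt (c n) 1 * ?Z ^ n) \<in> ?C (Suc N)" using e by blast
    then obtain u v where uv: "u \<in> diagonal_power sc (Suc N)" "v \<in> is_ideal hull ((\<lambda>i. dif (x i)) ` (A - {j}))"
        "pt (g ^ e) 1 * \<xi> - (\<Sum>n\<le>N. pt (c n) 1 * ?Z ^ n) = u + v"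
      unfolding coord_ideal_def by (rule is_ideal_hull_Un[OF is_ideal_diag_power]) (rule that)
    obtain b where b: "pt (g ^ Suc N) 1 * u - pt b 1 * ?Z ^ Suc N \<in> ?C (Suc (Suc N))"
      using diagonal_power_cong_coordinate_power[OF j uv(1)] by blast
    have "is_ideal hull ((\<lambda>i. dif (x i)) ` (A - {j})) \<subseteq> ?C (Suc (Suc N))"
      unfolding coord_ideal_def by (intro hull_mono) auto
    then have v: "pt (g ^ Suc N) 1 * v \<in> ?C (Suc (Suc N))" using uv(2) ideal_mult_left[OF C] by blast
    define c' where "c' n = (if n = Suc N then b else g ^ Suc N * c n)" for n
    have sum_eq: "(\<Sum>n\<le>Suc N. pt (c' n) 1 * ?Z ^ n) =
        pt b 1 * ?Z ^ Suc N + pt (g ^ Suc N) 1 * (\<Sum>n\<le>N. pt (c n) 1 * ?Z ^ n)"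
    proof -
      have "(\<Sum>n\<le>N. pt (c' n) 1 * ?Z ^ n) = pt (g ^ Suc N) 1 * (\<Sum>n\<le>N. pt (c n) 1 * ?Z ^ n)"
        unfolding sum_distrib_left by (rule sum.cong) (simp_all add: c'_def ptm mult_ac)
      then show ?thesis by (simp add: c'_def)
    qed
    have pow_eq: "pt (g ^ (Suc N + e)) 1 * \<xi> = pt (g ^ Suc N) 1 * (pt (g ^ e) 1 * \<xi>)"
      by (simp only: power_add ptm mult.assoc)
    have \<xi>_eq: "pt (g ^ e) 1 * \<xi> = u + v + (\<Sum>n\<le>N. pt (c n) 1 * ?Z ^ n)" using uv(3) by (simp add: algebra_simps)
    have "pt (g ^ (Suc N + e)) 1 * \<xi> - (\<Sum>n\<le>Suc N. pt (c' n) 1 * ?Z ^ n) =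
        (pt (g ^ Suc N) 1 * u - pt b 1 * ?Z ^ Suc N) + pt (g ^ Suc N) 1 * v"
      unfolding sum_eq pow_eq \<xi>_eq by (simp add: algebra_simps del: power_Suc)
    then have "pt (g ^ (Suc N + e)) 1 * \<xi> - (\<Sum>n\<le>Suc N. pt (c' n) 1 * ?Z ^ n) \<in> ?C (Suc (Suc N))"
      using ideal_add[OF C b v] by (simp only:)
    then show ?thesis by blast
  qed
  then show ?case by blast
qed

end

text \<open>The case \<open>g = 1\<close>: expansions exist without denominators.\<close>

locale etale_coordinates = generic_coordinates sc \<phi> x A D 1 E l
  for sc :: "'k::alg_closed_field \<Rightarrow> 'r::comm_ring_1 \<Rightarrow> 'r" and \<phi> :: "'r \<Rightarrow> 'f::field"
    and x A D E l +
  assumes generated: "\<tau> \<in> diagonal \<Longrightarrow> \<tau> \<in> coord_ideal sc x A 2"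
begin

abbreviation Z :: "nat \<Rightarrow> 'r pretensor" where "Z j \<equiv> dif (x j)"

abbreviation C :: "nat \<Rightarrow> nat \<Rightarrow> 'r pretensor set" where "C j n \<equiv> coord_ideal sc x (A - {j}) n"

lemmas C_ideal = is_ideal_coord_ideal
lemmas C_relations = coord_ideal_generators(3)

definition expansion :: "nat \<Rightarrow> nat \<Rightarrow> 'r pretensor \<Rightarrow> (nat \<Rightarrow> 'r) \<Rightarrow> bool" where
  "expansion j N \<xi> c \<longleftrightarrow> \<xi> - (\<Sum>n\<le>N. pt (c n) 1 * Z j ^ n) \<in> C j (Suc N)"

lemma expansion_ex:
  assumes "j \<in> A"
  shows "\<exists>c. expansion j N \<xi> c"
proof -
  obtain e where "\<forall>\<xi>. \<exists>c. pt (1 ^ e) 1 * \<xi> - (\<Sum>n\<le>N. pt (c n) 1 * Z j ^ n) \<in> C j (Suc N)"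
    using expansion_exists[OF sc finite_A, of 1 x j N] generated assms by (auto simp: pt_one)
  then show ?thesis by (simp add: expansion_def pt_one)
qed

lemma expansion_unique:
  assumes j: "j \<in> A" and "expansion j N \<xi> c" "expansion j N \<xi> c'" "n \<le> N"
  shows "c n = c' n"
proof -
  note I = C_ideal[of sc x "A - {j}" "Suc N"]
  have "(\<Sum>n\<le>N. pt (c n) 1 * Z j ^ n) - (\<Sum>n\<le>N. pt (c' n) 1 * Z j ^ n) \<in> C j (Suc N)"
    using ideal_diff[OF I assms(3,2)[unfolded expansion_def]] by simp
  moreover have "(\<Sum>n\<le>N. (pt (c n - c' n) 1 - (pt (c n) 1 - pt (c' n) 1)) * Z j ^ n) \<in> C j (Suc N)"
    by (intro ideal_sum[OF I] ideal_mult_right[OF I] pt_diff_left_cong[OF I C_relations])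
  ultimately have "(\<Sum>n\<le>N. (pt (c n - c' n) 1 - (pt (c n) 1 - pt (c' n) 1)) * Z j ^ n) +
      ((\<Sum>n\<le>N. pt (c n) 1 * Z j ^ n) - (\<Sum>n\<le>N. pt (c' n) 1 * Z j ^ n)) \<in> C j (Suc N)"
    by (rule ideal_add[OF I, rotated])
  then have "(\<Sum>n\<le>N. pt (c n - c' n) 1 * Z j ^ n) \<in> C j (Suc N)"
    by (simp add: left_diff_distrib sum_subtractf)
  then have "c n - c' n = 0" using power_coefficients_zero[OF j, of "\<lambda>n. c n - c' n"] assms(4) by blast
  then show ?thesis by simp
qed

lemma Z_power: "Z j ^ m \<in> C j n" if "n \<le> m"
proof -
  have "Z j ^ m \<in> diagonal_power sc n"
    using dif_power_diagonal_power[OF sc, of "x j" m] diagonal_power_antimono[OF that] by blast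
  then show ?thesis using coord_ideal_generators(1) by blast
qed

lemma expansion_mono:
  assumes "expansion j N \<xi> c" "M \<le> N"
  shows "expansion j M \<xi> c"
proof -
  note I = C_ideal[of sc x "A - {j}" "Suc M"]
  have "{..N} = {..M} \<union> {Suc M..N}" using assms(2) by auto
  then have split: "(\<Sum>n\<le>N. pt (c n) 1 * Z j ^ n) =
      (\<Sum>n\<le>M. pt (c n) 1 * Z j ^ n) + (\<Sum>n\<in>{Suc M..N}. pt (c n) 1 * Z j ^ n)"
    by (simp add: sum.union_disjoint)
  have "(\<Sum>n\<in>{Suc M..N}. pt (c n) 1 * Z j ^ n) \<in> C j (Suc M)"
    by (intro ideal_sum[OF I] ideal_mult_left[OF I] Z_power) auto
  moreover have "\<xi> - (\<Sum>n\<le>N. pt (c n) 1 * Z j ^ n) \<in> C j (Suc M)"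
    using assms coord_ideal_antimono[of "Suc M" "Suc N"] unfolding expansion_def by blast
  ultimately have "(\<Sum>n\<in>{Suc M..N}. pt (c n) 1 * Z j ^ n) + (\<xi> - (\<Sum>n\<le>N. pt (c n) 1 * Z j ^ n)) \<in> C j (Suc M)"
    by (rule ideal_add[OF I])
  then show ?thesis unfolding expansion_def split by simp
qed

text \<open>Read off from an expansion of order exactly \<open>n\<close>; uniqueness and truncation
  identify it with the coefficient in every longer expansion.\<close>

definition coefficient :: "nat \<Rightarrow> nat \<Rightarrow> 'r \<Rightarrow> 'r" where
  "coefficient j n r = (SOME c. expansion j n (pt 1 r) c) n"

lemma expansion_coefficient:
  assumes "j \<in> A"
  shows "expansion j N (pt 1 r) (\<lambda>n. coefficient j n r)"
proof -
  obtain c where c: "expansion j N (pt 1 r) c" using expansion_ex[OF assms] by blast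
  have "c n = coefficient j n r" if "n \<le> N" for n
  proof -
    have "expansion j n (pt 1 r) (SOME c. expansion j n (pt 1 r) c)"
      using expansion_ex[OF assms] by (rule someI_ex)
    then show ?thesis
      unfolding coefficient_def using expansion_unique[OF assms expansion_mono[OF c that]] by blast
  qed
  then have "(\<Sum>n\<le>N. pt (c n) 1 * Z j ^ n) = (\<Sum>n\<le>N. pt (coefficient j n r) 1 * Z j ^ n)"
    by (intro sum.cong) auto
  then show ?thesis using c unfolding expansion_def by simp
qed

lemma coefficient_eqI:
  assumes "j \<in> A" "expansion j N (pt 1 r) c" "n \<le> N"
  shows "coefficient j n r = c n"
  using expansion_unique[OF assms(1) expansion_coefficient[OF assms(1)] assms(2,3)] .

lemma coefficient_0: "j \<in> A \<Longrightarrow> coefficient j 0 r = r"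
proof -
  assume j: "j \<in> A"
  have "pt 1 r - pt (coefficient j 0 r) 1 \<in> diagonal"
    using expansion_coefficient[OF j, of 0 r] coord_ideal_diagonal[OF sc, of "Suc 0" x "A - {j}"]
    by (auto simp: expansion_def)
  then show ?thesis by (simp add: diagonal_def mult_map_diff)
qed

lemma coefficient_add:
  assumes j: "j \<in> A"
  shows "coefficient j n (r + s) = coefficient j n r + coefficient j n s"
proof -
  note I = C_ideal[of sc x "A - {j}" "Suc n"]
  let ?c = "\<lambda>n. coefficient j n r" and ?e = "\<lambda>n. coefficient j n s"
  have 1: "(\<Sum>i\<le>n. (pt (?c i + ?e i) 1 - (pt (?c i) 1 + pt (?e i) 1)) * Z j ^ i) \<in> C j (Suc n)"
    by (intro ideal_sum[OF I] ideal_mult_right[OF I] pt_add_left_cong[OF I C_relations])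
  note 2 = ideal_diff[OF I ideal_add[OF I pt_add_right_cong[OF I C_relations, of 1 r s]
        ideal_add[OF I expansion_coefficient[OF j, of n r, unfolded expansion_def]
          expansion_coefficient[OF j, of n s, unfolded expansion_def]]] 1]
  have "expansion j n (pt 1 (r + s)) (\<lambda>i. ?c i + ?e i)"
    unfolding expansion_def using 2 by (simp add: algebra_simps sum.distrib sum_subtractf)
  from coefficient_eqI[OF j this] show ?thesis by blast
qed

lemma coefficient_scale:
  assumes j: "j \<in> A"
  shows "coefficient j n (sc a r) = sc a (coefficient j n r)"
proof -
  note I = C_ideal[of sc x "A - {j}" "Suc n"]
  let ?c = "\<lambda>n. coefficient j n r"
  have eq: "pt (sc a (?c i)) 1 = pt (sc a 1) 1 * pt (?c i) (1::'r)" for i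
    by (simp add: pt_mult algebra_scale_hom[OF sc])
  have "pt (sc a 1) r = pt (sc a 1) 1 * pt 1 r" by (simp add: pt_mult)
  then have "pt (sc a 1) 1 * pt 1 r - pt 1 (sc a r) \<in> C j (Suc n)"
    using pt_scale_cong[OF I C_relations, of a 1 r] by simp
  note 1 = ideal_diff[OF I ideal_mult_left[OF I
        expansion_coefficient[OF j, of n r, unfolded expansion_def], of "pt (sc a 1) 1"] this]
  have "expansion j n (pt 1 (sc a r)) (\<lambda>i. sc a (?c i))"
    unfolding expansion_def eq using 1 by (simp add: right_diff_distrib sum_distrib_left mult.assoc)
  from coefficient_eqI[OF j this] show ?thesis by blast
qed

text \<open>The expansions of \<open>pt 1 r\<close> and \<open>pt 1 s\<close> multiply to one of
  \<open>pt 1 (r * s)\<close>, because products of total degree above \<open>N\<close> fall into the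
  ideal.\<close>

lemma coefficient_mult:
  assumes j: "j \<in> A"
  shows "coefficient j N (r * s) = (\<Sum>i\<le>N. coefficient j i r * coefficient j (N - i) s)"
proof -
  note I = C_ideal[of sc x "A - {j}" "Suc N"]
  let ?c = "\<lambda>n. coefficient j n r" and ?e = "\<lambda>n. coefficient j n s"
  define P where "P = (\<Sum>i\<le>N. pt (?c i) 1 * Z j ^ i)"
  define Q where "Q = (\<Sum>i\<le>N. pt (?e i) 1 * Z j ^ i)"
  let ?f = "\<lambda>i k. (pt (?c i) 1 * Z j ^ i) * (pt (?e k) 1 * Z j ^ k)"
  have PQ: "P * Q = (\<Sum>(i, k)\<in>{..N} \<times> {..N}. ?f i k)"
    unfolding P_def Q_def sum_product sum.cartesian_product ..
  have "{..N} \<times> {..N} = {(i, k). i + k \<le> N} \<union> {(i, k). i \<le> N \<and> k \<le> N \<and> i + k > N}" by auto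
  moreover have "finite {(i, k). i + k \<le> N}" "finite {(i, k). i \<le> N \<and> k \<le> N \<and> i + k > N}"
    by (rule finite_subset[of _ "{..N} \<times> {..N}"]; auto)+
  moreover have "{(i, k). i + k \<le> N} \<inter> {(i, k). i \<le> N \<and> k \<le> N \<and> i + k > N} = {}" by auto
  ultimately have split: "P * Q = (\<Sum>(i, k)\<in>{(i, k). i + k \<le> N}. ?f i k) +
      (\<Sum>(i, k)\<in>{(i, k). i \<le> N \<and> k \<le> N \<and> i + k > N}. ?f i k)"
    unfolding PQ using sum.union_disjoint by (metis (no_types, lifting))
  have tail: "(\<Sum>(i, k)\<in>{(i, k). i \<le> N \<and> k \<le> N \<and> i + k > N}. ?f i k) \<in> C j (Suc N)"
  proof (intro ideal_sum[OF I], clarify)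
    fix i k assume "N < i + k"
    then have "(pt (?c i) 1 * pt (?e k) 1) * Z j ^ (i + k) \<in> C j (Suc N)"
      by (intro ideal_mult_left[OF I] Z_power) simp
    then show "?f i k \<in> C j (Suc N)" by (simp add: power_add mult_ac)
  qed
  have low: "(\<Sum>(i, k)\<in>{(i, k). i + k \<le> N}. ?f i k) = (\<Sum>n\<le>N. (\<Sum>i\<le>n. pt (?c i * ?e (n - i)) 1) * Z j ^ n)"
    unfolding sum.triangle_reindex_eq sum_distrib_right
  proof (intro sum.cong refl)
    fix n i :: nat assume "i \<in> {..n}"
    then have "Z j ^ n = Z j ^ i * Z j ^ (n - i)" by (simp flip: power_add)
    moreover have "pt (?c i * ?e (n - i)) 1 = pt (?c i) 1 * pt (?e (n - i)) (1::'r)" by (simp add: pt_mult)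
    ultimately show "?f i (n - i) = pt (?c i * ?e (n - i)) 1 * Z j ^ n" by (simp add: mult_ac)
  qed
  have "(\<Sum>n\<le>N. (pt (\<Sum>i\<le>n. ?c i * ?e (n - i)) 1 - (\<Sum>i\<le>n. pt (?c i * ?e (n - i)) 1)) * Z j ^ n) \<in> C j (Suc N)"
    by (intro ideal_sum[OF I] ideal_mult_right[OF I] pt_sum_left_cong[OF I C_relations])
  from ideal_diff[OF I this tail]
  have conv: "(\<Sum>n\<le>N. pt (\<Sum>i\<le>n. ?c i * ?e (n - i)) 1 * Z j ^ n) - P * Q \<in> C j (Suc N)"
    unfolding split low left_diff_distrib sum_subtractf diff_diff_eq .
  have "pt 1 (r * s) - P * Q = pt 1 s * (pt 1 r - P) + P * (pt 1 s - Q)"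
    by (simp add: algebra_simps pt_mult)
  also have "\<dots> \<in> C j (Suc N)"
    using expansion_coefficient[OF j, of N, unfolded expansion_def] unfolding P_def Q_def
    by (intro ideal_add[OF I] ideal_mult_left[OF I])
  finally have "pt 1 (r * s) - P * Q \<in> C j (Suc N)" .
  from ideal_diff[OF I this conv]
  have "expansion j N (pt 1 (r * s)) (\<lambda>n. \<Sum>i\<le>n. ?c i * ?e (n - i))"
    unfolding expansion_def by simp
  from coefficient_eqI[OF j this] show ?thesis by blast
qed

lemma higher_derivation_coefficient: "j \<in> A \<Longrightarrow> higher_derivation (coefficient j)"
  unfolding higher_derivation_def
  by (simp add: fun_eq_iff coefficient_0 coefficient_add coefficient_mult)

lemma coefficient_coordinate_same:
  assumes j: "j \<in> A" and n: "n > 0"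
  shows "coefficient j n (x j) = (if n = 1 then 1 else 0)"
proof -
  note I = C_ideal[of sc x "A - {j}" "Suc n"]
  let ?c = "\<lambda>i. if i = 0 then x j else if i = 1 then 1 else 0"
  have "{..n} = insert 0 (insert 1 {2..n})" using n by auto
  then have "(\<Sum>i\<le>n. pt (?c i) 1 * Z j ^ i) = pt 1 (x j) + (\<Sum>i\<in>{2..n}. pt 0 1 * Z j ^ i)"
    by (simp add: dif_def pt_one)
  moreover have "(\<Sum>i\<in>{2..n}. pt 0 1 * Z j ^ i) \<in> C j (Suc n)"
    by (intro ideal_sum[OF I] ideal_mult_right[OF I] pt_zero_left_cong[OF I C_relations])
  ultimately have "expansion j n (pt 1 (x j)) ?c"
    unfolding expansion_def using ideal_uminus[OF I] by simp
  from coefficient_eqI[OF j this, of n] n show ?thesis by simp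
qed

lemma coefficient_coordinate_other:
  assumes j: "j \<in> A" and i: "i \<in> A" "j \<noteq> i" and n: "n > 0"
  shows "coefficient j n (x i) = 0"
proof -
  note I = C_ideal[of sc x "A - {j}" "Suc n"]
  let ?c = "\<lambda>m. if m = 0 then x i else 0"
  have "{..n} = insert 0 {1..n}" by auto
  then have "(\<Sum>m\<le>n. pt (?c m) 1 * Z j ^ m) = pt (x i) 1 + (\<Sum>m\<in>{1..n}. pt 0 1 * Z j ^ m)"
    by (simp add: dif_def)
  moreover have "(\<Sum>m\<in>{1..n}. pt 0 1 * Z j ^ m) \<in> C j (Suc n)"
    by (intro ideal_sum[OF I] ideal_mult_right[OF I] pt_zero_left_cong[OF I C_relations])
  moreover have "pt 1 (x i) - pt (x i) 1 \<in> C j (Suc n)"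
    using coord_ideal_generators(2)[of i "A - {j}" x sc "Suc n"] i by (simp add: dif_def)
  ultimately have "expansion j n (pt 1 (x i)) ?c"
    unfolding expansion_def using ideal_diff[OF I] by (simp add: diff_diff_eq[symmetric])
  from coefficient_eqI[OF j this, of n] n show ?thesis by simp
qed

text \<open>Generation modulo the square bootstraps itself: in a product of \<open>n + 1\<close>
  diagonal elements, rewriting one factor by the coordinate differentials leaves an error one power
  higher.\<close>

lemma diagonal_subset_coord_ideal: "diagonal \<subseteq> coord_ideal sc x A (Suc n)"
proof (induction n)
  case 0
  show ?case using coord_ideal_generators(1)[of sc 1 x A] by (simp add: diagonal_power_Suc_0[OF sc])
next
  case (Suc n)
  let ?C = "coord_ideal sc x A (Suc (Suc n))"
  note I = C_ideal[of sc x A "Suc (Suc n)"]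
  have "diagonal ^ Suc n \<subseteq> ?C"
  proof
    fix t :: "'r pretensor" assume "t \<in> diagonal ^ Suc n"
    then obtain a b where ab: "t = a * b" "a \<in> diagonal" "b \<in> diagonal ^ n" by (auto simp: set_times_def)
    have "b * a \<in> coord_ideal sc x A (n + 2)"
      using generated[OF ab(2)] diagonal_set_power_subset[of n sc] ab(3) by (intro coord_ideal_mult) auto
    then show "t \<in> ?C" by (simp add: ab(1) mult.commute)
  qed
  then have "diagonal_power sc (Suc n) \<subseteq> ?C"
    unfolding diagonal_power_def[of sc "Suc n"]
    using C_relations[of sc x A "Suc (Suc n)"] by (intro hull_minimal I) auto
  then have "coord_ideal sc x A (Suc n) \<subseteq> ?C"
    unfolding coord_ideal_def[of sc x A "Suc n"]
    using coord_ideal_generators(2)[of _ A x sc "Suc (Suc n)"] by (intro hull_minimal I) auto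
  then show ?case using Suc by blast
qed

text \<open>The functional of \<open>\<delta>\<close> annihilates all \<open>dif (x i)\<close> and a
  power of the diagonal, hence the whole diagonal; at \<open>dif r\<close> its value is
  \<open>\<delta> r - r * \<delta> 1\<close>.\<close>

lemma operator_zero:
  assumes \<delta>: "diff_op sc (\<lambda>x. x) n \<delta>" and comm: "\<And>i r. i \<in> A \<Longrightarrow> \<delta> (x i * r) = x i * \<delta> r" and one: "\<delta> 1 = 0"
  shows "\<delta> r = 0"
proof -
  note id = is_ring_hom_id
  let ?K = "{t. \<forall>f. tensor_map (\<lambda>x. x) \<delta> (t * f) = 0}"
  have "diff_op sc (\<lambda>x. x) (Suc n) \<delta>" by (rule diff_op_mono[OF sc id \<delta>]) simp
  then have "tensor_map (\<lambda>x. x) \<delta> f = 0" if "f \<in> diagonal_power sc (Suc n)" for f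
    using that unfolding diff_op_iff_vanishing[OF sc id] by blast
  then have "diagonal_power sc (Suc n) \<subseteq> ?K"
    using ideal_mult_right[OF is_ideal_diag_power, of _ sc "Suc n"] by blast
  moreover have "dif (x i) \<in> ?K" if "i \<in> A" for i
  proof -
    have "commutator (\<lambda>x. x) \<delta> (x i) = (\<lambda>_. 0)" by (rule ext) (simp add: commutator_id comm[OF that])
    then have "tensor_map (\<lambda>x. x) \<delta> (dif (x i) * f) = 0" for f
      by (simp only: tensor_map_dif[OF id]) (simp add: tensor_map_def)
    then show ?thesis by blast
  qed
  ultimately have "coord_ideal sc x A (Suc n) \<subseteq> ?K"
    unfolding coord_ideal_def by (intro hull_minimal is_ideal_functional_kernel) auto
  then have "dif r \<in> ?K" using diagonal_subset_coord_ideal dif_diagonal by blast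
  then have "tensor_map (\<lambda>x. x) \<delta> (dif r * 1) = 0" by blast
  then show ?thesis by (simp add: dif_def tensor_map_diff one)
qed

end


section \<open>Ascending chains of ideals in finitely generated algebras\<close>

text \<open>The chain condition is relative to a subring, so that generators can be adjoined one by
  one inside a fixed ring.\<close>

definition acc_ideals :: "'a::comm_ring_1 set \<Rightarrow> bool" where
  "acc_ideals B \<longleftrightarrow> (\<forall>Q. (\<forall>n::nat. ideal_in B (Q n) \<and> Q n \<subseteq> Q (Suc n)) \<longrightarrow> (\<exists>M. \<forall>n\<ge>M. Q n = Q M))"

lemma ideal_inD:
  assumes "ideal_in B J"
  shows "J \<subseteq> B" "0 \<in> J" "a \<in> J \<Longrightarrow> b \<in> J \<Longrightarrow> a + b \<in> J" "s \<in> B \<Longrightarrow> a \<in> J \<Longrightarrow> s * a \<in> J"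
  using assms by (auto simp: ideal_in_def)

definition adjoin :: "'a::comm_ring_1 set \<Rightarrow> 'a \<Rightarrow> 'a set" where
  "adjoin B v = {\<Sum>l\<le>i. c l * v ^ l | (i::nat) c. \<forall>l. c l \<in> B}"

definition is_subring :: "'a::comm_ring_1 set \<Rightarrow> bool" where
  "is_subring B \<longleftrightarrow> 1 \<in> B \<and> (\<forall>a\<in>B. \<forall>b\<in>B. a - b \<in> B \<and> a * b \<in> B)"

lemma is_subringD:
  assumes "is_subring B"
  shows "1 \<in> B" "0 \<in> B" "a \<in> B \<Longrightarrow> b \<in> B \<Longrightarrow> a - b \<in> B" "a \<in> B \<Longrightarrow> b \<in> B \<Longrightarrow> a * b \<in> B"
    "a \<in> B \<Longrightarrow> b \<in> B \<Longrightarrow> a + b \<in> B" "a \<in> B \<Longrightarrow> - a \<in> B" "a \<in> B \<Longrightarrow> a ^ n \<in> B"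
    "(\<And>i. i \<in> A \<Longrightarrow> f i \<in> B) \<Longrightarrow> sum f A \<in> B"
proof -
  show 1: "1 \<in> B" "a \<in> B \<Longrightarrow> b \<in> B \<Longrightarrow> a - b \<in> B" "a \<in> B \<Longrightarrow> b \<in> B \<Longrightarrow> a * b \<in> B" for a b
    using assms by (auto simp: is_subring_def)
  show 0: "0 \<in> B" using 1(2)[of 1 1] 1(1) by simp
  show m: "a \<in> B \<Longrightarrow> - a \<in> B" for a using 1(2)[of 0 a] 0 by simp
  show p: "a \<in> B \<Longrightarrow> b \<in> B \<Longrightarrow> a + b \<in> B" for a b using 1(2)[of a "- b"] m[of b] by simp
  show "a \<in> B \<Longrightarrow> a ^ n \<in> B" by (induction n) (simp_all add: 1)
  show "(\<And>i. i \<in> A \<Longrightarrow> f i \<in> B) \<Longrightarrow> sum f A \<in> B"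
    by (induction A rule: infinite_finite_induct) (simp_all add: 0 p)
qed

lemma adjoinI: "(\<And>l. c l \<in> B) \<Longrightarrow> (\<Sum>l\<le>i. c l * v ^ l) \<in> adjoin B v"
  unfolding adjoin_def by blast

lemma adjoin_pad:
  fixes c :: "nat \<Rightarrow> 'a::comm_ring_1"
  assumes "i \<le> k"
  shows "(\<Sum>l\<le>i. c l * v ^ l) = (\<Sum>l\<le>k. (if l \<le> i then c l else 0) * v ^ l)"
  by (rule sum.mono_neutral_cong_left) (use assms in auto)

lemma adjoin_monomial:
  assumes "is_subring B" "b \<in> B"
  shows "b * v ^ n \<in> adjoin B v"
proof -
  have "(\<Sum>l\<le>n. (if l = n then b else 0) * v ^ l) = b * v ^ n"
    by (simp add: if_distrib[of "\<lambda>z. z * _"] sum.delta cong: if_cong)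
  then show ?thesis using adjoinI[of "\<lambda>l. if l = n then b else 0" B v n] is_subringD(2)[OF assms(1)] assms(2) by auto
qed

lemma adjoin_subset:
  assumes "is_subring B"
  shows "B \<subseteq> adjoin B v" "v \<in> adjoin B v"
  using adjoin_monomial[OF assms, of _ v 0] adjoin_monomial[OF assms is_subringD(1)[OF assms], of v 1] by auto

lemma is_subring_adjoin:
  assumes B: "is_subring B"
  shows "is_subring (adjoin B v)"
proof -
  note Bd = is_subringD[OF B]
  have diff: "a - b \<in> adjoin B v" if ab: "a \<in> adjoin B v" "b \<in> adjoin B v" for a b
  proof -
    obtain i c k e where c: "a = (\<Sum>l\<le>i. c l * v ^ l)" "\<forall>l. c l \<in> B"
        and e: "b = (\<Sum>l\<le>k. e l * v ^ l)" "\<forall>l. e l \<in> B"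
      using ab unfolding adjoin_def by blast
    have "a - b = (\<Sum>l\<le>max i k. ((if l \<le> i then c l else 0) - (if l \<le> k then e l else 0)) * v ^ l)"
      unfolding c e using adjoin_pad[of i "max i k" c v] adjoin_pad[of k "max i k" e v]
      by (simp only: left_diff_distrib sum_subtractf)
    then show ?thesis using c(2) e(2) Bd(2,3) by (auto intro!: adjoinI)
  qed
  have zero: "0 \<in> adjoin B v" using adjoin_subset(1)[OF B] Bd(2) by blast
  have add: "a + b \<in> adjoin B v" if "a \<in> adjoin B v" "b \<in> adjoin B v" for a b
    using diff[of a "0 - b"] diff[OF zero that(2)] that by simp
  have sum: "sum f A \<in> adjoin B v" if "\<And>i. i \<in> A \<Longrightarrow> f i \<in> adjoin B v" for f and A :: "nat set"
    using that by (induction A rule: infinite_finite_induct) (auto intro: add simp: zero)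
  have mult: "a * b \<in> adjoin B v" if ab: "a \<in> adjoin B v" "b \<in> adjoin B v" for a b
  proof -
    obtain i c k e where c: "a = (\<Sum>l\<le>i. c l * v ^ l)" "\<forall>l. c l \<in> B"
        and e: "b = (\<Sum>l\<le>k. e l * v ^ l)" "\<forall>l. e l \<in> B"
      using ab unfolding adjoin_def by blast
    have "(c l * v ^ l) * (e m * v ^ m) \<in> adjoin B v" for l m
      using adjoin_monomial[OF B, of "c l * e m" v "l + m"] c(2) e(2) Bd(4) by (simp add: power_add mult_ac)
    then show ?thesis unfolding c e sum_product by (intro sum)
  qed
  have "1 \<in> adjoin B v" using adjoin_subset(1)[OF B] Bd(1) by blast
  then show ?thesis unfolding is_subring_def using diff mult by blast
qed

lemma chain_mono:
  assumes "\<And>n. Q n \<subseteq> Q (Suc n)" "m \<le> n"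
  shows "Q m \<subseteq> Q n"
  using lift_Suc_mono_le[of Q m n] assms by blast

text \<open>Hilbert's basis theorem. As \<open>v\<close> may be algebraic over \<open>B\<close>, an
  element has no well-defined leading coefficient; \<open>Ld n i\<close> collects the coefficients
  of \<open>v ^ i\<close> in all expressions of degree at most \<open>i\<close> for elements of
  \<open>Q n\<close>.\<close>

lemma acc_ideals_adjoin:
  assumes B: "is_subring B" and acc: "acc_ideals B"
  shows "acc_ideals (adjoin B v)"
  unfolding acc_ideals_def
proof (intro allI impI)
  fix Q :: "nat \<Rightarrow> 'a set"
  assume Q: "\<forall>n. ideal_in (adjoin B v) (Q n) \<and> Q n \<subseteq> Q (Suc n)"
  note Bd = is_subringD[OF B] and Qd = ideal_inD[OF Q[rule_format, THEN conjunct1]]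
  have Bv: "b \<in> B \<Longrightarrow> b \<in> adjoin B v" for b using adjoin_subset[OF B] by blast
  have Q_mono: "Q m \<subseteq> Q n" if "m \<le> n" for m n using chain_mono[of Q, OF _ that] Q by blast
  have Q_diff: "a - b \<in> Q n" if "a \<in> Q n" "b \<in> Q n" for a b n
    using Qd(3)[OF that(1), of "(- 1) * b"] Qd(4)[OF Bv[OF Bd(6)[OF Bd(1)]] that(2)] by simp
  define Ld where "Ld n i = {b. \<exists>c. (\<forall>l. c l \<in> B) \<and> c i = b \<and> (\<Sum>l\<le>i. c l * v ^ l) \<in> Q n}" for n i
  have Ld_ideal: "ideal_in B (Ld n i)" for n i
    unfolding ideal_in_def
  proof (intro conjI ballI)
    show "Ld n i \<subseteq> B" unfolding Ld_def by blast
    show "0 \<in> Ld n i" unfolding Ld_def using Bd(2) Qd(2) by (intro CollectI exI[of _ "\<lambda>_. 0"]) simp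
  next
    fix a b assume "a \<in> Ld n i" "b \<in> Ld n i"
    then obtain c e where "\<forall>l. c l \<in> B" "c i = a" "(\<Sum>l\<le>i. c l * v ^ l) \<in> Q n"
        "\<forall>l. e l \<in> B" "e i = b" "(\<Sum>l\<le>i. e l * v ^ l) \<in> Q n" unfolding Ld_def by blast
    then show "a + b \<in> Ld n i" unfolding Ld_def using Bd(5) Qd(3)
      by (intro CollectI exI[of _ "\<lambda>l. c l + e l"]) (simp add: distrib_right sum.distrib)
  next
    fix s a assume "s \<in> B" "a \<in> Ld n i"
    then obtain c where "\<forall>l. c l \<in> B" "c i = a" "(\<Sum>l\<le>i. c l * v ^ l) \<in> Q n" unfolding Ld_def by blast
    then show "s * a \<in> Ld n i" unfolding Ld_def using Bd(4) Qd(4) Bv \<open>s \<in> B\<close>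
      by (intro CollectI exI[of _ "\<lambda>l. s * c l"]) (simp add: mult.assoc flip: sum_distrib_left)
  qed
  have Ld_n: "Ld m i \<subseteq> Ld n i" if "m \<le> n" for m n i
    unfolding Ld_def using Q_mono[OF that] by blast
  have Ld_Suc: "Ld n i \<subseteq> Ld n (Suc i)" for n i
  proof
    fix b assume "b \<in> Ld n i"
    then obtain c where c: "\<forall>l. c l \<in> B" "c i = b" "(\<Sum>l\<le>i. c l * v ^ l) \<in> Q n" unfolding Ld_def by blast
    define e where "e l = (if l = 0 then 0 else c (l - 1))" for l
    have "(\<Sum>l\<le>Suc i. e l * v ^ l) = v * (\<Sum>l\<le>i. c l * v ^ l)"
      unfolding sum.atMost_Suc_shift by (simp add: e_def sum_distrib_left mult_ac)
    then have "(\<Sum>l\<le>Suc i. e l * v ^ l) \<in> Q n" using Qd(4)[OF adjoin_subset(2)[OF B] c(3)] by simp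
    then show "b \<in> Ld n (Suc i)" unfolding Ld_def using c Bd(2)
      by (intro CollectI exI[of _ e]) (auto simp: e_def)
  qed
  have Ld_i: "Ld n i \<subseteq> Ld n k" if "i \<le> k" for n i k using chain_mono[of "Ld n", OF Ld_Suc that] .
  \<comment> \<open>The diagonal chain settles all \<open>i \<ge> N\<close> at once; the finitely
    many rows \<open>i < N\<close> are settled one by one afterwards.\<close>
  have "ideal_in B (Ld n n) \<and> Ld n n \<subseteq> Ld (Suc n) (Suc n)" for n
    using Ld_ideal Ld_n[of n "Suc n" n] Ld_Suc[of "Suc n" n] by auto
  then obtain N where N: "\<forall>n\<ge>N. Ld n n = Ld N N" using acc unfolding acc_ideals_def by meson
  have "\<exists>M. \<forall>n\<ge>M. Ld n i = Ld M i" for i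
    using acc[unfolded acc_ideals_def, rule_format, of "\<lambda>n. Ld n i"] Ld_ideal Ld_n[of _ "Suc _" i] by simp
  then obtain M where M: "\<And>i n. n \<ge> M i \<Longrightarrow> Ld n i = Ld (M i) i" by metis
  define K where "K = N + (\<Sum>i<N. M i)"
  have Ld_K: "Ld n i \<subseteq> Ld K i" if "n \<ge> K" for n i
  proof (cases "i < N")
    case True
    then have "M i \<le> (\<Sum>i<N. M i)" by (intro member_le_sum) auto
    then have "M i \<le> K" by (simp add: K_def)
    then show ?thesis using M[of i n] M[of i K] that by simp
  next
    case False
    have "Ld n i \<subseteq> Ld (max n i) (max n i)" using Ld_n[of n "max n i" i] Ld_i[of i "max n i" "max n i"] by auto
    also have "\<dots> = Ld N N" by (rule N[rule_format]) (use False in simp)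
    also have "\<dots> \<subseteq> Ld K N" by (rule Ld_n) (simp add: K_def)
    also have "\<dots> \<subseteq> Ld K i" by (rule Ld_i) (use False in simp)
    finally show ?thesis .
  qed
  have "Q n \<subseteq> Q K" if n: "n \<ge> K" for n
  proof
    have *: "(\<Sum>l\<le>i. c l * v ^ l) \<in> Q K" if "\<forall>l. c l \<in> B" "(\<Sum>l\<le>i. c l * v ^ l) \<in> Q n" for i c
      using that
    proof (induction i arbitrary: c)
      case (Suc i)
      then have "c (Suc i) \<in> Ld K (Suc i)" using Ld_K[OF n] unfolding Ld_def by blast
      then obtain e where e: "\<forall>l. e l \<in> B" "e (Suc i) = c (Suc i)" "(\<Sum>l\<le>Suc i. e l * v ^ l) \<in> Q K"
        unfolding Ld_def by blast
      have eq: "(\<Sum>l\<le>Suc i. c l * v ^ l) - (\<Sum>l\<le>Suc i. e l * v ^ l) = (\<Sum>l\<le>i. (c l - e l) * v ^ l)"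
        using e(2) by (simp add: left_diff_distrib sum_subtractf)
      have "(\<Sum>l\<le>i. (c l - e l) * v ^ l) \<in> Q n"
        unfolding eq[symmetric] using Suc.prems(2) e(3) Q_mono[OF n] by (intro Q_diff) auto
      then have "(\<Sum>l\<le>i. (c l - e l) * v ^ l) \<in> Q K" using Suc.IH[of "\<lambda>l. c l - e l"] Suc.prems(1) e(1) Bd(3) by simp
      then have "(\<Sum>l\<le>i. (c l - e l) * v ^ l) + (\<Sum>l\<le>Suc i. e l * v ^ l) \<in> Q K" using e(3) Qd(3) by blast
      then show ?case unfolding eq[symmetric] by simp
    next
      case 0
      then have "c 0 \<in> Ld K 0" using Ld_K[OF n] unfolding Ld_def by blast
      then show ?case unfolding Ld_def by auto
    qed
    fix q assume "q \<in> Q n"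
    then have "q \<in> adjoin B v" using Qd(1) by blast
    then show "q \<in> Q K" using * \<open>q \<in> Q n\<close> unfolding adjoin_def by blast
  qed
  then have "\<forall>n\<ge>K. Q n = Q K" using Q_mono by blast
  then show "\<exists>M. \<forall>n\<ge>M. Q n = Q M" by blast
qed

section \<open>Finitely generated subalgebras\<close>

lemma is_subalgebra_hull_in: "is_subalgebra sc (is_subalgebra sc hull G)"
  by (rule hull_in) (auto simp: is_subalgebra_def)

lemma subalgebra_subring:
  assumes "algebra_over sc" "is_subalgebra sc B"
  shows "is_subring B"
proof -
  have m: "- b \<in> B" if "b \<in> B" for b
  proof -
    have "sc (- 1) b \<in> B" using assms(2) that by (auto simp: is_subalgebra_def)
    then show ?thesis using algebra_scale_hom(9)[OF assms(1), of 1 b] algebra_scale_hom(1)[OF assms(1), of b] by simp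
  qed
  have "a - b \<in> B" if "a \<in> B" "b \<in> B" for a b
  proof -
    have "a + (- b) \<in> B" using assms(2) that m by (auto simp: is_subalgebra_def simp del: add_uminus_conv_diff)
    then show ?thesis by simp
  qed
  then show ?thesis using assms(2) by (auto simp: is_subalgebra_def is_subring_def)
qed

lemma is_subalgebra_adjoin:
  assumes "algebra_over sc" "is_subalgebra sc B"
  shows "is_subalgebra sc (adjoin B v)"
proof -
  note B = subalgebra_subring[OF assms] and Bv = is_subringD[OF is_subring_adjoin[OF subalgebra_subring[OF assms], of v]]
  have "sc c b \<in> adjoin B v" if "b \<in> adjoin B v" for c b
  proof -
    have "sc c 1 \<in> B" using assms(2) by (auto simp: is_subalgebra_def)
    then have "sc c 1 * b \<in> adjoin B v" using Bv(4) adjoin_subset(1)[OF B, of v] that by blast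
    then show ?thesis by (subst algebra_scale[OF assms(1)])
  qed
  then show ?thesis using Bv(1,4,5) unfolding is_subalgebra_def by blast
qed

lemma subalgebra_hull_insert:
  assumes sc: "algebra_over sc"
  shows "is_subalgebra sc hull (insert v G) = adjoin (is_subalgebra sc hull G) v"
proof (rule hull_unique)
  let ?B = "is_subalgebra sc hull G"
  have B: "is_subalgebra sc ?B" by (rule is_subalgebra_hull_in)
  note R = subalgebra_subring[OF sc B]
  show "insert v G \<subseteq> adjoin ?B v" using adjoin_subset[OF R, of v] hull_subset[of G "is_subalgebra sc"] by blast
  show "is_subalgebra sc (adjoin ?B v)" by (rule is_subalgebra_adjoin[OF sc B])
  fix T assume T: "insert v G \<subseteq> T" "is_subalgebra sc T"
  note Td = is_subringD[OF subalgebra_subring[OF sc T(2)]]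
  have "?B \<subseteq> T" using T by (intro hull_minimal) auto
  then have "(\<Sum>l\<le>i. c l * v ^ l) \<in> T" if "\<forall>l. c l \<in> ?B" for c and i :: nat
    using T(1) that by (intro Td(8) Td(4) Td(7)) auto
  then show "adjoin ?B v \<subseteq> T"
    unfolding adjoin_def by blast
qed

lemma subalgebra_hull_empty:
  assumes sc: "algebra_over sc"
  shows "is_subalgebra sc hull {} = range (\<lambda>c. sc c 1)"
proof (rule hull_unique)
  note h = algebra_scale_hom[OF sc]
  show "is_subalgebra sc (range (\<lambda>c. sc c 1))"
    unfolding is_subalgebra_def
  proof (intro conjI ballI allI)
    show "1 \<in> range (\<lambda>c. sc c 1)" using h(1)[of 1] by (metis rangeI)
  next
    fix a b assume "a \<in> range (\<lambda>c. sc c 1)" "b \<in> range (\<lambda>c. sc c 1)"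
    then obtain c e where ce: "a = sc c 1" "b = sc e 1" by blast
    then have "a + b = sc (c + e) 1" "a * b = sc (c * e) 1" by (simp_all add: h(2,3,7))
    then show "a + b \<in> range (\<lambda>c. sc c 1)" "a * b \<in> range (\<lambda>c. sc c 1)" by blast+
  next
    fix c a assume "a \<in> range (\<lambda>c. sc c 1)"
    then obtain e where "a = sc e 1" by blast
    then have "sc c a = sc (c * e) 1" by (simp add: h(3))
    then show "sc c a \<in> range (\<lambda>c. sc c 1)" by blast
  qed
qed (auto simp: is_subalgebra_def)

lemma acc_ideals_finitely_generated:
  fixes sc :: "'k::field \<Rightarrow> 'a::comm_ring_1 \<Rightarrow> 'a"
  assumes sc: "algebra_over sc" and "finite G"
  shows "acc_ideals (is_subalgebra sc hull G)"
  using assms(2)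
proof (induction G rule: finite_induct)
  case empty
  show ?case
    unfolding acc_ideals_def subalgebra_hull_empty[OF sc]
  proof (intro allI impI)
    fix Q :: "nat \<Rightarrow> 'a set"
    assume Q: "\<forall>n. ideal_in (range (\<lambda>c. sc c 1)) (Q n) \<and> Q n \<subseteq> Q (Suc n)"
    note Qd = ideal_inD[OF Q[rule_format, THEN conjunct1]]
    have all: "Q n = range (\<lambda>c. sc c 1)" if a: "a \<in> Q n" "a \<noteq> 0" for n a
    proof
      obtain c where c: "a = sc c 1" using Qd(1)[of n] a by blast
      then have "c \<noteq> 0" using a algebra_scale_hom(5)[OF sc] by auto
      have "sc (e / c) 1 * a \<in> Q n" for e using Qd(4) a by blast
      moreover have "sc (e / c) 1 * a = sc e 1" for e
        using \<open>c \<noteq> 0\<close> unfolding c algebra_scale_hom(7)[OF sc] by (simp flip: algebra_scale_hom(3)[OF sc])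
      ultimately show "range (\<lambda>c. sc c 1) \<subseteq> Q n" by auto
    qed (rule Qd(1))
    show "\<exists>M. \<forall>n\<ge>M. Q n = Q M"
    proof (cases "\<exists>M a. a \<in> Q M \<and> a \<noteq> 0")
      case True
      then obtain M a where Ma: "a \<in> Q M" "a \<noteq> 0" by blast
      have "a \<in> Q n" if "n \<ge> M" for n using chain_mono[of Q M n] Q that Ma by blast
      then show ?thesis using all Ma by metis
    next
      case False
      then have "Q n = {0}" for n using Qd(2) by blast
      then show ?thesis by simp
    qed
  qed
next
  case (insert v G)
  then show ?case
    unfolding subalgebra_hull_insert[OF sc]
    by (intro acc_ideals_adjoin subalgebra_subring[OF sc is_subalgebra_hull_in])
qed


section \<open>Derivations from a basis of the differentials\<close>

lemma derivation_extends_to_fract: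
  fixes \<delta> :: "'a::idom \<Rightarrow> 'a fract"
  assumes add: "\<And>a b. \<delta> (a + b) = \<delta> a + \<delta> b"
    and mult: "\<And>a b. \<delta> (a * b) = Fract a 1 * \<delta> b + Fract b 1 * \<delta> a"
  obtains D where "is_derivation D" "\<And>a. D (Fract a 1) = \<delta> a"
proof -
  let ?t = "\<lambda>a. Fract a (1::'a)"
  have t0: "?t b \<noteq> 0" if "b \<noteq> 0" for b using that by (simp add: Zero_fract_def eq_fract)
  have tm: "?t (a * b) = ?t a * ?t b" "?t (a + b) = ?t a + ?t b" for a b by simp_all
  have ex: "\<exists>a b. b \<noteq> 0 \<and> z * ?t b = ?t a" for z :: "'a fract"
  proof (cases z)
    case (Fract a b)
    then have "z * ?t b = ?t a" by (simp add: eq_fract)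
    then show ?thesis using Fract by blast
  qed
  then obtain num den where nd: "\<And>z. den z \<noteq> 0" "\<And>z. z * ?t (den z) = ?t (num z)" by metis
  define D where "D z = (\<delta> (num z) - z * \<delta> (den z)) / ?t (den z)" for z
  \<comment> \<open>This equation determines \<open>D z\<close> from any way of writing
    \<open>z\<close> as a fraction; the sum and product rules follow from it by taking the common
    denominator.\<close>
  have D: "D z * ?t b + z * \<delta> b = \<delta> a" if b: "b \<noteq> 0" and z: "z * ?t b = ?t a" for z a b
  proof -
    let ?p = "num z" and ?q = "den z"
    have "?t (a * ?q) = ?t (?p * b)" using z nd(2)[of z] by (metis tm(1) mult.assoc mult.commute)
    then have "a * ?q = ?p * b" by (simp add: eq_fract)
    then have "?t a * \<delta> ?q + ?t ?q * \<delta> a = ?t ?p * \<delta> b + ?t b * \<delta> ?p" by (metis mult)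
    then have "?t ?q * \<delta> a = z * ?t ?q * \<delta> b + ?t b * \<delta> ?p - z * ?t b * \<delta> ?q"
      using z nd(2)[of z] by (simp add: algebra_simps)
    also have "\<dots> = ?t ?q * (D z * ?t b + z * \<delta> b)"
      using t0[OF nd(1)[of z]] unfolding D_def by (simp add: field_simps)
    finally show ?thesis using t0[OF nd(1)[of z]] by simp
  qed
  have one: "\<delta> 1 = 0"
    using mult[of 1 1] by (simp only: mult_1 mult_1_left One_fract_def[symmetric]) (simp only: add_cancel_right_right)
  have Dt: "D (?t a) = \<delta> a" for a using D[of 1 "?t a" a] one by (simp flip: One_fract_def)
  have "D (y + z) = D y + D z" "D (y * z) = y * D z + z * D y" for y z
  proof -
    obtain a b where ab: "b \<noteq> 0" "y * ?t b = ?t a" using ex by blast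
    obtain c e where ce: "e \<noteq> 0" "z * ?t e = ?t c" using ex by blast
    note Dy = D[OF ab] and Dz = D[OF ce]
    have be: "b * e \<noteq> 0" using ab ce by simp
    have 1: "(y + z) * ?t (b * e) = ?t (a * e + c * b)"
      unfolding tm ab(2)[symmetric] ce(2)[symmetric] by (simp add: algebra_simps)
    have 2: "(y * z) * ?t (b * e) = ?t (a * c)"
      unfolding tm ab(2)[symmetric] ce(2)[symmetric] by (simp add: algebra_simps)
    have "D (y + z) * ?t (b * e) = (D y + D z) * ?t (b * e)"
    proof -
      have "D (y + z) * ?t (b * e) = \<delta> (a * e + c * b) - (y + z) * \<delta> (b * e)"
        using D[OF be 1] by (simp add: algebra_simps)
      also have "\<dots> = (D y + D z) * ?t (b * e)"
        unfolding add mult tm Dy[symmetric] Dz[symmetric] ab(2)[symmetric] ce(2)[symmetric]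
        by (simp add: algebra_simps)
      finally show ?thesis .
    qed
    then show "D (y + z) = D y + D z" using t0[OF be] by simp
    have "D (y * z) * ?t (b * e) = (y * D z + z * D y) * ?t (b * e)"
    proof -
      have "D (y * z) * ?t (b * e) = \<delta> (a * c) - (y * z) * \<delta> (b * e)"
        using D[OF be 2] by (simp add: algebra_simps)
      also have "\<dots> = (y * D z + z * D y) * ?t (b * e)"
        unfolding add mult tm Dy[symmetric] Dz[symmetric] ab(2)[symmetric] ce(2)[symmetric]
        by (simp add: algebra_simps)
      finally show ?thesis .
    qed
    then show "D (y * z) = y * D z + z * D y" using t0[OF be] by simp
  qed
  then have "is_derivation D" by (simp add: is_derivation_def)
  then show thesis using Dt that by blast
qed

text \<open>\<open>pd i r\<close> is the coefficient of the i-th differential in \<open>g\<close>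
  times the differential of \<open>r\<close>, divided by \<open>g\<close>. Uniqueness of
  coefficients gives the rules; the product rule holds because the error in
  \<open>dif (r * s)\<close> is \<open>dif s * dif r\<close>.\<close>

lemma partial_derivatives:
  fixes sc :: "'k::field \<Rightarrow> 'r::comm_ring_1 \<Rightarrow> 'r" and \<phi> :: "'r \<Rightarrow> 'f::field"
  assumes sc: "algebra_over sc" and \<phi>: "is_ring_hom \<phi>" and inj: "\<And>r. \<phi> r = 0 \<Longrightarrow> r = 0"
    and A: "finite A" and g: "g \<noteq> 0"
    and ex: "\<And>\<tau>. \<tau> \<in> diagonal \<Longrightarrow> \<exists>c. pt g 1 * \<tau> - (\<Sum>i\<in>A. pt (c i) 1 * dif (x i)) \<in> diagonal_power sc 2"
    and uniq: "\<And>c i. (\<Sum>i\<in>A. pt (c i) 1 * dif (x i)) \<in> diagonal_power sc 2 \<Longrightarrow> i \<in> A \<Longrightarrow> c i = 0"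
  obtains pd :: "nat \<Rightarrow> 'r \<Rightarrow> 'f" where
    "\<And>i r s. i \<in> A \<Longrightarrow> pd i (r + s) = pd i r + pd i s"
    "\<And>i r s. i \<in> A \<Longrightarrow> pd i (r * s) = \<phi> r * pd i s + \<phi> s * pd i r"
    "\<And>i c. i \<in> A \<Longrightarrow> pd i (sc c 1) = 0"
    "\<And>i j. i \<in> A \<Longrightarrow> j \<in> A \<Longrightarrow> pd i (x j) = (if i = j then 1 else 0)"
proof -
  note I = is_ideal_diag_power[of sc 2] and rel = relations_diagonal_power[of sc 2]
  let ?S = "\<lambda>c. \<Sum>i\<in>A. pt (c i) 1 * dif (x i)"
  have S_cong: "?S (\<lambda>i. c i + e i) - (?S c + ?S e) \<in> diagonal_power sc 2" for c e
  proof -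
    have "(\<Sum>i\<in>A. (pt (c i + e i) 1 - (pt (c i) 1 + pt (e i) 1)) * dif (x i)) \<in> diagonal_power sc 2"
      by (intro ideal_sum[OF I] ideal_mult_right[OF I] pt_add_left_cong[OF I rel])
    then show ?thesis by (simp add: left_diff_distrib distrib_right sum_subtractf sum.distrib)
  qed
  have S_cong': "?S (\<lambda>i. c i - e i) - (?S c - ?S e) \<in> diagonal_power sc 2" for c e
  proof -
    have "(\<Sum>i\<in>A. (pt (c i - e i) 1 - (pt (c i) 1 - pt (e i) 1)) * dif (x i)) \<in> diagonal_power sc 2"
      by (intro ideal_sum[OF I] ideal_mult_right[OF I] pt_diff_left_cong[OF I rel])
    then show ?thesis by (simp add: left_diff_distrib sum_subtractf)
  qed
  have S_scale: "?S (\<lambda>i. r * c i) = pt r 1 * ?S c" for r c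
  proof -
    have "pt (r * c i) 1 = pt r 1 * pt (c i) (1::'r)" for i by (simp add: pt_mult)
    then show ?thesis by (simp add: sum_distrib_left mult.assoc)
  qed
  define rep where "rep \<tau> c \<longleftrightarrow> pt g 1 * \<tau> - ?S c \<in> diagonal_power sc 2" for \<tau> c
  have rep_uniq: "c i = e i" if "rep \<tau> c" "rep \<tau> e" "i \<in> A" for \<tau> c e i
  proof -
    have "?S c - ?S e \<in> diagonal_power sc 2"
      using ideal_diff[OF I that(2,1)[unfolded rep_def]] by simp
    from ideal_add[OF I S_cong'[of c e] this] have "?S (\<lambda>i. c i - e i) \<in> diagonal_power sc 2" by simp
    then show ?thesis using uniq[of "\<lambda>i. c i - e i" i] that(3) by simp
  qed
  have rep_add: "rep (\<sigma> + \<tau>) (\<lambda>i. c i + e i)" if "rep \<sigma> c" "rep \<tau> e" for \<sigma> \<tau> c e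
    using ideal_diff[OF I ideal_add[OF I that[unfolded rep_def]] S_cong[of c e]]
    by (simp add: rep_def algebra_simps)
  have rep_scale: "rep (pt r 1 * \<tau>) (\<lambda>i. r * c i)" if "rep \<tau> c" for r \<tau> c
    using ideal_mult_left[OF I that[unfolded rep_def], of "pt r 1"]
    unfolding rep_def S_scale by (simp add: right_diff_distrib mult.left_commute)
  have rep_cong: "rep \<sigma> c" if "rep \<tau> c" "\<sigma> - \<tau> \<in> diagonal_power sc 2" for \<sigma> \<tau> c
    using ideal_add[OF I that(1)[unfolded rep_def] ideal_mult_left[OF I that(2), of "pt g 1"]]
    by (simp add: rep_def algebra_simps)
  have "\<exists>c. rep (dif r) c" for r using ex[OF dif_diagonal] unfolding rep_def by blast
  then obtain c where c: "\<And>r. rep (dif r) (c r)" by metis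
  have gF: "\<phi> g \<noteq> 0" using inj g by blast
  define pd where "pd i r = \<phi> (c r i) / \<phi> g" for i r
  show thesis
  proof (rule that)
    fix i r s assume i: "i \<in> A"
    have "rep (dif (r + s)) (\<lambda>i. c r i + c s i)"
      by (rule rep_cong[OF rep_add[OF c c]]) (rule dif_add_cong[OF I rel])
    then have "c (r + s) i = c r i + c s i" using rep_uniq[OF c _ i] by blast
    then show "pd i (r + s) = pd i r + pd i s"
      by (simp add: pd_def is_ring_homD[OF \<phi>] add_divide_distrib)
    have "dif s * dif r \<in> diagonal_power sc (1 + 1)"
      using dif_diagonal by (intro diagonal_power_mult) (simp_all only: diagonal_power_1[OF sc])
    moreover have "dif (r * s) - (pt r 1 * dif s + pt s 1 * dif r) = dif s * dif r"
    proof -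
      have "pt 1 s * dif r - pt s 1 * dif r = dif s * dif r" by (simp only: dif_def[of s] left_diff_distrib)
      then show ?thesis unfolding dif_mult by (simp only: add_diff_add diff_self add_0_left)
    qed
    ultimately have "rep (dif (r * s)) (\<lambda>i. r * c s i + s * c r i)"
      by (intro rep_cong[OF rep_add[OF rep_scale[OF c] rep_scale[OF c]]]) (simp add: numeral_2_eq_2)
    then have "c (r * s) i = r * c s i + s * c r i" using rep_uniq[OF c _ i] by blast
    then show "pd i (r * s) = \<phi> r * pd i s + \<phi> s * pd i r"
      by (simp add: pd_def is_ring_homD[OF \<phi>] add_divide_distrib)
  next
    fix i b assume i: "i \<in> A"
    \<comment> \<open>\<open>pt 0 1\<close> is a nonzero formal tensor; it vanishes only modulo the
      relations.\<close>
    have z: "?S (\<lambda>_. 0) \<in> diagonal_power sc 2"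
      by (intro ideal_sum[OF I] ideal_mult_right[OF I] pt_zero_left_cong[OF I rel])
    have "rep (dif (sc b 1)) (\<lambda>_. 0)"
      unfolding rep_def by (intro ideal_diff[OF I] ideal_mult_left[OF I] dif_scale_one_cong[OF I rel] z)
    then have "c (sc b 1) i = 0" using rep_uniq[OF c _ i] by blast
    then show "pd i (sc b 1) = 0" by (simp add: pd_def is_ring_homD[OF \<phi>])
  next
    fix i j assume ij: "i \<in> A" "j \<in> A"
    have "?S (\<lambda>i. if i = j then g else 0) - pt g 1 * dif (x j) = (\<Sum>i\<in>A - {j}. pt 0 1 * dif (x i))"
    proof -
      have "?S (\<lambda>i. if i = j then g else 0) = pt g 1 * dif (x j) + (\<Sum>i\<in>A - {j}. pt (if i = j then g else 0) 1 * dif (x i))"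
        using sum.remove[OF A ij(2), of "\<lambda>i. pt (if i = j then g else 0) 1 * dif (x i)"] by simp
      also have "(\<Sum>i\<in>A - {j}. pt (if i = j then g else 0) 1 * dif (x i)) = (\<Sum>i\<in>A - {j}. pt 0 1 * dif (x i))"
        by (rule sum.cong) auto
      finally show ?thesis by simp
    qed
    moreover have "(\<Sum>i\<in>A - {j}. pt 0 1 * dif (x i)) \<in> diagonal_power sc 2"
      by (intro ideal_sum[OF I] ideal_mult_right[OF I] pt_zero_left_cong[OF I rel])
    ultimately have "?S (\<lambda>i. if i = j then g else 0) - pt g 1 * dif (x j) \<in> diagonal_power sc 2" by (simp only:)
    from ideal_uminus[OF I this] have "rep (dif (x j)) (\<lambda>i. if i = j then g else 0)"
      unfolding rep_def minus_diff_eq .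
    then have "c (x j) i = (if i = j then g else 0)" using rep_uniq[OF c _ ij(1)] by blast
    then show "pd i (x j) = (if i = j then 1 else 0)" using gF by (simp add: pd_def is_ring_homD[OF \<phi>])
  qed
qed

lemma dif_generators_hull:
  assumes sc: "algebra_over sc" and V: "\<And>c. dif c \<in> is_ideal hull (tensor_relations sc \<union> dif ` V)"
  shows "diagonal \<subseteq> is_ideal hull (tensor_relations sc \<union> dif ` V)"
  by (rule diagonal_subset_if_dif[OF is_ideal_hull, of sc]) (auto intro: hull_inc V)

text \<open>The product rule; consequently the differentials of algebra generators suffice to
  generate the diagonal.\<close>

lemma is_subalgebra_dif:
  assumes sc: "algebra_over sc" and J: "is_ideal J" "tensor_relations sc \<subseteq> J"
  shows "is_subalgebra sc {c. dif c \<in> J}"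
  unfolding is_subalgebra_def
proof (intro conjI ballI allI)
  have s: "dif (sc c 1) \<in> J" for c by (rule dif_scale_one_cong[OF J])
  show "1 \<in> {c. dif c \<in> J}" using s[of 1] by (simp add: algebra_scale_hom(1)[OF sc])
  show ab: "a * b \<in> {c. dif c \<in> J}" if "a \<in> {c. dif c \<in> J}" "b \<in> {c. dif c \<in> J}" for a b
    using that by (simp add: dif_mult ideal_add[OF J(1)] ideal_mult_left[OF J(1)])
  show "a + b \<in> {c. dif c \<in> J}" if "a \<in> {c. dif c \<in> J}" "b \<in> {c. dif c \<in> J}" for a b
    using ideal_add[OF J(1) dif_add_cong[OF J, of a b] ideal_add[OF J(1), of "dif a" "dif b"]] that by simp
  show "sc c a \<in> {c. dif c \<in> J}" if "a \<in> {c. dif c \<in> J}" for c a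
    using ab[of "sc c 1" a] s that by (simp add: algebra_scale_hom(7)[OF sc])
qed

section \<open>Localizations of coordinate rings\<close>

lemma differentials_basis:
  fixes sc :: "'k::field \<Rightarrow> 'r::comm_ring_1 \<Rightarrow> 'r"
  assumes basis: "differentials_form_basis sc d x"
  shows differentials_basis_ex:
    "\<And>\<tau>. \<tau> \<in> diagonal \<Longrightarrow> \<exists>c. \<tau> - (\<Sum>i\<in>{1..d}. pt (c i) 1 * dif (x i)) \<in> diagonal_power sc 2"
    and differentials_basis_unique:
    "\<And>c i. (\<Sum>i\<in>{1..d}. pt (c i) 1 * dif (x i)) \<in> diagonal_power sc 2 \<Longrightarrow> i \<in> {1..d} \<Longrightarrow> c i = 0"
proof -
  note I = is_ideal_diag_power[of sc 2] and rel = relations_diagonal_power[of sc 2]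
  let ?S = "\<lambda>c. \<Sum>i\<in>{1..d}. pt (c i) 1 * dif (x i)"
  have coset: "a +o diagonal_power sc 2 = b +o diagonal_power sc 2 \<longleftrightarrow> a - b \<in> diagonal_power sc 2" for a b
  proof
    assume eq: "a +o diagonal_power sc 2 = b +o diagonal_power sc 2"
    have "a \<in> a +o diagonal_power sc 2"
      using ideal_zero[OF I] by (auto simp: elt_set_plus_def intro!: bexI[of _ 0])
    then show "a - b \<in> diagonal_power sc 2" unfolding eq by (auto simp: elt_set_plus_def)
  next
    have sub: "a +o diagonal_power sc 2 \<subseteq> b +o diagonal_power sc 2" if "a - b \<in> diagonal_power sc 2" for a b
    proof
      fix z assume "z \<in> a +o diagonal_power sc 2"
      then obtain y where y: "y \<in> diagonal_power sc 2" "z = a + y" by (auto simp: elt_set_plus_def)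
      have "z = b + (a - b + y)" by (simp add: y(2))
      then show "z \<in> b +o diagonal_power sc 2"
        unfolding elt_set_plus_def using ideal_add[OF I that y(1)] by blast
    qed
    assume "a - b \<in> diagonal_power sc 2"
    moreover from this have "b - a \<in> diagonal_power sc 2" using ideal_uminus[OF I] by fastforce
    ultimately show "a +o diagonal_power sc 2 = b +o diagonal_power sc 2" using sub by blast
  qed
  have b: "\<exists>!c. c \<in> extensional {1..d} \<and> \<tau> - ?S c \<in> diagonal_power sc 2" if "\<tau> \<in> diagonal" for \<tau>
  proof -
    have "\<tau> +o diagonal_power sc 2 \<in> Omega sc" unfolding Omega_def using that by blast
    with basis show ?thesis
      unfolding differentials_form_basis_def coset[symmetric] dif_def by blast
  qed
  show "\<exists>c. \<tau> - ?S c \<in> diagonal_power sc 2" if "\<tau> \<in> diagonal" for \<tau> using b[OF that] by blast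
  fix c i assume c: "?S c \<in> diagonal_power sc 2" and i: "i \<in> {1..d}"
  have z: "?S (\<lambda>_. 0) \<in> diagonal_power sc 2"
    by (intro ideal_sum[OF I] ideal_mult_right[OF I] pt_zero_left_cong[OF I rel])
  have restr: "?S (restrict e {1..d}) = ?S e" for e by (rule sum.cong) auto
  have "0 - ?S (restrict c {1..d}) \<in> diagonal_power sc 2" "0 - ?S (restrict (\<lambda>_. 0) {1..d}) \<in> diagonal_power sc 2"
    unfolding restr using ideal_diff[OF I ideal_zero[OF I]] c z by blast+
  then have "restrict c {1..d} = restrict (\<lambda>_. 0) {1..d}"
    using b[OF ideal_zero[OF is_ideal_diagonal]] restrict_extensional by blast
  then have "restrict c {1..d} i = restrict (\<lambda>_. 0) {1..d} i" by simp
  then show "c i = 0" using i by simp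
qed

theorem coordinate_derivations_localization:
  fixes scA :: "'k::alg_closed_field \<Rightarrow> 'a::idom \<Rightarrow> 'a" and scR :: "'k \<Rightarrow> 'r::comm_ring_1 \<Rightarrow> 'r"
  assumes scA: "algebra_over scA" and fg: "finite G" "is_subalgebra scA hull G = UNIV"
    and sc: "algebra_over scR" and loc: "is_localization_of scA scR" and basis: "differentials_form_basis scR d x"
  shows "\<exists>H. coordinate_derivations scR d x H"
proof -
  obtain S \<phi> where S: "1 \<in> S" "0 \<notin> S" "\<forall>s\<in>S. \<forall>t\<in>S. s * t \<in> S"
      and bij: "bij_betw \<phi> UNIV (localization_set S)" and "\<phi> 1 = 1"
      and \<phi>_hom: "\<forall>x y. \<phi> (x + y) = \<phi> x + \<phi> y \<and> \<phi> (x * y) = \<phi> x * \<phi> y"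
      and \<phi>_sc: "\<forall>c x. \<phi> (scR c x) = Fract (scA c 1) 1 * \<phi> x"
    using loc unfolding is_localization_of_def by blast
  have \<phi>: "is_ring_hom \<phi>" using \<open>\<phi> 1 = 1\<close> \<phi>_hom by (simp add: is_ring_hom_def)
  note \<phi>d = is_ring_homD[OF \<phi>]
  have \<phi>_inj: "r = s" if "\<phi> r = \<phi> s" for r s using bij that by (auto simp: bij_betw_def inj_on_def)
  have inj: "r = 0" if "\<phi> r = 0" for r using \<phi>_inj[of r 0] that \<phi>d(4) by simp
  have "\<exists>r. \<phi> r = Fract a 1" for a
  proof -
    have "Fract a 1 \<in> localization_set S" unfolding localization_set_def using S(1) by blast
    then show ?thesis using bij by (metis bij_betw_imp_surj_on image_iff)
  qed
  then obtain \<iota> where \<iota>: "\<And>a. \<phi> (\<iota> a) = Fract a 1" by metis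
  have \<iota>_hom: "\<iota> (a + b) = \<iota> a + \<iota> b" "\<iota> (a * b) = \<iota> a * \<iota> b" "\<iota> 1 = 1" "\<iota> 0 = 0" "\<iota> (scA c a) = scR c (\<iota> a)" for a b c
  proof -
    show "\<iota> (a + b) = \<iota> a + \<iota> b" "\<iota> (a * b) = \<iota> a * \<iota> b" "\<iota> 1 = 1" "\<iota> 0 = 0"
      by (rule \<phi>_inj, simp add: \<iota> \<phi>d fract_collapse)+
    have "\<phi> (\<iota> (scA c a)) = Fract (scA c 1 * a) 1" unfolding \<iota> by (simp only: algebra_scale[OF scA, of c a])
    also have "\<dots> = \<phi> (scR c (\<iota> a))" by (simp add: \<phi>_sc \<iota>)
    finally show "\<iota> (scA c a) = scR c (\<iota> a)" by (rule \<phi>_inj)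
  qed
  have frac: "\<exists>a s u. s \<in> S \<and> r * \<iota> s = \<iota> a \<and> u * \<iota> s = 1" for r
  proof -
    have "\<phi> r \<in> localization_set S" using bij by (auto simp: bij_betw_def)
    then obtain a s where as: "\<phi> r = Fract a s" "s \<in> S" unfolding localization_set_def by blast
    have s0: "s \<noteq> 0" using S as by auto
    have "Fract 1 s \<in> localization_set S" unfolding localization_set_def using as by blast
    then obtain u where u: "\<phi> u = Fract 1 s" using bij by (metis bij_betw_imp_surj_on image_iff)
    have "r * \<iota> s = \<iota> a" by (rule \<phi>_inj) (simp add: \<phi>d \<iota> as s0 eq_fract)
    moreover have "u * \<iota> s = 1" by (rule \<phi>_inj) (simp add: \<phi>d \<iota> u s0 eq_fract One_fract_def)
    ultimately show ?thesis using as by blast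
  qed
  note b_ex = differentials_basis_ex[OF basis] and b_un = differentials_basis_unique[OF basis]
  have b_ex1: "\<exists>c. pt 1 1 * \<tau> - (\<Sum>i\<in>{1..d}. pt (c i) 1 * dif (x i)) \<in> diagonal_power scR 2" if "\<tau> \<in> diagonal" for \<tau>
    using b_ex[OF that] by (simp add: pt_one)
  have one_nz: "(1::'r) \<noteq> 0" using \<phi>d(1,4) by (metis zero_neq_one)
  obtain pd :: "nat \<Rightarrow> 'r \<Rightarrow> 'a fract" where pd:
    "\<And>i r s. i \<in> {1..d} \<Longrightarrow> pd i (r + s) = pd i r + pd i s"
    "\<And>i r s. i \<in> {1..d} \<Longrightarrow> pd i (r * s) = \<phi> r * pd i s + \<phi> s * pd i r"
    "\<And>i c. i \<in> {1..d} \<Longrightarrow> pd i (scR c 1) = 0"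
    "\<And>i j. i \<in> {1..d} \<Longrightarrow> j \<in> {1..d} \<Longrightarrow> pd i (x j) = (if i = j then 1 else 0)"
  proof (rule partial_derivatives[where A = "{1..d}" and x = x and g = 1 and sc = scR and \<phi> = \<phi>])
    show "c i = 0" if "(\<Sum>i\<in>{1..d}. pt (c i) 1 * dif (x i)) \<in> diagonal_power scR 2" "i \<in> {1..d}" for c i
      by (rule b_un[OF that])
  qed (rule sc \<phi> finite_atLeastAtMost one_nz | erule inj b_ex1 | (rule that; assumption))+
  have "\<exists>D. is_derivation D \<and> (\<forall>a. D (Fract a 1) = pd i (\<iota> a))" if i: "i \<in> {1..d}" for i
  proof -
    obtain D where "is_derivation D" "\<And>a. D (Fract a 1) = pd i (\<iota> a)"
      by (rule derivation_extends_to_fract[of "\<lambda>a. pd i (\<iota> a)"])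
        (simp_all add: \<iota>_hom pd(1,2)[OF i] \<iota>)
    then show ?thesis by blast
  qed
  then obtain D where D: "\<And>i. i \<in> {1..d} \<Longrightarrow> is_derivation (D i)"
      "\<And>i a. i \<in> {1..d} \<Longrightarrow> D i (Fract a 1) = pd i (\<iota> a)" by metis
  \<comment> \<open>The extension was made from \<open>A\<close>; that it agrees with
    \<open>pd\<close> on all of \<open>R\<close> follows by clearing the denominator
    \<open>s\<close>.\<close>
  have D\<phi>: "D i (\<phi> r) = pd i r" if i: "i \<in> {1..d}" for i r
  proof -
    obtain a s u where as: "s \<in> S" "r * \<iota> s = \<iota> a" using frac by blast
    have s0: "\<phi> (\<iota> s) \<noteq> 0" unfolding \<iota> using as(1) S(2) by (auto simp: Zero_fract_def eq_fract)
    have "D i (\<phi> r * \<phi> (\<iota> s)) = pd i (r * \<iota> s)"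
      unfolding \<phi>d(3)[symmetric] as(2) unfolding \<iota> by (rule D(2)[OF i])
    moreover have "D i (\<phi> (\<iota> s)) = pd i (\<iota> s)" by (simp add: \<iota> D(2)[OF i])
    ultimately have "\<phi> (\<iota> s) * D i (\<phi> r) = \<phi> (\<iota> s) * pd i r"
      by (simp add: is_derivationD(2)[OF D(1)[OF i]] pd(2)[OF i])
    then show ?thesis using s0 by simp
  qed
  let ?V = "\<iota> ` G"
  let ?J = "is_ideal hull (tensor_relations scR \<union> dif ` ?V)"
  have J: "is_ideal ?J" "tensor_relations scR \<subseteq> ?J" by (auto intro: is_ideal_hull hull_inc)
  note sub = is_subalgebra_dif[OF sc J]
  have "is_subalgebra scA {a. dif (\<iota> a) \<in> ?J}"
    using sub \<iota>_hom by (auto simp: is_subalgebra_def)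
  then have "is_subalgebra scA hull G \<subseteq> {a. dif (\<iota> a) \<in> ?J}"
    by (rule hull_minimal[rotated]) (auto intro: hull_inc)
  then have dif_\<iota>: "dif (\<iota> a) \<in> ?J" for a using fg(2) by blast
  have "dif r \<in> ?J" for r
  proof -
    obtain a s u where as: "r * \<iota> s = \<iota> a" "u * \<iota> s = 1" using frac by blast
    \<comment> \<open>Differentiating \<open>u * \<iota> s = 1\<close> expresses the differential of
      \<open>u\<close> through that of \<open>\<iota> s\<close>.\<close>
    have "dif (u * \<iota> s) \<in> ?J" using sub as(2) by (simp add: is_subalgebra_def)
    then have "pt 1 (\<iota> s) * dif u \<in> ?J"
      using ideal_diff[OF J(1) _ ideal_mult_left[OF J(1) dif_\<iota>, of "pt u 1" s], of "dif (u * \<iota> s)"]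
      by (simp add: dif_mult)
    then have "pt 1 u * (pt 1 (\<iota> s) * dif u) \<in> ?J" by (rule ideal_mult_left[OF J(1)])
    then have "dif u \<in> ?J" using as(2) by (simp add: pt_mult pt_one flip: mult.assoc)
    moreover have "r = \<iota> a * u" using as by (metis mult.assoc mult.commute mult_1)
    ultimately show ?thesis using dif_\<iota>[of a] sub unfolding is_subalgebra_def by blast
  qed
  then have diag: "diagonal \<subseteq> ?J" by (rule dif_generators_hull[OF sc])
  have gen: "\<tau> \<in> coord_ideal scR x {1..d} 2" if \<tau>: "\<tau> \<in> diagonal" for \<tau>
  proof -
    note I = is_ideal_coord_ideal[of scR x "{1..d}" 2]
    obtain c where c: "\<tau> - (\<Sum>i\<in>{1..d}. pt (c i) 1 * dif (x i)) \<in> diagonal_power scR 2" using b_ex[OF \<tau>] by blast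
    have "(\<Sum>i\<in>{1..d}. pt (c i) 1 * dif (x i)) \<in> coord_ideal scR x {1..d} 2"
      by (intro ideal_sum[OF I] ideal_mult_left[OF I] coord_ideal_generators(2))
    from ideal_add[OF I _ this] c coord_ideal_generators(1)[of scR 2 x "{1..d}"] show ?thesis by force
  qed
  obtain E l where E: "mult_map E = 1 ^ l" "\<And>\<tau>. \<tau> \<in> diagonal \<Longrightarrow> E * \<tau> \<in> differential_ideal scR x {1..d}"
  proof (rule separability_element[OF sc _ diag, of 1 x "{1..d}"])
    show "pt 1 1 * dif v \<in> coord_ideal scR x {1..d} 2" for v :: 'r using gen[OF dif_diagonal, of v] by (simp add: pt_one)
  qed (use fg(1) that in auto)
  interpret etale_coordinates scR \<phi> x "{1..d}" D E l
  proof
    show "D i (\<phi> (scR c 1)) = 0" if "i \<in> {1..d}" for i c using D\<phi>[OF that] pd(3)[OF that] by simp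
    show "D i (\<phi> (x j)) = (if i = j then 1 else 0)" if "i \<in> {1..d}" "j \<in> {1..d}" for i j
      using D\<phi>[OF that(1)] pd(4)[OF that] by simp
  qed (use sc \<phi> inj D(1) one_nz E gen in auto)
  \<comment> \<open>The elements of \<open>A\<close> that \<open>x i ^ n\<close> moves into the
    multiples of \<open>w\<close> form an ascending chain of ideals. The chain condition of
    \<open>A\<close> reaches \<open>R\<close> because denominators are units there.\<close>
  have stable: "\<exists>M. \<forall>b. w dvd x i ^ Suc M * b \<longrightarrow> w dvd x i ^ M * b" for i w
  proof -
    define Q where "Q n = {a. w dvd x i ^ n * \<iota> a}" for n
    have "is_ideal (Q n) \<and> Q n \<subseteq> Q (Suc n)" for n
      unfolding Q_def by (auto intro!: is_idealI simp: \<iota>_hom distrib_left mult.left_commute mult.assoc)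
    moreover have "acc_ideals (UNIV :: 'a set)" using acc_ideals_finitely_generated[OF scA fg(1)] fg(2) by simp
    ultimately obtain M where M: "\<forall>n\<ge>M. Q n = Q M" unfolding acc_ideals_def by meson
    have "w dvd x i ^ M * b" if "w dvd x i ^ Suc M * b" for b
    proof -
      obtain a s u where as: "b * \<iota> s = \<iota> a" "u * \<iota> s = 1" using frac by blast
      have "w dvd (x i ^ Suc M * b) * \<iota> s" using that by (rule dvd_mult2)
      then have "a \<in> Q (Suc M)" using as(1) by (simp only: Q_def mem_Collect_eq mult.assoc)
      then have "a \<in> Q M" using M[rule_format, of "Suc M"] by simp
      then have "w dvd x i ^ M * \<iota> a" by (simp only: Q_def mem_Collect_eq)
      then have "w dvd (x i ^ M * \<iota> a) * u" by (rule dvd_mult2)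
      moreover have "\<iota> a * u = b" using as by (metis mult.assoc mult.commute mult_1)
      ultimately show ?thesis by (simp only: mult.assoc)
    qed
    then show ?thesis by blast
  qed
  \<comment> \<open>Iterating \<open>step\<close> makes \<open>f\<close> congruent to a multiple
    \<open>x i ^ n * b\<close> modulo \<open>w\<close> for each \<open>n\<close>. At the stable
    exponent \<open>M\<close>, vanishing of \<open>x i * f\<close> modulo \<open>w\<close> forces
    that of \<open>x i ^ M * b\<close>, hence of \<open>f\<close>.\<close>
  have colon: "w dvd f" if i: "i \<in> {1..d}" and w: "\<And>n z. coefficient i n (w * z) = w * coefficient i n z"
      and dvd: "w dvd x i * f" for i w f
  proof -
    obtain M where M: "\<And>b. w dvd x i ^ Suc M * b \<Longrightarrow> w dvd x i ^ M * b" using stable by blast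
    have step: "\<exists>b'. w dvd b - x i * b'" if "w dvd x i ^ n * b" for n b
      using higher_derivation_colon[OF higher_derivation_coefficient[OF i] coefficient_coordinate_same[OF i] w that] .
    have "\<exists>b. w dvd f - x i ^ n * b" for n
    proof (induction n)
      case 0
      show ?case by (intro exI[of _ f]) simp
    next
      case (Suc n)
      then obtain b where b: "w dvd f - x i ^ n * b" by blast
      have "w dvd x i * f - x i * (f - x i ^ n * b)" by (rule dvd_diff[OF dvd dvd_mult[OF b]])
      then have "w dvd x i ^ Suc n * b" by (simp add: algebra_simps)
      then obtain b' where b': "w dvd b - x i * b'" using step by blast
      have "w dvd (f - x i ^ n * b) + x i ^ n * (b - x i * b')" by (rule dvd_add[OF b dvd_mult[OF b']])
      then have "w dvd f - x i ^ Suc n * b'" by (simp add: algebra_simps)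
      then show ?case by blast
    qed
    then obtain b where b: "w dvd f - x i ^ M * b" by blast
    have "w dvd x i * f - x i * (f - x i ^ M * b)" by (rule dvd_diff[OF dvd dvd_mult[OF b]])
    then have "w dvd x i ^ Suc M * b" by (simp add: algebra_simps)
    then have "w dvd x i ^ M * b" by (rule M)
    then have "w dvd (f - x i ^ M * b) + x i ^ M * b" using b by (intro dvd_add)
    then show ?thesis by simp
  qed
  have "coordinate_derivations scR d x coefficient"
  proof
    show "coefficient i n (scR c r) = scR c (coefficient i n r)" if "i \<in> {1..d}" for i n c r
      by (rule coefficient_scale[OF that])
    show "\<delta> r = 0" if "diff_op scR (\<lambda>x. x) n \<delta>" "\<And>i r. i \<in> {1..d} \<Longrightarrow> \<delta> (x i * r) = x i * \<delta> r" "\<delta> 1 = 0" for n \<delta> r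
      using that by (rule operator_zero)
    show "w dvd f" if "i \<in> {1..d}" "\<And>n z. coefficient i n (w * z) = w * coefficient i n z" "w dvd x i * f" for i w f
      using that by (rule colon)
  qed (rule sc | erule higher_derivation_coefficient | erule (1) coefficient_coordinate_same
      | erule (3) coefficient_coordinate_other)+
  then show ?thesis by blast
qed


section \<open>Rational points of maximal ideals\<close>

lemma maximal_ideal_facts:
  assumes "maximal_in (UNIV :: 'a::comm_ring_1 set) m"
  shows "is_ideal m" "1 \<notin> m" "a * b \<in> m \<Longrightarrow> a \<in> m \<or> b \<in> m" "a \<notin> m \<Longrightarrow> \<exists>r. 1 - r * a \<in> m"
proof -
  show m: "is_ideal m" using assms by (simp add: maximal_in_def)
  show one: "1 \<notin> m"
  proof
    assume "1 \<in> m"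
    then have "r \<in> m" for r using ideal_mult_left[OF m, of 1 r] by simp
    then show False using assms by (auto simp: maximal_in_def)
  qed
  show inv: "\<exists>r. 1 - r * a \<in> m" if "a \<notin> m" for a
  proof -
    have "m \<subseteq> is_ideal hull (insert a m)" "a \<in> is_ideal hull (insert a m)" by (auto intro: hull_inc)
    then have "is_ideal hull (insert a m) = UNIV"
      using assms is_ideal_hull[of "insert a m"] that unfolding maximal_in_def by blast
    moreover have "is_ideal hull m = m" using hull_same[of is_ideal, OF m] .
    ultimately obtain r y where "1 = r * a + y" "y \<in> m" unfolding is_ideal_hull_insert by blast
    then have "1 - r * a = y" by (metis add_diff_cancel_left')
    then show ?thesis using \<open>y \<in> m\<close> by blast
  qed
  show "a * b \<in> m \<Longrightarrow> a \<in> m \<or> b \<in> m"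
  proof (rule disjCI)
    assume ab: "a * b \<in> m" and "b \<notin> m"
    then obtain r where "1 - r * b \<in> m" using inv by blast
    from ideal_add[OF m ideal_mult_left[OF m this, of a] ideal_mult_left[OF m ab, of r]]
    show "a \<in> m" by (simp add: algebra_simps)
  qed
qed

text \<open>A homomorphism of algebras from \<open>B\<close> to the ground field that vanishes on
  \<open>B \<inter> m\<close>, as a map on the whole ring whose values count only on
  \<open>B\<close>.\<close>

definition rational_point :: "('k \<Rightarrow> 'a \<Rightarrow> 'a) \<Rightarrow> 'a set \<Rightarrow> 'a::comm_ring_1 set \<Rightarrow> ('a \<Rightarrow> 'k::field) \<Rightarrow> bool" where
  "rational_point sc m B \<psi> \<longleftrightarrow> (\<forall>a\<in>B. \<forall>b\<in>B. \<psi> (a + b) = \<psi> a + \<psi> b \<and> \<psi> (a * b) = \<psi> a * \<psi> b) \<and>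
     (\<forall>c. \<psi> (sc c 1) = c) \<and> (\<forall>b\<in>B \<inter> m. \<psi> b = 0)"

definition polys_over :: "'a::comm_ring_1 set \<Rightarrow> 'a poly set" where
  "polys_over B = {p. \<forall>i. coeff p i \<in> B}"

lemma polys_overI: "(\<And>i. coeff p i \<in> B) \<Longrightarrow> p \<in> polys_over B"
  by (simp add: polys_over_def)

lemma polys_overD: "p \<in> polys_over B \<Longrightarrow> coeff p i \<in> B"
  by (simp add: polys_over_def)

lemma adjoin_eq_poly:
  assumes "is_subring B"
  shows "adjoin B v = {poly p v | p. p \<in> polys_over B}"
proof
  show "{poly p v | p. p \<in> polys_over B} \<subseteq> adjoin B v"
    by (auto simp: poly_altdef polys_over_def intro: adjoinI)
  show "adjoin B v \<subseteq> {poly p v | p. p \<in> polys_over B}"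
  proof
    fix a assume "a \<in> adjoin B v"
    then obtain i c where c: "a = (\<Sum>l\<le>i. c l * v ^ l)" "\<forall>l. c l \<in> B" unfolding adjoin_def by blast
    define p where "p = (\<Sum>l\<le>i. monom (c l) l)"
    have "coeff p j = (if j \<le> i then c j else 0)" for j
      by (simp add: p_def coeff_sum coeff_monom sum.delta cong: if_cong)
    then have "p \<in> polys_over B" using c(2) is_subringD(2)[OF assms] by (auto intro: polys_overI)
    moreover have "poly p v = a" by (simp add: p_def c(1) poly_sum poly_monom)
    ultimately show "a \<in> {poly p v | p. p \<in> polys_over B}" by blast
  qed
qed

context
  fixes B :: "'a::idom set"
  assumes B: "is_subring B"
begin

lemma polys_over_closed:
  shows "p \<in> polys_over B \<Longrightarrow> q \<in> polys_over B \<Longrightarrow> p + q \<in> polys_over B"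
    "p \<in> polys_over B \<Longrightarrow> q \<in> polys_over B \<Longrightarrow> p - q \<in> polys_over B"
    "p \<in> polys_over B \<Longrightarrow> q \<in> polys_over B \<Longrightarrow> p * q \<in> polys_over B"
    "c \<in> B \<Longrightarrow> p \<in> polys_over B \<Longrightarrow> smult c p \<in> polys_over B"
    "c \<in> B \<Longrightarrow> monom c n \<in> polys_over B" "0 \<in> polys_over B" "1 \<in> polys_over B"
  using is_subringD[OF B]
  by (auto simp: polys_over_def coeff_mult coeff_monom coeff_1 intro!: is_subringD(8)[OF B])

lemma pseudo_division_over:
  assumes "g \<in> polys_over B" "g \<noteq> 0" "f \<in> polys_over B"
  shows "\<exists>s q r. q \<in> polys_over B \<and> r \<in> polys_over B \<and> smult (lead_coeff g ^ s) f = q * g + r \<and>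
    (r = 0 \<or> degree r < degree g)"
  using assms(3)
proof (induction "degree f" arbitrary: f rule: less_induct)
  case less
  note cl = polys_over_closed
  show ?case
  proof (cases "f = 0 \<or> degree f < degree g")
    case True
    then show ?thesis using less.prems cl(6) by (intro exI[of _ 0] exI[of _ f]) auto
  next
    case False
    define t where "t = monom (lead_coeff f) (degree f - degree g)"
    define f1 where "f1 = smult (lead_coeff g) f - t * g"
    have t: "t \<in> polys_over B" unfolding t_def by (rule cl(5)) (rule polys_overD[OF less.prems])
    have lg: "lead_coeff g \<in> B" by (rule polys_overD[OF assms(1)])
    have f1: "f1 \<in> polys_over B" unfolding f1_def using cl(2,3,4) t lg assms(1) less.prems by blast
    have "t \<noteq> 0" using False by (simp add: t_def monom_eq_0_iff)
    have deg_t: "degree (t * g) = degree f"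
      using \<open>t \<noteq> 0\<close> assms(2) False by (simp add: degree_mult_eq t_def degree_monom_eq)
    have lead: "coeff (t * g) (degree f) = lead_coeff f * lead_coeff g"
    proof -
      have t: "lead_coeff t = lead_coeff f" using False by (simp add: t_def degree_monom_eq)
      show ?thesis using lead_coeff_mult[of t g] unfolding deg_t t .
    qed
    show ?thesis
    proof (cases "f1 = 0")
      case True
      then have "smult (lead_coeff g ^ 1) f = t * g + 0" by (simp add: f1_def)
      then show ?thesis using t cl(6) by blast
    next
      case nz: False
      have "degree f1 \<le> degree f" unfolding f1_def
        using deg_t by (intro degree_diff_le) (auto simp: degree_smult_le)
      moreover have "coeff f1 (degree f) = 0" unfolding f1_def coeff_diff coeff_smult lead by (simp add: mult.commute)
      ultimately have d: "degree f1 < degree f"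
        using nz by (metis le_neq_implies_less leading_coeff_0_iff)
      obtain s q r where sqr: "q \<in> polys_over B" "r \<in> polys_over B"
          "smult (lead_coeff g ^ s) f1 = q * g + r" "r = 0 \<or> degree r < degree g"
        using less.hyps[OF d f1] by blast
      have "smult (lead_coeff g ^ Suc s) f = smult (lead_coeff g ^ s) (f1 + t * g)"
        by (simp add: f1_def mult.commute)
      also have "\<dots> = (q + smult (lead_coeff g ^ s) t) * g + r"
        unfolding smult_add_right sqr(3) by (simp add: algebra_simps)
      finally have "smult (lead_coeff g ^ Suc s) f = (q + smult (lead_coeff g ^ s) t) * g + r" .
      moreover have "q + smult (lead_coeff g ^ s) t \<in> polys_over B"
        using sqr(1) t lg cl(1,4) is_subringD(7)[OF B] by blast
      ultimately show ?thesis using sqr(2,4) by blast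
    qed
  qed
qed

end

context
  fixes sc :: "'k::alg_closed_field \<Rightarrow> 'a::idom \<Rightarrow> 'a" and m :: "'a set"
  assumes sc: "algebra_over sc" and m: "is_ideal m" and one: "1 \<notin> m"
    and prime: "\<And>a b. a * b \<in> m \<Longrightarrow> a \<in> m \<or> b \<in> m"
begin

lemma poly_coeffs_in_ideal: "(\<And>i. coeff p i \<in> m) \<Longrightarrow> poly p v \<in> m"
  unfolding poly_altdef by (intro ideal_sum[OF m] ideal_mult_right[OF m])

lemma rational_pointD:
  assumes B: "is_subalgebra sc B" and \<psi>: "rational_point sc m B \<psi>"
  shows "a \<in> B \<Longrightarrow> b \<in> B \<Longrightarrow> \<psi> (a + b) = \<psi> a + \<psi> b" "a \<in> B \<Longrightarrow> b \<in> B \<Longrightarrow> \<psi> (a * b) = \<psi> a * \<psi> b"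
    "\<psi> (sc c 1) = c" "b \<in> B \<Longrightarrow> b \<in> m \<Longrightarrow> \<psi> b = 0" "\<psi> 0 = 0" "\<psi> 1 = 1"
    "a \<in> B \<Longrightarrow> b \<in> B \<Longrightarrow> \<psi> (a - b) = \<psi> a - \<psi> b" "a \<in> B \<Longrightarrow> \<psi> (a ^ n) = \<psi> a ^ n"
    "(\<And>i. i \<in> S \<Longrightarrow> f i \<in> B) \<Longrightarrow> \<psi> (sum f S) = (\<Sum>i\<in>S. \<psi> (f i))"
proof -
  note Bd = is_subringD[OF subalgebra_subring[OF sc B]]
  show 1: "a \<in> B \<Longrightarrow> b \<in> B \<Longrightarrow> \<psi> (a + b) = \<psi> a + \<psi> b" "a \<in> B \<Longrightarrow> b \<in> B \<Longrightarrow> \<psi> (a * b) = \<psi> a * \<psi> b"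
    "\<psi> (sc c 1) = c" "b \<in> B \<Longrightarrow> b \<in> m \<Longrightarrow> \<psi> b = 0" for a b c
    using \<psi> by (auto simp: rational_point_def)
  show 0: "\<psi> 0 = 0" using 1(3)[of 0] by (simp add: algebra_scale_hom[OF sc])
  show one: "\<psi> 1 = 1" using 1(3)[of 1] by (simp add: algebra_scale_hom[OF sc])
  show "\<psi> (a - b) = \<psi> a - \<psi> b" if "a \<in> B" "b \<in> B"
    using 1(1)[of "a - b" b] that Bd(3) by (simp add: algebra_simps)
  show "\<psi> (a ^ n) = \<psi> a ^ n" if "a \<in> B" using that by (induction n) (simp_all add: one 1(2) Bd(7))
  show "\<psi> (sum f S) = (\<Sum>i\<in>S. \<psi> (f i))" if "\<And>i. i \<in> S \<Longrightarrow> f i \<in> B"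
    using that by (induction S rule: infinite_finite_induct) (simp_all add: 0 1(1) Bd(8))
qed

context
  fixes B :: "'a set" and v :: 'a
  assumes B: "is_subalgebra sc B"
begin

lemma map_poly_point:
  assumes \<psi>: "rational_point sc m B \<psi>" and "p \<in> polys_over B" "q \<in> polys_over B"
  shows "map_poly \<psi> (p + q) = map_poly \<psi> p + map_poly \<psi> q" "map_poly \<psi> (p - q) = map_poly \<psi> p - map_poly \<psi> q"
    "map_poly \<psi> (p * q) = map_poly \<psi> p * map_poly \<psi> q"
proof -
  note \<psi>d = rational_pointD[OF B \<psi>] and Bd = is_subringD[OF subalgebra_subring[OF sc B]]
  have c: "coeff p i \<in> B" "coeff q i \<in> B" for i using assms polys_overD by blast+
  show "map_poly \<psi> (p + q) = map_poly \<psi> p + map_poly \<psi> q" "map_poly \<psi> (p - q) = map_poly \<psi> p - map_poly \<psi> q"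
    by (simp_all add: poly_eq_iff coeff_map_poly \<psi>d c)
  show "map_poly \<psi> (p * q) = map_poly \<psi> p * map_poly \<psi> q"
    by (simp add: poly_eq_iff coeff_map_poly \<psi>d(5) coeff_mult \<psi>d(9) \<psi>d(2) c Bd(4))
qed

text \<open>By \<open>van\<close>, every polynomial relation of \<open>v\<close> modulo
  \<open>m\<close> holds at \<open>\<tau>\<close>; so evaluation at \<open>\<tau>\<close> does not
  depend on the polynomial that represents an element of \<open>adjoin B v\<close>.\<close>

lemma rational_point_extend:
  assumes \<psi>: "rational_point sc m B \<psi>"
    and van: "\<And>p. p \<in> polys_over B \<Longrightarrow> poly p v \<in> m \<Longrightarrow> poly (map_poly \<psi> p) \<tau> = 0"
  obtains \<psi>' where "rational_point sc m (adjoin B v) \<psi>'" "\<And>b. b \<in> B \<Longrightarrow> \<psi>' b = \<psi> b"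
    "\<And>p. p \<in> polys_over B \<Longrightarrow> \<psi>' (poly p v) = poly (map_poly \<psi> p) \<tau>"
proof -
  note \<psi>d = rational_pointD[OF B \<psi>]
  note R = subalgebra_subring[OF sc B] and cl = polys_over_closed[OF subalgebra_subring[OF sc B]]
  define \<psi>' where "\<psi>' a = poly (map_poly \<psi> (SOME p. p \<in> polys_over B \<and> poly p v = a)) \<tau>" for a
  have eq: "\<psi>' (poly p v) = poly (map_poly \<psi> p) \<tau>" if p: "p \<in> polys_over B" for p
  proof -
    let ?q = "SOME q. q \<in> polys_over B \<and> poly q v = poly p v"
    have q: "?q \<in> polys_over B \<and> poly ?q v = poly p v" by (rule someI[of "\<lambda>q. q \<in> polys_over B \<and> poly q v = poly p v" p]) (simp add: p)
    then have "poly (map_poly \<psi> (?q - p)) \<tau> = 0"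
      using p by (intro van cl(2)) (auto simp: ideal_zero[OF m])
    then show ?thesis using q p by (simp add: map_poly_point[OF \<psi>] \<psi>'_def)
  qed
  have const: "\<psi>' b = \<psi> b" if b: "b \<in> B" for b
  proof -
    have "[:b:] \<in> polys_over B" using cl(5)[OF b, of 0] by (simp add: monom_0)
    from eq[OF this] show ?thesis by (simp add: map_poly_pCons \<psi>d(5))
  qed
  have "rational_point sc m (adjoin B v) \<psi>'"
    unfolding rational_point_def adjoin_eq_poly[OF R]
  proof (intro conjI ballI allI)
    fix a b assume "a \<in> {poly p v |p. p \<in> polys_over B}" "b \<in> {poly p v |p. p \<in> polys_over B}"
    then obtain p q where pq: "a = poly p v" "b = poly q v" "p \<in> polys_over B" "q \<in> polys_over B" by blast
    show "\<psi>' (a + b) = \<psi>' a + \<psi>' b"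
      using eq[OF cl(1)[OF pq(3,4)]] by (simp add: pq eq map_poly_point[OF \<psi>])
    show "\<psi>' (a * b) = \<psi>' a * \<psi>' b"
      using eq[OF cl(3)[OF pq(3,4)]] by (simp add: pq eq map_poly_point[OF \<psi>])
  next
    fix c show "\<psi>' (sc c 1) = c" using const[of "sc c 1"] B \<psi>d(3) by (simp add: is_subalgebra_def)
  next
    fix b assume "b \<in> {poly p v |p. p \<in> polys_over B} \<inter> m"
    then show "\<psi>' b = 0" using eq van by auto
  qed
  then show thesis using const eq that by blast
qed

text \<open>The induction step of the Nullstellensatz, carried out modulo the prime \<open>m\<close>
  without forming the quotient. The element \<open>c\<close> is a coefficient of \<open>c'\<close>
  if \<open>v\<close> is transcendental modulo \<open>m\<close>; otherwise it is the leading
  coefficient of a minimal relation of \<open>v\<close> times an element of \<open>B\<close> that is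
  a multiple of \<open>c'\<close> modulo \<open>m\<close>.\<close>

lemma rational_point_extend_nonvanishing:
  assumes c': "c' \<in> adjoin B v" "c' \<notin> m"
  shows "\<exists>c\<in>B. c \<notin> m \<and> (\<forall>\<psi>. rational_point sc m B \<psi> \<and> \<psi> c \<noteq> 0 \<longrightarrow>
    (\<exists>\<psi>'. rational_point sc m (adjoin B v) \<psi>' \<and> \<psi>' c' \<noteq> 0))"
proof -
  note R = subalgebra_subring[OF sc B] and cl = polys_over_closed[OF subalgebra_subring[OF sc B]]
  note Rd = is_subringD[OF R]
  define null where "null p \<longleftrightarrow> (\<forall>i. coeff p i \<in> m)" for p :: "'a poly"
  have null_map: "map_poly \<psi> p = 0" if "rational_point sc m B \<psi>" "p \<in> polys_over B" "null p" for \<psi> p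
    using that rational_pointD(4,5)[OF B that(1)] polys_overD[OF that(2)]
    by (simp add: poly_eq_iff coeff_map_poly null_def)
  have null_poly: "poly p v \<in> m" if "null p" for p
    using poly_coeffs_in_ideal that by (simp add: null_def)
  obtain f where f: "f \<in> polys_over B" "poly f v = c'" using c'(1) unfolding adjoin_eq_poly[OF R] by blast
  show ?thesis
  proof (cases "\<forall>p\<in>polys_over B. poly p v \<in> m \<longrightarrow> null p")
    case True
    have "\<not> null f" using null_poly[of f] c'(2) f(2) by blast
    then obtain i where i: "coeff f i \<notin> m" by (auto simp: null_def)
    have "\<exists>\<psi>'. rational_point sc m (adjoin B v) \<psi>' \<and> \<psi>' c' \<noteq> 0"
      if \<psi>: "rational_point sc m B \<psi>" and nz: "\<psi> (coeff f i) \<noteq> 0" for \<psi>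
    proof -
      let ?q = "map_poly \<psi> f"
      have "coeff ?q i \<noteq> 0" using nz by (simp add: coeff_map_poly rational_pointD(5)[OF B \<psi>])
      then have q: "?q \<noteq> 0" by auto
      \<comment> \<open>\<open>pCons (- 1) ?q\<close> is \<open>X * ?q - 1\<close>; at a root of it
        the value of \<open>?q\<close> is invertible.\<close>
      then have "degree (pCons (- 1) ?q) > 0" by simp
      then obtain \<tau> where "poly (pCons (- 1) ?q) \<tau> = 0" using alg_closed_imp_poly_has_root by blast
      then have \<tau>: "poly ?q \<tau> \<noteq> 0" by auto
      obtain \<psi>' where "rational_point sc m (adjoin B v) \<psi>'"
          "\<And>p. p \<in> polys_over B \<Longrightarrow> \<psi>' (poly p v) = poly (map_poly \<psi> p) \<tau>"
        by (rule rational_point_extend[OF \<psi>, of \<tau>]) (use True null_map[OF \<psi>] in auto)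
      then show ?thesis using \<tau> f by metis
    qed
    then show ?thesis using i polys_overD[OF f(1)] by blast
  next
    case False
    define van where "van p \<longleftrightarrow> p \<in> polys_over B \<and> poly p v \<in> m \<and> \<not> null p" for p
    \<comment> \<open>Dropping the coefficients in \<open>m\<close> does not change values modulo
      \<open>m\<close> and leaves a leading coefficient outside \<open>m\<close>.\<close>
    have clean: "\<exists>p'\<in>polys_over B. degree p' \<le> degree p \<and> null (p - p') \<and> (p' = 0 \<or> lead_coeff p' \<notin> m)"
      if p: "p \<in> polys_over B" for p
    proof -
      let ?h = "\<lambda>c. if c \<in> m then 0 else c"
      let ?p = "map_poly ?h p"
      have co: "coeff ?p i = ?h (coeff p i)" for i by (rule coeff_map_poly) simp
      have "?p \<in> polys_over B" using polys_overD[OF p] Rd(2) by (auto simp: co intro: polys_overI)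
      moreover have "null (p - ?p)" by (auto simp: null_def co ideal_zero[OF m])
      moreover have "lead_coeff ?p \<notin> m" if "?p \<noteq> 0"
      proof
        assume "lead_coeff ?p \<in> m"
        moreover have "lead_coeff ?p \<noteq> 0" using that by (simp only: leading_coeff_0_iff not_False_eq_True)
        ultimately show False using co[of "degree ?p"] by (auto split: if_splits)
      qed
      moreover have "degree ?p \<le> degree p" by (rule degree_le) (simp add: co coeff_eq_0)
      ultimately show ?thesis by blast
    qed
    have clean_val: "poly p v \<in> m \<longleftrightarrow> poly p' v \<in> m" if "null (p - p')" for p p'
      using null_poly[OF that] ideal_add_cancel[OF m, of "poly (p - p') v" "poly p' v"] by simp
    have "\<exists>p. van p" using False by (auto simp: van_def)
    then obtain b0 where b0: "van b0" "\<And>p. van p \<Longrightarrow> degree b0 \<le> degree p"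
      using ex_has_least_nat[of van _ degree] by blast
    obtain b where b: "b \<in> polys_over B" "degree b \<le> degree b0" "null (b0 - b)" "b = 0 \<or> lead_coeff b \<notin> m"
      using clean[of b0] b0(1) by (auto simp: van_def)
    have bv: "poly b v \<in> m" using clean_val[OF b(3)] b0(1) by (auto simp: van_def)
    have b_nz: "b \<noteq> 0" using b(3) b0(1) by (auto simp: van_def)
    then have lb: "lead_coeff b \<notin> m" "lead_coeff b \<in> B" using b(4) polys_overD[OF b(1)] by auto
    have min: "null p" if "p \<in> polys_over B" "poly p v \<in> m" "degree p < degree b" for p
      using b0(2)[of p] that b(2) by (auto simp: van_def)
    have deg_b: "degree b > 0"
    proof (rule ccontr)
      assume "\<not> degree b > 0"
      then have "poly b v = lead_coeff b" by (auto elim!: degree_eq_zeroE)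
      then show False using bv lb(1) by simp
    qed
    have lpow: "a ^ s \<notin> m" if "a \<notin> m" for a s
      by (induction s) (use one prime that in auto)
    \<comment> \<open>Euclid's algorithm with pseudo-division, by descent on the degree:
      \<open>f\<close> is inverted modulo the minimal relation up to an element \<open>a\<close> of
      \<open>B\<close> outside \<open>m\<close>.\<close>
    have bezout: "\<exists>p\<in>polys_over B. \<exists>a\<in>B. a \<notin> m \<and> poly p v * poly f v - a \<in> m"
      if "f \<in> polys_over B" "poly f v \<notin> m" for f
      using that
    proof (induction "degree f" arbitrary: f rule: less_induct)
      case less
      obtain g where g: "g \<in> polys_over B" "degree g \<le> degree f" "null (f - g)" "g = 0 \<or> lead_coeff g \<notin> m"
        using clean[OF less.prems(1)] by blast
      have gv: "poly g v \<notin> m" using clean_val[OF g(3)] less.prems(2) by blast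
      have g_nz: "g \<noteq> 0" using gv ideal_zero[OF m] by auto
      then have lg: "lead_coeff g \<notin> m" "lead_coeff g \<in> B" using g(4) polys_overD[OF g(1)] by auto
      have to_f: ?case if "p \<in> polys_over B" "a \<in> B" "a \<notin> m" "poly p v * poly g v - a \<in> m" for p a
      proof -
        have "poly p v * poly (f - g) v + (poly p v * poly g v - a) \<in> m"
          by (rule ideal_add[OF m ideal_mult_left[OF m null_poly[OF g(3)]] that(4)])
        moreover have "poly p v * poly (f - g) v + (poly p v * poly g v - a) = poly p v * poly f v - a"
          by (simp add: right_diff_distrib)
        ultimately show ?thesis using that(1,2,3) by metis
      qed
      consider "degree g = 0" | "0 < degree g" "degree g < degree b" | "degree b \<le> degree g" by linarith
      then show ?case
      proof cases
        case 1
        then have "poly g v = lead_coeff g" by (auto elim!: degree_eq_zeroE)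
        then show ?thesis using to_f[of 1 "lead_coeff g"] cl(7) lg ideal_zero[OF m] by simp
      next
        case 2
        obtain s q r where sqr: "q \<in> polys_over B" "r \<in> polys_over B"
            "smult (lead_coeff g ^ s) b = q * g + r" "r = 0 \<or> degree r < degree g"
          using pseudo_division_over[OF R g(1) g_nz b(1)] by blast
        have val: "poly q v * poly g v + poly r v \<in> m"
          using arg_cong[OF sqr(3), of "\<lambda>p. poly p v"] ideal_mult_left[OF m bv] by (metis poly_add poly_mult poly_smult)
        show ?thesis
        proof (cases "poly r v \<in> m")
          \<comment> \<open>The remainder would vanish modulo \<open>m\<close>, making
            \<open>g\<close> a proper divisor of the minimal relation. Then the cofactor
            \<open>q\<close> would vanish too and put a product of leading coefficients into
            \<open>m\<close>.\<close>
          case True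
          have "null r" using min[OF sqr(2) True] sqr(4) 2 ideal_zero[OF m] by (auto simp: null_def)
          have "poly q v * poly g v \<in> m"
            using val True ideal_diff[OF m val True] by simp
          then have qv: "poly q v \<in> m" using prime gv by blast
          have "q \<noteq> 0"
          proof
            assume "q = 0"
            then have "coeff (smult (lead_coeff g ^ s) b) (degree b) \<in> m" using sqr(3) \<open>null r\<close> by (simp add: null_def)
            then show False using prime lpow[OF lg(1)] lb(1) by auto
          qed
          have "degree (q * g) \<le> degree b"
          proof -
            have "q * g = smult (lead_coeff g ^ s) b - r" using sqr(3) by simp
            moreover have "degree r \<le> degree b" using sqr(4) 2 by auto
            ultimately show ?thesis by (simp add: degree_diff_le degree_smult_le)
          qed
          then have "degree q < degree b" using \<open>q \<noteq> 0\<close> g_nz 2 by (simp add: degree_mult_eq)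
          then have "null q" by (rule min[OF sqr(1) qv])
          have "coeff (q * g + r) (degree b) \<in> m"
            using \<open>null q\<close> \<open>null r\<close> unfolding coeff_add coeff_mult null_def
            by (intro ideal_add[OF m] ideal_sum[OF m] ideal_mult_right[OF m]) auto
          then have "lead_coeff g ^ s * lead_coeff b \<in> m" unfolding sqr(3)[symmetric] by simp
          then show ?thesis using prime lpow[OF lg(1)] lb(1) by blast
        next
          case False
          have "degree r < degree f" using sqr(4) g(2) False ideal_zero[OF m] by auto
          then obtain p a where pa: "p \<in> polys_over B" "a \<in> B" "a \<notin> m" "poly p v * poly r v - a \<in> m"
            using less.hyps[OF _ sqr(2) False] by blast
          have "(0 - p) * q \<in> polys_over B" using cl(2,3,6) pa(1) sqr(1) by blast
          moreover have "(poly p v * poly r v - a) - poly p v * (poly q v * poly g v + poly r v) \<in> m"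
            by (rule ideal_diff[OF m pa(4) ideal_mult_left[OF m val]])
          moreover have "(poly p v * poly r v - a) - poly p v * (poly q v * poly g v + poly r v) =
              poly ((0 - p) * q) v * poly g v - a" by (simp add: algebra_simps)
          ultimately show ?thesis using to_f[of "(0 - p) * q" a] pa(2,3) by metis
        qed
      next
        case 3
        obtain s q r where sqr: "q \<in> polys_over B" "r \<in> polys_over B"
            "smult (lead_coeff b ^ s) g = q * b + r" "r = 0 \<or> degree r < degree b"
          using pseudo_division_over[OF R b(1) b_nz g(1)] by blast
        have val: "lead_coeff b ^ s * poly g v = poly q v * poly b v + poly r v"
          using arg_cong[OF sqr(3), of "\<lambda>p. poly p v"] by simp
        have rv: "poly r v \<notin> m"
        proof
          assume "poly r v \<in> m"
          then have "lead_coeff b ^ s * poly g v \<in> m"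
            unfolding val using ideal_add[OF m ideal_mult_left[OF m bv]] by blast
          then show False using prime lpow[OF lb(1)] gv by blast
        qed
        then have "degree r < degree f" using sqr(4) 3 g(2) ideal_zero[OF m] by auto
        then obtain p a where pa: "p \<in> polys_over B" "a \<in> B" "a \<notin> m" "poly p v * poly r v - a \<in> m"
          using less.hyps[OF _ sqr(2) rv] by blast
        have "smult (lead_coeff b ^ s) p \<in> polys_over B" using cl(4) Rd(7) lb(2) pa(1) by blast
        moreover have "poly (smult (lead_coeff b ^ s) p) v * poly g v - a \<in> m"
        proof -
          have "poly (smult (lead_coeff b ^ s) p) v * poly g v = poly p v * (lead_coeff b ^ s * poly g v)" by simp
          also have "\<dots> = poly p v * poly q v * poly b v + poly p v * poly r v" unfolding val by (simp add: algebra_simps)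
          finally have eq: "poly (smult (lead_coeff b ^ s) p) v * poly g v - a =
              poly p v * poly q v * poly b v + (poly p v * poly r v - a)" by simp
          show ?thesis unfolding eq by (rule ideal_add[OF m ideal_mult_left[OF m bv] pa(4)])
        qed
        ultimately show ?thesis using to_f pa(2,3) by blast
      qed
    qed
    obtain p a where pa: "p \<in> polys_over B" "a \<in> B" "a \<notin> m" "poly p v * c' - a \<in> m"
      using bezout[OF f(1)] f(2) c'(2) by blast
    have "\<exists>\<psi>'. rational_point sc m (adjoin B v) \<psi>' \<and> \<psi>' c' \<noteq> 0"
      if \<psi>: "rational_point sc m B \<psi>" and nz: "\<psi> (lead_coeff b * a) \<noteq> 0" for \<psi>
    proof -
      note \<psi>d = rational_pointD[OF B \<psi>]
      have nz': "\<psi> (lead_coeff b) \<noteq> 0" "\<psi> a \<noteq> 0" using nz \<psi>d(2)[OF lb(2) pa(2)] by auto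
      have "coeff (map_poly \<psi> b) (degree b) \<noteq> 0" using nz' by (simp add: coeff_map_poly \<psi>d(5))
      then have "degree b \<le> degree (map_poly \<psi> b)" by (rule le_degree)
      \<comment> \<open>A root of the specialised minimal relation, whose degree does not drop as
        \<open>\<psi>\<close> is nonzero at the leading coefficient.\<close>
      then obtain \<tau> where \<tau>: "poly (map_poly \<psi> b) \<tau> = 0" using alg_closed_imp_poly_has_root deg_b by (metis order_less_le_trans)
      have "poly (map_poly \<psi> h) \<tau> = 0" if h: "h \<in> polys_over B" "poly h v \<in> m" for h
      proof -
        obtain s q r where sqr: "q \<in> polys_over B" "r \<in> polys_over B"
            "smult (lead_coeff b ^ s) h = q * b + r" "r = 0 \<or> degree r < degree b"
          using pseudo_division_over[OF R b(1) b_nz h(1)] by blast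
        have "poly r v = lead_coeff b ^ s * poly h v - poly q v * poly b v"
          using arg_cong[OF sqr(3), of "\<lambda>p. poly p v"] by simp
        then have "poly r v \<in> m" using ideal_diff[OF m ideal_mult_left[OF m h(2)] ideal_mult_left[OF m bv]] by simp
        then have "null r" using sqr(4) min[OF sqr(2)] ideal_zero[OF m] by (auto simp: null_def)
        then have r0: "map_poly \<psi> r = 0" using null_map[OF \<psi> sqr(2)] by blast
        have const: "[:lead_coeff b ^ s:] \<in> polys_over B" using cl(5)[OF Rd(7)[OF lb(2)], of s 0] by (simp add: monom_0)
        have "map_poly \<psi> ([:lead_coeff b ^ s:] * h) = map_poly \<psi> (q * b + r)" using sqr(3) by simp
        then have "map_poly \<psi> [:lead_coeff b ^ s:] * map_poly \<psi> h = map_poly \<psi> q * map_poly \<psi> b"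
          by (simp only: map_poly_point(3)[OF \<psi> const h(1)] map_poly_point(1)[OF \<psi> cl(3)[OF sqr(1) b(1)] sqr(2)]
              map_poly_point(3)[OF \<psi> sqr(1) b(1)] r0 add_0_right)
        then have "poly (map_poly \<psi> [:lead_coeff b ^ s:]) \<tau> * poly (map_poly \<psi> h) \<tau> = 0"
          using \<tau> by (metis poly_mult mult_zero_right)
        moreover have "poly (map_poly \<psi> [:lead_coeff b ^ s:]) \<tau> = \<psi> (lead_coeff b) ^ s"
          by (simp add: map_poly_pCons \<psi>d(5) \<psi>d(8)[OF lb(2)])
        ultimately show ?thesis using nz'(1) by simp
      qed
      then obtain \<psi>' where \<psi>': "rational_point sc m (adjoin B v) \<psi>'" "\<And>b. b \<in> B \<Longrightarrow> \<psi>' b = \<psi> b"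
        using rational_point_extend[OF \<psi>, of \<tau>] by blast
      note \<psi>'d = rational_pointD[OF is_subalgebra_adjoin[OF sc B] \<psi>'(1)] and Av = is_subringD[OF is_subring_adjoin[OF R, of v]]
      have pv: "poly p v \<in> adjoin B v" using pa(1) unfolding adjoin_eq_poly[OF R] by blast
      have aA: "a \<in> adjoin B v" using pa(2) adjoin_subset[OF R] by blast
      have "\<psi>' (poly p v * c' - a) = 0" using pa(4) pv aA c'(1) Av(3,4) by (intro \<psi>'d(4)) auto
      then have "\<psi>' (poly p v) * \<psi>' c' = \<psi> a"
        using \<psi>'d(7)[OF Av(4)[OF pv c'(1)] aA] \<psi>'d(2)[OF pv c'(1)] \<psi>'(2)[OF pa(2)] by simp
      then have "\<psi>' c' \<noteq> 0" using nz'(2) by auto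
      then show ?thesis using \<psi>'(1) by blast
    qed
    moreover have "lead_coeff b * a \<in> B" "lead_coeff b * a \<notin> m" using Rd(4) lb pa(2,3) prime by blast+
    ultimately show ?thesis by blast
  qed
qed

end

lemma rational_point_exists:
  assumes "finite G" "c' \<in> is_subalgebra sc hull G" "c' \<notin> m"
  shows "\<exists>\<psi>. rational_point sc m (is_subalgebra sc hull G) \<psi> \<and> \<psi> c' \<noteq> 0"
  using assms
proof (induction G arbitrary: c' rule: finite_induct)
  case empty
  note h = algebra_scale_hom[OF sc]
  have inj: "c = e" if "sc c 1 = sc e (1::'a)" for c e
  proof (rule ccontr)
    assume "c \<noteq> e"
    have "sc (inverse (c - e)) (sc (c - e) 1) = (0::'a)" using that by (simp add: h(10) h(6))
    then show False using \<open>c \<noteq> e\<close> by (simp add: h(1) flip: h(3))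
  qed
  have inm: "c = 0" if "sc c 1 \<in> m" for c
  proof (rule ccontr)
    assume "c \<noteq> 0"
    have "sc (inverse c) 1 * sc c 1 \<in> m" by (rule ideal_mult_left[OF m that])
    moreover have "sc (inverse c) 1 * sc c 1 = (1::'a)" using \<open>c \<noteq> 0\<close> by (simp add: h(1,7) flip: h(3))
    ultimately show False using one by simp
  qed
  define \<psi> where "\<psi> a = (THE c. a = sc c 1)" for a :: 'a
  have \<psi>: "\<psi> (sc c 1) = c" for c unfolding \<psi>_def by (rule the_equality) (auto dest: inj)
  have "rational_point sc m (range (\<lambda>c. sc c 1)) \<psi>"
    unfolding rational_point_def
  proof (intro conjI ballI allI)
    fix a b assume "a \<in> range (\<lambda>c. sc c (1::'a))" "b \<in> range (\<lambda>c. sc c (1::'a))"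
    then obtain c e where ce: "a = sc c 1" "b = sc e 1" by blast
    have "a + b = sc (c + e) 1" "a * b = sc (c * e) 1" by (simp_all add: ce h(2,3,7))
    then show "\<psi> (a + b) = \<psi> a + \<psi> b" "\<psi> (a * b) = \<psi> a * \<psi> b" by (simp_all only: \<psi> ce)
  qed (use \<psi> inm in auto)
  moreover obtain c where c: "c' = sc c 1" using empty.prems unfolding subalgebra_hull_empty[OF sc] by blast
  moreover have "c \<noteq> 0" using empty.prems(2) c ideal_zero[OF m] by (auto simp: h(5))
  ultimately show ?case unfolding subalgebra_hull_empty[OF sc] using \<psi> by metis
next
  case (insert v G)
  have c': "c' \<in> adjoin (is_subalgebra sc hull G) v" using insert.prems(1) by (simp only: subalgebra_hull_insert[OF sc])
  obtain c where c: "c \<in> is_subalgebra sc hull G" "c \<notin> m"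
      "\<forall>\<psi>. rational_point sc m (is_subalgebra sc hull G) \<psi> \<and> \<psi> c \<noteq> 0 \<longrightarrow>
        (\<exists>\<psi>'. rational_point sc m (adjoin (is_subalgebra sc hull G) v) \<psi>' \<and> \<psi>' c' \<noteq> 0)"
    using rational_point_extend_nonvanishing[OF is_subalgebra_hull_in c' insert.prems(2)] by blast
  then show ?case using insert.IH[OF c(1,2)] unfolding subalgebra_hull_insert[OF sc] by blast
qed

end

text \<open>The kernel of a rational point is a proper ideal containing \<open>m\<close>, hence
  equals \<open>m\<close>; so \<open>a\<close> is congruent to its value.\<close>

theorem nullstellensatz:
  fixes sc :: "'k::alg_closed_field \<Rightarrow> 'a::idom \<Rightarrow> 'a"
  assumes sc: "algebra_over sc" and G: "finite G" "is_subalgebra sc hull G = UNIV"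
    and max: "maximal_in UNIV m"
  shows "\<exists>c. a - sc c 1 \<in> m"
proof -
  note mf = maximal_ideal_facts[OF max]
  obtain \<psi> where \<psi>: "rational_point sc m UNIV \<psi>"
    using rational_point_exists[OF sc mf(1,2) mf(3) G(1), of 1] G(2) mf(2) by auto
  have U: "is_subalgebra sc UNIV" by (simp add: is_subalgebra_def)
  note \<psi>d = rational_pointD[OF sc mf(1,2) mf(3) U \<psi>, simplified]
  have "is_ideal {b. \<psi> b = 0}" by (rule is_idealI) (auto simp: \<psi>d)
  moreover have "m \<subseteq> {b. \<psi> b = 0}" using \<psi>d(4) by blast
  moreover have "1 \<notin> {b. \<psi> b = 0}" by (simp add: \<psi>d)
  ultimately have "m = {b. \<psi> b = 0}" using max unfolding maximal_in_def by blast
  moreover have "\<psi> (a - sc (\<psi> a) 1) = 0" by (simp add: \<psi>d)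
  ultimately show ?thesis by blast
qed


section \<open>The dimension and the number of generators of the differentials\<close>

text \<open>A finite supremum of natural numbers is attained: some chain is longer than
  \<open>d - 1\<close>, and none is longer than \<open>d\<close>.\<close>

lemma krull_dim_chain:
  assumes "krull_dim (UNIV :: 'a::comm_ring_1 set) = enat d" "d > 0"
  obtains P where "\<And>i. i \<le> d \<Longrightarrow> prime_in (UNIV :: 'a set) (P i)" "\<And>i. i < d \<Longrightarrow> P i \<subset> P (Suc i)"
proof -
  let ?X = "{enat n |n. \<exists>P. (\<forall>i\<le>n. prime_in (UNIV :: 'a set) (P i)) \<and> (\<forall>i<n. P i \<subset> P (Suc i))}"
  have S: "Sup ?X = enat d" using assms(1) by (simp add: krull_dim_def)
  have "enat (d - 1) < Sup ?X" unfolding S using assms(2) by simp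
  then obtain x where x: "x \<in> ?X" "enat (d - 1) < x" unfolding less_Sup_iff by blast
  then obtain n where n: "x = enat n" by blast
  have "x \<le> Sup ?X" using x(1) by (rule Sup_upper)
  then have "n = d" unfolding S using x(2) n by simp
  then show thesis using x(1) n that by auto
qed

context
  fixes sc :: "'k::field \<Rightarrow> 'a::comm_ring_1 \<Rightarrow> 'a" and P :: "nat \<Rightarrow> 'a set" and s :: "nat \<Rightarrow> 'a" and d :: nat
  assumes sc: "algebra_over sc" and prime: "\<And>i. i \<le> d \<Longrightarrow> prime_in UNIV (P i)"
    and chain: "\<And>i. i < d \<Longrightarrow> P i \<subset> P (Suc i)"
    and s: "\<And>i. i < d \<Longrightarrow> s (Suc i) \<in> P (Suc i)" "\<And>i. i < d \<Longrightarrow> s (Suc i) \<notin> P i"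
begin

lemma prime_chainD:
  assumes "i \<le> d"
  shows "is_ideal (P i)" "1 \<notin> P i" "a * b \<in> P i \<Longrightarrow> a \<in> P i \<or> b \<in> P i" "a \<notin> P i \<Longrightarrow> a ^ n \<notin> P i"
proof -
  show 1: "is_ideal (P i)" "a * b \<in> P i \<Longrightarrow> a \<in> P i \<or> b \<in> P i" for a b using prime[OF assms] by (auto simp: prime_in_def)
  have "P i \<noteq> UNIV" using prime[OF assms] by (simp add: prime_in_def)
  then show 2: "1 \<notin> P i" using ideal_mult_left[OF 1(1), of 1] by auto
  show "a \<notin> P i \<Longrightarrow> a ^ n \<notin> P i" by (induction n) (use 1(2) 2 in auto)
qed

text \<open>In a combination lying in \<open>P j\<close>, split off the lowest occurring power of
  \<open>s (Suc j)\<close>. It is outside the prime \<open>P j\<close>, so the cofactor is in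
  \<open>P j\<close>, hence in \<open>P (Suc j)\<close>; modulo \<open>s (Suc j)\<close> only a
  combination of the remaining monomials is left there, against the induction hypothesis. For
  \<open>j = 0\<close> in particular the \<open>s i\<close> are algebraically independent.\<close>

lemma chain_monomials_not_in:
  assumes "j \<le> d" "I \<in> PiE {Suc j..d} (\<lambda>_. {..K::nat})" "c I \<noteq> 0"
  shows "(\<Sum>I\<in>PiE {Suc j..d} (\<lambda>_. {..K}). sc (c I) (\<Prod>i\<in>{Suc j..d}. s i ^ I i)) \<notin> P j"
  using assms
proof (induction j arbitrary: c I rule: inc_induct)
  case base
  have "sc (c I) 1 \<notin> P d"
  proof
    assume "sc (c I) 1 \<in> P d"
    then have "sc (inverse (c I)) 1 * sc (c I) 1 \<in> P d" by (rule ideal_mult_left[OF prime_chainD(1)[OF order_refl]])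
    moreover have "sc (inverse (c I)) 1 * sc (c I) 1 = 1"
      using base(2) by (simp add: algebra_scale_hom(1,7)[OF sc] flip: algebra_scale_hom(3)[OF sc])
    ultimately show False using prime_chainD(2)[of d] by simp
  qed
  then show ?case using base(1) by simp
next
  case (step j)
  let ?B = "PiE {Suc (Suc j)..d} (\<lambda>_. {..K})"
  note h = algebra_scale_hom[OF sc]
  have ins: "{Suc j..d} = insert (Suc j) {Suc (Suc j)..d}" using step.hyps by auto
  define m where "m I = (\<Prod>i\<in>{Suc (Suc j)..d}. s i ^ I i)" for I
  define T where "T n = (\<Sum>I\<in>?B. sc (c (I(Suc j := n))) (m I))" for n
  have sum: "(\<Sum>I\<in>PiE {Suc j..d} (\<lambda>_. {..K}). sc (c I) (\<Prod>i\<in>{Suc j..d}. s i ^ I i)) = (\<Sum>n\<le>K. s (Suc j) ^ n * T n)"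
  proof -
    have "(\<Prod>i\<in>{Suc j..d}. s i ^ (I(Suc j := n)) i) = s (Suc j) ^ n * m I" for I n
    proof -
      have "(\<Prod>i\<in>{Suc (Suc j)..d}. s i ^ (I(Suc j := n)) i) = m I" unfolding m_def by (rule prod.cong) auto
      then show ?thesis unfolding ins by simp
    qed
    then show ?thesis
      unfolding T_def sum_distrib_left h(8) by (subst ins, subst sum_PiE_insert) (simp_all add: ins)
  qed
  \<comment> \<open>The exponents of \<open>s (Suc j)\<close> that occur with a nonzero coefficient;
    the least one is split off.\<close>
  define N where "N = {n. n \<le> K \<and> (\<exists>I\<in>?B. c (I(Suc j := n)) \<noteq> 0)}"
  have "I(Suc j := undefined) \<in> ?B" "I (Suc j) \<le> K" "(I(Suc j := undefined))(Suc j := I (Suc j)) = I"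
    using step.prems(1) step.hyps by (auto simp: PiE_iff extensional_def)
  then have "I (Suc j) \<in> N" using step.prems(2) unfolding N_def by (intro CollectI conjI bexI[of _ "I(Suc j := undefined)"]) simp_all
  then have "(LEAST n. n \<in> N) \<in> N" by (rule LeastI)
  then obtain t where t: "t \<in> N" "t = (LEAST n. n \<in> N)" by blast
  have low: "T n = 0" if "n < t" for n
  proof -
    have "n \<notin> N" using that t(2) not_less_Least by blast
    moreover have "n \<le> K" using that t(1) by (auto simp: N_def)
    ultimately show ?thesis by (auto simp: N_def T_def h(5) intro!: sum.neutral)
  qed
  have jd: "j < d" "Suc j \<le> d" "j \<le> d" using step.hyps by auto
  obtain I' where I': "I' \<in> ?B" "c (I'(Suc j := t)) \<noteq> 0" using t(1) by (auto simp: N_def)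
  have Tt: "T t \<notin> P (Suc j)"
    using step.IH[of I' "\<lambda>I. c (I(Suc j := t))"] I' unfolding T_def m_def by blast
  show ?case
  proof
    assume "(\<Sum>I\<in>PiE {Suc j..d} (\<lambda>_. {..K}). sc (c I) (\<Prod>i\<in>{Suc j..d}. s i ^ I i)) \<in> P j"
    moreover have "(\<Sum>n\<le>K. s (Suc j) ^ n * T n) = s (Suc j) ^ t * (\<Sum>n=t..K. s (Suc j) ^ (n - t) * T n)"
    proof -
      have "(\<Sum>n\<le>K. s (Suc j) ^ n * T n) = (\<Sum>n=t..K. s (Suc j) ^ n * T n)"
        by (rule sum.mono_neutral_right) (auto simp: low)
      also have "\<dots> = (\<Sum>n=t..K. s (Suc j) ^ t * (s (Suc j) ^ (n - t) * T n))"
        by (rule sum.cong) (auto simp flip: mult.assoc power_add)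
      finally show ?thesis by (simp add: sum_distrib_left)
    qed
    ultimately have "(\<Sum>n=t..K. s (Suc j) ^ (n - t) * T n) \<in> P j"
      using prime_chainD(3,4)[OF jd(3)] s(2)[OF jd(1)] unfolding sum by metis
    then have *: "(\<Sum>n=t..K. s (Suc j) ^ (n - t) * T n) \<in> P (Suc j)" using chain[OF jd(1)] by blast
    have tK: "t \<le> K" using t(1) by (simp add: N_def)
    have split: "(\<Sum>n=t..K. s (Suc j) ^ (n - t) * T n) = (\<Sum>n=Suc t..K. s (Suc j) ^ (n - t) * T n) + T t"
      using tK by (subst sum.atLeast_Suc_atMost) (simp_all add: add.commute)
    have "(\<Sum>n=Suc t..K. s (Suc j) ^ (n - t) * T n) \<in> P (Suc j)"
    proof (rule ideal_sum[OF prime_chainD(1)[OF jd(2)]], rule ideal_mult_right[OF prime_chainD(1)[OF jd(2)]])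
      fix n assume "n \<in> {Suc t..K}"
      then have "s (Suc j) ^ (n - t) = s (Suc j) ^ (n - t - 1) * s (Suc j)" by (cases "n - t") auto
      then show "s (Suc j) ^ (n - t) \<in> P (Suc j)" using ideal_mult_left[OF prime_chainD(1)[OF jd(2)] s(1)[OF jd(1)]] by metis
    qed
    then show False using * Tt ideal_add_cancel[OF prime_chainD(1)[OF jd(2)]] unfolding split by blast
  qed
qed

end

text \<open>As its product is nonzero, the tensor of the \<open>b i\<close> and \<open>a i\<close>
  over \<open>L\<close> is nonzero, so some functional on the second factor detects it. By
  induction: an \<open>a j\<close> depending on the others is absorbed into their coefficients, an
  independent one is separated from them.\<close>

lemma nonzero_functional:
  fixes a b :: "'i \<Rightarrow> 'f::field"
  assumes L: "is_subfield L" and "finite I" "(\<Sum>i\<in>I. b i * a i) \<noteq> 0"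
  obtains \<mu> where "\<And>v w. \<mu> (v + w) = \<mu> v + \<mu> w" "\<And>l w. l \<in> L \<Longrightarrow> \<mu> (l * w) = l * \<mu> w"
    "\<And>w. \<mu> w \<in> L" "(\<Sum>i\<in>I. b i * \<mu> (a i)) \<noteq> 0"
proof -
  define lin where "lin \<mu> \<longleftrightarrow> (\<forall>v w. \<mu> (v + w) = \<mu> v + \<mu> w) \<and> (\<forall>l\<in>L. \<forall>w. \<mu> (l * w) = l * \<mu> w) \<and> (\<forall>w. \<mu> w \<in> L)"
    for \<mu> :: "'f \<Rightarrow> 'f"
  have "\<exists>\<mu>. lin \<mu> \<and> (\<Sum>i\<in>I. b i * \<mu> (a i)) \<noteq> 0"
    using assms(2,3)
  proof (induction I arbitrary: b rule: finite_induct)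
    case (insert j I)
    show ?case
    proof (cases "a j \<in> {\<Sum>i\<in>I. l i * a i | l. \<forall>i. l i \<in> L}")
      case True
      then obtain l where l: "a j = (\<Sum>i\<in>I. l i * a i)" "\<forall>i. l i \<in> L" by blast
      have "(\<Sum>i\<in>I. (b i + b j * l i) * a i) = (\<Sum>i\<in>insert j I. b i * a i)"
        using insert.hyps by (simp add: l(1) distrib_right sum.distrib sum_distrib_left mult.assoc add.commute)
      then obtain \<mu> where \<mu>: "lin \<mu>" "(\<Sum>i\<in>I. (b i + b j * l i) * \<mu> (a i)) \<noteq> 0"
        using insert.IH[of "\<lambda>i. b i + b j * l i"] insert.prems by auto
      have add: "\<mu> (v + w) = \<mu> v + \<mu> w" for v w using \<mu>(1) by (simp add: lin_def)
      have zero: "\<mu> 0 = 0" using add[of 0 0] by (metis add_cancel_right_right)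
      have "\<mu> (sum f S) = (\<Sum>i\<in>S. \<mu> (f i))" for f and S :: "'i set"
        by (induction S rule: infinite_finite_induct) (simp_all add: add zero)
      then have "\<mu> (a j) = (\<Sum>i\<in>I. l i * \<mu> (a i))" using \<mu>(1) l(2) unfolding l(1) by (simp add: lin_def)
      then have "(\<Sum>i\<in>insert j I. b i * \<mu> (a i)) = (\<Sum>i\<in>I. (b i + b j * l i) * \<mu> (a i))"
        using insert.hyps by (simp add: distrib_right sum.distrib sum_distrib_left mult.assoc add.commute)
      then show ?thesis using \<mu> by auto
    next
      case False
      obtain \<mu> where \<mu>: "\<And>v w. \<mu> (v + w) = \<mu> v + \<mu> w" "\<And>l w. l \<in> L \<Longrightarrow> \<mu> (l * w) = l * \<mu> w"
          "\<And>w. \<mu> w \<in> L" "\<mu> (a j) = 1" "\<And>w. w \<in> {\<Sum>i\<in>I. l i * a i | l. \<forall>i. l i \<in> L} \<Longrightarrow> \<mu> w = 0"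
        by (rule separating_functional[OF L subspace_span[OF L] False]) (rule that)
      show ?thesis
      proof (cases "b j = 0")
        case True
        then show ?thesis using insert.IH[of b] insert.prems insert.hyps by simp
      next
        case nz: False
        have "(\<Sum>i\<in>I. b i * \<mu> (a i)) = 0" using \<mu>(5) span_member[OF L insert.hyps(1)] by (intro sum.neutral) simp
        then have "(\<Sum>i\<in>insert j I. b i * \<mu> (a i)) \<noteq> 0" using nz insert.hyps \<mu>(4) by simp
        moreover have "lin \<mu>" using \<mu>(1-3) by (simp add: lin_def)
        ultimately show ?thesis by blast
      qed
    qed
  qed simp
  then show thesis using that unfolding lin_def by blast
qed

section \<open>The fraction field over the field generated by the parameters\<close>

definition quotients :: "'a::idom set \<Rightarrow> 'a fract set" where
  "quotients K = {Fract p q | p q. p \<in> K \<and> q \<in> K \<and> q \<noteq> 0}"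

lemma quotientsI: "p \<in> K \<Longrightarrow> q \<in> K \<Longrightarrow> q \<noteq> 0 \<Longrightarrow> Fract p q \<in> quotients K"
  by (auto simp: quotients_def)

lemma is_subfield_quotients:
  assumes K: "is_subring K"
  shows "is_subfield (quotients K)"
  unfolding is_subfield_def
proof (intro conjI ballI)
  note Kd = is_subringD[OF K]
  show "1 \<in> quotients K" unfolding One_fract_def by (rule quotientsI) (simp_all add: Kd)
  fix a assume "a \<in> quotients K"
  then obtain p q where a: "a = Fract p q" "p \<in> K" "q \<in> K" "q \<noteq> 0" by (auto simp: quotients_def)
  have "0 \<in> quotients K" unfolding Zero_fract_def by (rule quotientsI) (simp_all add: Kd)
  then show "inverse a \<in> quotients K" using quotientsI[OF a(3,2)] by (cases "p = 0") (simp_all add: a(1) fract_collapse)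
  fix b assume "b \<in> quotients K"
  then obtain r t where b: "b = Fract r t" "r \<in> K" "t \<in> K" "t \<noteq> 0" by (auto simp: quotients_def)
  show "a - b \<in> quotients K" "a * b \<in> quotients K"
    using a b by (auto intro!: quotientsI simp: Kd)
qed

lemma quotients_of_ring: "is_subring K \<Longrightarrow> p \<in> K \<Longrightarrow> Fract p 1 \<in> quotients K"
  by (rule quotientsI) (auto dest: is_subringD)

lemma common_denominator:
  assumes K: "is_subring K" and "finite I" "\<And>i. i \<in> I \<Longrightarrow> l i \<in> quotients K"
  shows "\<exists>q\<in>K. q \<noteq> 0 \<and> (\<exists>p. \<forall>i\<in>I. p i \<in> K \<and> Fract q 1 * l i = Fract (p i) 1)"
  using assms(2,3)
proof (induction I rule: finite_induct)
  case empty
  then show ?case using is_subringD(1)[OF K] by (intro bexI[of _ 1]) auto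
next
  case (insert j I)
  note Kd = is_subringD[OF K]
  obtain q p where q: "q \<in> K" "q \<noteq> 0" "\<And>i. i \<in> I \<Longrightarrow> p i \<in> K \<and> Fract q 1 * l i = Fract (p i) 1"
    using insert.IH insert.prems by blast
  obtain u v where u: "l j = Fract u v" "u \<in> K" "v \<in> K" "v \<noteq> 0" using insert.prems[of j] by (auto simp: quotients_def)
  have "(if i = j then q * u else v * p i) \<in> K \<and> Fract (v * q) 1 * l i = Fract (if i = j then q * u else v * p i) 1"
    if i: "i \<in> insert j I" for i
  proof (cases "i = j")
    case True
    then show ?thesis using u q(1) by (simp add: Kd eq_fract mult_ac)
  next
    case False
    have "Fract (v * q) 1 * l i = Fract v 1 * (Fract q 1 * l i)" by (simp flip: mult.assoc)
    also have "\<dots> = Fract (v * p i) 1" using q(3)[of i] i False by simp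
    finally show ?thesis using q(3)[of i] i False u(3) by (simp add: Kd)
  qed
  then show ?case using q(1,2) u(3,4) Kd(4)
    by (intro bexI[of _ "v * q"] conjI exI[of _ "\<lambda>i. if i = j then q * u else v * p i"]) auto
qed

text \<open>
  The element \<open>E\<close> turns a functional over the field generated by the \<open>y\<^sub>i\<close> into a trace-like
  form, whence the left factors of \<open>E\<close> span the fraction field.
\<close>

lemma fraction_field_span:
  fixes sc :: "'k::field \<Rightarrow> 'a::idom \<Rightarrow> 'a"
  assumes sc: "algebra_over sc" and K: "is_subalgebra sc K" and y: "\<And>i. i \<in> B \<Longrightarrow> y i \<in> K"
    and E: "mult_map E \<noteq> 0" "\<And>\<tau>. \<tau> \<in> diagonal \<Longrightarrow> E * \<tau> \<in> differential_ideal sc y B"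
  shows "\<exists>l. (\<forall>p. l p \<in> quotients K) \<and> z = (\<Sum>p\<in>Poly_Mapping.keys E. l p * Fract (left_factor p) 1)"
proof -
  let ?L = "quotients K" and ?t = "\<lambda>a::'a. Fract a 1"
  note KR = subalgebra_subring[OF sc K]
  note L = is_subfield_quotients[OF KR] and Ld = is_subfieldD[OF is_subfield_quotients[OF KR]]
  have t: "is_ring_hom ?t" by (simp add: is_ring_hom_def One_fract_def)
  have int_L: "of_int n \<in> ?L" for n
  proof -
    have nat: "of_nat n \<in> ?L" for n by (induction n) (simp_all add: Ld)
    show ?thesis by (cases n rule: int_cases2) (simp_all add: nat Ld(7))
  qed
  define lin where "lin \<mu> \<longleftrightarrow> (\<forall>v w. \<mu> (v + w) = \<mu> v + \<mu> w) \<and> (\<forall>l\<in>?L. \<forall>w. \<mu> (l * w) = l * \<mu> w) \<and> (\<forall>w. \<mu> w \<in> ?L)"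
    for \<mu> :: "'a fract \<Rightarrow> 'a fract"
  let ?\<Phi> = "\<lambda>\<mu>. tensor_map ?t (\<lambda>b. \<mu> (?t b))"
  \<comment> \<open>\<open>E * pt 1 c\<close> and \<open>E * pt c 1\<close> agree modulo the
    annihilated ideal; so multiplying the argument of \<open>\<mu>\<close> by \<open>c\<close>
    multiplies the value by \<open>c\<close>.\<close>
  have trace: "?\<Phi> (\<lambda>v. \<mu> (?t c * v)) E = ?t c * ?\<Phi> \<mu> E" if \<mu>: "lin \<mu>" for \<mu> c
  proof -
    have "scalar_linear sc ?t (\<lambda>b. \<mu> (?t b))"
      unfolding scalar_linear_def
    proof (intro conjI allI)
      fix e a b
      show "\<mu> (?t (a + b)) = \<mu> (?t a) + \<mu> (?t b)" using \<mu> unfolding is_ring_homD(2)[OF t] lin_def by blast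
      have "?t (sc e a) = ?t (sc e 1) * ?t a" by (simp add: algebra_scale_hom(7)[OF sc])
      moreover have "?t (sc e 1) \<in> ?L" using K by (intro quotients_of_ring[OF KR]) (auto simp: is_subalgebra_def)
      ultimately show "\<mu> (?t (sc e a)) = ?t (sc e 1) * \<mu> (?t a)" using \<mu> unfolding lin_def by metis
    qed
    note rel = tensor_map_relations[OF sc t this]
    have "differential_ideal sc y B \<subseteq> {\<tau>. \<forall>f. ?\<Phi> \<mu> (\<tau> * f) = 0}"
      unfolding differential_ideal_def
    proof (rule hull_minimal)
      show "is_ideal {\<tau>. \<forall>f. ?\<Phi> \<mu> (\<tau> * f) = 0}" by (rule is_ideal_functional_kernel)
    next
      show "tensor_relations sc \<union> (\<lambda>i. dif (y i)) ` B \<subseteq> {\<tau>. \<forall>f. ?\<Phi> \<mu> (\<tau> * f) = 0}"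
      proof
      fix \<tau> assume "\<tau> \<in> tensor_relations sc \<union> (\<lambda>i. dif (y i)) ` B"
      then show "\<tau> \<in> {\<tau>. \<forall>f. ?\<Phi> \<mu> (\<tau> * f) = 0}"
      proof
        assume "\<tau> \<in> (\<lambda>i. dif (y i)) ` B"
        then obtain i where i: "i \<in> B" "\<tau> = dif (y i)" by blast
        have "commutator ?t (\<lambda>b. \<mu> (?t b)) (y i) = (\<lambda>_. 0)"
        proof
          fix b
          have "\<mu> (?t (y i) * ?t b) = ?t (y i) * \<mu> (?t b)" using \<mu> quotients_of_ring[OF KR y[OF i(1)]] unfolding lin_def by blast
          then show "commutator ?t (\<lambda>b. \<mu> (?t b)) (y i) b = 0" by (simp add: commutator_def)
        qed
        then show ?thesis unfolding i(2) mem_Collect_eq tensor_map_dif[OF t] by (simp add: tensor_map_def)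
      qed (use rel in blast)
      qed
    qed
    then have "?\<Phi> \<mu> (E * dif c * 1) = 0" using E(2)[OF dif_diagonal[of c]] by blast
    then have "?\<Phi> \<mu> (dif c * E) = 0" by (simp add: mult.commute)
    then have "?\<Phi> \<mu> (pt 1 c * E) - ?\<Phi> \<mu> (pt c 1 * E) = 0" by (simp add: dif_def left_diff_distrib tensor_map_diff)
    then show ?thesis by (simp add: tensor_map_left[OF t] tensor_map_right)
  qed
  have lin_mult: "lin (\<lambda>v. \<mu> (z * v))" if "lin \<mu>" for \<mu> z
    using that unfolding lin_def by (simp add: distrib_left mult.left_commute[of z])
  let ?coef = "\<lambda>p. of_int (Poly_Mapping.lookup E p) * ?t (left_factor p)"
  have "(\<Sum>p\<in>Poly_Mapping.keys E. ?coef p * ?t (right_factor p)) = ?t (mult_map E)"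
  proof -
    have "?t (of_int n) = of_int n" for n
      by (cases n rule: int_cases2) (simp_all only: of_int_minus of_int_of_nat_eq is_ring_homD(5,10)[OF t])
    then show ?thesis unfolding mult_map_def is_ring_homD(8)[OF t] is_ring_homD(3)[OF t] by (simp only: mult.assoc)
  qed
  then have "(\<Sum>p\<in>Poly_Mapping.keys E. ?coef p * ?t (right_factor p)) \<noteq> 0" using E(1) by (simp add: Zero_fract_def eq_fract)
  then obtain \<mu> where \<mu>0: "\<And>v w. \<mu> (v + w) = \<mu> v + \<mu> w" "\<And>l w. l \<in> ?L \<Longrightarrow> \<mu> (l * w) = l * \<mu> w"
      "\<And>w. \<mu> w \<in> ?L" "(\<Sum>p\<in>Poly_Mapping.keys E. ?coef p * \<mu> (?t (right_factor p))) \<noteq> 0"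
    by (rule nonzero_functional[OF L finite_keys]) (rule that)
  have \<mu>: "lin \<mu>" "(\<Sum>p\<in>Poly_Mapping.keys E. ?coef p * \<mu> (?t (right_factor p))) \<noteq> 0"
    using \<mu>0(1-3) by (simp add: lin_def) (rule \<mu>0(4))
  have w: "?\<Phi> \<mu> E \<noteq> 0" using \<mu>(2) by (simp add: tensor_map_def mult.assoc)
  \<comment> \<open>The trace rule covers multipliers from the ring only; the denominator
    \<open>v\<close> is handled by precomposing \<open>\<mu>\<close> with division by
    \<open>v\<close>. The coefficients obtained for \<open>z\<close> are integers times values of a
    functional, hence in \<open>?L\<close>.\<close>
  obtain u v where uv: "z / ?\<Phi> \<mu> E = Fract u v" "v \<noteq> 0" by (cases "z / ?\<Phi> \<mu> E") blast
  have v0: "?t v \<noteq> 0" using uv(2) by (simp add: Zero_fract_def eq_fract)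
  let ?\<nu> = "\<lambda>x. \<mu> (inverse (?t v) * x)"
  have \<nu>: "lin ?\<nu>" by (rule lin_mult[OF \<mu>(1)])
  have "inverse (?t v) * (?t v * x) = x" for x using v0 unfolding mult.assoc[symmetric] by (subst left_inverse) simp_all
  then have "?\<Phi> (\<lambda>x. ?\<nu> (?t v * x)) E = ?\<Phi> \<mu> E" by presburger
  then have vw: "?t v * ?\<Phi> ?\<nu> E = ?\<Phi> \<mu> E" using trace[OF \<nu>, of v] by simp
  have "z = Fract u v * ?\<Phi> \<mu> E" using w by (simp flip: uv(1))
  also have "\<dots> = ?t u * ?\<Phi> ?\<nu> E" 
  proof -
    have "Fract u v * ?t v = ?t u" using uv(2) by (simp add: eq_fract)
    then show ?thesis unfolding vw[symmetric] by (simp only: mult.assoc[symmetric])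
  qed
  also have "\<dots> = ?\<Phi> (\<lambda>x. ?\<nu> (?t u * x)) E" by (rule trace[OF \<nu>, symmetric])
  also have "\<dots> = (\<Sum>p\<in>Poly_Mapping.keys E. (of_int (Poly_Mapping.lookup E p) * ?\<nu> (?t u * ?t (right_factor p))) * ?t (left_factor p))"
    unfolding tensor_map_def by (rule sum.cong) (simp_all only: mult_ac)
  finally have "z = (\<Sum>p\<in>Poly_Mapping.keys E. (of_int (Poly_Mapping.lookup E p) * ?\<nu> (?t u * ?t (right_factor p))) * ?t (left_factor p))" .
  moreover have "of_int (Poly_Mapping.lookup E p) * ?\<nu> (?t u * ?t (right_factor p)) \<in> ?L" for p
  proof (rule Ld(4)[OF int_L])
    show "?\<nu> (?t u * ?t (right_factor p)) \<in> ?L" using \<mu>(1) unfolding lin_def by blast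
  qed
  ultimately show ?thesis
    by (intro exI[of _ "\<lambda>p. of_int (Poly_Mapping.lookup E p) * ?\<nu> (?t u * ?t (right_factor p))"] conjI allI)
qed


section \<open>Counting monomials\<close>

context
  fixes sc :: "'k::field \<Rightarrow> 'a::comm_ring_1 \<Rightarrow> 'a"
  assumes sc: "algebra_over sc"
begin

interpretation V: vector_space sc
  using sc by (simp add: algebra_over_def)

lemma span_image_mult:
  assumes "z \<in> V.span S" "\<And>u. u \<in> S \<Longrightarrow> c * u \<in> V.span T"
  shows "c * z \<in> V.span T"
  using assms(1)
proof (induction rule: V.span_induct_alt)
  case base
  show ?case by (simp add: V.span_zero)
next
  case (step e u z)
  have "c * (sc e u + z) = sc e (c * u) + c * z" by (simp add: distrib_left algebra_scale_hom(8)[OF sc])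
  then show ?case using V.span_add[OF V.span_scale[OF assms(2)[OF step(1)], of e] step(2)] by (simp only:)
qed

text \<open>Bounding every exponent separately makes boxes add under products and bounds their size
  by \<open>(N + 1) ^ card B\<close>.\<close>

definition box_monomials :: "(nat \<Rightarrow> 'a) \<Rightarrow> nat set \<Rightarrow> nat \<Rightarrow> 'a set" where
  "box_monomials y B N = (\<lambda>J. \<Prod>i\<in>B. y i ^ J i) ` PiE B (\<lambda>_. {..N})"

lemma box_monomials_mult:
  assumes "u \<in> box_monomials y B M" "v \<in> box_monomials y B N"
  shows "u * v \<in> box_monomials y B (M + N)"
proof -
  obtain I J where "u = (\<Prod>i\<in>B. y i ^ I i)" "v = (\<Prod>i\<in>B. y i ^ J i)" "I \<in> PiE B (\<lambda>_. {..M})" "J \<in> PiE B (\<lambda>_. {..N})"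
    using assms unfolding box_monomials_def by blast
  moreover from this have "u * v = (\<Prod>i\<in>B. y i ^ (restrict (\<lambda>i. I i + J i) B) i)"
    by (simp add: power_add flip: prod.distrib)
  moreover from calculation have "restrict (\<lambda>i. I i + J i) B \<in> PiE B (\<lambda>_. {..M + N})"
    by (auto simp: PiE_iff add_mono)
  ultimately show ?thesis unfolding box_monomials_def by blast
qed

lemma box_monomials_mono: "M \<le> N \<Longrightarrow> box_monomials y B M \<subseteq> box_monomials y B N"
  unfolding box_monomials_def by (intro image_mono PiE_mono) auto

lemma box_monomials_single:
  assumes "finite B" "j \<in> B"
  shows "y j \<in> box_monomials y B 1"
proof -
  have "y j = (\<Prod>i\<in>B. y i ^ (restrict (\<lambda>i. if i = j then 1 else 0) B) i)"
  proof -
    have "(\<Prod>i\<in>B. y i ^ (restrict (\<lambda>i. if i = j then 1 else 0) B) i) = (\<Prod>i\<in>B. if i = j then y j else 1)"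
      by (rule prod.cong) auto
    then show ?thesis using assms by (simp add: prod.delta')
  qed
  moreover have "restrict (\<lambda>i. if i = j then 1 else 0) B \<in> PiE B (\<lambda>_. {..1::nat})" by auto
  ultimately show ?thesis unfolding box_monomials_def by (rule image_eqI)
qed

lemma card_box_monomials: "finite B \<Longrightarrow> finite (box_monomials y B N) \<and> card (box_monomials y B N) \<le> (N + 1) ^ card B"
proof -
  assume B: "finite B"
  have "card (box_monomials y B N) \<le> card (PiE B (\<lambda>_. {..N}))"
    unfolding box_monomials_def by (rule card_image_le) (simp add: B finite_PiE)
  then show ?thesis using B by (simp add: box_monomials_def finite_PiE card_PiE)
qed

lemma subalgebra_hull_degree:
  assumes B: "finite B" and p: "p \<in> is_subalgebra sc hull (y ` B)"
  shows "\<exists>N. p \<in> V.span (box_monomials y B N)"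
proof -
  have mono: "V.span (box_monomials y B M) \<subseteq> V.span (box_monomials y B N)" if "M \<le> N" for M N
    by (rule V.span_mono[OF box_monomials_mono[OF that]])
  have "is_subalgebra sc hull (y ` B) \<subseteq> {p. \<exists>N. p \<in> V.span (box_monomials y B N)}"
  proof (rule hull_minimal)
    show "y ` B \<subseteq> {p. \<exists>N. p \<in> V.span (box_monomials y B N)}"
      using V.span_base[OF box_monomials_single[OF B]] by blast
    show "is_subalgebra sc {p. \<exists>N. p \<in> V.span (box_monomials y B N)}"
      unfolding is_subalgebra_def
    proof (intro conjI ballI allI)
      have "1 \<in> box_monomials y B 0"
        unfolding box_monomials_def by (rule image_eqI[of _ _ "restrict (\<lambda>_. 0) B"]) auto
      then show "1 \<in> {p. \<exists>N. p \<in> V.span (box_monomials y B N)}" using V.span_base by blast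
      fix u assume "u \<in> {p. \<exists>N. p \<in> V.span (box_monomials y B N)}"
      then obtain M where M: "u \<in> V.span (box_monomials y B M)" by blast
      show "sc c u \<in> {p. \<exists>N. p \<in> V.span (box_monomials y B N)}" for c using V.span_scale[OF M] by blast
      fix v assume "v \<in> {p. \<exists>N. p \<in> V.span (box_monomials y B N)}"
      then obtain N where N: "v \<in> V.span (box_monomials y B N)" by blast
      have "u + v \<in> V.span (box_monomials y B (M + N))"
        using mono[of M "M + N"] mono[of N "M + N"] M N by (intro V.span_add) auto
      then show "u + v \<in> {p. \<exists>N. p \<in> V.span (box_monomials y B N)}" by blast
      have *: "w * v \<in> V.span (box_monomials y B (M + N))" if w: "w \<in> box_monomials y B M" for w
        by (rule span_image_mult[OF N]) (rule V.span_base[OF box_monomials_mult[OF w]])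
      have "v * u \<in> V.span (box_monomials y B (M + N))"
        by (rule span_image_mult[OF M]) (use * in \<open>simp add: mult.commute\<close>)
      then show "u * v \<in> {p. \<exists>N. p \<in> V.span (box_monomials y B N)}" by (auto simp: mult.commute)
    qed
  qed
  then show ?thesis using p by blast
qed

text \<open>Multiplication by \<open>q * s i\<close> maps combinations of the \<open>b j\<close>
  with coefficients of degree \<open>N\<close> to such combinations of degree \<open>N + D\<close>.
  So \<open>(M + 1) ^ d\<close> independent elements lie in a space whose dimension grows only like
  \<open>M ^ card B\<close>.\<close>

lemma growth_bound:
  fixes s :: "nat \<Rightarrow> 'a" and b :: "'i \<Rightarrow> 'a"
  assumes B: "finite B" and I: "finite I"
    and q: "q \<in> V.span (box_monomials y B D)"
    and step: "\<And>i j. i \<in> {1..d} \<Longrightarrow> j \<in> I \<Longrightarrow> \<exists>p. (\<forall>l\<in>I. p l \<in> V.span (box_monomials y B D)) \<and> q * s i * b j = (\<Sum>l\<in>I. p l * b l)"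
    and one: "\<exists>p. (\<forall>l\<in>I. p l \<in> V.span (box_monomials y B D)) \<and> q = (\<Sum>l\<in>I. p l * b l)"
    and indep: "\<And>M c. (\<Sum>J\<in>PiE {1..d} (\<lambda>_. {..M}). sc (c J) (q ^ (d * M + 1) * (\<Prod>i\<in>{1..d}. s i ^ J i))) = 0 \<Longrightarrow>
      \<forall>J\<in>PiE {1..d} (\<lambda>_. {..M}). c J = 0"
  shows "d \<le> card B"
proof -
  define X where "X N = (\<lambda>(u, j). u * b j) ` (box_monomials y B N \<times> I)" for N
  have card_X: "finite (X N)" "card (X N) \<le> (N + 1) ^ card B * card I" for N
  proof -
    have "card (X N) \<le> card (box_monomials y B N \<times> I)"
      unfolding X_def using card_box_monomials[OF B] I by (intro card_image_le) auto
    also have "\<dots> \<le> (N + 1) ^ card B * card I" using card_box_monomials[OF B] by (simp add: card_cartesian_product)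
    finally show "card (X N) \<le> (N + 1) ^ card B * card I" .
    show "finite (X N)" unfolding X_def using card_box_monomials[OF B] I by simp
  qed
  have comb: "(\<Sum>l\<in>I. p l * b l) * u \<in> V.span (X (N + D))"
    if p: "\<forall>l\<in>I. p l \<in> V.span (box_monomials y B D)" and u: "u \<in> box_monomials y B N" for p u N
  proof -
    have "(b l * u) * p l \<in> V.span (X (N + D))" if l: "l \<in> I" for l
    proof (rule span_image_mult[OF p[rule_format, OF l]])
      fix v assume "v \<in> box_monomials y B D"
      then have "u * v \<in> box_monomials y B (N + D)" by (rule box_monomials_mult[OF u])
      then have "(u * v) * b l \<in> X (N + D)" using l unfolding X_def by force
      then show "b l * u * v \<in> V.span (X (N + D))" by (intro V.span_base) (simp add: mult_ac)
    qed
    then have "(\<Sum>l\<in>I. (b l * u) * p l) \<in> V.span (X (N + D))" by (rule V.span_sum)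
    moreover have "(\<Sum>l\<in>I. p l * b l) * u = (\<Sum>l\<in>I. (b l * u) * p l)"
      unfolding sum_distrib_right by (rule sum.cong) (simp_all add: mult_ac)
    ultimately show ?thesis by simp
  qed
  have q_step: "q * z \<in> V.span (X (N + D))" if z: "z \<in> V.span (X N)" for z N
  proof (rule span_image_mult[OF z])
    fix w assume "w \<in> X N"
    then obtain u j where w: "w = u * b j" "u \<in> box_monomials y B N" "j \<in> I" unfolding X_def by auto
    have "(u * b j) * q \<in> V.span (X (N + D))"
    proof (rule span_image_mult[OF q])
      fix v assume "v \<in> box_monomials y B D"
      then have "u * v \<in> box_monomials y B (N + D)" by (rule box_monomials_mult[OF w(2)])
      then have "(u * v) * b j \<in> X (N + D)" using w(3) unfolding X_def by force
      then show "u * b j * v \<in> V.span (X (N + D))" by (intro V.span_base) (simp add: mult_ac)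
    qed
    then show "q * w \<in> V.span (X (N + D))" by (simp add: w(1) mult.commute)
  qed
  have s_step: "q * s i * z \<in> V.span (X (N + D))" if z: "z \<in> V.span (X N)" and i: "i \<in> {1..d}" for z N i
  proof (rule span_image_mult[OF z])
    fix w assume "w \<in> X N"
    then obtain u j where w: "w = u * b j" "u \<in> box_monomials y B N" "j \<in> I" unfolding X_def by auto
    obtain p where p: "\<forall>l\<in>I. p l \<in> V.span (box_monomials y B D)" "q * s i * b j = (\<Sum>l\<in>I. p l * b l)"
      using step[OF i w(3)] by blast
    have "q * s i * w = (q * s i * b j) * u" by (simp add: w(1) mult_ac)
    then show "q * s i * w \<in> V.span (X (N + D))" using comb[OF p(1) w(2)] unfolding p(2) by simp
  qed
  \<comment> \<open>Each variable is padded to exactly \<open>M\<close> factors \<open>q\<close>, so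
    that all monomials share one power of \<open>q\<close> and one degree bound.\<close>
  have power_step: "q ^ M * s i ^ n * z \<in> V.span (X (N + M * D))"
    if "z \<in> V.span (X N)" "i \<in> {1..d}" "n \<le> M" for z N i n M
    using that(3)
  proof (induction M arbitrary: n)
    case 0
    then show ?case using that by simp
  next
    case (Suc M)
    have e: "N + Suc M * D = (N + M * D) + D" by simp
    show ?case
    proof (cases n)
      case 0
      have "q * (q ^ M * s i ^ 0 * z) \<in> V.span (X (N + M * D + D))" by (rule q_step[OF Suc.IH]) simp
      then show ?thesis unfolding e by (simp add: 0 mult_ac)
    next
      case (Suc k)
      have "q * s i * (q ^ M * s i ^ k * z) \<in> V.span (X (N + M * D + D))"
        by (rule s_step[OF Suc.IH that(2)]) (use Suc.prems \<open>n = Suc k\<close> in simp)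
      then show ?thesis unfolding e by (simp add: Suc mult_ac)
    qed
  qed
  have monomial: "q ^ (d * M + 1) * (\<Prod>i\<in>{1..d}. s i ^ J i) \<in> V.span (X ((d * M + 1) * D))"
    if J: "J \<in> PiE {1..d} (\<lambda>_. {..M})" for J M
  proof -
    have "1 \<in> box_monomials y B 0" unfolding box_monomials_def by (rule image_eqI[of _ _ "restrict (\<lambda>_. 0) B"]) auto
    \<comment> \<open>The extra factor \<open>q\<close>, the \<open>+ 1\<close> in the exponent,
      brings the empty product into the span.\<close>
    then have q0: "q \<in> V.span (X (0 + D))" using comb[of _ 1 0] one by fastforce
    have "(\<Prod>i\<in>S. q ^ M * s i ^ J i) * q \<in> V.span (X (D + card S * M * D))" if "S \<subseteq> {1..d}" for S
    proof -
      have "finite S" using that finite_subset by blast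
      then show ?thesis using that
      proof (induction S rule: finite_induct)
        case empty
        show ?case using q0 by simp
      next
        case (insert i S)
        have "J i \<le> M" using J insert.prems by auto
        with insert have "q ^ M * s i ^ J i * ((\<Prod>i\<in>S. q ^ M * s i ^ J i) * q) \<in> V.span (X (D + card S * M * D + M * D))"
          by (intro power_step) auto
        then show ?case using insert.hyps by (simp add: mult_ac add_ac distrib_left)
      qed
    qed
    from this[OF order_refl] show ?thesis by (simp add: prod.distrib power_mult[symmetric] mult_ac add_ac distrib_left)
  qed
  have count: "(M + 1) ^ d \<le> ((d * M + 1) * D + 1) ^ card B * card I" for M
  proof -
    let ?P = "PiE {1..d} (\<lambda>_::nat. {..M})"
    let ?m = "\<lambda>J. q ^ (d * M + 1) * (\<Prod>i\<in>{1..d}. s i ^ J i)"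
    have P: "finite ?P" by (simp add: finite_PiE)
    have inj: "inj_on ?m ?P"
    proof (rule inj_onI, rule ccontr)
      fix J J' assume J: "J \<in> ?P" "J' \<in> ?P" "?m J = ?m J'" "J \<noteq> J'"
      let ?c = "\<lambda>K. if K = J then 1 else if K = J' then - 1 else (0::'k)"
      have "(\<Sum>K\<in>?P. sc (?c K) (?m K)) = (\<Sum>K\<in>{J, J'}. sc (?c K) (?m K))"
        by (rule sum.mono_neutral_right[OF P]) (use J in auto)
      also have "\<dots> = 0" using J(3,4) by simp
      finally have "?c J = 0" using indep[of ?c M] J(1) by blast
      then show False by simp
    qed
    have "V.independent (?m ` ?P)"
    proof (rule V.independent_if_scalars_zero)
      show "finite (?m ` ?P)" using P by simp
      fix f x assume f: "(\<Sum>x\<in>?m ` ?P. sc (f x) x) = 0" and x: "x \<in> ?m ` ?P"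
      have "(\<Sum>J\<in>?P. sc (f (?m J)) (?m J)) = 0" using f unfolding sum.reindex[OF inj] by simp
      then have "\<forall>J\<in>?P. f (?m J) = 0" by (rule indep)
      then show "f x = 0" using x by blast
    qed
    moreover have "?m ` ?P \<subseteq> V.span (X ((d * M + 1) * D))" using monomial by blast
    ultimately have "card (?m ` ?P) \<le> card (X ((d * M + 1) * D))" using V.independent_span_bound[OF card_X(1)] by blast
    also have "card (?m ` ?P) = (M + 1) ^ d" unfolding card_image[OF inj] by (simp add: card_PiE)
    finally show ?thesis using card_X(2)[of "(d * M + 1) * D"] by linarith
  qed
  show ?thesis
  proof (rule ccontr)
    assume "\<not> d \<le> card B"
    \<comment> \<open>With \<open>M = C\<close> the right side of \<open>count\<close> is at most
      \<open>C * (C + 1) ^ card B\<close>, less than \<open>(C + 1) ^ (card B + 1)\<close>.\<close>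
    define C where "C = (d * D + D + 1) ^ card B * card I"
    have "(d * C + 1) * D + 1 \<le> (d * D + D + 1) * (C + 1)" by (simp add: algebra_simps)
    then have "((d * C + 1) * D + 1) ^ card B \<le> (d * D + D + 1) ^ card B * (C + 1) ^ card B"
      unfolding power_mult_distrib[symmetric] by (rule power_mono) simp
    then have "((d * C + 1) * D + 1) ^ card B * card I \<le> C * (C + 1) ^ card B"
      unfolding C_def by (simp add: mult.commute mult.left_commute mult_le_mono2)
    moreover have "(C + 1) ^ Suc (card B) \<le> (C + 1) ^ d" using \<open>\<not> d \<le> card B\<close> by (intro power_increasing) auto
    ultimately have "(C + 1) * (C + 1) ^ card B \<le> C * (C + 1) ^ card B" using count[of C] unfolding power_Suc by linarith
    then show False by simp
  qed
qed

end

lemma diagonal_subset_generators: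
  fixes sc :: "'k::field \<Rightarrow> 'a::comm_ring_1 \<Rightarrow> 'a"
  assumes sc: "algebra_over sc" and G: "is_subalgebra sc hull G = UNIV"
  shows "diagonal \<subseteq> is_ideal hull (tensor_relations sc \<union> dif ` G)"
proof -
  have J: "is_ideal (is_ideal hull (tensor_relations sc \<union> dif ` G))"
    "tensor_relations sc \<subseteq> is_ideal hull (tensor_relations sc \<union> dif ` G)" by (auto intro: is_ideal_hull hull_inc)
  have "is_subalgebra sc hull G \<subseteq> {c. dif c \<in> is_ideal hull (tensor_relations sc \<union> dif ` G)}"
  proof (rule hull_minimal)
    show "is_subalgebra sc {c. dif c \<in> is_ideal hull (tensor_relations sc \<union> dif ` G)}" by (rule is_subalgebra_dif[OF sc J])
  qed (auto intro: hull_inc)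
  then show ?thesis unfolding G by (intro dif_generators_hull[OF sc]) blast
qed

text \<open>If \<open>card B\<close> differentials generate after inverting \<open>g\<close>, the
  fraction field is finite over that of the subalgebra generated by the \<open>y i\<close>, while a
  chain of primes supplies \<open>d\<close> independent elements. Comparing growth gives the
  bound.\<close>

theorem dimension_le_differential_generators:
  fixes sc :: "'k::field \<Rightarrow> 'a::idom \<Rightarrow> 'a"
  assumes sc: "algebra_over sc" and G: "finite G" "is_subalgebra sc hull G = UNIV"
    and dim: "krull_dim (UNIV :: 'a set) = enat d" and B: "finite B" and g: "g \<noteq> 0"
    and gen: "\<And>v. v \<in> G \<Longrightarrow> pt g 1 * dif v \<in> coord_ideal sc y B 2"
  shows "d \<le> card B"
proof (cases "d = 0")
  case False
  let ?t = "\<lambda>a::'a. Fract a 1" and ?K = "is_subalgebra sc hull (y ` B)"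
  interpret V: vector_space sc using sc by (simp add: algebra_over_def)
  have K: "is_subalgebra sc ?K" by (rule is_subalgebra_hull_in)
  note KR = subalgebra_subring[OF sc K]
  note diag = diagonal_subset_generators[OF sc G(2)]
  obtain E l where E: "mult_map E = g ^ l" "\<And>\<tau>. \<tau> \<in> diagonal \<Longrightarrow> E * \<tau> \<in> differential_ideal sc y B"
    by (rule separability_element[OF sc G(1) diag gen]) (assumption | rule that)+
  have E0: "mult_map E \<noteq> 0" using E(1) g by simp
  have yK: "y i \<in> ?K" if "i \<in> B" for i using that by (auto intro: hull_inc)
  have span: "\<exists>f. (\<forall>p. f p \<in> quotients ?K) \<and> z = (\<Sum>p\<in>Poly_Mapping.keys E. f p * ?t (left_factor p))" for z
    by (rule fraction_field_span[OF sc K yK E0 E(2)])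
  obtain P where P: "\<And>i. i \<le> d \<Longrightarrow> prime_in (UNIV :: 'a set) (P i)" "\<And>i. i < d \<Longrightarrow> P i \<subset> P (Suc i)"
    by (rule krull_dim_chain[OF dim]) (use False in simp, rule that)
  have "\<exists>a. \<forall>i<d. a i \<in> P (Suc i) \<and> a i \<notin> P i" using P(2) by (intro choice) blast
  then obtain a where a: "\<And>i. i < d \<Longrightarrow> a i \<in> P (Suc i) \<and> a i \<notin> P i" by blast
  define s where "s i = a (i - 1)" for i
  have s: "\<And>i. i < d \<Longrightarrow> s (Suc i) \<in> P (Suc i)" "\<And>i. i < d \<Longrightarrow> s (Suc i) \<notin> P i" using a by (simp_all add: s_def)
  let ?I = "Poly_Mapping.keys E"
  \<comment> \<open>The elements to be expanded in the spanning set: the products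
    \<open>s i * left_factor p\<close>, and 1 as a start. One denominator \<open>q\<close> serves
    them all.\<close>
  define C where "C = insert 1 ((\<lambda>(i, p). s i * left_factor p) ` ({1..d} \<times> ?I))"
  have finC: "finite C" by (simp add: C_def)
  from span have "\<forall>z. \<exists>f. (\<forall>p. f p \<in> quotients ?K) \<and> z = (\<Sum>p\<in>?I. f p * ?t (left_factor p))" by blast
  from choice[OF this] obtain f where f: "\<And>z p. f z p \<in> quotients ?K" "\<And>z. z = (\<Sum>p\<in>?I. f z p * ?t (left_factor p))" by blast
  obtain q r where q: "q \<in> ?K" "q \<noteq> 0"
      "\<And>c p. c \<in> C \<Longrightarrow> p \<in> ?I \<Longrightarrow> r (c, p) \<in> ?K \<and> ?t q * f (?t c) p = ?t (r (c, p))"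
    using common_denominator[OF KR, of "C \<times> ?I" "\<lambda>(c, p). f (?t c) p"] finC f(1) by fastforce
  have qc: "q * c = (\<Sum>p\<in>?I. r (c, p) * left_factor p)" if c: "c \<in> C" for c
  proof -
    have t: "is_ring_hom ?t" by (simp add: is_ring_hom_def One_fract_def)
    have "?t (q * c) = ?t q * ?t c" by simp
    also have "\<dots> = ?t q * (\<Sum>p\<in>?I. f (?t c) p * ?t (left_factor p))" using f(2)[of "?t c"] by simp
    also have "\<dots> = (\<Sum>p\<in>?I. ?t (r (c, p) * left_factor p))"
      unfolding sum_distrib_left
    proof (rule sum.cong[OF refl])
      fix p assume p: "p \<in> ?I"
      have "?t q * (f (?t c) p * ?t (left_factor p)) = ?t (r (c, p)) * ?t (left_factor p)"
        using q(3)[OF c p] by (simp only: mult.assoc[symmetric])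
      then show "?t q * (f (?t c) p * ?t (left_factor p)) = ?t (r (c, p) * left_factor p)" by simp
    qed
    also have "\<dots> = ?t (\<Sum>p\<in>?I. r (c, p) * left_factor p)" unfolding is_ring_homD(8)[OF t] ..
    finally show ?thesis by (simp add: eq_fract)
  qed
  let ?Y = "\<lambda>N. V.span (box_monomials y B N)"
  have "\<exists>N. p \<in> ?Y N" if "p \<in> ?K" for p using subalgebra_hull_degree[OF sc B that] .
  then obtain deg where deg: "\<And>p. p \<in> ?K \<Longrightarrow> p \<in> ?Y (deg p)" by metis
  define D where "D = deg q + (\<Sum>x\<in>C \<times> ?I. deg (r x))"
  have bound: "p \<in> ?Y D" if "p \<in> ?K" "deg p \<le> D" for p
    using deg[OF that(1)] V.span_mono[OF box_monomials_mono[OF sc that(2)]] by blast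
  have qD: "q \<in> ?Y D" by (rule bound[OF q(1)]) (simp add: D_def)
  have rD: "r (c, p) \<in> ?Y D" if "c \<in> C" "p \<in> ?I" for c p
  proof (rule bound)
    have "deg (r (c, p)) \<le> (\<Sum>x\<in>C \<times> ?I. deg (r x))" using that finC by (intro member_le_sum) auto
    then show "deg (r (c, p)) \<le> D" by (simp add: D_def)
  qed (use q(3)[OF that] in blast)
  show ?thesis
  proof (rule growth_bound[OF sc B, of ?I q y D d s left_factor])
    fix i p assume "i \<in> {1..d}" "p \<in> ?I"
    then have c: "s i * left_factor p \<in> C" unfolding C_def by force
    show "\<exists>u. (\<forall>l\<in>?I. u l \<in> ?Y D) \<and> q * s i * left_factor p = (\<Sum>l\<in>?I. u l * left_factor l)"
      using qc[OF c] rD[OF c] by (intro exI[of _ "\<lambda>p'. r (s i * left_factor p, p')"]) (simp add: mult.assoc)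
  next
    have c: "1 \<in> C" by (simp add: C_def)
    show "\<exists>u. (\<forall>l\<in>?I. u l \<in> ?Y D) \<and> q = (\<Sum>l\<in>?I. u l * left_factor l)"
      using qc[OF c] rD[OF c] by (intro exI[of _ "\<lambda>p'. r (1, p')"]) simp
  next
    fix M c assume 0: "(\<Sum>J\<in>PiE {1..d} (\<lambda>_. {..M}). sc (c J) (q ^ (d * M + 1) * (\<Prod>i\<in>{1..d}. s i ^ J i))) = 0"
    have "q ^ (d * M + 1) * (\<Sum>J\<in>PiE {1..d} (\<lambda>_. {..M}). sc (c J) (\<Prod>i\<in>{1..d}. s i ^ J i)) = 0"
      using 0 by (simp only: sum_distrib_left algebra_scale_hom(8)[OF sc])
    then have 1: "(\<Sum>J\<in>PiE {1..d} (\<lambda>_. {..M}). sc (c J) (\<Prod>i\<in>{1..d}. s i ^ J i)) = 0" using q(2) by simp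
    show "\<forall>J\<in>PiE {1..d} (\<lambda>_. {..M}). c J = 0"
    proof (rule ccontr)
      assume "\<not> ?thesis"
      then obtain J where J: "J \<in> PiE {Suc 0..d} (\<lambda>_. {..M})" "c J \<noteq> 0" by auto
      have "(\<Sum>J\<in>PiE {Suc 0..d} (\<lambda>_. {..M}). sc (c J) (\<Prod>i\<in>{Suc 0..d}. s i ^ J i)) \<notin> P 0"
        by (rule chain_monomials_not_in[where I = J and d = d]) (rule sc P s J le0 | assumption)+
      then have "0 \<notin> P 0" using 1 by simp
      moreover have "is_ideal (P 0)" using P(1)[of 0] by (simp add: prime_in_def)
      ultimately show False using ideal_zero by blast
    qed
  qed (use qD in simp_all)
qed simp


section \<open>Parameters at a point of a coordinate ring\<close>

lemma is_ideal_power: "is_ideal (ideal_power J n)"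
  unfolding ideal_power_def by (rule is_ideal_hull)

lemma ideal_power_mult:
  assumes "u \<in> ideal_power J a" "v \<in> ideal_power J b"
  shows "u * v \<in> ideal_power J (a + b)"
proof (rule hull_mult_subset[OF is_ideal_power _ assms[unfolded ideal_power_def]])
  fix p q assume "p \<in> J ^ a" "q \<in> J ^ b"
  then have "p * q \<in> J ^ (a + b)" unfolding power_add by (rule set_times_intro)
  then show "p * q \<in> ideal_power J (a + b)" unfolding ideal_power_def by (rule hull_inc)
qed

lemma ideal_power_0: "ideal_power J 0 = UNIV"
proof -
  have "1 \<in> ideal_power J 0" unfolding ideal_power_def by (rule hull_inc) simp
  then show ?thesis using ideal_mult_left[OF is_ideal_power, of 1 J 0] by auto
qed

lemma ideal_power_1: "is_ideal J \<Longrightarrow> ideal_power J 1 = J"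
  unfolding ideal_power_def power_one_right by (rule hull_same)

lemma ideal_power_antimono: "a \<le> b \<Longrightarrow> ideal_power J b \<subseteq> ideal_power J a"
  unfolding ideal_power_def
proof (rule is_ideal_hull_least[OF is_ideal_hull], rule subsetI)
  fix z assume "a \<le> b" "z \<in> J ^ b"
  then have "z \<in> J ^ (b - a) * J ^ a" by (simp flip: power_add)
  then obtain p q where "z = p * q" "q \<in> J ^ a" unfolding set_times_def by blast
  then show "z \<in> is_ideal hull J ^ a" using ideal_mult_left[OF is_ideal_hull hull_inc, of q "J ^ a" p] by simp
qed

lemma infinite_UNIV_alg_closed: "infinite (UNIV :: 'k::alg_closed_field set)"
proof
  assume fin: "finite (UNIV :: 'k set)"
  define p where "p = (\<Prod>a\<in>UNIV. [:- a, 1::'k:]) + 1"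
  have val: "poly p a = 1" for a unfolding p_def poly_add poly_prod using fin by (simp add: prod_zero_iff)
  have "degree (\<Prod>a\<in>UNIV. [:- a, 1::'k:]) = card (UNIV :: 'k set)" by (subst degree_prod_eq_sum_degree) auto
  moreover have "card (UNIV :: 'k set) > 0" using fin by (simp add: card_gt_0_iff)
  ultimately have "degree p > 0" unfolding p_def by (subst degree_add_eq_left) auto
  then obtain a where "poly p a = 0" using alg_closed_imp_poly_has_root by blast
  then show False using val by simp
qed

lemma nonzero_value_exists:
  fixes c :: "(nat \<Rightarrow> nat) \<Rightarrow> 'k::alg_closed_field"
  assumes "finite A" "I \<in> PiE A (\<lambda>_. {..K})" "c I \<noteq> 0"
  shows "\<exists>t. (\<Sum>I\<in>PiE A (\<lambda>_. {..K}). c I * (\<Prod>i\<in>A. t i ^ I i)) \<noteq> 0"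
  using assms
proof (induction A arbitrary: c I rule: finite_induct)
  case (insert a A)
  have I: "I(a := undefined) \<in> PiE A (\<lambda>_. {..K})" "I a \<le> K" "(I(a := undefined))(a := I a) = I"
    using insert.prems(1) insert.hyps by (auto simp: PiE_iff extensional_def)
  have "c ((I(a := undefined))(a := I a)) \<noteq> 0" unfolding I(3) by (rule insert.prems(2))
  from insert.IH[of "I(a := undefined)" "\<lambda>J. c (J(a := I a))", OF I(1) this]
  obtain t where t: "(\<Sum>J\<in>PiE A (\<lambda>_. {..K}). c (J(a := I a)) * (\<Prod>i\<in>A. t i ^ J i)) \<noteq> 0" by blast
  define p where "p = (\<Sum>n\<le>K. monom (\<Sum>J\<in>PiE A (\<lambda>_. {..K}). c (J(a := n)) * (\<Prod>i\<in>A. t i ^ J i)) n)"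
  have "coeff p (I a) \<noteq> 0" using t I(2) unfolding p_def coeff_sum coeff_monom by (simp add: sum.delta')
  then have "p \<noteq> 0" by auto
  then obtain u where u: "poly p u \<noteq> 0"
    using poly_roots_finite[of p] infinite_UNIV_alg_closed by (metis (mono_tags, lifting) Collect_cong UNIV_def)
  have "(\<Sum>J\<in>PiE (insert a A) (\<lambda>_. {..K}). c J * (\<Prod>i\<in>insert a A. (t(a := u)) i ^ J i)) = poly p u"
  proof -
    have "(\<Prod>i\<in>insert a A. (t(a := u)) i ^ (J(a := n)) i) = (\<Prod>i\<in>A. t i ^ J i) * u ^ n" for J n
    proof -
      have "(\<Prod>i\<in>A. (t(a := u)) i ^ (J(a := n)) i) = (\<Prod>i\<in>A. t i ^ J i)" by (rule prod.cong) (use insert.hyps in auto)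
      then show ?thesis using insert.hyps by (simp add: mult.commute)
    qed
    then show ?thesis
      unfolding sum_PiE_insert[OF insert.hyps(2)] p_def poly_sum poly_monom sum_distrib_right by (simp only: mult.assoc)
  qed
  then show ?case using u by metis
qed auto

text \<open>The differential of \<open>b * u\<close> has a term with \<open>dif u\<close>, which is
  in \<open>N\<close>, and one with \<open>u\<close> times \<open>dif b\<close>, which is in
  \<open>N\<close> because \<open>u\<close> is in \<open>m\<close>.\<close>

lemma is_ideal_vimage_dif:
  assumes sc: "algebra_over sc" and m: "is_ideal m" and N: "is_ideal N" "diagonal_power sc 2 \<subseteq> N"
    and mN: "\<And>u \<tau>. u \<in> m \<Longrightarrow> \<tau> \<in> diagonal \<Longrightarrow> pt u 1 * \<tau> \<in> N"
  shows "is_ideal {u \<in> m. dif u \<in> N}"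
proof (rule is_idealI)
  note rel = relations_diagonal_power[of sc 2, THEN subset_trans, OF N(2)]
  show "0 \<in> {u \<in> m. dif u \<in> N}" using ideal_zero[OF m] dif_scale_one_cong[OF N(1) rel, of 0]
    by (simp add: algebra_scale_hom(5)[OF sc])
  fix u assume u: "u \<in> {u \<in> m. dif u \<in> N}"
  show "u + v \<in> {u \<in> m. dif u \<in> N}" if "v \<in> {u \<in> m. dif u \<in> N}" for v
    using u that ideal_add[OF m, of u v] ideal_add[OF N(1) dif_add_cong[OF N(1) rel, of u v] ideal_add[OF N(1), of "dif u" "dif v"]]
    by simp
  fix b
  have "dif b * dif u \<in> diagonal_power sc (1 + 1)"
    using diagonal_power_1[OF sc] dif_diagonal by (intro diagonal_power_mult) auto
  then have "dif u * dif b \<in> N" using N(2) by (auto simp: numeral_2_eq_2 mult.commute)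
  moreover have "pt 1 u * dif b = pt u 1 * dif b + dif u * dif b" by (simp add: dif_def[of u] algebra_simps)
  ultimately have "pt 1 u * dif b \<in> N" using ideal_add[OF N(1) mN[OF _ dif_diagonal[of b], of u]] u by simp
  then have "dif (b * u) \<in> N"
    unfolding dif_mult using u ideal_add[OF N(1) ideal_mult_left[OF N(1)]] by blast
  then show "b * u \<in> {u \<in> m. dif u \<in> N}" using u ideal_mult_left[OF m] by blast
qed

context
  fixes sc :: "'k::alg_closed_field \<Rightarrow> 'a::idom \<Rightarrow> 'a" and G m :: "'a set" and d :: nat
  assumes sc: "algebra_over sc" and G: "finite G" "is_subalgebra sc hull G = UNIV"
    and dim: "krull_dim (UNIV :: 'a set) = enat d" and max: "maximal_in UNIV m"
begin

lemma point_generators: "\<exists>V. finite V \<and> V \<subseteq> m \<and> is_subalgebra sc hull V = UNIV"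
proof -
  from nullstellensatz[OF sc G max] have "\<forall>a. \<exists>c. a - sc c 1 \<in> m" by blast
  from choice[OF this] obtain e where e: "\<And>a. a - sc (e a) 1 \<in> m" by blast
  let ?V = "(\<lambda>v. v - sc (e v) 1) ` G"
  have "G \<subseteq> is_subalgebra sc hull ?V"
  proof
    fix v assume "v \<in> G"
    note V = is_subalgebra_hull_in[of sc ?V]
    have "v - sc (e v) 1 \<in> is_subalgebra sc hull ?V" using \<open>v \<in> G\<close> by (auto intro: hull_inc)
    moreover have "sc (e v) 1 \<in> is_subalgebra sc hull ?V" using V by (auto simp: is_subalgebra_def)
    ultimately have "(v - sc (e v) 1) + sc (e v) 1 \<in> is_subalgebra sc hull ?V" using V unfolding is_subalgebra_def by blast
    then show "v \<in> is_subalgebra sc hull ?V" by simp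
  qed
  then have "is_subalgebra sc hull G \<subseteq> is_subalgebra sc hull ?V" by (rule hull_minimal) (rule is_subalgebra_hull_in)
  then show ?thesis using G e by (intro exI[of _ ?V]) auto
qed

context
  fixes x :: "nat \<Rightarrow> 'a"
  assumes x: "\<And>i. i \<in> {1..d} \<Longrightarrow> x i \<in> m" and m_gen: "m \<subseteq> is_ideal hull (ideal_power m 2 \<union> x ` {1..d})"
begin

text \<open>Nakayama at the point. As \<open>m\<close> is generated by its square and the
  \<open>x i\<close>, the product rule writes differentials of \<open>m\<close> through those of the
  \<open>x i\<close> up to coefficients in \<open>m\<close>. Elimination yields \<open>E\<close>
  congruent to 1, so its image \<open>g\<close> does not vanish at the point.\<close>

lemma differentials_generated_at_point:
  obtains g where "g \<notin> m" "\<And>\<tau>. \<tau> \<in> diagonal \<Longrightarrow> pt g 1 * \<tau> \<in> coord_ideal sc x {1..d} 2"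
proof -
  note mf = maximal_ideal_facts[OF max] and m = maximal_ideal_facts(1)[OF max]
  let ?J = "coord_ideal sc x {1..d} 2" and ?Q = "is_ideal hull ((\<lambda>z. pt z 1) ` m)"
  note J = is_ideal_coord_ideal[of sc x "{1..d}" 2] and Jg = coord_ideal_generators[where sc = sc and x = x and B = "{1..d}" and n = 2]
  note Q = is_ideal_hull[of "(\<lambda>z. pt z 1) ` m"]
  obtain V where V: "finite V" "V \<subseteq> m" "is_subalgebra sc hull V = UNIV" using point_generators by blast
  let ?D = "dif ` V"
  have diag: "diagonal \<subseteq> is_ideal hull (tensor_relations sc \<union> ?D)" by (rule diagonal_subset_generators[OF sc V(3)])
  have lin: "\<exists>c. \<tau> - (\<Sum>u\<in>?D. c u * u) \<in> ?J" if "\<tau> \<in> diagonal" for \<tau>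
  proof -
    have "tensor_relations sc \<union> ?D \<subseteq> ?J \<union> ?D" using Jg(3) by blast
    then have "\<tau> \<in> is_ideal hull (?J \<union> ?D)" using diag that hull_mono[of _ _ is_ideal] by blast
    then obtain a b where ab: "a \<in> ?J" "b \<in> is_ideal hull ?D" "\<tau> = a + b" by (rule is_ideal_hull_Un[OF J])
    have "is_ideal hull ?D = {\<Sum>u\<in>?D. r u * u | r. True}" using is_ideal_hull_finite[of ?D "\<lambda>u. u"] V(1) by simp
    then obtain r where "b = (\<Sum>u\<in>?D. r u * u)" using ab(2) by blast
    then have "\<tau> - (\<Sum>u\<in>?D. r u * u) = a" using ab(3) by simp
    then have "\<tau> - (\<Sum>u\<in>?D. r u * u) \<in> ?J" using ab(1) by (simp only:)
    then show ?thesis by (rule exI[of _ r])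
  qed
  \<comment> \<open>The differentials with coefficients in \<open>m\<close>, together with the ideal
    of the \<open>dif (x i)\<close>, written with the finite generating set
    \<open>?D\<close>.\<close>
  define N where "N = {\<tau>. \<exists>q. (\<forall>u\<in>?D. q u \<in> ?Q) \<and> \<tau> - (\<Sum>u\<in>?D. q u * u) \<in> ?J}"
  have N: "is_ideal N"
  proof (rule is_idealI)
    show "0 \<in> N" unfolding N_def using ideal_zero[OF J] ideal_zero[OF Q] by (intro CollectI exI[of _ "\<lambda>_. 0"]) simp
    fix s t assume s: "s \<in> N"
    then obtain q where q: "\<forall>u\<in>?D. q u \<in> ?Q" "s - (\<Sum>u\<in>?D. q u * u) \<in> ?J" unfolding N_def by blast
    have "r * s - (\<Sum>u\<in>?D. (r * q u) * u) = r * (s - (\<Sum>u\<in>?D. q u * u))" for r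
      by (simp add: right_diff_distrib sum_distrib_left mult.assoc)
    then show "r * s \<in> N" for r unfolding N_def using q ideal_mult_left[OF J q(2)] ideal_mult_left[OF Q]
      by (intro CollectI exI[of _ "\<lambda>u. r * q u"]) simp
    assume "t \<in> N"
    then obtain q' where q': "\<forall>u\<in>?D. q' u \<in> ?Q" "t - (\<Sum>u\<in>?D. q' u * u) \<in> ?J" unfolding N_def by blast
    have eq: "s + t - (\<Sum>u\<in>?D. (q u + q' u) * u) = (s - (\<Sum>u\<in>?D. q u * u)) + (t - (\<Sum>u\<in>?D. q' u * u))"
      by (simp add: distrib_right sum.distrib)
    have "s + t - (\<Sum>u\<in>?D. (q u + q' u) * u) \<in> ?J" unfolding eq by (rule ideal_add[OF J q(2) q'(2)])
    moreover have "\<forall>u\<in>?D. q u + q' u \<in> ?Q" using q(1) q'(1) ideal_add[OF Q] by blast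
    ultimately show "s + t \<in> N" unfolding N_def by (intro CollectI exI[of _ "\<lambda>u. q u + q' u"] conjI)
  qed
  have JN: "?J \<subseteq> N"
    unfolding N_def using ideal_zero[OF Q] by (auto intro!: exI[of _ "\<lambda>_. 0"])
  have mN: "pt u 1 * \<tau> \<in> N" if u: "u \<in> m" and \<tau>: "\<tau> \<in> diagonal" for u \<tau>
  proof -
    obtain c where c: "\<tau> - (\<Sum>u\<in>?D. c u * u) \<in> ?J" using lin[OF \<tau>] by blast
    have "pt u 1 * \<tau> - (\<Sum>w\<in>?D. (pt u 1 * c w) * w) = pt u 1 * (\<tau> - (\<Sum>u\<in>?D. c u * u))"
      by (simp add: right_diff_distrib sum_distrib_left mult.assoc)
    then have "pt u 1 * \<tau> - (\<Sum>w\<in>?D. (pt u 1 * c w) * w) \<in> ?J" using ideal_mult_left[OF J c] by simp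
    moreover have "pt u 1 * c w \<in> ?Q" for w by (rule ideal_mult_right[OF Q hull_inc]) (use u in blast)
    ultimately show ?thesis unfolding N_def by (intro CollectI exI[of _ "\<lambda>w. pt u 1 * c w"] conjI ballI)
  qed
  have "m \<subseteq> {u \<in> m. dif u \<in> N}"
  proof (rule subset_trans[OF m_gen], rule hull_minimal)
    show I: "is_ideal {u \<in> m. dif u \<in> N}"
      by (rule is_ideal_vimage_dif[OF sc m N _ mN]) (use Jg(1) JN in blast)
    have "x ` {1..d} \<subseteq> {u \<in> m. dif u \<in> N}" using x Jg(2) JN by blast
    moreover have "ideal_power m 2 \<subseteq> {u \<in> m. dif u \<in> N}"
      unfolding ideal_power_def
    proof (rule is_ideal_hull_least[OF I], rule subsetI)
      fix z assume "z \<in> m ^ 2"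
      then obtain u v where uv: "z = u * v" "u \<in> m" "v \<in> m" unfolding power2_eq_square set_times_def by blast
      have "dif v * dif u \<in> diagonal_power sc (1 + 1)"
        using diagonal_power_1[OF sc] dif_diagonal by (intro diagonal_power_mult) auto
      then have d2: "dif v * dif u \<in> N" using Jg(1) JN by (auto simp: numeral_2_eq_2)
      have "dif z = pt u 1 * dif v + (pt v 1 * dif u + dif v * dif u)" by (simp add: uv(1) dif_mult dif_def[of v] algebra_simps)
      then have "dif z \<in> N"
        using ideal_add[OF N mN[OF uv(2) dif_diagonal] ideal_add[OF N mN[OF uv(3) dif_diagonal] d2]] by simp
      then show "z \<in> {u \<in> m. dif u \<in> N}" using uv ideal_mult_left[OF m] by blast
    qed
    ultimately show "ideal_power m 2 \<union> x ` {1..d} \<subseteq> {u \<in> m. dif u \<in> N}" by blast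
  qed
  then have "\<exists>q. (\<forall>u\<in>?D. q u \<in> ?Q) \<and> v - (\<Sum>u\<in>?D. q u * u) \<in> ?J" if "v \<in> ?D" for v
    using that V(2) unfolding N_def by blast
  then have "\<exists>e l q. e - 1 ^ l \<in> ?Q \<and> (\<forall>u\<in>?D. q u \<in> ?Q) \<and> e * v - (\<Sum>u\<in>?D. q u * u) \<in> ?J" if "v \<in> ?D" for v
    using that ideal_zero[OF Q] by (intro exI[of _ 1] exI[of _ 0]) simp
  from nakayama_elimination[OF J Q _ this] V(1) obtain E l where E: "E - 1 ^ l \<in> ?Q" "\<forall>v\<in>?D. E * v \<in> ?J" by blast
  have Qm: "mult_map q \<in> m" if "q \<in> ?Q" for q
  proof -
    note h = is_ring_homD[OF is_ring_hom_mult_map]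
    have "is_ideal {q. mult_map q \<in> m}"
      by (rule is_idealI) (simp_all add: h(2,3,4) ideal_zero[OF m] ideal_add[OF m] ideal_mult_left[OF m])
    then have "?Q \<subseteq> {q. mult_map q \<in> m}" by (rule hull_minimal[rotated]) auto
    then show ?thesis using that by blast
  qed
  let ?g = "mult_map E"
  have "mult_map (E - 1) \<in> m" using Qm E(1) by simp
  then have gm: "?g - 1 \<in> m" by (simp add: is_ring_homD[OF is_ring_hom_mult_map])
  have "?g \<notin> m"
  proof
    assume "?g \<in> m"
    from ideal_diff[OF m this gm] show False using mf(2) by simp
  qed
  moreover have "pt ?g 1 * \<tau> \<in> ?J" if "\<tau> \<in> diagonal" for \<tau>
  proof -
    have "is_ideal hull (tensor_relations sc \<union> ?D) \<subseteq> {\<tau>. pt ?g 1 * \<tau> \<in> ?J}"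
    proof (rule hull_minimal)
      show "is_ideal {\<tau>. pt ?g 1 * \<tau> \<in> ?J}" by (rule is_ideal_vimage_mult[OF J])
      have "pt ?g 1 * u \<in> ?J" if u: "u \<in> ?D" for u
      proof -
        have "(E - pt ?g 1) * u \<in> diagonal_power sc (1 + 1)"
          using diagonal_power_1[OF sc] dif_diagonal pt_mult_map_cong[of E] u by (intro diagonal_power_mult) auto
        then have "(E - pt ?g 1) * u \<in> ?J" using Jg(1) by (auto simp: numeral_2_eq_2)
        from ideal_diff[OF J E(2)[rule_format, OF u] this] show ?thesis by (simp add: left_diff_distrib)
      qed
      then show "tensor_relations sc \<union> ?D \<subseteq> {\<tau>. pt ?g 1 * \<tau> \<in> ?J}" using Jg(3) ideal_mult_left[OF J] by blast
    qed
    then show ?thesis using diag that by blast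
  qed
  ultimately show thesis by (rule that)
qed

text \<open>The differentials are also independent: in a relation with nonzero j-th coefficient,
  inverting that coefficient would let the other \<open>d - 1\<close> differentials generate, fewer
  than the dimension allows. So partial derivatives exist on the fraction field.\<close>

lemma parameters_generic_coordinates:
  obtains D g E l where "g \<notin> m" "\<And>\<tau>. \<tau> \<in> diagonal \<Longrightarrow> pt g 1 * \<tau> \<in> coord_ideal sc x {1..d} 2"
    "generic_coordinates sc (\<lambda>a. Fract a 1) x {1..d} D g E l"
proof -
  obtain g where g: "g \<notin> m" "\<And>\<tau>. \<tau> \<in> diagonal \<Longrightarrow> pt g 1 * \<tau> \<in> coord_ideal sc x {1..d} 2"
    by (rule differentials_generated_at_point) (rule that; assumption)
  let ?t = "\<lambda>a::'a. Fract a 1"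
  have g0: "g \<noteq> 0" using g(1) ideal_zero[OF maximal_ideal_facts(1)[OF max]] by blast
  have hom: "is_ring_hom ?t" by (simp add: is_ring_hom_def One_fract_def)
  have inj: "a = 0" if "?t a = 0" for a using that by (simp add: Zero_fract_def eq_fract)
  let ?J = "coord_ideal sc x {1..d} 2"
  have gens: "\<exists>c. pt g 1 * \<tau> - (\<Sum>i\<in>{1..d}. pt (c i) 1 * dif (x i)) \<in> diagonal_power sc 2" if \<tau>: "\<tau> \<in> diagonal" for \<tau>
  proof -
    obtain a b where ab: "a \<in> diagonal_power sc 2" "b \<in> is_ideal hull ((\<lambda>i. dif (x i)) ` {1..d})" "pt g 1 * \<tau> = a + b"
      using g(2)[OF \<tau>] is_ideal_hull_Un[OF is_ideal_diag_power] unfolding coord_ideal_def by metis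
    obtain r where r: "b = (\<Sum>i\<in>{1..d}. r i * dif (x i))" using ab(2) unfolding is_ideal_hull_finite[OF finite_atLeastAtMost] by blast
    have "(r i - pt (mult_map (r i)) 1) * dif (x i) \<in> diagonal_power sc (1 + 1)" for i
      using diagonal_power_1[OF sc] dif_diagonal pt_mult_map_cong by (intro diagonal_power_mult) auto
    then have "a + (\<Sum>i\<in>{1..d}. (r i - pt (mult_map (r i)) 1) * dif (x i)) \<in> diagonal_power sc 2"
      using ab(1) by (intro ideal_add[OF is_ideal_diag_power] ideal_sum[OF is_ideal_diag_power]) (simp_all add: numeral_2_eq_2)
    then show ?thesis
      by (intro exI[of _ "\<lambda>i. mult_map (r i)"]) (simp only: ab(3) r left_diff_distrib sum_subtractf add_diff_eq)
  qed
  have uniq: "c j = 0" if c: "(\<Sum>i\<in>{1..d}. pt (c i) 1 * dif (x i)) \<in> diagonal_power sc 2" and j: "j \<in> {1..d}" for c j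
  proof (rule ccontr)
    assume "c j \<noteq> 0"
    let ?J' = "coord_ideal sc x ({1..d} - {j}) 2"
    note J' = is_ideal_coord_ideal[of sc x "{1..d} - {j}" 2]
      and J'g = coord_ideal_generators[where sc = sc and x = x and B = "{1..d} - {j}" and n = 2]
    have rest: "(\<Sum>i\<in>{1..d} - {j}. pt (c i) 1 * dif (x i)) \<in> ?J'"
      by (intro ideal_sum[OF J'] ideal_mult_left[OF J'] J'g(2))
    have all: "(\<Sum>i\<in>{1..d}. pt (c i) 1 * dif (x i)) \<in> ?J'" using J'g(1) c by (rule subsetD)
    have "(\<Sum>i\<in>{1..d}. pt (c i) 1 * dif (x i)) = pt (c j) 1 * dif (x j) + (\<Sum>i\<in>{1..d} - {j}. pt (c i) 1 * dif (x i))"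
      by (rule sum.remove) (use j in auto)
    then have cj: "pt (c j) 1 * dif (x j) \<in> ?J'" using ideal_diff[OF J' all rest] by simp
    have "?J \<subseteq> {\<tau>. pt (c j) 1 * \<tau> \<in> ?J'}"
      unfolding coord_ideal_def[of sc x "{1..d}"]
    proof (rule hull_minimal)
      show "is_ideal {\<tau>. pt (c j) 1 * \<tau> \<in> ?J'}" by (rule is_ideal_vimage_mult[OF J'])
      show "diagonal_power sc 2 \<union> (\<lambda>i. dif (x i)) ` {1..d} \<subseteq> {\<tau>. pt (c j) 1 * \<tau> \<in> ?J'}"
        using J'g(1,2) cj ideal_mult_left[OF J'] by blast
    qed
    then have "pt (c j) 1 * (pt g 1 * dif v) \<in> ?J'" for v using g(2)[OF dif_diagonal[of v]] by blast
    moreover have "pt (c j) 1 * (pt g 1 * dif v) = pt (c j * g) 1 * dif v" for v by (simp add: pt_mult flip: mult.assoc)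
    ultimately have "pt (c j * g) 1 * dif v \<in> ?J'" for v by metis
    then have "d \<le> card ({1..d} - {j})"
      by (intro dimension_le_differential_generators[OF sc G dim, of _ "c j * g" x]) (use \<open>c j \<noteq> 0\<close> g0 in auto)
    then show False using j by (simp, arith)
  qed
  obtain pd :: "nat \<Rightarrow> 'a \<Rightarrow> 'a fract" where pd:
    "\<And>i r s. i \<in> {1..d} \<Longrightarrow> pd i (r + s) = pd i r + pd i s"
    "\<And>i r s. i \<in> {1..d} \<Longrightarrow> pd i (r * s) = ?t r * pd i s + ?t s * pd i r"
    "\<And>i c. i \<in> {1..d} \<Longrightarrow> pd i (sc c 1) = 0"
    "\<And>i j. i \<in> {1..d} \<Longrightarrow> j \<in> {1..d} \<Longrightarrow> pd i (x j) = (if i = j then 1 else 0)"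
  proof (rule partial_derivatives[where A = "{1..d}" and x = x and g = g and sc = sc and \<phi> = ?t])
    show "c i = 0" if "(\<Sum>i\<in>{1..d}. pt (c i) 1 * dif (x i)) \<in> diagonal_power sc 2" "i \<in> {1..d}" for c i
      by (rule uniq[OF that])
  qed (rule sc hom finite_atLeastAtMost g0 | erule inj gens | (rule that; assumption))+
  have "\<exists>D. is_derivation D \<and> (\<forall>a. D (?t a) = pd i a)" if i: "i \<in> {1..d}" for i
  proof -
    obtain D where "is_derivation D" "\<And>a. D (?t a) = pd i a"
      by (rule derivation_extends_to_fract[of "pd i"]) (rule pd(1,2)[OF i] that | assumption)+
    then show ?thesis by blast
  qed
  then obtain D where D: "\<And>i. i \<in> {1..d} \<Longrightarrow> is_derivation (D i)" "\<And>i a. i \<in> {1..d} \<Longrightarrow> D i (?t a) = pd i a" by metis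
  obtain E l where E: "mult_map E = g ^ l" "\<And>\<tau>. \<tau> \<in> diagonal \<Longrightarrow> E * \<tau> \<in> differential_ideal sc x {1..d}"
  proof (rule separability_element[OF sc G(1) diagonal_subset_generators[OF sc G(2)], of g x "{1..d}"])
    show "pt g 1 * dif v \<in> ?J" for v by (rule g(2)[OF dif_diagonal])
  qed (use that in auto)
  have "generic_coordinates sc ?t x {1..d} D g E l"
  proof
    show "D i (?t (sc c 1)) = 0" if "i \<in> {1..d}" for i c using D(2)[OF that] pd(3)[OF that] by simp
    show "D i (?t (x j)) = (if i = j then 1 else 0)" if "i \<in> {1..d}" "j \<in> {1..d}" for i j
      using D(2)[OF that(1)] pd(4)[OF that] by simp
  qed (use sc hom inj D(1) g0 E in auto)
  then show thesis using that g by blast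
qed

text \<open>Expand \<open>pt 1 u\<close> in powers of \<open>dif (x j)\<close>. Up to a power of
  \<open>g\<close>, members of the ideal have all coefficients in \<open>m\<close>, whereas
  \<open>x j ^ s\<close> agrees with \<open>dif (x j) ^ s\<close> up to such terms. Uniqueness of
  the coefficients would put a power of \<open>g\<close> into \<open>m\<close>.\<close>

lemma parameter_power_not_in:
  assumes j: "j \<in> {1..d}"
  shows "x j ^ s \<notin> is_ideal hull (ideal_power m (Suc s) \<union> x ` ({1..d} - {j}))"
proof
  assume xs: "x j ^ s \<in> is_ideal hull (ideal_power m (Suc s) \<union> x ` ({1..d} - {j}))"
  note mf = maximal_ideal_facts[OF max] and m = maximal_ideal_facts(1)[OF max]
  obtain D g E l where g: "g \<notin> m" "\<And>\<tau>. \<tau> \<in> diagonal \<Longrightarrow> pt g 1 * \<tau> \<in> coord_ideal sc x {1..d} 2"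
      and gc: "generic_coordinates sc (\<lambda>a. Fract a 1) x {1..d} D g E l"
    by (rule parameters_generic_coordinates) (rule that; assumption)
  let ?Q = "coord_ideal sc x ({1..d} - {j}) (Suc s)" and ?Z = "dif (x j)"
  note Q = is_ideal_coord_ideal[of sc x "{1..d} - {j}" "Suc s"]
    and Qg = coord_ideal_generators[where sc = sc and x = x and B = "{1..d} - {j}" and n = "Suc s"]
  obtain e where e: "\<And>\<xi>. \<exists>c. pt (g ^ e) 1 * \<xi> - (\<Sum>n\<le>s. pt (c n) 1 * ?Z ^ n) \<in> ?Q"
    using expansion_exists[OF sc finite_atLeastAtMost g(2) j, of s] by blast
  \<comment> \<open>Tensors all of whose multiples have an expansion with coefficients in
    \<open>m\<close>; the multiplier \<open>\<sigma>\<close> makes this an ideal.\<close>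
  define S where "S = {\<tau>. \<forall>\<sigma>. \<exists>c. (\<forall>n. c n \<in> m) \<and> pt (g ^ e) 1 * (\<sigma> * \<tau>) - (\<Sum>n\<le>s. pt (c n) 1 * ?Z ^ n) \<in> ?Q}"
  have QS: "?Q \<subseteq> S"
  proof
    fix \<tau> assume \<tau>: "\<tau> \<in> ?Q"
    have "(\<Sum>n\<le>s. pt 0 1 * ?Z ^ n) \<in> ?Q"
      by (intro ideal_sum[OF Q] ideal_mult_right[OF Q] pt_zero_left_cong[OF Q Qg(3)])
    then have "pt (g ^ e) 1 * (\<sigma> * \<tau>) - (\<Sum>n\<le>s. pt 0 1 * ?Z ^ n) \<in> ?Q" for \<sigma>
      by (intro ideal_diff[OF Q] ideal_mult_left[OF Q] \<tau>)
    then show "\<tau> \<in> S" unfolding S_def using ideal_zero[OF m] by (intro CollectI allI exI[of _ "\<lambda>_. 0"]) simp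
  qed
  have S: "is_ideal S"
  proof (rule is_idealI)
    show "0 \<in> S" using QS ideal_zero[OF Q] by blast
    fix t u assume t: "t \<in> S"
    show "r * t \<in> S" for r
      unfolding S_def
    proof (intro CollectI allI)
      fix \<sigma>
      have "\<sigma> * (r * t) = (\<sigma> * r) * t" by (rule mult.assoc[symmetric])
      then show "\<exists>c. (\<forall>n. c n \<in> m) \<and> pt (g ^ e) 1 * (\<sigma> * (r * t)) - (\<Sum>n\<le>s. pt (c n) 1 * ?Z ^ n) \<in> ?Q"
        using t unfolding S_def by (simp only: mem_Collect_eq)
    qed
    assume u: "u \<in> S"
    show "t + u \<in> S"
      unfolding S_def
    proof (intro CollectI allI)
      fix \<sigma>
      obtain c where c: "\<forall>n. c n \<in> m" "pt (g ^ e) 1 * (\<sigma> * t) - (\<Sum>n\<le>s. pt (c n) 1 * ?Z ^ n) \<in> ?Q" using t unfolding S_def by blast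
      obtain b where b: "\<forall>n. b n \<in> m" "pt (g ^ e) 1 * (\<sigma> * u) - (\<Sum>n\<le>s. pt (b n) 1 * ?Z ^ n) \<in> ?Q" using u unfolding S_def by blast
      have R: "(\<Sum>n\<le>s. (pt (c n + b n) 1 - (pt (c n) 1 + pt (b n) 1)) * ?Z ^ n) \<in> ?Q"
        by (intro ideal_sum[OF Q] ideal_mult_right[OF Q] pt_add_left_cong[OF Q Qg(3)])
      have "pt (g ^ e) 1 * (\<sigma> * (t + u)) - (\<Sum>n\<le>s. pt (c n + b n) 1 * ?Z ^ n) \<in> ?Q"
      proof -
        have "(\<Sum>n\<le>s. (pt (c n + b n) 1 - (pt (c n) 1 + pt (b n) 1)) * ?Z ^ n) =
            (\<Sum>n\<le>s. pt (c n + b n) 1 * ?Z ^ n) - ((\<Sum>n\<le>s. pt (c n) 1 * ?Z ^ n) + (\<Sum>n\<le>s. pt (b n) 1 * ?Z ^ n))"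
          by (simp only: left_diff_distrib distrib_right sum_subtractf sum.distrib)
        moreover have "p - C + (q - B) - (X - (C + B)) = p + q - X" for p q B C X :: "'a pretensor" by simp
        ultimately show ?thesis
          using ideal_diff[OF Q ideal_add[OF Q c(2) b(2)] R] by (simp only: distrib_left)
      qed
      then show "\<exists>c. (\<forall>n. c n \<in> m) \<and> pt (g ^ e) 1 * (\<sigma> * (t + u)) - (\<Sum>n\<le>s. pt (c n) 1 * ?Z ^ n) \<in> ?Q"
        using c(1) b(1) ideal_add[OF m] by (intro exI[of _ "\<lambda>n. c n + b n"]) blast
    qed
  qed
  have mS: "pt z 1 \<in> S" if z: "z \<in> m" for z
    unfolding S_def
  proof (intro CollectI allI)
    fix \<sigma>
    obtain c where c: "pt (g ^ e) 1 * \<sigma> - (\<Sum>n\<le>s. pt (c n) 1 * ?Z ^ n) \<in> ?Q" using e by blast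
    have "pt z 1 * (pt (g ^ e) 1 * \<sigma> - (\<Sum>n\<le>s. pt (c n) 1 * ?Z ^ n)) =
        pt (g ^ e) 1 * (\<sigma> * pt z 1) - (\<Sum>n\<le>s. (pt z 1 * pt (c n) 1) * ?Z ^ n)"
      by (simp only: right_diff_distrib sum_distrib_left mult_ac)
    moreover have "pt z 1 * pt (c n) 1 = pt (z * c n) 1" for n by (simp add: pt_mult)
    ultimately have "pt (g ^ e) 1 * (\<sigma> * pt z 1) - (\<Sum>n\<le>s. pt (z * c n) 1 * ?Z ^ n) \<in> ?Q"
      using ideal_mult_left[OF Q c, of "pt z 1"] by simp
    then show "\<exists>c. (\<forall>n. c n \<in> m) \<and> pt (g ^ e) 1 * (\<sigma> * pt z 1) - (\<Sum>n\<le>s. pt (c n) 1 * ?Z ^ n) \<in> ?Q"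
      using ideal_mult_right[OF m z] by (intro exI[of _ "\<lambda>n. z * c n"] conjI allI)
  qed
  have split: "pt 1 z = pt z 1 + dif z" for z :: 'a by (simp add: dif_def)
  have I: "is_ideal {u. pt 1 u \<in> S}"
  proof (rule is_idealI)
    note rel = subset_trans[OF Qg(3) QS]
    show "0 \<in> {u. pt 1 u \<in> S}" using pt_zero_right_cong[OF S rel] by simp
    show "u + v \<in> {u. pt 1 u \<in> S}" if "u \<in> {u. pt 1 u \<in> S}" "v \<in> {u. pt 1 u \<in> S}" for u v
      using ideal_add[OF S pt_add_right_cong[OF S rel, of 1 u v] ideal_add[OF S, of "pt 1 u" "pt 1 v"]] that by simp
    show "r * u \<in> {u. pt 1 u \<in> S}" if "u \<in> {u. pt 1 u \<in> S}" for r u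
      using ideal_mult_left[OF S, of "pt 1 u" "pt 1 r"] that by (simp add: pt_mult)
  qed
  \<comment> \<open>Each factor splits as \<open>pt 1 z = pt z 1 + dif z\<close>, so for a product
    from \<open>m ^ n\<close> only the product of the differentials escapes
    \<open>S\<close>.\<close>
  have prods: "\<exists>a\<in>S. \<exists>b\<in>diagonal_power sc n. pt 1 u = a + b" if "u \<in> m ^ n" for u n
    using that
  proof (induction n arbitrary: u)
    case 0
    show ?case using ideal_zero[OF S] by (intro bexI[of _ 0] bexI[of _ "pt 1 u"]) (simp_all add: diagonal_power_0)
  next
    case (Suc n)
    then obtain z u' where u: "u = z * u'" "z \<in> m" "u' \<in> m ^ n" unfolding power_Suc set_times_def by blast
    obtain a b where ab: "a \<in> S" "b \<in> diagonal_power sc n" "pt 1 u' = a + b" using Suc.IH[OF u(3)] by blast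
    have "pt 1 u = pt 1 z * pt 1 u'" by (simp add: u(1) pt_mult)
    then have eq: "pt 1 u = (pt z 1 * (a + b) + dif z * a) + dif z * b"
      unfolding ab(3) split[of z] by (simp add: algebra_simps)
    have "pt z 1 * (a + b) + dif z * a \<in> S"
      using ideal_add[OF S ideal_mult_right[OF S mS[OF u(2)]] ideal_mult_left[OF S ab(1)]] by blast
    moreover have "dif z * b \<in> diagonal_power sc (1 + n)"
      using ab(2) diagonal_power_1[OF sc] dif_diagonal by (intro diagonal_power_mult) auto
    ultimately show ?case using eq by auto
  qed
  have "is_ideal hull (ideal_power m (Suc s) \<union> x ` ({1..d} - {j})) \<subseteq> {u. pt 1 u \<in> S}"
  proof (rule is_ideal_hull_least[OF I], rule Un_least)
    show "ideal_power m (Suc s) \<subseteq> {u. pt 1 u \<in> S}"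
      unfolding ideal_power_def
    proof (rule is_ideal_hull_least[OF I], rule subsetI)
      fix u assume "u \<in> m ^ Suc s"
      from prods[OF this] obtain a b where "a \<in> S" "b \<in> diagonal_power sc (Suc s)" "pt 1 u = a + b" by blast
      then show "u \<in> {u. pt 1 u \<in> S}" using ideal_add[OF S] Qg(1) QS by auto
    qed
    show "x ` ({1..d} - {j}) \<subseteq> {u. pt 1 u \<in> S}"
      using ideal_add[OF S mS[OF x]] Qg(2) QS unfolding split by blast
  qed
  then have "pt 1 (x j) ^ s \<in> S" using xs by (auto simp: pt_power)
  moreover have "pt 1 (x j) ^ s - ?Z ^ s \<in> S"
    by (rule power_cong_ideal[OF S]) (use mS[OF x[OF j]] in \<open>simp add: split\<close>)
  ultimately have "?Z ^ s \<in> S" using ideal_diff[OF S] by fastforce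
  then obtain c where c: "\<forall>n. c n \<in> m" "pt (g ^ e) 1 * (1 * ?Z ^ s) - (\<Sum>n\<le>s. pt (c n) 1 * ?Z ^ n) \<in> ?Q"
    unfolding S_def by blast
  \<comment> \<open>With \<open>g ^ e\<close> subtracted at \<open>s\<close> this is an expansion of
    0, so uniqueness yields \<open>g ^ e = c s\<close>.\<close>
  let ?c = "c(s := c s - g ^ e)"
  have "(\<Sum>n\<le>s. pt (?c n) 1 * ?Z ^ n) = (\<Sum>n<s. pt (c n) 1 * ?Z ^ n) + pt (c s - g ^ e) 1 * ?Z ^ s"
    unfolding lessThan_Suc_atMost[symmetric] by simp
  also have "\<dots> = (pt (c s - g ^ e) 1 - (pt (c s) 1 - pt (g ^ e) 1)) * ?Z ^ s -
      (pt (g ^ e) 1 * (1 * ?Z ^ s) - (\<Sum>n\<le>s. pt (c n) 1 * ?Z ^ n))"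
    unfolding lessThan_Suc_atMost[symmetric] by (simp add: algebra_simps)
  also have "\<dots> \<in> ?Q" by (intro ideal_diff[OF Q] ideal_mult_right[OF Q] pt_diff_left_cong[OF Q Qg(3)] c(2))
  finally have "(\<Sum>n\<le>s. pt (?c n) 1 * ?Z ^ n) \<in> ?Q" .
  from generic_coordinates.power_coefficients_zero[OF gc j this order_refl] have "g ^ e = c s" by simp
  then have "g ^ e \<in> m" using c(1) by simp
  moreover have "g ^ n \<notin> m" for n by (induction n) (use mf(2,3) g(1) in auto)
  ultimately show False by blast
qed

end

text \<open>
  A form of degree \<open>s\<close> that vanishes to order \<open>s + 1\<close> is evaluated along a line on which it does not
  vanish: after a linear change of the parameters it becomes a power of the \<open>j\<close>-th one.
\<close>

theorem parameters_independent:
  fixes c :: "(nat \<Rightarrow> nat) \<Rightarrow> 'k"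
  assumes x: "\<And>i. i \<in> {1..d} \<Longrightarrow> x i \<in> m" and m_gen: "m \<subseteq> is_ideal hull (ideal_power m 2 \<union> x ` {1..d})"
    and S: "S = {I \<in> PiE {1..d} (\<lambda>_. UNIV). sum I {1..d} = s}"
    and F: "(\<Sum>I\<in>S. sc (c I) (\<Prod>i\<in>{1..d}. x i ^ I i)) \<in> ideal_power m (Suc s)"
    and I: "I \<in> S"
  shows "c I = 0"
proof (rule ccontr)
  assume cI: "c I \<noteq> 0"
  note mf = maximal_ideal_facts[OF max] and m = maximal_ideal_facts(1)[OF max] and h = algebra_scale_hom[OF sc]
  let ?P = "PiE {1..d} (\<lambda>_. {..s})"
  have SP: "S \<subseteq> ?P"
  proof
    fix I assume I: "I \<in> S"
    have "I i \<le> sum I {1..d}" if "i \<in> {1..d}" for i by (rule member_le_sum) (use that in auto)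
    then show "I \<in> ?P" using I by (simp add: S PiE_iff)
  qed
  let ?c = "\<lambda>I. if I \<in> S then c I else 0"
  have finP: "finite ?P" by (simp add: finite_PiE)
  have "\<exists>t. (\<Sum>I\<in>?P. ?c I * (\<Prod>i\<in>{1..d}. t i ^ I i)) \<noteq> 0"
    by (rule nonzero_value_exists[of "{1..d}" I]) (use I SP cI in auto)
  moreover have "(\<Sum>I\<in>?P. ?c I * (\<Prod>i\<in>{1..d}. t i ^ I i)) = (\<Sum>I\<in>S. c I * (\<Prod>i\<in>{1..d}. t i ^ I i))" for t
    by (rule sum.mono_neutral_cong_right[OF finP SP]) auto
  \<comment> \<open>The direction of the line. \<open>nonzero_value_exists\<close> speaks of boxes
    of exponents, so the form is first extended by 0.\<close>
  ultimately obtain t where t: "(\<Sum>I\<in>S. c I * (\<Prod>i\<in>{1..d}. t i ^ I i)) \<noteq> 0" by metis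
  define f where "f = (\<Sum>I\<in>S. c I * (\<Prod>i\<in>{1..d}. t i ^ I i))"
  have unit: "z \<in> J" if "is_ideal J" "sc f z \<in> J" for J z
  proof -
    have "sc (inverse f) 1 * sc f z \<in> J" by (rule ideal_mult_left[OF that])
    moreover have "sc (inverse f) 1 * sc f z = z" using t by (simp add: h(1,7) f_def flip: h(3))
    ultimately show ?thesis by simp
  qed
  have low: "ideal_power m (Suc s) \<subseteq> m" using ideal_power_antimono[of 1 "Suc s" m] ideal_power_1[OF m] by simp
  show False
  proof (cases "s = 0")
    case True
    have e: "I = restrict (\<lambda>_. 0) {1..d}" if "I \<in> S" for I using that True by (auto simp: S PiE_iff extensional_def restrict_def)
    then have "S = {restrict (\<lambda>_. 0) {1..d}}" using I by blast
    then have "sc f 1 \<in> m" using F low by (auto simp: f_def)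
    then show False using unit[OF m] mf(2) by blast
  next
    case False
    have "\<exists>j\<in>{1..d}. t j \<noteq> 0"
    proof (rule ccontr)
      assume "\<not> ?thesis"
      then have t0: "t i = 0" if "i \<in> {1..d}" for i using that by blast
      have "(\<Prod>i\<in>{1..d}. t i ^ I i) = 0" if "I \<in> S" for I
      proof -
        have "\<exists>i\<in>{1..d}. I i \<noteq> 0" 
        proof (rule ccontr)
          assume "\<not> ?thesis"
          then have "sum I {1..d} = 0" by (intro sum.neutral) blast
          then show False using that False by (simp add: S)
        qed
        then show ?thesis using t0 by (auto simp: prod_zero_iff)
      qed
      then have "(\<Sum>I\<in>S. c I * (\<Prod>i\<in>{1..d}. t i ^ I i)) = 0" by (intro sum.neutral) auto
      then show False using t by blast
    qed
    then obtain j where j: "j \<in> {1..d}" "t j \<noteq> 0" by blast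
    \<comment> \<open>New parameters: \<open>x j\<close> is \<open>t j\<close> times
      \<open>y j\<close>, and the other \<open>x i\<close> are \<open>y i\<close> plus
      \<open>t i\<close> times \<open>y j\<close>. Modulo the other \<open>y i\<close> the form
      becomes \<open>f\<close> times \<open>y j ^ s\<close>.\<close>
    define y where "y i = (if i = j then sc (inverse (t j)) (x j) else x i - sc (t i / t j) (x j))" for i
    have scm: "sc e z \<in> J" if "is_ideal J" "z \<in> J" for e z J
      using ideal_mult_left[OF that, of "sc e 1"] by (simp add: h(1,7))
    have ym: "y i \<in> m" if "i \<in> {1..d}" for i using x[OF that] x[OF j(1)] by (simp add: y_def scm[OF m] ideal_diff[OF m])
    have tj: "sc (t i) (y j) = sc (t i / t j) (x j)" for i by (simp add: y_def divide_inverse flip: h(3))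
    have xj: "x j = sc (t j) (y j)" unfolding tj using j(2) by (simp add: h(1))
    have xi: "x i = y i + sc (t i) (y j)" if "i \<noteq> j" for i unfolding tj using that by (simp add: y_def)
    have "x ` {1..d} \<subseteq> is_ideal hull (ideal_power m 2 \<union> y ` {1..d})"
    proof
      fix z assume "z \<in> x ` {1..d}"
      then obtain i where i: "i \<in> {1..d}" "z = x i" by blast
      have "y i \<in> is_ideal hull (ideal_power m 2 \<union> y ` {1..d})" if "i \<in> {1..d}" for i using that by (auto intro: hull_inc)
      then show "z \<in> is_ideal hull (ideal_power m 2 \<union> y ` {1..d})"
        using i j(1) xj xi[of i] by (cases "i = j") (auto intro!: ideal_add[OF is_ideal_hull] scm[OF is_ideal_hull])
    qed
    moreover have "ideal_power m 2 \<subseteq> is_ideal hull (ideal_power m 2 \<union> y ` {1..d})" by (auto intro: hull_inc)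
    ultimately have "is_ideal hull (ideal_power m 2 \<union> x ` {1..d}) \<subseteq> is_ideal hull (ideal_power m 2 \<union> y ` {1..d})"
      by (intro hull_minimal is_ideal_hull) blast
    then have y_gen: "m \<subseteq> is_ideal hull (ideal_power m 2 \<union> y ` {1..d})" using m_gen by blast
    let ?H = "is_ideal hull (ideal_power m (Suc s) \<union> y ` ({1..d} - {j}))"
    note H = is_ideal_hull[of "ideal_power m (Suc s) \<union> y ` ({1..d} - {j})"]
    have xH: "x i - sc (t i) (y j) \<in> ?H" if "i \<in> {1..d}" for i
    proof (cases "i = j")
      case True
      then show ?thesis using ideal_zero[OF H] xj by simp
    next
      case False
      then show ?thesis using xi[of i] that by (auto intro: hull_inc)
    qed
    have mon: "(\<Prod>i\<in>A. x i ^ I i) - sc (\<Prod>i\<in>A. t i ^ I i) (y j ^ sum I A) \<in> ?H" if "A \<subseteq> {1..d}" for A I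
    proof -
      have "finite A" using that finite_subset by blast
      then show ?thesis using that
      proof (induction A rule: finite_induct)
        case (insert a A)
        have pw: "sc e z ^ n = sc (e ^ n) (z ^ n)" for e z and n :: nat by (induction n) (simp_all add: h(1,7,8) mult.commute flip: h(3))
        have a: "x a ^ I a - sc (t a ^ I a) (y j ^ I a) \<in> ?H"
          unfolding pw[symmetric] by (rule power_cong_ideal[OF H xH]) (use insert in blast)
        have eq: "p * q - sc (e * u) (y j ^ (k + l)) = (p - sc e (y j ^ k)) * q + sc e (y j ^ k) * (q - sc u (y j ^ l))" for p q e u k l
        proof -
          have "sc (e * u) (y j ^ (k + l)) = sc e (y j ^ k) * sc u (y j ^ l)"
            by (simp only: power_add h(3) h(7)) (simp only: h(8))
          then show ?thesis by (simp add: algebra_simps)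
        qed
        have "(x a ^ I a) * (\<Prod>i\<in>A. x i ^ I i) - sc (t a ^ I a * (\<Prod>i\<in>A. t i ^ I i)) (y j ^ (I a + sum I A)) \<in> ?H"
          unfolding eq by (rule ideal_add[OF H ideal_mult_right[OF H a] ideal_mult_left[OF H insert.IH]]) (use insert in blast)
        then show ?case using insert.hyps by simp
      qed (simp add: h(1) ideal_zero[OF is_ideal_hull])
    qed
    have "(\<Sum>I\<in>S. sc (c I) (\<Prod>i\<in>{1..d}. x i ^ I i)) - sc f (y j ^ s) =
        (\<Sum>I\<in>S. sc (c I) ((\<Prod>i\<in>{1..d}. x i ^ I i) - sc (\<Prod>i\<in>{1..d}. t i ^ I i) (y j ^ sum I {1..d})))"
    proof -
      interpret V: vector_space sc using sc by (simp add: algebra_over_def)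
      have "sc f (y j ^ s) = (\<Sum>I\<in>S. sc (c I) (sc (\<Prod>i\<in>{1..d}. t i ^ I i) (y j ^ sum I {1..d})))"
        unfolding f_def V.scale_sum_left
      proof (rule sum.cong[OF refl])
        fix I assume "I \<in> S"
        then have "sum I {1..d} = s" unfolding S by blast
        then show "sc (c I * (\<Prod>i\<in>{1..d}. t i ^ I i)) (y j ^ s) = sc (c I) (sc (\<Prod>i\<in>{1..d}. t i ^ I i) (y j ^ sum I {1..d}))"
          by (simp only: h(3))
      qed
      then show ?thesis by (simp only: V.scale_right_diff_distrib sum_subtractf)
    qed
    also have "\<dots> \<in> ?H" by (intro ideal_sum[OF H] scm[OF H] mon order_refl)
    finally have "(\<Sum>I\<in>S. sc (c I) (\<Prod>i\<in>{1..d}. x i ^ I i)) - sc f (y j ^ s) \<in> ?H" .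
    moreover have "(\<Sum>I\<in>S. sc (c I) (\<Prod>i\<in>{1..d}. x i ^ I i)) \<in> ?H" using F by (auto intro: hull_inc)
    ultimately have "sc f (y j ^ s) \<in> ?H" using ideal_diff[OF H] by fastforce
    then have "y j ^ s \<in> ?H" by (rule unit[OF H])
    then show False using parameter_power_not_in[of y, OF ym y_gen j(1)] by blast
  qed
qed

end


section \<open>Rings of formal power series\<close>

text \<open>\<open>K n\<close> stands for the closure of the n-th power of the maximal ideal, which
  in a completion is known through residue classes. Together with \<open>residue\<close>,
  \<open>approx\<close> and \<open>indep\<close> say that the graded ring of \<open>K\<close> is the
  polynomial ring in the \<open>y i\<close>.\<close>

locale power_series_ring =
  fixes sc :: "'k::field \<Rightarrow> 'r::comm_ring_1 \<Rightarrow> 'r" and d :: nat and y :: "nat \<Rightarrow> 'r" and K :: "nat \<Rightarrow> 'r set"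
  assumes sc: "algebra_over sc" and K: "is_ideal (K n)" and K_0: "K 0 = UNIV"
    and K_Suc: "K (Suc n) \<subseteq> K n" and K_mult: "a \<in> K i \<Longrightarrow> b \<in> K j \<Longrightarrow> a * b \<in> K (i + j)"
    and separated: "(\<And>n. r \<in> K n) \<Longrightarrow> r = 0"
    and complete: "(\<And>n. s (Suc n) - s n \<in> K n) \<Longrightarrow> \<exists>r. \<forall>n. r - s n \<in> K n"
    and K_1: "K 1 = is_ideal hull (y ` {1..d})" and residue: "\<exists>c. r - sc c 1 \<in> K 1"
    and approx: "r \<in> K n \<Longrightarrow> \<exists>a\<in>ideal_power (K 1) n. r - a \<in> K (Suc n)"
    and indep: "(\<Sum>I\<in>{I \<in> PiE {1..d} (\<lambda>_. UNIV). sum I {1..d} = n}. sc (c I) (\<Prod>i\<in>{1..d}. y i ^ I i)) \<in> K (Suc n) \<Longrightarrow>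
      I \<in> PiE {1..d} (\<lambda>_. UNIV) \<Longrightarrow> sum I {1..d} = n \<Longrightarrow> c I = 0"
begin

context
  notes One_nat_def [simp del] and plus_1_eq_Suc [simp]
begin

section \<open>Monomials, forms and expansions\<close>

definition index :: "(nat \<Rightarrow> nat) set" where "index = PiE {1..d} (\<lambda>_. UNIV)"

definition size :: "(nat \<Rightarrow> nat) \<Rightarrow> nat" where "size I = sum I {1..d}"

definition mon :: "(nat \<Rightarrow> nat) \<Rightarrow> 'r" where "mon I = (\<Prod>i\<in>{1..d}. y i ^ I i)"

definition trunc :: "nat \<Rightarrow> ((nat \<Rightarrow> nat) \<Rightarrow> 'k) \<Rightarrow> 'r" where
  "trunc n c = (\<Sum>I\<in>{I \<in> index. size I < n}. sc (c I) (mon I))"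

definition form :: "nat \<Rightarrow> ((nat \<Rightarrow> nat) \<Rightarrow> 'k) \<Rightarrow> 'r" where
  "form n c = (\<Sum>I\<in>{I \<in> index. size I = n}. sc (c I) (mon I))"

definition expansion :: "'r \<Rightarrow> ((nat \<Rightarrow> nat) \<Rightarrow> 'k) \<Rightarrow> bool" where
  "expansion r c \<longleftrightarrow> (\<forall>n. r - trunc n c \<in> K n)"

lemmas h = algebra_scale_hom[OF sc]

lemma K_antimono: "i \<le> j \<Longrightarrow> K j \<subseteq> K i"
  by (rule lift_Suc_antimono_le[of K, OF K_Suc])

lemma K_scale: "z \<in> K n \<Longrightarrow> sc c z \<in> K n"
  using ideal_mult_left[OF K, of z n "sc c 1"] by (simp add: h(1,7))

lemma y_K: "i \<in> {1..d} \<Longrightarrow> y i \<in> K 1"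
  unfolding K_1 by (auto intro: hull_inc)

lemma K_power: "z \<in> K 1 \<Longrightarrow> z ^ n \<in> K n"
proof (induction n)
  case (Suc n)
  then show ?case using K_mult[of z 1 "z ^ n" n] by simp
qed (simp add: K_0)

lemma mon_K: "mon I \<in> K (size I)"
proof -
  have "(\<Prod>i\<in>A. y i ^ I i) \<in> K (sum I A)" if "A \<subseteq> {1..d}" for A
  proof -
    have "finite A" using that finite_subset by blast
    then show ?thesis using that by (induction A rule: finite_induct) (auto simp: K_0 intro!: K_mult K_power y_K)
  qed
  then show ?thesis by (simp add: mon_def size_def)
qed

lemma finite_index: "finite {I \<in> index. size I < n}" "finite {I \<in> index. size I = n}"
proof -
  have "{I \<in> index. size I < Suc n} \<subseteq> PiE {1..d} (\<lambda>_. {..n})" for n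
  proof
    fix I assume I: "I \<in> {I \<in> index. size I < Suc n}"
    have "I i \<le> sum I {1..d}" if "i \<in> {1..d}" for i by (rule member_le_sum) (use that in auto)
    moreover have "sum I {1..d} \<le> n" using I by (simp add: size_def)
    ultimately have "I i \<le> n" if "i \<in> {1..d}" for i using that le_trans by blast
    then show "I \<in> PiE {1..d} (\<lambda>_. {..n})" using I by (simp add: index_def PiE_iff)
  qed
  then have "finite {I \<in> index. size I < Suc n}" for n by (rule finite_subset) (simp add: finite_PiE)
  from this[of n] show "finite {I \<in> index. size I < n}" "finite {I \<in> index. size I = n}"
    by (auto elim!: finite_subset[rotated])
qed

lemma trunc_Suc: "trunc (Suc n) c = trunc n c + form n c"
proof -
  have "{I \<in> index. size I < Suc n} = {I \<in> index. size I < n} \<union> {I \<in> index. size I = n}" by auto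
  then show ?thesis unfolding trunc_def form_def using finite_index by (simp add: sum.union_disjoint disjoint_iff)
qed

lemma form_K: "form n c \<in> K n"
  unfolding form_def by (rule ideal_sum[OF K], rule K_scale) (use mon_K in auto)

lemma trunc_lin: "trunc n (\<lambda>I. c I + e I) = trunc n c + trunc n e" "trunc n (\<lambda>I. a * c I) = sc a (trunc n c)"
proof -
  interpret V: vector_space sc using sc by (simp add: algebra_over_def)
  show "trunc n (\<lambda>I. c I + e I) = trunc n c + trunc n e" by (simp add: trunc_def h(2) sum.distrib)
  show "trunc n (\<lambda>I. a * c I) = sc a (trunc n c)" unfolding trunc_def V.scale_sum_right h(3) ..
qed

lemma trunc_cong: "(\<And>I. I \<in> index \<Longrightarrow> size I < n \<Longrightarrow> c I = e I) \<Longrightarrow> trunc n c = trunc n e"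
  unfolding trunc_def by (rule sum.cong) auto

lemma expansion_cong: "expansion r c \<Longrightarrow> (\<And>I. I \<in> index \<Longrightarrow> c I = e I) \<Longrightarrow> expansion r e"
  unfolding expansion_def using trunc_cong[of _ c e] by metis

lemma expansion_add: "expansion r c \<Longrightarrow> expansion s e \<Longrightarrow> expansion (r + s) (\<lambda>I. c I + e I)"
  unfolding expansion_def trunc_lin add_diff_add using ideal_add[OF K] by blast

lemma expansion_scale:
  assumes "expansion r c"
  shows "expansion (sc a r) (\<lambda>I. a * c I)"
proof -
  interpret V: vector_space sc using sc by (simp add: algebra_over_def)
  show ?thesis using assms K_scale unfolding expansion_def trunc_lin V.scale_right_diff_distrib[symmetric] by blast
qed

text \<open>So \<open>K n\<close> consists of the series of order at least \<open>n\<close>.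
  Coefficients vanish degree by degree: the form of lowest degree lies one step deeper in the
  filtration, where \<open>indep\<close> applies.\<close>

lemma expansion_K_iff:
  assumes "expansion r c"
  shows "r \<in> K n \<longleftrightarrow> (\<forall>I\<in>index. size I < n \<longrightarrow> c I = 0)"
proof
  assume "r \<in> K n"
  then show "\<forall>I\<in>index. size I < n \<longrightarrow> c I = 0"
  proof (induction n)
    case (Suc n)
    then have 0: "\<forall>I\<in>index. size I < n \<longrightarrow> c I = 0" using K_Suc by blast
    then have "trunc n c = 0" unfolding trunc_def by (auto simp: h(5) intro!: sum.neutral)
    then have "r - form n c \<in> K (Suc n)" using assms unfolding expansion_def by (metis trunc_Suc add_0)
    from ideal_diff[OF K Suc.prems this] have "form n c \<in> K (Suc n)" by simp
    then have "c I = 0" if "I \<in> index" "size I = n" for I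
      using indep[of c n I] that by (simp add: form_def index_def size_def mon_def)
    then show ?case using 0 less_Suc_eq by metis
  qed simp
next
  assume "\<forall>I\<in>index. size I < n \<longrightarrow> c I = 0"
  then have "trunc n c = 0" unfolding trunc_def by (auto simp: h(5) intro!: sum.neutral)
  then show "r \<in> K n" using assms unfolding expansion_def by (metis diff_zero)
qed

lemma expansion_unique:
  assumes "expansion r c" "expansion r e" "I \<in> index"
  shows "c I = e I"
proof -
  have "expansion (r + sc (- 1) r) (\<lambda>I. c I + - 1 * e I)" by (intro expansion_add expansion_scale assms)
  then have "expansion 0 (\<lambda>I. c I - e I)" by (simp add: h(1,9))
  from expansion_K_iff[OF this, of "Suc (size I)"] show ?thesis using assms(3) ideal_zero[OF K] by simp
qed

lemma series_exists: "\<exists>r. expansion r c"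
  unfolding expansion_def by (rule complete) (simp add: trunc_Suc form_K)

lemma series_unique:
  assumes "expansion r c" "expansion s c"
  shows "r = s"
proof -
  have "(r - trunc n c) - (s - trunc n c) \<in> K n" for n using assms ideal_diff[OF K] unfolding expansion_def by blast
  then show ?thesis using separated[of "r - s"] by simp
qed

lemma index_upd: "I \<in> index \<Longrightarrow> i \<in> {1..d} \<Longrightarrow> I(i := n) \<in> index"
  by (auto simp: index_def PiE_iff extensional_def)

lemma size_upd: "i \<in> {1..d} \<Longrightarrow> size (I(i := n)) + I i = size I + n"
  by (simp add: size_def sum.remove[of "{1..d}" i] cong: sum.cong) (rule sum.cong, auto)

lemma mon_upd: "i \<in> {1..d} \<Longrightarrow> mon (I(i := I i + n)) = y i ^ n * mon I"
proof -
  assume i: "i \<in> {1..d}"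
  have "(\<Prod>j\<in>{1..d} - {i}. y j ^ (I(i := I i + n)) j) = (\<Prod>j\<in>{1..d} - {i}. y j ^ I j)" by (rule prod.cong) auto
  then show ?thesis using i by (simp add: mon_def prod.remove[of "{1..d}" i] power_add mult_ac)
qed

lemma form_single: "J \<in> index \<Longrightarrow> size J = n \<Longrightarrow> form n (\<lambda>I. if I = J then 1 else 0) = mon J"
  unfolding form_def by (subst sum.mono_neutral_right[of _ "{J}"]) (use finite_index in \<open>auto simp: h(1,5)\<close>)

text \<open>The elements of \<open>K n\<close> with this property form an ideal \<open>W n\<close>,
  since a ring element acts on degree \<open>n\<close> through its residue. Multiplication by
  \<open>K 1\<close> leads from \<open>W n\<close> to \<open>W (Suc n)\<close>, so
  \<open>W n\<close> contains the n-th power of \<open>K 1\<close>, and \<open>approx\<close> does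
  the rest.\<close>

lemma forms_generate:
  assumes "r \<in> K n"
  shows "\<exists>c. r - form n c \<in> K (Suc n)"
proof -
  interpret V: vector_space sc using sc by (simp add: algebra_over_def)
  define W where "W n = {z \<in> K n. \<exists>c. z - form n c \<in> K (Suc n)}" for n
  have W: "is_ideal (W n)" for n
  proof (rule is_idealI)
    have "form n (\<lambda>_. 0) = 0" by (simp add: form_def h(5))
    then show "0 \<in> W n" unfolding W_def using ideal_zero[OF K] by (metis (mono_tags, lifting) diff_zero mem_Collect_eq)
    fix z w assume z: "z \<in> W n"
    then obtain c where c: "z - form n c \<in> K (Suc n)" unfolding W_def by blast
    show "z + w \<in> W n" if w: "w \<in> W n"
    proof -
      obtain e where e: "w - form n e \<in> K (Suc n)" using w unfolding W_def by blast
      have "form n (\<lambda>I. c I + e I) = form n c + form n e" by (simp add: form_def h(2) sum.distrib)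
      then have "z + w - form n (\<lambda>I. c I + e I) \<in> K (Suc n)" using ideal_add[OF K c e] by (simp add: algebra_simps)
      then show ?thesis using z w ideal_add[OF K] unfolding W_def by blast
    qed
    fix r
    obtain a where a: "r - sc a 1 \<in> K 1" using residue by blast
    have "(r - sc a 1) * z \<in> K (Suc n)" using K_mult[OF a, of z n] z by (simp add: W_def)
    then have "(r - sc a 1) * z + sc a (z - form n c) \<in> K (Suc n)" using K_scale[OF c] ideal_add[OF K] by simp
    moreover have "form n (\<lambda>I. a * c I) = sc a (form n c)" unfolding form_def V.scale_sum_right h(3) ..
    ultimately have "r * z - form n (\<lambda>I. a * c I) \<in> K (Suc n)"
      by (simp add: left_diff_distrib V.scale_right_diff_distrib h(1,7))
    then show "r * z \<in> W n" using z ideal_mult_left[OF K] unfolding W_def by blast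
  qed
  have mon_W: "mon J \<in> W (size J)" if "J \<in> index" for J
    unfolding W_def using mon_K form_single[OF that refl] ideal_zero[OF K]
    by (intro CollectI conjI exI[of _ "\<lambda>I. if I = J then 1 else 0"]) simp_all
  have step: "u * z \<in> W (Suc n)" if z: "z \<in> W n" and u: "u \<in> K 1" for u z n
  proof -
    obtain e where e: "u = (\<Sum>i\<in>{1..d}. e i * y i)"
      using u unfolding K_1 is_ideal_hull_finite[OF finite_atLeastAtMost] by blast
    obtain c where c: "z - form n c \<in> K (Suc n)" using z unfolding W_def by blast
    have "y i * z \<in> W (Suc n)" if i: "i \<in> {1..d}" for i
    proof -
      have "y i * sc (c I) (mon I) \<in> W (Suc n)" if "I \<in> {I \<in> index. size I = n}" for I
      proof -
        have "mon (I(i := I i + 1)) \<in> W (size (I(i := I i + 1)))" using that i by (intro mon_W index_upd) auto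
        moreover have "size (I(i := I i + 1)) = Suc n" using size_upd[OF i, of I "I i + 1"] that by simp
        ultimately have "sc (c I) 1 * (y i * mon I) \<in> W (Suc n)" using ideal_mult_left[OF W] mon_upd[OF i, of I 1] by simp
        moreover have "sc (c I) 1 * (y i * mon I) = y i * sc (c I) (mon I)" by (simp add: h(7,8))
        ultimately show ?thesis by simp
      qed
      then have 1: "y i * form n c \<in> W (Suc n)" unfolding form_def sum_distrib_left by (rule ideal_sum[OF W])
      have "form (Suc n) (\<lambda>_. 0) = 0" by (simp add: form_def h(5))
      moreover have "y i * (z - form n c) \<in> K (1 + Suc n)" by (rule K_mult[OF y_K[OF i] c])
      ultimately have "y i * (z - form n c) \<in> W (Suc n)"
        unfolding W_def using K_Suc[of "Suc n"] by (intro CollectI conjI exI[of _ "\<lambda>_. 0"]) auto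
      from ideal_add[OF W this 1] show ?thesis by (simp add: algebra_simps)
    qed
    then have "(\<Sum>i\<in>{1..d}. e i * (y i * z)) \<in> W (Suc n)" by (intro ideal_sum[OF W]) (rule ideal_mult_left[OF W])
    then show ?thesis by (simp add: e sum_distrib_right mult.assoc)
  qed
  have "1 \<in> W 0"
    using mon_W[of "restrict (\<lambda>_. 0) {1..d}"] by (simp add: mon_def size_def index_def)
  then have "z \<in> W n" if "z \<in> K 1 ^ n" for z n
    using that
  proof (induction n arbitrary: z)
    case (Suc n)
    then obtain u v where "z = u * v" "u \<in> K 1" "v \<in> K 1 ^ n" unfolding power_Suc set_times_def by blast
    then show ?case using Suc step by blast
  qed simp
  then have sub: "ideal_power (K 1) n \<subseteq> W n" unfolding ideal_power_def by (intro is_ideal_hull_least[OF W]) blast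
  obtain a where a: "a \<in> ideal_power (K 1) n" "r - a \<in> K (Suc n)" using approx[OF assms] by blast
  then obtain c where "a - form n c \<in> K (Suc n)" using sub unfolding W_def by blast
  from ideal_add[OF K a(2) this] show ?thesis by auto
qed

text \<open>Forms of increasing degree are subtracted; the remainders \<open>\<rho> n\<close>
  descend through the filtration.\<close>

lemma expansion_exists: "\<exists>c. expansion r c"
proof -
  have "\<forall>r n. \<exists>c. r \<in> K n \<longrightarrow> r - form n c \<in> K (Suc n)" using forms_generate by blast
  then obtain F where F: "\<And>r n. r \<in> K n \<Longrightarrow> r - form n (F r n) \<in> K (Suc n)" by metis
  define \<rho> where "\<rho> = rec_nat r (\<lambda>n s. s - form n (F s n))"
  have \<rho>_Suc: "\<rho> (Suc n) = \<rho> n - form n (F (\<rho> n) n)" for n by (simp add: \<rho>_def)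
  have \<rho>_K: "\<rho> n \<in> K n" for n by (induction n) (simp_all add: K_0 \<rho>_Suc F)
  define c where "c I = F (\<rho> (size I)) (size I) I" for I
  have form_c: "form n c = form n (F (\<rho> n) n)" for n unfolding form_def by (rule sum.cong) (auto simp: c_def)
  have "r - trunc n c = \<rho> n" for n
  proof (induction n)
    case 0
    show ?case by (simp add: trunc_def \<rho>_def)
  next
    case (Suc n)
    then show ?case by (simp add: trunc_Suc \<rho>_Suc form_c algebra_simps)
  qed
  then show ?thesis unfolding expansion_def using \<rho>_K by metis
qed

section \<open>Hasse derivatives of power series\<close>

definition coef :: "'r \<Rightarrow> (nat \<Rightarrow> nat) \<Rightarrow> 'k" where "coef r = (SOME c. expansion r c)"

lemma expansion_coef: "expansion r (coef r)"
  unfolding coef_def using expansion_exists by (rule someI_ex)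

text \<open>The divided derivative, which sends the exponent \<open>k\<close> of \<open>y j\<close>
  to \<open>k - n\<close> with factor \<open>k choose n\<close>, written in terms of the resulting
  exponent.\<close>

definition hasse :: "nat \<Rightarrow> nat \<Rightarrow> 'r \<Rightarrow> 'r" where
  "hasse j n r = (SOME s. expansion s (\<lambda>I. of_nat ((I j + n) choose n) * coef r (I(j := I j + n))))"

lemma expansion_hasse:
  assumes "j \<in> {1..d}" "expansion r c"
  shows "expansion (hasse j n r) (\<lambda>I. of_nat ((I j + n) choose n) * c (I(j := I j + n)))"
proof -
  have "expansion (hasse j n r) (\<lambda>I. of_nat ((I j + n) choose n) * coef r (I(j := I j + n)))"
    unfolding hasse_def using series_exists by (rule someI_ex)
  then show ?thesis
    by (rule expansion_cong) (simp add: expansion_unique[OF expansion_coef assms(2)] index_upd[OF _ assms(1)])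
qed

lemma hasse_eqI: "j \<in> {1..d} \<Longrightarrow> expansion r c \<Longrightarrow>
  expansion s (\<lambda>I. of_nat ((I j + n) choose n) * c (I(j := I j + n))) \<Longrightarrow> hasse j n r = s"
  using expansion_hasse series_unique by blast

lemma hasse_add: "j \<in> {1..d} \<Longrightarrow> hasse j n (r + s) = hasse j n r + hasse j n s"
  by (rule hasse_eqI[OF _ expansion_add[OF expansion_coef expansion_coef]], assumption)
    (simp add: distrib_left expansion_add[OF expansion_hasse[OF _ expansion_coef] expansion_hasse[OF _ expansion_coef]])

lemma hasse_scale: "j \<in> {1..d} \<Longrightarrow> hasse j n (sc a r) = sc a (hasse j n r)"
  by (rule hasse_eqI[OF _ expansion_scale[OF expansion_coef]], assumption)
    (simp add: mult.left_commute[of _ a] expansion_scale[OF expansion_hasse[OF _ expansion_coef]])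

lemma hasse_0: "j \<in> {1..d} \<Longrightarrow> hasse j 0 r = r"
  by (rule hasse_eqI[OF _ expansion_coef]) (simp_all add: expansion_coef)

text \<open>Continuity: the order of a series drops by at most \<open>n\<close>.\<close>

lemma hasse_K:
  assumes j: "j \<in> {1..d}" and r: "r \<in> K N"
  shows "hasse j n r \<in> K (N - n)"
  unfolding expansion_K_iff[OF expansion_hasse[OF j expansion_coef]]
proof (intro ballI impI)
  fix I assume I: "I \<in> index" "size I < N - n"
  have "size (I(j := I j + n)) < N" using size_upd[OF j, of I "I j + n"] I(2) by simp
  then have "coef r (I(j := I j + n)) = 0"
    using r index_upd[OF I(1) j] unfolding expansion_K_iff[OF expansion_coef] by blast
  then show "of_nat ((I j + n) choose n) * coef r (I(j := I j + n)) = 0" by simp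
qed

lemma expansion_mon:
  assumes J: "J \<in> index"
  shows "expansion (mon J) (\<lambda>I. if I = J then 1 else 0)"
  unfolding expansion_def
proof
  fix n
  show "mon J - trunc n (\<lambda>I. if I = J then 1 else 0) \<in> K n"
  proof (cases "size J < n")
    case True
    have "trunc n (\<lambda>I. if I = J then 1 else 0) = mon J"
      unfolding trunc_def by (subst sum.mono_neutral_right[of _ "{J}"]) (use finite_index True J in \<open>auto simp: h(1,5)\<close>)
    then show ?thesis by (simp add: ideal_zero[OF K])
  next
    case False
    then have "trunc n (\<lambda>I. if I = J then 1 else 0) = 0" unfolding trunc_def by (intro sum.neutral) (auto simp: h(5))
    then show ?thesis using mon_K[of J] K_antimono[of n "size J"] False by auto
  qed
qed

lemma hasse_mon:
  assumes j: "j \<in> {1..d}" and J: "J \<in> index"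
  shows "hasse j n (mon J) = sc (of_nat (J j choose n)) (mon (J(j := J j - n)))"
proof (rule hasse_eqI[OF j expansion_mon[OF J]], rule expansion_cong)
  show "expansion (sc (of_nat (J j choose n)) (mon (J(j := J j - n))))
      (\<lambda>I. of_nat (J j choose n) * (if I = J(j := J j - n) then 1 else 0))"
    by (intro expansion_scale expansion_mon index_upd[OF J j])
  fix I
  show "of_nat (J j choose n) * (if I = J(j := J j - n) then 1 else 0) =
      of_nat ((I j + n) choose n) * (if I(j := I j + n) = J then 1 else (0::'k))"
  proof (cases "I(j := I j + n) = J")
    case True
    then show ?thesis by auto
  next
    case False
    have "J j < n" if "I = J(j := J j - n)"
    proof (rule ccontr)
      assume "\<not> J j < n"
      then have "I(j := I j + n) = J" using that by auto
      then show False using False by blast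
    qed
    then show ?thesis using False by (auto simp: binomial_eq_0)
  qed
qed

lemma mon_mult: "mon I * mon J = mon (restrict (\<lambda>i. I i + J i) {1..d})"
  by (simp add: mon_def power_add flip: prod.distrib)

text \<open>The Leibniz rule holds for monomials by Vandermonde's identity, and extends by continuity.\<close>

lemma hasse_mult:
  assumes j: "j \<in> {1..d}"
  shows "hasse j n (r * s) = (\<Sum>a\<le>n. hasse j a r * hasse j (n - a) s)"
proof -
  interpret V: vector_space sc using sc by (simp add: algebra_over_def)
  define B where "B r s = hasse j n (r * s) - (\<Sum>a\<le>n. hasse j a r * hasse j (n - a) s)" for r s
  have B_add: "B (r + r') s = B r s + B r' s" "B r (s + s') = B r s + B r s'" for r r' s s'
    by (simp_all add: B_def distrib_left distrib_right hasse_add[OF j] sum.distrib)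
  have B_sc: "B (sc a r) s = sc a (B r s)" "B r (sc a s) = sc a (B r s)" for a r s
    by (simp_all add: B_def h(7,8) hasse_scale[OF j] V.scale_sum_right V.scale_right_diff_distrib)
  have B_0: "B 0 s = 0" "B r 0 = 0" for r s using B_sc(1)[of 0 0 s] B_sc(2)[of r 0 0] by (simp_all add: h(5))
  have B_sum: "B (sum f S) s = (\<Sum>i\<in>S. B (f i) s)" "B r (sum f S) = (\<Sum>i\<in>S. B r (f i))" for r s f and S :: "(nat \<Rightarrow> nat) set"
    by (induction S rule: infinite_finite_induct) (simp_all add: B_0 B_add)
  have B_K: "B r s \<in> K (N - n)" if rs: "r \<in> K N \<or> s \<in> K N" for r s N
  proof -
    have "hasse j n (r * s) \<in> K (N - n)" using rs ideal_mult_left[OF K] ideal_mult_right[OF K] by (intro hasse_K[OF j]) blast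
    moreover have "hasse j a r * hasse j (n - a) s \<in> K (N - n)" if "a \<le> n" for a
      using rs
    proof
      assume "r \<in> K N"
      then have "hasse j a r \<in> K (N - n)" using hasse_K[OF j, of r N a] K_antimono[OF diff_le_mono2[OF that], of N] by blast
      then show ?thesis by (rule ideal_mult_right[OF K])
    next
      assume "s \<in> K N"
      then have "hasse j (n - a) s \<in> K (N - n)" using hasse_K[OF j, of s N "n - a"] K_antimono[OF diff_le_mono2[OF diff_le_self], of N n a] by blast
      then show ?thesis by (rule ideal_mult_left[OF K])
    qed
    ultimately show ?thesis unfolding B_def by (intro ideal_diff[OF K] ideal_sum[OF K]) auto
  qed
  have B_mon: "B (mon I) (mon J) = 0" if I: "I \<in> index" and J: "J \<in> index" for I J
  proof -
    let ?L = "restrict (\<lambda>i. I i + J i) {1..d}"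
    have L: "?L \<in> index" by (simp add: index_def)
    have product: "hasse j a (mon I) * hasse j (n - a) (mon J) =
        sc (of_nat ((I j choose a) * (J j choose (n - a)))) (mon (?L(j := ?L j - n)))" if a: "a \<le> n" for a
    proof (cases "a \<le> I j \<and> n - a \<le> J j")
      case True
      have "restrict (\<lambda>i. (I(j := I j - a)) i + (J(j := J j - (n - a))) i) {1..d} = ?L(j := ?L j - n)"
        using True a j by (auto simp: fun_eq_iff)
      then show ?thesis by (simp add: hasse_mon[OF j I] hasse_mon[OF j J] h(7,8) mon_mult mult.commute flip: h(3))
    next
      \<comment> \<open>Truncated subtraction makes the exponents meaningless here, but both sides
        carry a vanishing binomial coefficient.\<close>
      case False
      then have "(I j choose a) * (J j choose (n - a)) = 0" by (auto simp: binomial_eq_0)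
      moreover from this have "hasse j a (mon I) * hasse j (n - a) (mon J) = 0"
        by (auto simp: hasse_mon[OF j I] hasse_mon[OF j J] h(5) binomial_eq_0)
      ultimately show ?thesis by (simp only: of_nat_0 h(5))
    qed
    have "(\<Sum>a\<le>n. hasse j a (mon I) * hasse j (n - a) (mon J)) =
        sc (of_nat (\<Sum>a\<le>n. (I j choose a) * (J j choose (n - a)))) (mon (?L(j := ?L j - n)))"
      using product by (simp add: V.scale_sum_left)
    also have "\<dots> = hasse j n (mon I * mon J)"
      unfolding vandermonde mon_mult hasse_mon[OF j L] using j by simp
    finally show ?thesis by (simp add: B_def)
  qed
  have "B r s \<in> K M" for M
  proof -
    let ?N = "M + n"
    let ?r = "trunc ?N (coef r)" and ?s = "trunc ?N (coef s)"
    have rK: "r - ?r \<in> K ?N" "s - ?s \<in> K ?N" using expansion_coef unfolding expansion_def by blast+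
    have "B ?r ?s = 0" unfolding trunc_def B_sum B_sc by (intro sum.neutral) (auto simp: B_mon h(6))
    moreover have "B r s = B (r - ?r) s + (B ?r (s - ?s) + B ?r ?s)" by (simp flip: B_add)
    ultimately show ?thesis using ideal_add[OF K B_K[of "r - ?r" ?N s] B_K[of ?r ?N "s - ?s"]] rK by simp
  qed
  then show ?thesis using separated[of "B r s"] by (simp add: B_def)
qed

text \<open>Iterating \<open>b = w * e + z * b'\<close> writes \<open>f\<close> as \<open>w\<close>
  times a partial sum plus a multiple of \<open>z ^ n\<close>; the partial sums converge because
  \<open>z\<close> is in \<open>K 1\<close>.\<close>

lemma dvd_if_approximable:
  assumes z: "z \<in> K 1" and f: "f \<in> S" and step: "\<And>b. b \<in> S \<Longrightarrow> \<exists>b'\<in>S. w dvd b - z * b'"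
  shows "w dvd f"
proof -
  have "\<forall>b. \<exists>b' e. b \<in> S \<longrightarrow> b' \<in> S \<and> b - z * b' = w * e" using step by (metis dvdE)
  then obtain \<nu> e where \<nu>: "\<And>b. b \<in> S \<Longrightarrow> \<nu> b \<in> S" "\<And>b. b \<in> S \<Longrightarrow> b - z * \<nu> b = w * e b" by metis
  define b where "b n = (\<nu> ^^ n) f" for n
  have bS: "b n \<in> S" for n by (induction n) (simp_all add: b_def f \<nu>(1))
  define a where "a n = (\<Sum>l<n. z ^ l * e (b l))" for n
  have fa: "f = w * a n + z ^ n * b n" for n
  proof (induction n)
    case 0
    show ?case by (simp add: a_def b_def)
  next
    case (Suc n)
    have "b n = w * e (b n) + z * b (Suc n)" using \<nu>(2)[OF bS[of n]] by (simp add: b_def algebra_simps)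
    then have "w * a n + z ^ n * b n = w * a n + z ^ n * (w * e (b n) + z * b (Suc n))" by simp
    also have "\<dots> = w * a (Suc n) + z ^ Suc n * b (Suc n)" by (simp add: a_def algebra_simps)
    finally show ?case using Suc by simp
  qed
  have "a (Suc n) - a n \<in> K n" for n unfolding a_def using ideal_mult_right[OF K K_power[OF z]] by simp
  then obtain a' where a': "\<And>n. a' - a n \<in> K n" using complete by blast
  have "f - w * a' \<in> K n" for n
  proof -
    have "z ^ n * b n - w * (a' - a n) \<in> K n"
      by (intro ideal_diff[OF K] ideal_mult_left[OF K a'] ideal_mult_right[OF K K_power[OF z]])
    then show ?thesis using fa[of n] by (simp add: algebra_simps)
  qed
  then have "f - w * a' = 0" by (rule separated)
  then show ?thesis by simp
qed

theorem coordinate_derivations_hasse: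
  assumes x: "\<And>i. i \<in> {1..d} \<Longrightarrow> x i = y i + sc (\<alpha> i) 1"
  shows "coordinate_derivations sc d x hasse"
proof
  let ?o = "restrict (\<lambda>_. 0) {1..d}"
  have o: "?o \<in> index" "mon ?o = 1" by (simp_all add: index_def mon_def)
  have one: "hasse i n 1 = 0" if "i \<in> {1..d}" "n > 0" for i n
    using hasse_mon[OF that(1) o(1), of n] that by (simp add: o(2) h(5) binomial_eq_0)
  have y: "y i = mon (?o(i := 1))" if "i \<in> {1..d}" for i using mon_upd[OF that, of ?o 1] that by (simp add: o(2))
  show hd: "higher_derivation (hasse i)" if "i \<in> {1..d}" for i
    unfolding higher_derivation_def using hasse_0[OF that] hasse_add[OF that] hasse_mult[OF that] by auto
  show same: "hasse i n (x i) = (if n = 1 then 1 else 0)" if i: "i \<in> {1..d}" and n: "n > 0" for i n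
  proof -
    have "hasse i n (y i) = sc (of_nat (1 choose n)) (mon (?o(i := 1 - n)))"
      using hasse_mon[OF i index_upd[OF o(1) i], of n 1] by (simp add: y[OF i])
    moreover have "?o(i := 1 - n) = ?o" using n i by (auto simp: fun_eq_iff)
    ultimately have "hasse i n (y i) = sc (of_nat (1 choose n)) 1" by (simp add: o(2))
    moreover have "1 choose n = (if n = 1 then 1 else 0)" using n by (simp add: binomial_eq_0)
    ultimately show ?thesis using one[OF i n] by (simp add: x[OF i] hasse_add[OF i] hasse_scale[OF i] h(1,5,6))
  qed
  show "hasse i n (x j) = 0" if i: "i \<in> {1..d}" and j: "j \<in> {1..d}" and "i \<noteq> j" "n > 0" for i j n
    using hasse_mon[OF i index_upd[OF o(1) j], of n 1] one[OF i \<open>n > 0\<close>] that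
    by (simp add: x[OF j] hasse_add[OF i] hasse_scale[OF i] y[OF j] h(5,6) binomial_eq_0)
  show "hasse i n (sc c r) = sc c (hasse i n r)" if "i \<in> {1..d}" for i n c r by (rule hasse_scale[OF that])
  show "\<delta> r = 0" if \<delta>: "diff_op sc (\<lambda>x. x) n \<delta>" "\<And>i r. i \<in> {1..d} \<Longrightarrow> \<delta> (x i * r) = x i * \<delta> r" "\<delta> 1 = 0" for n \<delta> r
  proof -
    note lin = scalar_linearD[OF sc is_ring_hom_id diff_op_scalar_linear[OF sc is_ring_hom_id \<delta>(1)]]
    have \<delta>y: "\<delta> (r * y i) = y i * \<delta> r" if i: "i \<in> {1..d}" for i r
    proof -
      have "x i * r = y i * r + sc (\<alpha> i) r" by (simp add: x[OF i] distrib_right h(1,7))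
      then have "\<delta> (y i * r) + sc (\<alpha> i) 1 * \<delta> r = x i * \<delta> r" using \<delta>(2)[OF i, of r] lin(1) lin(2)[of "\<alpha> i" r] by metis
      then show ?thesis by (simp add: x[OF i] distrib_right mult.commute[of r])
    qed
    \<comment> \<open>Writing \<open>r\<close> as a constant plus multiples of the
      \<open>y i\<close> gains one level per induction step, as \<open>\<delta>\<close> commutes
      with the \<open>y i\<close> and kills constants.\<close>
    have "\<delta> r \<in> K M" for M r
    proof (induction M arbitrary: r)
      case (Suc M)
      obtain c where "r - sc c 1 \<in> K 1" using residue by blast
      then obtain e where "r - sc c 1 = (\<Sum>i\<in>{1..d}. e i * y i)"
        unfolding K_1 is_ideal_hull_finite[OF finite_atLeastAtMost] by blast
      then have "r = sc c 1 + (\<Sum>i\<in>{1..d}. e i * y i)" by (simp add: algebra_simps)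
      then have "\<delta> r = \<delta> (sc c 1) + \<delta> (\<Sum>i\<in>{1..d}. e i * y i)" using lin(1) by simp
      also have "\<dots> = (\<Sum>i\<in>{1..d}. y i * \<delta> (e i))" unfolding lin(2)[of c 1] lin(5) using \<delta>(3) \<delta>y by simp
      also have "\<dots> \<in> K (1 + M)" by (intro ideal_sum[OF K] K_mult y_K Suc.IH)
      finally show ?case by simp
    qed (simp add: K_0)
    then show "\<delta> r = 0" by (rule separated)
  qed
  show "w dvd f" if i: "i \<in> {1..d}" and w: "\<And>n z. hasse i n (w * z) = w * hasse i n z" and dvd: "w dvd x i * f" for i w f
  proof (cases "\<alpha> i = 0")
    case True
    then have xi: "x i \<in> K 1" using x[OF i] y_K[OF i] by (simp add: h(5))
    \<comment> \<open>The elements that some power of \<open>x i\<close> moves into the multiples of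
      \<open>w\<close> are stable under the step of \<open>higher_derivation_colon\<close>.\<close>
    show ?thesis
    proof (rule dvd_if_approximable[OF xi, of f "{b. \<exists>n. w dvd x i ^ n * b}"])
      show "f \<in> {b. \<exists>n. w dvd x i ^ n * b}" using dvd by (intro CollectI exI[of _ 1]) simp
      fix b assume "b \<in> {b. \<exists>n. w dvd x i ^ n * b}"
      then obtain n where n: "w dvd x i ^ n * b" by blast
      obtain b' where b': "w dvd b - x i * b'" using higher_derivation_colon[OF hd[OF i] same[OF i] w n] by blast
      have "w dvd x i ^ n * b - x i ^ n * (b - x i * b')" by (rule dvd_diff[OF n dvd_mult[OF b']])
      then have "w dvd x i ^ Suc n * b'" by (simp add: algebra_simps)
      then show "\<exists>b'\<in>{b. \<exists>n. w dvd x i ^ n * b}. w dvd b - x i * b'" using b' by blast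
    qed
  next
    case False
    \<comment> \<open>Here \<open>x i\<close> is a unit: modulo \<open>w\<close>, vanishing of
      \<open>x i * f\<close> reads \<open>f = ?z * f\<close> with \<open>?z\<close> in
      \<open>K 1\<close>.\<close>
    let ?z = "sc (- inverse (\<alpha> i)) (y i)"
    show ?thesis
    proof (rule dvd_if_approximable[of ?z f "{f}"])
      show "?z \<in> K 1" by (rule K_scale[OF y_K[OF i]])
      have "sc (inverse (\<alpha> i)) 1 * (x i * f) = f - ?z * f"
        using False by (simp add: x[OF i] distrib_right h(1,4,7,9) flip: h(3))
      then show "\<exists>b'\<in>{f}. w dvd b - ?z * b'" if "b \<in> {f}" for b using dvd_mult[OF dvd, of "sc (inverse (\<alpha> i)) 1"] that by simp
    qed simp
  qed
qed (rule sc)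

end

end

section \<open>Completions of coordinate rings\<close>

theorem coordinate_derivations_completion:
  fixes scA :: "'k::alg_closed_field \<Rightarrow> 'a::idom \<Rightarrow> 'a" and scR :: "'k \<Rightarrow> 'r::comm_ring_1 \<Rightarrow> 'r"
  assumes scA: "algebra_over scA" and fg: "finite G" "is_subalgebra scA hull G = UNIV"
    and dim: "krull_dim (UNIV :: 'a set) = enat d" and sc: "algebra_over scR" and max: "maximal_in UNIV m"
    and comp: "is_completion_of scA m scR"
    and M: "{M. maximal_in (UNIV :: 'r set) M} = {is_ideal hull {x i - scR (\<alpha> i) 1 |i. i \<in> {1..d}}}"
  shows "\<exists>H. coordinate_derivations scR d x H"
proof -
  note mf = maximal_ideal_facts[OF max] and m = maximal_ideal_facts(1)[OF max] and hR = algebra_scale_hom[OF sc]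
  let ?P = "ideal_power m"
  note P = is_ideal_power[of m]
  have P1: "?P 1 = m" by (rule ideal_power_1[OF m])
  obtain \<theta> where bij: "bij_betw \<theta> UNIV (adic_limit m)" and \<theta>_1: "\<And>n. 1 \<in> \<theta> 1 n"
      and \<theta>_hom: "\<And>r s n a b. a \<in> \<theta> r n \<Longrightarrow> b \<in> \<theta> s n \<Longrightarrow> a + b \<in> \<theta> (r + s) n \<and> a * b \<in> \<theta> (r * s) n"
      and \<theta>_sc: "\<And>c r n a. a \<in> \<theta> r n \<Longrightarrow> scA c a \<in> \<theta> (scR c r) n"
    using comp unfolding is_completion_of_def by blast
  have \<theta>_lim: "\<theta> r \<in> adic_limit m" for r using bij by (auto simp: bij_betw_def)
  have dec: "\<theta> r (Suc n) \<subseteq> \<theta> r n" for r n using \<theta>_lim unfolding adic_limit_def by blast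
  have coset: "\<theta> r n = a +o ?P n" if a: "a \<in> \<theta> r n" for a r n
  proof -
    obtain b where b: "\<theta> r n = b +o ?P n" using \<theta>_lim unfolding adic_limit_def by blast
    have ab: "a - b \<in> ?P n" using a unfolding b by (auto simp: elt_set_plus_def)
    have "z \<in> b +o ?P n \<longleftrightarrow> z \<in> a +o ?P n" for z
    proof -
      have "z \<in> c +o ?P n \<longleftrightarrow> z - c \<in> ?P n" for c
        unfolding elt_set_plus_def by (auto intro!: bexI[of _ "z - c"])
      then show ?thesis using ideal_add_cancel[OF P ab, of "z - a"] by simp
    qed
    then show ?thesis unfolding b by blast
  qed
  have mem: "b \<in> \<theta> r n \<longleftrightarrow> b - a \<in> ?P n" if "a \<in> \<theta> r n" for a b r n
    unfolding coset[OF that] elt_set_plus_def by (auto intro!: bexI[of _ "b - a"])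
  have ne: "\<exists>a. a \<in> \<theta> r n" for r n
  proof -
    obtain b where b: "\<theta> r n = b +o ?P n" using \<theta>_lim unfolding adic_limit_def by blast
    then have "b + 0 \<in> \<theta> r n" unfolding elt_set_plus_def using ideal_zero[OF P] by blast
    then show ?thesis by blast
  qed
  have \<theta>_0: "0 \<in> \<theta> 0 n" for n
  proof -
    obtain a where a: "a \<in> \<theta> 0 n" using ne by blast
    then have "a + a \<in> \<theta> 0 n" using \<theta>_hom[OF a a] by simp
    then have "a \<in> ?P n" using mem[OF a] by simp
    then show ?thesis using mem[OF a, of 0] ideal_uminus[OF P] by simp
  qed
  have \<theta>_diff: "a - b \<in> \<theta> (r - s) n" if a: "a \<in> \<theta> r n" and b: "b \<in> \<theta> s n" for a b r s n
  proof -
    obtain c where c: "c \<in> \<theta> (r - s) n" using ne by blast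
    then have "c + b \<in> \<theta> r n" using \<theta>_hom[OF c b] by simp
    then have "a - (c + b) \<in> ?P n" using mem a by blast
    then show ?thesis unfolding mem[OF c] by (simp add: algebra_simps)
  qed
  have eqI: "r = s" if "\<And>n. \<theta> r n = \<theta> s n" for r s
  proof -
    have "\<theta> r = \<theta> s" using that by (rule ext)
    then show ?thesis using bij by (auto simp: bij_betw_def inj_on_def)
  qed
  \<comment> \<open>The kernel of the projection to \<open>A\<close> modulo the n-th power of
    \<open>m\<close>.\<close>
  define K where "K n = {r. 0 \<in> \<theta> r n}" for n
  have K_iff: "r \<in> K n \<longleftrightarrow> a \<in> ?P n" if "a \<in> \<theta> r n" for a r n
    unfolding K_def mem_Collect_eq mem[OF that] using ideal_uminus[OF P, of "- a" n] ideal_uminus[OF P, of a n] by auto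
  have K: "is_ideal (K n)" for n
  proof (rule is_idealI)
    show "0 \<in> K n" by (simp add: K_def \<theta>_0)
    fix r s assume r: "r \<in> K n"
    show "r + s \<in> K n" if "s \<in> K n" using \<theta>_hom[of 0 r n 0 s] r that by (simp add: K_def)
    show "t * r \<in> K n" for t using ne[of t n] \<theta>_hom[of _ t n 0 r] r by (auto simp: K_def)
  qed
  have "r \<in> K 0" for r using ne[of r 0] K_iff[of _ r 0] by (auto simp: ideal_power_0)
  then have K_0: "K 0 = UNIV" by blast
  have K_Suc: "K (Suc n) \<subseteq> K n" for n using dec by (auto simp: K_def)
  have \<theta>_antimono: "\<theta> r j \<subseteq> \<theta> r i" if "i \<le> j" for r i j by (rule lift_Suc_antimono_le[of "\<theta> r", OF dec that])
  have K_mult: "r * s \<in> K (i + j)" if "r \<in> K i" "s \<in> K j" for r s i j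
  proof -
    obtain u v where uv: "u \<in> \<theta> r (i + j)" "v \<in> \<theta> s (i + j)" using ne by blast
    have "u \<in> ?P i" "v \<in> ?P j" using uv \<theta>_antimono[of i "i + j"] \<theta>_antimono[of j "i + j"] K_iff that by (meson le_add1 le_add2 subsetD)+
    then have "u * v \<in> ?P (i + j)" by (rule ideal_power_mult)
    then show ?thesis using K_iff \<theta>_hom[OF uv] by blast
  qed
  have cong: "\<theta> r n = \<theta> s n" if "r - s \<in> K n" for r s n
  proof -
    obtain a b where ab: "a \<in> \<theta> r n" "b \<in> \<theta> s n" using ne by blast
    then have "a - b \<in> ?P n" using K_iff[OF \<theta>_diff[OF ab]] that by blast
    then have "a \<in> \<theta> s n" using mem[OF ab(2)] by blast
    then show ?thesis using coset[OF ab(1)] coset by blast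
  qed
  have separated: "r = 0" if "\<And>n. r \<in> K n" for r by (rule eqI) (use cong[of r 0] that in simp)
  have limit: "\<exists>r. \<theta> r = \<sigma>" if "\<sigma> \<in> adic_limit m" for \<sigma> using bij that by (metis bij_betw_imp_surj_on image_iff)
  have complete: "\<exists>r. \<forall>n. r - s n \<in> K n" if s: "\<And>n. s (Suc n) - s n \<in> K n" for s
  proof -
    have "(\<lambda>n. \<theta> (s n) n) \<in> adic_limit m"
      unfolding adic_limit_def
    proof (intro CollectI conjI allI)
      show "\<exists>a. \<theta> (s n) n = a +o ?P n" for n using ne coset by blast
      show "\<theta> (s (Suc n)) (Suc n) \<subseteq> \<theta> (s n) n" for n using dec[of "s (Suc n)" n] cong[OF s[of n]] by blast
    qed
    then obtain r where r: "\<theta> r = (\<lambda>n. \<theta> (s n) n)" using limit by blast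
    have "r - s n \<in> K n" for n
    proof -
      obtain a where a: "a \<in> \<theta> (s n) n" using ne by blast
      then have "a - a \<in> \<theta> (r - s n) n" by (intro \<theta>_diff) (simp_all add: r)
      then show ?thesis by (simp add: K_def)
    qed
    then show ?thesis by blast
  qed
  have "\<exists>r. \<forall>n. a \<in> \<theta> r n" for a
  proof -
    have "(\<lambda>n. a +o ?P n) \<in> adic_limit m"
      unfolding adic_limit_def elt_set_plus_def using ideal_power_antimono[of _ "Suc _" m, OF le_SucI[OF order_refl]] by blast
    then obtain r where "\<theta> r = (\<lambda>n. a +o ?P n)" using limit by blast
    moreover have "a + 0 \<in> a +o ?P n" for n unfolding elt_set_plus_def using ideal_zero[OF P] by blast
    ultimately show ?thesis by (intro exI[of _ r]) simp
  qed
  \<comment> \<open>The canonical map from \<open>A\<close> into its completion, which sends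
    \<open>a\<close> to its own residue classes.\<close>
  then obtain \<iota> where \<iota>: "\<And>a n. a \<in> \<theta> (\<iota> a) n" by metis
  have \<iota>_K: "\<iota> a \<in> K n \<longleftrightarrow> a \<in> ?P n" for a n by (rule K_iff[OF \<iota>])
  have \<iota>_eq: "\<iota> a = r" if "\<And>n. a \<in> \<theta> r n" for a r
  proof (rule eqI)
    fix n show "\<theta> (\<iota> a) n = \<theta> r n" unfolding coset[OF \<iota>[of a n]] coset[OF that[of n]] ..
  qed
  have \<iota>_hom: "\<iota> (a + b) = \<iota> a + \<iota> b" "\<iota> (a * b) = \<iota> a * \<iota> b" "\<iota> 1 = 1" "\<iota> 0 = 0" "\<iota> (scA c a) = scR c (\<iota> a)"
    "\<iota> (a - b) = \<iota> a - \<iota> b" for a b c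
    by (rule \<iota>_eq, rule \<theta>_hom[OF \<iota> \<iota>, THEN conjunct1] \<theta>_hom[OF \<iota> \<iota>, THEN conjunct2] \<theta>_1 \<theta>_0 \<theta>_sc[OF \<iota>] \<theta>_diff[OF \<iota> \<iota>])+
  have near: "r - \<iota> a \<in> K n" if "a \<in> \<theta> r n" for a r n using \<theta>_diff[OF that \<iota>[of a n]] by (simp add: K_def)
  \<comment> \<open>This identifies \<open>K 1\<close> with the ideal generated by the shifted
    \<open>x i\<close>, which is given as the only maximal ideal of \<open>R\<close>.\<close>
  have "maximal_in UNIV (K 1)"
    unfolding maximal_in_def
  proof (intro conjI allI impI)
    show "is_ideal (K 1)" by (rule K)
    show "K 1 \<noteq> UNIV" using K_iff[OF \<theta>_1, of 1] mf(2) unfolding P1 by auto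
    fix J assume J: "is_ideal J \<and> K 1 \<subseteq> J"
    show "J = K 1 \<or> J = UNIV"
    proof (rule disjCI, rule equalityI)
      assume "J \<noteq> UNIV"
      show "J \<subseteq> K 1"
      proof (rule subsetI, rule ccontr)
        fix r assume r: "r \<in> J" "r \<notin> K 1"
        obtain a where a: "a \<in> \<theta> r 1" using ne by blast
        then have "a \<notin> m" using r K_iff P1 by blast
        then obtain b where b: "1 - b * a \<in> m" using mf(4) by blast
        have "1 - b * a \<in> \<theta> (1 - \<iota> b * r) 1" using \<theta>_diff[OF \<theta>_1] \<theta>_hom[OF \<iota> a] by blast
        then have "1 - \<iota> b * r \<in> J" using K_iff b P1 J by blast
        then have "(1 - \<iota> b * r) + \<iota> b * r \<in> J" using J r(1) ideal_add ideal_mult_left by blast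
        then have "1 \<in> J" by simp
        then have "t \<in> J" for t using J ideal_mult_left[of J 1 t] by simp
        then show False using \<open>J \<noteq> UNIV\<close> by blast
      qed
    qed (use J in blast)
  qed
  define y where "y i = x i - scR (\<alpha> i) 1" for i
  have "{x i - scR (\<alpha> i) 1 |i. i \<in> {1..d}} = y ` {1..d}" by (auto simp: y_def)
  moreover have "K 1 \<in> {M. maximal_in UNIV M}" using \<open>maximal_in UNIV (K 1)\<close> by (rule CollectI)
  ultimately have K_1: "K 1 = is_ideal hull (y ` {1..d})" unfolding M by (simp only: singleton_iff)
  have residue: "\<exists>c. r - scR c 1 \<in> K 1" for r
  proof -
    obtain a where a: "a \<in> \<theta> r 1" using ne by blast
    obtain c where "a - scA c 1 \<in> m" using nullstellensatz[OF scA fg max] by blast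
    then show ?thesis using K_iff[OF \<theta>_diff[OF a \<theta>_sc[OF \<theta>_1]]] P1 by blast
  qed
  have approx: "\<exists>a\<in>ideal_power (K 1) n. r - a \<in> K (Suc n)" if r: "r \<in> K n" for r n
  proof -
    obtain a where a: "a \<in> \<theta> r (Suc n)" using ne by blast
    then have aP: "a \<in> ?P n" using K_iff dec r by blast
    have I: "is_ideal {a. \<iota> a \<in> ideal_power (K 1) n}"
      by (rule is_idealI) (simp_all add: \<iota>_hom ideal_zero[OF is_ideal_power] ideal_add[OF is_ideal_power]
          ideal_mult_left[OF is_ideal_power])
    have "\<iota> z \<in> K 1 ^ n" if "z \<in> m ^ n" for z n
      using that
    proof (induction n arbitrary: z)
      case (Suc n)
      then obtain u v where "z = u * v" "u \<in> m" "v \<in> m ^ n" unfolding power_Suc set_times_def by blast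
      then show ?case using Suc.IH[of v] \<iota>_K[of u 1] P1 by (simp only: \<iota>_hom(2) power_Suc) (rule set_times_intro, auto)
    qed (simp add: \<iota>_hom)
    then have "m ^ n \<subseteq> {a. \<iota> a \<in> ideal_power (K 1) n}" unfolding ideal_power_def by (auto intro: hull_inc)
    then have "?P n \<subseteq> {a. \<iota> a \<in> ideal_power (K 1) n}" unfolding ideal_power_def[of m] by (rule is_ideal_hull_least[OF I])
    then show ?thesis using aP near[OF a] by blast
  qed
  \<comment> \<open>Representatives modulo the square of \<open>m\<close> suffice: by
    \<open>m_gen\<close> they are parameters at the point of \<open>A\<close>.\<close>
  have "\<exists>x'. \<forall>i. x' i \<in> \<theta> (y i) 2" using ne by (intro choice) blast
  then obtain x' where x': "\<And>i. x' i \<in> \<theta> (y i) 2" by blast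
  have y_K: "y i \<in> K 1" if "i \<in> {1..d}" for i unfolding K_1 using that by (auto intro: hull_inc)
  have x'm: "x' i \<in> m" if "i \<in> {1..d}" for i
  proof -
    have "x' i \<in> \<theta> (y i) 1" using x'[of i] \<theta>_antimono[of 1 2] by auto
    then show ?thesis using K_iff y_K[OF that] P1 by blast
  qed
  have m_gen: "m \<subseteq> is_ideal hull (?P 2 \<union> x' ` {1..d})"
  proof
    fix z assume "z \<in> m"
    then have "\<iota> z \<in> K 1" using \<iota>_K P1 by blast
    then obtain e where e: "\<iota> z = (\<Sum>i\<in>{1..d}. e i * y i)"
      unfolding K_1 is_ideal_hull_finite[OF finite_atLeastAtMost] by blast
    have "\<exists>b. \<forall>i. b i \<in> \<theta> (e i) 2" using ne by (intro choice) blast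
    then obtain b where b: "\<And>i. b i \<in> \<theta> (e i) 2" by blast
    have "(\<Sum>i\<in>A. b i * x' i) \<in> \<theta> (\<Sum>i\<in>A. e i * y i) 2" for A
      by (induction A rule: infinite_finite_induct) (simp_all add: \<theta>_0 \<theta>_hom[OF \<theta>_hom[OF b x', THEN conjunct2], THEN conjunct1])
    then have "z - (\<Sum>i\<in>{1..d}. b i * x' i) \<in> ?P 2" using mem \<iota>[of z 2] unfolding e by blast
    then have 1: "z - (\<Sum>i\<in>{1..d}. b i * x' i) \<in> is_ideal hull (?P 2 \<union> x' ` {1..d})" by (intro hull_inc) blast
    have "(\<Sum>i\<in>{1..d}. b i * x' i) \<in> is_ideal hull (?P 2 \<union> x' ` {1..d})"
      by (intro ideal_sum[OF is_ideal_hull] ideal_mult_left[OF is_ideal_hull] hull_inc) blast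
    from ideal_add[OF is_ideal_hull 1 this] show "z \<in> is_ideal hull (?P 2 \<union> x' ` {1..d})" by simp
  qed
  interpret power_series_ring scR d y K
  proof
    fix c :: "(nat \<Rightarrow> nat) \<Rightarrow> 'k" and n I
    let ?S = "{I \<in> PiE {1..d} (\<lambda>_. UNIV :: nat set). sum I {1..d} = n}"
    assume F: "(\<Sum>I\<in>?S. scR (c I) (\<Prod>i\<in>{1..d}. y i ^ I i)) \<in> K (Suc n)" and I: "I \<in> PiE {1..d} (\<lambda>_. UNIV)" "sum I {1..d} = n"
    have pw: "\<iota> (a ^ k) = \<iota> a ^ k" for a and k :: nat by (induction k) (simp_all add: \<iota>_hom)
    have Kpow: "u ^ k \<in> K k" if "u \<in> K 1" for u k
      using that K_mult[of u 1] by (induction k) (fastforce simp: K_0)+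
    have pow: "u ^ k - v ^ k \<in> K (Suc k)" if u: "u \<in> K 1" and v: "v \<in> K 1" and "u - v \<in> K 2" for u v and k :: nat
    proof (induction k)
      case (Suc k)
      have "u * (u ^ k - v ^ k) + (u - v) * v ^ k \<in> K (Suc (Suc k))"
        using K_mult[OF u Suc] K_mult[OF that(3) Kpow[OF v, of k]] by (intro ideal_add[OF K]) simp_all
      then show ?case by (simp add: algebra_simps)
    qed (simp add: ideal_zero[OF K])
    \<comment> \<open>Each \<open>y i\<close> differs from \<open>\<iota> (x' i)\<close> by an
      element of \<open>K 2\<close>, so a monomial of degree \<open>n\<close> changes only by an
      element of \<open>K (Suc n)\<close>, and the relation descends to \<open>A\<close>.\<close>
    have mon: "(\<Prod>i\<in>A. y i ^ I i) - \<iota> (\<Prod>i\<in>A. x' i ^ I i) \<in> K (Suc (sum I A)) \<and> (\<Prod>i\<in>A. y i ^ I i) \<in> K (sum I A)"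
      if "A \<subseteq> {1..d}" for A I
    proof -
      have "finite A" using that finite_subset by blast
      then show ?thesis using that
      proof (induction A rule: finite_induct)
        case (insert a A)
        let ?p = "\<Prod>i\<in>A. y i ^ I i" and ?q = "\<Prod>i\<in>A. x' i ^ I i"
        have a: "y a \<in> K 1" "\<iota> (x' a) \<in> K 1" "y a - \<iota> (x' a) \<in> K 2"
          using y_K x'm \<iota>_K[of _ 1] P1 near[OF x'] insert.prems by auto
        have IH: "?p - \<iota> ?q \<in> K (Suc (sum I A))" "?p \<in> K (sum I A)" using insert by auto
        have "\<iota> (x' a) ^ I a * (?p - \<iota> ?q) \<in> K (I a + Suc (sum I A))" by (rule K_mult[OF Kpow[OF a(2)] IH(1)])
        moreover have "(y a ^ I a - \<iota> (x' a) ^ I a) * ?p \<in> K (Suc (I a) + sum I A)" by (rule K_mult[OF pow[OF a] IH(2)])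
        ultimately have "\<iota> (x' a) ^ I a * (?p - \<iota> ?q) + (y a ^ I a - \<iota> (x' a) ^ I a) * ?p \<in> K (Suc (I a + sum I A))"
          by (intro ideal_add[OF K]) simp_all
        then have "y a ^ I a * ?p - \<iota> (x' a ^ I a * ?q) \<in> K (Suc (I a + sum I A))"
          by (simp add: \<iota>_hom pw algebra_simps)
        then show ?case using insert.hyps K_mult[OF Kpow[OF a(1)] IH(2), of "I a"] by simp
      qed (simp_all add: \<iota>_hom ideal_zero[OF K] K_0)
    qed
    have \<iota>_sum: "\<iota> (sum f S) = (\<Sum>i\<in>S. \<iota> (f i))" for f and S :: "(nat \<Rightarrow> nat) set"
      by (induction S rule: infinite_finite_induct) (simp_all add: \<iota>_hom)
    interpret V: vector_space scR using sc by (simp add: algebra_over_def)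
    have "(\<Sum>I\<in>?S. scR (c I) ((\<Prod>i\<in>{1..d}. y i ^ I i) - \<iota> (\<Prod>i\<in>{1..d}. x' i ^ I i))) \<in> K (Suc n)"
    proof (rule ideal_sum[OF K])
      fix I assume I: "I \<in> ?S"
      then have "(\<Prod>i\<in>{1..d}. y i ^ I i) - \<iota> (\<Prod>i\<in>{1..d}. x' i ^ I i) \<in> K (Suc n)" using mon[OF order_refl, of I] by auto
      from ideal_mult_left[OF K this, of "scR (c I) 1"]
      show "scR (c I) ((\<Prod>i\<in>{1..d}. y i ^ I i) - \<iota> (\<Prod>i\<in>{1..d}. x' i ^ I i)) \<in> K (Suc n)" by (simp only: hR(7) mult_1_left)
    qed
    from ideal_diff[OF K F this] have "\<iota> (\<Sum>I\<in>?S. scA (c I) (\<Prod>i\<in>{1..d}. x' i ^ I i)) \<in> K (Suc n)"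
      by (simp only: \<iota>_sum \<iota>_hom(5) V.scale_right_diff_distrib sum_subtractf) simp
    then have "(\<Sum>I\<in>?S. scA (c I) (\<Prod>i\<in>{1..d}. x' i ^ I i)) \<in> ?P (Suc n)" unfolding \<iota>_K .
    from parameters_independent[OF scA fg dim max x'm m_gen refl this] I show "c I = 0" by blast
  qed (rule sc K K_0 K_Suc K_1 residue | erule (1) K_mult | erule separated complete approx)+
  have "coordinate_derivations scR d x hasse" by (rule coordinate_derivations_hasse) (simp add: y_def)
  then show ?thesis by blast
qed

section \<open>Saturations\<close>

theorem corollary2p2p3p2:
  fixes scA :: "'k::alg_closed_field \<Rightarrow> 'a::idom \<Rightarrow> 'a"
    and scR :: "'k \<Rightarrow> 'r::comm_ring_1 \<Rightarrow> 'r"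
    and d :: nat
    and x :: "nat \<Rightarrow> 'r"
    and I :: "('r \<times> real) set"
  assumes "nonsingular_coordinate_ring scA d"
    and "algebra_over scR"
    and "regular_system_of_parameters scA scR d x"
    and "idealistic_filtration I"
  shows "B_saturation (Diff scR) I = R_saturation (D_saturation (Diff scR) I) \<and>
         (\<forall>m IE. 1 \<le> m \<and> m \<le> d \<and> IE = is_ideal hull {\<Prod>i=1..m. x i} \<longrightarrow>
            B_saturation (Diff_log scR IE) I = R_saturation (D_saturation (Diff_log scR IE) I))"
proof -
  obtain G where A: "algebra_over scA" "finite G" "is_subalgebra scA hull G = UNIV" "krull_dim (UNIV :: 'a set) = enat d"
    using assms(1) unfolding nonsingular_coordinate_ring_def by blast
  have "\<exists>H. coordinate_derivations scR d x H"
    using assms(3) unfolding regular_system_of_parameters_def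
  proof (elim disjE conjE exE)
    assume "is_localization_of scA scR" "differentials_form_basis scR d x"
    then show ?thesis by (rule coordinate_derivations_localization[OF A(1-3) assms(2)])
  next
    fix m \<alpha>
    assume "maximal_in UNIV m" "is_completion_of scA m scR"
      "{M. maximal_in (UNIV :: 'r set) M} = {is_ideal hull {x i - scR (\<alpha> i) 1 |i. i \<in> {1..d}}}"
    then show ?thesis by (rule coordinate_derivations_completion[OF A assms(2)])
  qed
  then obtain H where "coordinate_derivations scR d x H" by blast
  then interpret coordinate_derivations scR d x H .
  show ?thesis using B_saturation_Diff B_saturation_Diff_log by blast
qed

end
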